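(* Let $A(t)=\exp(tB)$ be a one-parameter subgroup of $\mathrm{GL}(n,\mathbb{R})$ with $A(1)\in \mathrm{SL}(n,\mathbb{Z})$ such that $G=\mathbb{R}^n\rtimes_A\mathbb{R}$ is nilpotent, and let $\Gamma=\mathbb{Z}^n\rtimes_A\mathbb{Z}$. Let $\mathcal{H}$ be a left-invariant, oriented, bracket-generating distribution of rank $d$ on $G$ with $b\in\mathcal{H}_e$, equipped with a left-invariant Riemannian metric $g$ such that $b$ is $g_e$-orthogonal to $\mathcal{H}_e\cap\mathfrak{n}$. Let $\nabla$ be a left-invariant metric connection on $\mathcal{H}$ satisfying the divergence condition $\mathrm{div}\,X=\sum_{i=1}^d g(\nabla_{s_i}X,s_i)$ for all $X\in\Gamma(\mathcal{H})$ (for local orthonormal frames $s_1,\dots,s_d$ of $\mathcal H$), and let $\varepsilon:\Gamma\to\mathbb{Z}_2$ be a homomorphism. Then the closure of the associated sub-Dirac operator $D$ on $\Gamma\setminus G$ has pure point spectrum, i.e. $L^2(G,\varepsilon)\otimes\Delta$ has an orthonormal basis consisting of eigenvectors of the closure of $D$.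
   Context: The group law of $G=\mathbb{R}^n\rtimes_A\mathbb{R}$ is $(x,s)(y,t)=(x+A(s)y,\,s+t)$; $\Gamma=\mathbb{Z}^n\rtimes_A\mathbb{Z}$ is a uniform discrete subgroup. The Lie algebra of $G$ is $\mathfrak{g}=\mathbb{R}^n\rtimes_B\mathbb{R}$ with abelian ideal $\mathfrak{n}=\mathbb{R}^n\times\{0\}$, $b=(0,1)$, and $[b,X]=BX$ for $X\in\mathfrak{n}$. It is identified with $T_eG$, $e$ the identity. Bracket-generating: with $C^0(\mathcal{H}_e)=\mathcal{H}_e$ and $C^k(\mathcal{H}_e)=[\mathcal{H}_e,C^{k-1}(\mathcal{H}_e)]$ for $k\ge1$, one has $\mathfrak{g}=\sum_{k=0}^n C^k(\mathcal{H}_e)$. A metric connection on $\mathcal H$ is a map $\nabla:\Gamma(\mathcal{H})\otimes\Gamma(\mathcal{H})\to\Gamma(\mathcal{H})$ (differentiating only in directions of $\mathcal{H}$) with the usual rules, compatible with $g$. The divergence is taken with respect to the left-invariant volume form on $G$ given by Haar measure; for left-invariant $\nabla$ the divergence condition is equivalent to $\sum_i g(\nabla_{s_i}s_j,s_i)=0$ for all $j$, where $s_1,\dots,s_d$ is a left-invariant orthonormal frame. The space $L^2(G,\varepsilon)$ is the completion of the space of continuous $\varphi:G\to\mathbb{C}$ satisfying $\varphi(\gamma y)=e^{i\pi\varepsilon(\gamma)}\varphi(y)$ ($\gamma\in\Gamma$, $y\in G$) for the norm $\|\varphi\|^2=\int_{\Gamma\setminus G}|\varphi|^2d\mu$, with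 $\mu$ the normalised right $G$-invariant measure on $\Gamma\setminus G$; $C^\infty(G,\varepsilon)$ is its subspace of smooth functions with this equivariance. The homomorphism $\varepsilon$ corresponds to a spin structure of the distribution $\dot{\mathcal{H}}$ induced by $\mathcal H$ on $\Gamma\setminus G$, and smooth spinor fields are identified with $C^\infty(G,\varepsilon)\otimes\Delta$, where $\Delta$ is the complex spinor representation, i.e. an irreducible complex module of the Clifford algebra $\mathcal{C}l(\mathcal{H}_e)$ (convention $v\cdot v=-|v|^2$) with a hermitian inner product for which Clifford multiplication by vectors is antisymmetric. Let $s_1,\dots,s_d$ be a positively oriented orthonormal basis of $\mathcal{H}_e$ with $s_1,\dots,s_{d-1}\in\mathcal{H}_e\cap\mathfrak{n}$ and $s_d$ a positive multiple of $b$ (also denoting left-invariant vector fields), and $\Gamma_{ij}^k=g(\nabla_{s_i}s_j,s_k)$. The sub-Dirac operator, with domain $C^\infty(G,\varepsilon)\otimes\Delta$, is $$D=\sum_i d\rho(s_i)\otimes s_i+\frac14\sum_{i,j,k}\Gamma_{ij}^k\; I\otimes s_is_js_k,$$ where $d\rho(s_i)$ is differentiation along the left-invariant vector field $s_i$ and the $s_i$ in the second tensor factor act on $\Delta$ by Clifford multiplication. *)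

theory Defs
  imports
    "HOL-Analysis.Analysis"
    "HOL-Algebra.Generated_Groups"
    "HOL-Algebra.Elementary_Groups"
    "HOL-Combinatorics.Permutations"
begin

section \<open>The group, its lattice and its Lie algebra\<close>

text \<open>
  The product of type \<open>real^'n^'n\<close> inherited from the class \<open>times\<close> is componentwise, so
  the library's \<open>exp\<close> is not the matrix exponential.
\<close>

primrec matpow :: "real^'n^'n \<Rightarrow> nat \<Rightarrow> real^'n^'n" where
  "matpow B 0 = mat 1"
| "matpow B (Suc k) = B ** matpow B k"

definition mexp :: "real^'n^'n \<Rightarrow> real^'n^'n" where
  "mexp B = (\<Sum>k. (1 / fact k) *\<^sub>R matpow B k)"

definition flow :: "real^'n^'n \<Rightarrow> real \<Rightarrow> real^'n^'n" where
  "flow B t = mexp (t *\<^sub>R B)"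

definition SL_int :: "(real^'n^'n) set" where
  "SL_int = {A. (\<forall>i j. A $ i $ j \<in> \<int>) \<and> det A = 1}"

definition sdp :: "real^'n^'n \<Rightarrow> ((real^'n) \<times> real) monoid" where
  "sdp B = \<lparr>carrier = UNIV,
            monoid.mult = (\<lambda>(x, s) (y, t). (x + flow B s *v y, s + t)),
            one = (0, 0)\<rparr>"

definition lattice_sub :: "((real^'n) \<times> real) set" where
  "lattice_sub = {(x, s). (\<forall>i. x $ i \<in> \<int>) \<and> s \<in> \<int>}"

primrec lower_central :: "('a, 'b) monoid_scheme \<Rightarrow> nat \<Rightarrow> 'a set" where
  "lower_central G 0 = carrier G"
| "lower_central G (Suc k) =
     generate G {x \<otimes>\<^bsub>G\<^esub> y \<otimes>\<^bsub>G\<^esub> inv\<^bsub>G\<^esub> x \<otimes>\<^bsub>G\<^esub> inv\<^bsub>G\<^esub> y |x y.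
                  x \<in> carrier G \<and> y \<in> lower_central G k}"

definition nilpotent_group :: "('a, 'b) monoid_scheme \<Rightarrow> bool" where
  "nilpotent_group G \<longleftrightarrow> group G \<and> (\<exists>k. lower_central G k = {\<one>\<^bsub>G\<^esub>})"

text \<open>
  The Lie algebra has the underlying space of the group; the distinguished vector is
  \<open>b = (0, 1)\<close> and the abelian ideal consists of the vectors with second component 0.
\<close>

definition bvec :: "(real^'n) \<times> real" where
  "bvec = (0, 1)"

definition ideal_n :: "((real^'n) \<times> real) set" where
  "ideal_n = {v. snd v = 0}"

definition bracket ::
  "real^'n^'n \<Rightarrow> (real^'n) \<times> real \<Rightarrow> (real^'n) \<times> real \<Rightarrow> (real^'n) \<times> real" where
  "bracket B v w = (snd v *\<^sub>R (B *v fst w) - snd w *\<^sub>R (B *v fst v), 0)"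

primrec iterated_brackets ::
  "real^'n^'n \<Rightarrow> ((real^'n) \<times> real) set \<Rightarrow> nat \<Rightarrow> ((real^'n) \<times> real) set" where
  "iterated_brackets B W 0 = W"
| "iterated_brackets B W (Suc k) =
     span {bracket B v w |v w. v \<in> W \<and> w \<in> iterated_brackets B W k}"

definition bracket_generating :: "real^'n^'n \<Rightarrow> ((real^'n) \<times> real) set \<Rightarrow> bool" where
  "bracket_generating B W \<longleftrightarrow> span (\<Union>k\<le>CARD('n). iterated_brackets B W k) = UNIV"


section \<open>Smooth maps, left translations and vector fields\<close>

primrec Ck :: "nat \<Rightarrow> ('a::euclidean_space \<Rightarrow> 'b::real_normed_vector) \<Rightarrow> bool" where
  "Ck 0 f \<longleftrightarrow> continuous_on UNIV f"
| "Ck (Suc k) f \<longleftrightarrow> (\<forall>x. f differentiable (at x)) \<and>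
                   (\<forall>v. Ck k (\<lambda>x. frechet_derivative f (at x) v))"

definition smooth :: "('a::euclidean_space \<Rightarrow> 'b::real_normed_vector) \<Rightarrow> bool" where
  "smooth f \<longleftrightarrow> (\<forall>k. Ck k f)"

text \<open>
  Every tangent space is identified with \<open>real^'n \<times> real\<close>, and a vector field is a map from
  the group to this space. \<open>dleft B p q\<close> is the differential at \<open>q\<close> of left
  translation by \<open>p\<close>.
\<close>

definition dleft ::
  "real^'n^'n \<Rightarrow> (real^'n) \<times> real \<Rightarrow> (real^'n) \<times> real \<Rightarrow> (real^'n) \<times> real \<Rightarrow> (real^'n) \<times> real" where
  "dleft B p q v = frechet_derivative (\<lambda>r. p \<otimes>\<^bsub>sdp B\<^esub> r) (at q) v"

definition left_field ::
  "real^'n^'n \<Rightarrow> (real^'n) \<times> real \<Rightarrow> (real^'n) \<times> real \<Rightarrow> (real^'n) \<times> real" where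
  "left_field B v p = dleft B p \<one>\<^bsub>sdp B\<^esub> v"

definition push_field ::
  "real^'n^'n \<Rightarrow> (real^'n) \<times> real \<Rightarrow> ((real^'n) \<times> real \<Rightarrow> (real^'n) \<times> real)
     \<Rightarrow> ((real^'n) \<times> real \<Rightarrow> (real^'n) \<times> real)" where
  "push_field B p X q =
     (let r = inv\<^bsub>sdp B\<^esub> p \<otimes>\<^bsub>sdp B\<^esub> q in dleft B p r (X r))"

definition dir_deriv ::
  "('a::euclidean_space \<Rightarrow> 'a) \<Rightarrow> ('a \<Rightarrow> 'b::real_normed_vector) \<Rightarrow> 'a \<Rightarrow> 'b" where
  "dir_deriv X f p = frechet_derivative f (at p) (X p)"

text \<open>
  Left translation by \<open>(x, s)\<close> has Jacobian determinant \<open>det (A s)\<close>, so the left-invariant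
  volume form is \<open>1 / det (A s)\<close> times the Euclidean one. The divergence with respect to a
  volume form of density \<open>\<rho>\<close> is \<open>(1 / \<rho>) \<Sum>\<^sub>u \<partial>\<^sub>u (\<rho> X\<^sub>u)\<close>.
\<close>

definition vol_density :: "real^'n^'n \<Rightarrow> (real^'n) \<times> real \<Rightarrow> real" where
  "vol_density B p = 1 / det (flow B (snd p))"

definition divergence ::
  "real^'n^'n \<Rightarrow> ((real^'n) \<times> real \<Rightarrow> (real^'n) \<times> real) \<Rightarrow> (real^'n) \<times> real \<Rightarrow> real" where
  "divergence B X p =
     (\<Sum>u\<in>Basis. frechet_derivative (\<lambda>q. vol_density B q * (X q \<bullet> u)) (at p) u)
       / vol_density B p"


section \<open>Left-invariant distributions, metrics, orientations and connections\<close>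

text \<open>
  A distribution is given by its fibres \<open>H p\<close>, a fibre metric by \<open>g p\<close>, of which only
  the restriction to \<open>H p\<close> matters, and an orientation by the sets \<open>Or p\<close> of positively
  oriented ordered bases of \<open>H p\<close>. Left-invariance makes all of these smooth.
\<close>

definition left_invariant_distribution ::
  "real^'n^'n \<Rightarrow> nat \<Rightarrow> ((real^'n) \<times> real \<Rightarrow> ((real^'n) \<times> real) set) \<Rightarrow> bool" where
  "left_invariant_distribution B d H \<longleftrightarrow>
     (\<forall>p. subspace (H p) \<and> dim (H p) = d) \<and>
     (\<forall>p q. H (p \<otimes>\<^bsub>sdp B\<^esub> q) = dleft B p q ` H q)"

definition inner_product_on ::
  "'a::real_vector set \<Rightarrow> ('a \<Rightarrow> 'a \<Rightarrow> real) \<Rightarrow> bool" where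
  "inner_product_on W g \<longleftrightarrow>
     (\<forall>u\<in>W. \<forall>v\<in>W. \<forall>w\<in>W. \<forall>a. g (a *\<^sub>R u + v) w = a * g u w + g v w) \<and>
     (\<forall>u\<in>W. \<forall>v\<in>W. g u v = g v u) \<and>
     (\<forall>u\<in>W. u \<noteq> 0 \<longrightarrow> 0 < g u u)"

definition left_invariant_metric ::
  "real^'n^'n \<Rightarrow> ((real^'n) \<times> real \<Rightarrow> ((real^'n) \<times> real) set)
     \<Rightarrow> ((real^'n) \<times> real \<Rightarrow> (real^'n) \<times> real \<Rightarrow> (real^'n) \<times> real \<Rightarrow> real) \<Rightarrow> bool" where
  "left_invariant_metric B H g \<longleftrightarrow>
     (\<forall>p. inner_product_on (H p) (g p)) \<and>
     (\<forall>p q. \<forall>v\<in>H q. \<forall>w\<in>H q.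
        g (p \<otimes>\<^bsub>sdp B\<^esub> q) (dleft B p q v) (dleft B p q w) = g q v w)"

definition ordered_basis :: "nat \<Rightarrow> 'a::real_vector set \<Rightarrow> (nat \<Rightarrow> 'a) \<Rightarrow> bool" where
  "ordered_basis d W s \<longleftrightarrow>
     inj_on s {1..d} \<and> independent (s ` {1..d}) \<and> span (s ` {1..d}) = W"

text \<open>
  The transition matrix is indexed by natural numbers because the rank \<open>d\<close> is not a type;
  its determinant is written out by the Leibniz formula.
\<close>

definition same_orientation ::
  "nat \<Rightarrow> (nat \<Rightarrow> 'a::real_vector) \<Rightarrow> (nat \<Rightarrow> 'a) \<Rightarrow> bool" where
  "same_orientation d s s' \<longleftrightarrow>
     (\<exists>M :: nat \<Rightarrow> nat \<Rightarrow> real.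
        (\<forall>i\<in>{1..d}. s' i = (\<Sum>j=1..d. M i j *\<^sub>R s j)) \<and>
        0 < (\<Sum>\<pi> | \<pi> permutes {1..d}. of_int (sign \<pi>) * (\<Prod>i=1..d. M i (\<pi> i))))"

definition orientation_of ::
  "nat \<Rightarrow> 'a::real_vector set \<Rightarrow> (nat \<Rightarrow> 'a) set \<Rightarrow> bool" where
  "orientation_of d W Or \<longleftrightarrow>
     (\<exists>s. ordered_basis d W s \<and> Or = {s'. ordered_basis d W s' \<and> same_orientation d s s'})"

definition left_invariant_orientation ::
  "real^'n^'n \<Rightarrow> nat \<Rightarrow> ((real^'n) \<times> real \<Rightarrow> ((real^'n) \<times> real) set)
     \<Rightarrow> ((real^'n) \<times> real \<Rightarrow> (nat \<Rightarrow> (real^'n) \<times> real) set) \<Rightarrow> bool" where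
  "left_invariant_orientation B d H Or \<longleftrightarrow>
     (\<forall>p. orientation_of d (H p) (Or p)) \<and>
     (\<forall>p q s. ordered_basis d (H q) s \<longrightarrow>
        ((\<lambda>i. dleft B p q (s i)) \<in> Or (p \<otimes>\<^bsub>sdp B\<^esub> q) \<longleftrightarrow> s \<in> Or q))"

definition orthonormal ::
  "nat \<Rightarrow> ('a \<Rightarrow> 'a \<Rightarrow> real) \<Rightarrow> (nat \<Rightarrow> 'a) \<Rightarrow> bool" where
  "orthonormal d g s \<longleftrightarrow> (\<forall>i\<in>{1..d}. \<forall>j\<in>{1..d}. g (s i) (s j) = (if i = j then 1 else 0))"

definition sections ::
  "((real^'n) \<times> real \<Rightarrow> ((real^'n) \<times> real) set)
     \<Rightarrow> ((real^'n) \<times> real \<Rightarrow> (real^'n) \<times> real) set" where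
  "sections H = {X. smooth X \<and> (\<forall>p. X p \<in> H p)}"

definition metric_connection ::
  "((real^'n) \<times> real \<Rightarrow> ((real^'n) \<times> real) set)
     \<Rightarrow> ((real^'n) \<times> real \<Rightarrow> (real^'n) \<times> real \<Rightarrow> (real^'n) \<times> real \<Rightarrow> real)
     \<Rightarrow> (((real^'n) \<times> real \<Rightarrow> (real^'n) \<times> real) \<Rightarrow> ((real^'n) \<times> real \<Rightarrow> (real^'n) \<times> real)
           \<Rightarrow> ((real^'n) \<times> real \<Rightarrow> (real^'n) \<times> real)) \<Rightarrow> bool" where
  "metric_connection H g nabla \<longleftrightarrow>
     (\<forall>X\<in>sections H. \<forall>Y\<in>sections H. nabla X Y \<in> sections H) \<and>
     (\<forall>X\<in>sections H. \<forall>X'\<in>sections H. \<forall>Y\<in>sections H.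
        nabla (\<lambda>p. X p + X' p) Y = (\<lambda>p. nabla X Y p + nabla X' Y p)) \<and>
     (\<forall>X\<in>sections H. \<forall>Y\<in>sections H. \<forall>Y'\<in>sections H.
        nabla X (\<lambda>p. Y p + Y' p) = (\<lambda>p. nabla X Y p + nabla X Y' p)) \<and>
     (\<forall>f :: (real^'n) \<times> real \<Rightarrow> real. smooth f \<longrightarrow>
        (\<forall>X\<in>sections H. \<forall>Y\<in>sections H.
           nabla (\<lambda>p. f p *\<^sub>R X p) Y = (\<lambda>p. f p *\<^sub>R nabla X Y p) \<and>
           nabla X (\<lambda>p. f p *\<^sub>R Y p) =
             (\<lambda>p. dir_deriv X f p *\<^sub>R Y p + f p *\<^sub>R nabla X Y p))) \<and>
     (\<forall>X\<in>sections H. \<forall>Y\<in>sections H. \<forall>Z\<in>sections H. \<forall>p.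
        dir_deriv X (\<lambda>q. g q (Y q) (Z q)) p =
          g p (nabla X Y p) (Z p) + g p (Y p) (nabla X Z p))"

definition left_invariant_connection ::
  "real^'n^'n \<Rightarrow> ((real^'n) \<times> real \<Rightarrow> ((real^'n) \<times> real) set)
     \<Rightarrow> (((real^'n) \<times> real \<Rightarrow> (real^'n) \<times> real) \<Rightarrow> ((real^'n) \<times> real \<Rightarrow> (real^'n) \<times> real)
           \<Rightarrow> ((real^'n) \<times> real \<Rightarrow> (real^'n) \<times> real)) \<Rightarrow> bool" where
  "left_invariant_connection B H nabla \<longleftrightarrow>
     (\<forall>p. \<forall>X\<in>sections H. \<forall>Y\<in>sections H.
        nabla (push_field B p X) (push_field B p Y) = push_field B p (nabla X Y))"

text \<open>
  A local orthonormal frame over \<open>U\<close> is given by global sections that are orthonormal at the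
  points of \<open>U\<close>; after shrinking \<open>U\<close> every local frame is of this form, and the
  connection only has to be applied to global sections.
\<close>

definition divergence_condition ::
  "real^'n^'n \<Rightarrow> nat \<Rightarrow> ((real^'n) \<times> real \<Rightarrow> ((real^'n) \<times> real) set)
     \<Rightarrow> ((real^'n) \<times> real \<Rightarrow> (real^'n) \<times> real \<Rightarrow> (real^'n) \<times> real \<Rightarrow> real)
     \<Rightarrow> (((real^'n) \<times> real \<Rightarrow> (real^'n) \<times> real) \<Rightarrow> ((real^'n) \<times> real \<Rightarrow> (real^'n) \<times> real)
           \<Rightarrow> ((real^'n) \<times> real \<Rightarrow> (real^'n) \<times> real)) \<Rightarrow> bool" where
  "divergence_condition B d H g nabla \<longleftrightarrow>
     (\<forall>X\<in>sections H. \<forall>U S. open U \<longrightarrow> (\<forall>i\<in>{1..d}. S i \<in> sections H) \<longrightarrow>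
        (\<forall>p\<in>U. orthonormal d (g p) (\<lambda>i. S i p)) \<longrightarrow>
        (\<forall>p\<in>U. divergence B X p = (\<Sum>i=1..d. g p (nabla (S i) X p) (S i p))))"

definition christoffel ::
  "real^'n^'n \<Rightarrow> ((real^'n) \<times> real \<Rightarrow> (real^'n) \<times> real \<Rightarrow> (real^'n) \<times> real \<Rightarrow> real)
     \<Rightarrow> (((real^'n) \<times> real \<Rightarrow> (real^'n) \<times> real) \<Rightarrow> ((real^'n) \<times> real \<Rightarrow> (real^'n) \<times> real)
           \<Rightarrow> ((real^'n) \<times> real \<Rightarrow> (real^'n) \<times> real))
     \<Rightarrow> (nat \<Rightarrow> (real^'n) \<times> real) \<Rightarrow> nat \<Rightarrow> nat \<Rightarrow> nat \<Rightarrow> (real^'n) \<times> real \<Rightarrow> real" where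
  "christoffel B g nabla s i j k p =
     g p (nabla (left_field B (s i)) (left_field B (s j)) p) (left_field B (s k) p)"

definition adapted_basis ::
  "nat \<Rightarrow> ((real^'n) \<times> real) set \<Rightarrow> ((real^'n) \<times> real \<Rightarrow> (real^'n) \<times> real \<Rightarrow> real)
     \<Rightarrow> (nat \<Rightarrow> (real^'n) \<times> real) set \<Rightarrow> (nat \<Rightarrow> (real^'n) \<times> real) \<Rightarrow> bool" where
  "adapted_basis d W g Or s \<longleftrightarrow>
     ordered_basis d W s \<and> orthonormal d g s \<and> s \<in> Or \<and>
     (\<forall>i\<in>{1..<d}. s i \<in> W \<inter> ideal_n) \<and> (\<exists>c>0. s d = c *\<^sub>R bvec)"


section \<open>The complex spinor representation\<close>

definition hermitian_inner_product :: "(complex^'m \<Rightarrow> complex^'m \<Rightarrow> complex) \<Rightarrow> bool" where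
  "hermitian_inner_product h \<longleftrightarrow>
     (\<forall>a x y z. h (a *s x + y) z = a * h x z + h y z) \<and>
     (\<forall>x y. h y x = cnj (h x y)) \<and>
     (\<forall>x. x \<noteq> 0 \<longrightarrow> 0 < Re (h x x))"

text \<open>
  By the universal property of the Clifford algebra, a complex module over it is a real-linear
  map \<open>cl\<close> from \<open>W\<close> to the complex-linear endomorphisms with
  \<open>cl v \<circ> cl v = - g v v\<close>; its submodules are the complex subspaces invariant under
  all \<open>cl v\<close>.
\<close>

definition spinor_representation ::
  "'a::real_vector set \<Rightarrow> ('a \<Rightarrow> 'a \<Rightarrow> real) \<Rightarrow> ('a \<Rightarrow> complex^'m \<Rightarrow> complex^'m)
     \<Rightarrow> (complex^'m \<Rightarrow> complex^'m \<Rightarrow> complex) \<Rightarrow> bool" where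
  "spinor_representation W g cl h \<longleftrightarrow>
     (\<forall>v\<in>W. \<forall>a x y. cl v (a *s x + y) = a *s cl v x + cl v y) \<and>
     (\<forall>v\<in>W. \<forall>w\<in>W. \<forall>a x. cl (a *\<^sub>R v + w) x = a *\<^sub>R cl v x + cl w x) \<and>
     (\<forall>v\<in>W. \<forall>x. cl v (cl v x) = - (g v v *\<^sub>R x)) \<and>
     (\<forall>S. vec.subspace S \<and> (\<forall>v\<in>W. cl v ` S \<subseteq> S) \<longrightarrow> S = {0} \<or> S = UNIV) \<and>
     hermitian_inner_product h \<and>
     (\<forall>v\<in>W. \<forall>x y. h (cl v x) y = - h x (cl v y))"


section \<open>Equivariant spinor fields and the Hilbert space\<close>

definition lattice_hom :: "real^'n^'n \<Rightarrow> ((real^'n) \<times> real \<Rightarrow> int) \<Rightarrow> bool" where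
  "lattice_hom B \<epsilon> \<longleftrightarrow>
     \<epsilon> \<in> hom (sdp B\<lparr>carrier := lattice_sub\<rparr>) (integer_mod_group 2)"

definition equivariant ::
  "real^'n^'n \<Rightarrow> ((real^'n) \<times> real \<Rightarrow> int) \<Rightarrow> ((real^'n) \<times> real \<Rightarrow> complex^'m) \<Rightarrow> bool" where
  "equivariant B \<epsilon> \<psi> \<longleftrightarrow>
     (\<forall>\<gamma>\<in>lattice_sub. \<forall>y. \<psi> (\<gamma> \<otimes>\<^bsub>sdp B\<^esub> y) = exp (\<i> * of_real pi * of_int (\<epsilon> \<gamma>)) *s \<psi> y)"

text \<open>
  The quotient of the group by the left action of the lattice is the set of cosets
  \<open>\<Gamma> #> p\<close> with the Borel sets of the quotient topology.
\<close>

definition quotient_space :: "real^'n^'n \<Rightarrow> ((real^'n) \<times> real) set set" where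
  "quotient_space B = rcosets\<^bsub>sdp B\<^esub> lattice_sub"

definition quotient_borel :: "real^'n^'n \<Rightarrow> ((real^'n) \<times> real) set measure" where
  "quotient_borel B = sigma (quotient_space B)
     {U. U \<subseteq> quotient_space B \<and> open {p. lattice_sub #>\<^bsub>sdp B\<^esub> p \<in> U}}"

definition normalised_invariant_measure ::
  "real^'n^'n \<Rightarrow> ((real^'n) \<times> real) set measure \<Rightarrow> bool" where
  "normalised_invariant_measure B \<mu> \<longleftrightarrow>
     sets \<mu> = sets (quotient_borel B) \<and> emeasure \<mu> (space \<mu>) = 1 \<and>
     (\<forall>q. \<forall>S\<in>sets \<mu>. emeasure \<mu> ((\<lambda>C. C #>\<^bsub>sdp B\<^esub> q) ` S) = emeasure \<mu> S)"

text \<open>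
  Pointwise inner products of equivariant maps are invariant under the lattice, since
  \<open>exp (\<i> \<pi> \<epsilon> \<gamma>)\<close> is unitary; the integrand below therefore does not depend on the chosen
  coset representative.
\<close>

definition L2_inner ::
  "((real^'n) \<times> real) set measure \<Rightarrow> (complex^'m \<Rightarrow> complex^'m \<Rightarrow> complex)
     \<Rightarrow> ((real^'n) \<times> real \<Rightarrow> complex^'m) \<Rightarrow> ((real^'n) \<times> real \<Rightarrow> complex^'m) \<Rightarrow> complex" where
  "L2_inner \<mu> h \<psi> \<phi> = (LINT C|\<mu>. (let p = (SOME p. p \<in> C) in h (\<psi> p) (\<phi> p)))"

definition L2_norm ::
  "((real^'n) \<times> real) set measure \<Rightarrow> (complex^'m \<Rightarrow> complex^'m \<Rightarrow> complex)
     \<Rightarrow> ((real^'n) \<times> real \<Rightarrow> complex^'m) \<Rightarrow> real" where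
  "L2_norm \<mu> h \<psi> = sqrt (Re (L2_inner \<mu> h \<psi> \<psi>))"

text \<open>
  \<open>L2_space\<close> represents the tensor product of \<open>L\<^sup>2(G, \<epsilon>)\<close> with the spinor module: spinor-valued
  maps stand for elements of the tensor product, and the completion of the continuous
  equivariant maps is realised as their closure among the square-integrable equivariant
  Borel maps. Maps at \<open>L2_norm\<close>-distance 0 represent the same element.
\<close>

definition L2_space ::
  "real^'n^'n \<Rightarrow> ((real^'n) \<times> real \<Rightarrow> int) \<Rightarrow> ((real^'n) \<times> real) set measure
     \<Rightarrow> (complex^'m \<Rightarrow> complex^'m \<Rightarrow> complex) \<Rightarrow> ((real^'n) \<times> real \<Rightarrow> complex^'m) set" where
  "L2_space B \<epsilon> \<mu> h =
     {\<psi>. \<psi> \<in> borel_measurable borel \<and> equivariant B \<epsilon> \<psi> \<and>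
          integrable \<mu> (\<lambda>C. let p = (SOME p. p \<in> C) in h (\<psi> p) (\<psi> p)) \<and>
          (\<exists>u. (\<forall>m. continuous_on UNIV (u m) \<and> equivariant B \<epsilon> (u m)) \<and>
               (\<lambda>m. L2_norm \<mu> h (\<lambda>p. u m p - \<psi> p)) \<longlonglongrightarrow> 0)}"

definition smooth_spinors ::
  "real^'n^'n \<Rightarrow> ((real^'n) \<times> real \<Rightarrow> int) \<Rightarrow> ((real^'n) \<times> real \<Rightarrow> complex^'m) set" where
  "smooth_spinors B \<epsilon> = {\<psi>. smooth \<psi> \<and> equivariant B \<epsilon> \<psi>}"


section \<open>The sub-Dirac operator, its closure and its spectrum\<close>

definition sub_dirac ::
  "real^'n^'n \<Rightarrow> nat \<Rightarrow> ((real^'n) \<times> real \<Rightarrow> (real^'n) \<times> real \<Rightarrow> (real^'n) \<times> real \<Rightarrow> real)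
     \<Rightarrow> (((real^'n) \<times> real \<Rightarrow> (real^'n) \<times> real) \<Rightarrow> ((real^'n) \<times> real \<Rightarrow> (real^'n) \<times> real)
           \<Rightarrow> ((real^'n) \<times> real \<Rightarrow> (real^'n) \<times> real))
     \<Rightarrow> ((real^'n) \<times> real \<Rightarrow> complex^'m \<Rightarrow> complex^'m) \<Rightarrow> (nat \<Rightarrow> (real^'n) \<times> real)
     \<Rightarrow> ((real^'n) \<times> real \<Rightarrow> complex^'m) \<Rightarrow> ((real^'n) \<times> real \<Rightarrow> complex^'m)" where
  "sub_dirac B d g nabla cl s \<psi> p =
     (\<Sum>i=1..d. cl (s i) (dir_deriv (left_field B (s i)) \<psi> p)) +
     (1/4) *\<^sub>R (\<Sum>i=1..d. \<Sum>j=1..d. \<Sum>k=1..d.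
        christoffel B g nabla s i j k p *\<^sub>R cl (s i) (cl (s j) (cl (s k) (\<psi> p))))"

text \<open>
  In the next three definitions \<open>N\<close> is the norm of a Hilbert space \<open>L\<close> of maps (up to maps
  of norm 0), and \<open>D\<close> is an operator with domain \<open>V\<close>.
  \<open>closure_graph N L V D\<close> is the graph of the closure of \<open>D\<close>;
  \<open>closable\<close> says that it is the graph of an operator.
\<close>

definition closure_graph ::
  "(('a \<Rightarrow> complex^'m) \<Rightarrow> real) \<Rightarrow> ('a \<Rightarrow> complex^'m) set \<Rightarrow> ('a \<Rightarrow> complex^'m) set
     \<Rightarrow> (('a \<Rightarrow> complex^'m) \<Rightarrow> ('a \<Rightarrow> complex^'m))
     \<Rightarrow> (('a \<Rightarrow> complex^'m) \<times> ('a \<Rightarrow> complex^'m)) set" where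
  "closure_graph N L V D =
     {(\<psi>, \<phi>). \<psi> \<in> L \<and> \<phi> \<in> L \<and>
        (\<exists>u. (\<forall>m::nat. u m \<in> V) \<and>
             (\<lambda>m. N (\<lambda>p. u m p - \<psi> p)) \<longlonglongrightarrow> 0 \<and>
             (\<lambda>m. N (\<lambda>p. D (u m) p - \<phi> p)) \<longlonglongrightarrow> 0)}"

definition closable ::
  "(('a \<Rightarrow> complex^'m) \<Rightarrow> real) \<Rightarrow> ('a \<Rightarrow> complex^'m) set \<Rightarrow> ('a \<Rightarrow> complex^'m) set
     \<Rightarrow> (('a \<Rightarrow> complex^'m) \<Rightarrow> ('a \<Rightarrow> complex^'m)) \<Rightarrow> bool" where
  "closable N L V D \<longleftrightarrow>
     (\<forall>\<psi> \<phi>. (\<psi>, \<phi>) \<in> closure_graph N L V D \<and> N \<psi> = 0 \<longrightarrow> N \<phi> = 0)"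

definition closure_eigenvector ::
  "(('a \<Rightarrow> complex^'m) \<Rightarrow> real) \<Rightarrow> ('a \<Rightarrow> complex^'m) set \<Rightarrow> ('a \<Rightarrow> complex^'m) set
     \<Rightarrow> (('a \<Rightarrow> complex^'m) \<Rightarrow> ('a \<Rightarrow> complex^'m)) \<Rightarrow> ('a \<Rightarrow> complex^'m) \<Rightarrow> bool" where
  "closure_eigenvector N L V D \<psi> \<longleftrightarrow>
     N \<psi> \<noteq> 0 \<and> (\<exists>l::complex. (\<psi>, \<lambda>p. l *s \<psi> p) \<in> closure_graph N L V D)"

definition orthonormal_basis ::
  "(('a \<Rightarrow> complex^'m) \<Rightarrow> ('a \<Rightarrow> complex^'m) \<Rightarrow> complex) \<Rightarrow> (('a \<Rightarrow> complex^'m) \<Rightarrow> real)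
     \<Rightarrow> ('a \<Rightarrow> complex^'m) set \<Rightarrow> ('a \<Rightarrow> complex^'m) set \<Rightarrow> bool" where
  "orthonormal_basis ip N L E \<longleftrightarrow>
     E \<subseteq> L \<and>
     (\<forall>e\<in>E. \<forall>f\<in>E. ip e f = (if e = f then 1 else 0)) \<and>
     (\<forall>\<psi>\<in>L. \<forall>\<delta>>0. \<exists>F a. finite F \<and> F \<subseteq> E \<and> N (\<lambda>p. \<psi> p - (\<Sum>e\<in>F. a e *s e p)) < \<delta>)"

definition pure_point_closure ::
  "(('a \<Rightarrow> complex^'m) \<Rightarrow> ('a \<Rightarrow> complex^'m) \<Rightarrow> complex) \<Rightarrow> (('a \<Rightarrow> complex^'m) \<Rightarrow> real)
     \<Rightarrow> ('a \<Rightarrow> complex^'m) set \<Rightarrow> ('a \<Rightarrow> complex^'m) set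
     \<Rightarrow> (('a \<Rightarrow> complex^'m) \<Rightarrow> ('a \<Rightarrow> complex^'m)) \<Rightarrow> bool" where
  "pure_point_closure ip N L V D \<longleftrightarrow>
     closable N L V D \<and>
     (\<exists>E. orthonormal_basis ip N L E \<and> (\<forall>e\<in>E. closure_eigenvector N L V D e))"

end

theory Submission
  imports
    Defs
    "HOL-Library.Function_Algebras"
    "HOL-Computational_Algebra.Polynomial"
    "HOL-Complex_Analysis.Great_Picard"
begin

text \<open>
  Expand a spinor field along the abelian normal subgroup \<open>\<real>\<^sup>n\<close>. For a character \<open>l\<close> of \<open>\<real>\<^sup>n\<close> that
  agrees with \<open>\<epsilon>\<close> on \<open>\<int>\<^sup>n\<close>, and \<open>f\<close> on \<open>\<real>\<close>, averaging \<open>exp (2 \<pi> \<i> l x) f (t)\<close> over the translations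
  by \<open>\<int>\<close> gives an equivariant field on which the sub-Dirac operator acts as the ordinary differential
  operator \<open>c e f' + P f + W f\<close>, where \<open>e\<close> is Clifford multiplication by \<open>s\<^sub>d\<close> and \<open>P\<close> is Clifford
  multiplication by a vector whose entries are polynomials in \<open>t\<close>, because the flow is unipotent; the
  divergence condition makes \<open>W\<close> hermitian. If \<open>l\<close> is not fixed by the flow then, \<open>\<H>\<close> being bracket
  generating, \<open>P\<close> is not constant, so its square tends to infinity; the averaging map is isometric, and
  the operator has compact graph ball and dense ranges of \<open>D \<plusminus> \<i>\<close>. If \<open>l\<close> is fixed, Fourier
  expansion in \<open>t\<close> leaves finite-dimensional invariant subspaces. On each of these pieces eigenvectors are
  dense, and by the Weierstrass theorem on the torus the pieces together span a dense subspace.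
\<close>

section \<open>Symmetric operators with compact graph balls\<close>

text \<open>Vectors are functions, not classes modulo null sets, so the inner product is only
  semi-definite, and limits, projections and resolvents are determined up to vectors of seminorm 0.
  Different characters may give the same piece: \<open>l\<close> and its image under the transposed
  integral flow are averaged to the same fields. The pieces are therefore not an orthogonal
  decomposition, and eigenbases of the pieces cannot be united. Only the density of their sum is
  used; the orthonormal basis is a maximal orthonormal system of eigenvectors of the whole operator.
  The average is isometric because, for a character that is not fixed, no non-trivial integral flow
  fixes it either: the frequencies are polynomials in time, and a polynomial taking one value at all
  multiples of a period is constant. For the same reason the flow has determinant 1 at all times.
  Clifford multiplication by \<open>s d\<close> anticommutes with the multiplications in
  \<open>P\<close>, so \<open>D\<close> squares to an operator of Schroedinger type; this is what
  turns growth of \<open>P\<close> into compactness.\<close>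

locale semi_inner = VS: vector_space sc
  for sc :: "complex \<Rightarrow> 'v::ab_group_add \<Rightarrow> 'v" +
  fixes ip :: "'v \<Rightarrow> 'v \<Rightarrow> complex" and L :: "'v set"
  assumes L_sub: "VS.subspace L"
    and ip_add: "x \<in> L \<Longrightarrow> y \<in> L \<Longrightarrow> z \<in> L \<Longrightarrow> ip (x + y) z = ip x z + ip y z"
    and ip_scale: "x \<in> L \<Longrightarrow> y \<in> L \<Longrightarrow> ip (sc a x) y = a * ip x y"
    and ip_cnj: "x \<in> L \<Longrightarrow> y \<in> L \<Longrightarrow> ip y x = cnj (ip x y)"
    and ip_pos: "x \<in> L \<Longrightarrow> 0 \<le> Re (ip x x)"
begin

definition N :: "'v \<Rightarrow> real" where "N x = sqrt (Re (ip x x))"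

text \<open>Limits in this sense are unique only up to vectors of seminorm 0, see
  \<open>tends_unique\<close>.\<close>

definition tends :: "(nat \<Rightarrow> 'v) \<Rightarrow> 'v \<Rightarrow> bool" where
  "tends u x \<longleftrightarrow> (\<lambda>n. N (u n - x)) \<longlonglongrightarrow> 0"

definition clo :: "'v set \<Rightarrow> 'v set" where
  "clo S = {x \<in> L. \<forall>\<delta>>0. \<exists>s\<in>S. N (x - s) < \<delta>}"

lemmas L_add [simp, intro] = VS.subspace_add[OF L_sub]
lemmas L_diff [simp, intro] = VS.subspace_diff[OF L_sub]
lemmas L_scale [simp, intro] = VS.subspace_scale[OF L_sub]
lemmas L_zero [simp, intro] = VS.subspace_0[OF L_sub]
lemmas L_neg [simp, intro] = VS.subspace_neg[OF L_sub]

lemma N_nonneg [simp]: "x \<in> L \<Longrightarrow> 0 \<le> N x"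
  by (simp add: N_def ip_pos)

lemma ip_self: assumes "x \<in> L" shows "ip x x = of_real ((N x)\<^sup>2)"
proof -
  have "Im (ip x x) = 0" using ip_cnj[OF assms assms] by (metis Reals_cnj_iff complex_is_Real_iff)
  thus ?thesis using ip_pos[OF assms] by (simp add: N_def complex_eq_iff)
qed

lemma N_sq: "x \<in> L \<Longrightarrow> (N x)\<^sup>2 = Re (ip x x)"
  by (simp add: N_def ip_pos)

lemma ip_add_right: "x \<in> L \<Longrightarrow> y \<in> L \<Longrightarrow> z \<in> L \<Longrightarrow> ip z (x + y) = ip z x + ip z y"
  by (metis L_add complex_cnj_add ip_add ip_cnj)

lemma ip_scale_right: "x \<in> L \<Longrightarrow> y \<in> L \<Longrightarrow> ip x (sc a y) = cnj a * ip x y"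
  by (metis L_scale complex_cnj_mult ip_cnj ip_scale)

lemma ip_neg: "x \<in> L \<Longrightarrow> y \<in> L \<Longrightarrow> ip (- x) y = - ip x y"
  using ip_scale[of x y "-1"] by simp

lemma ip_neg_right: "x \<in> L \<Longrightarrow> y \<in> L \<Longrightarrow> ip x (- y) = - ip x y"
  using ip_scale_right[of x y "-1"] by simp

lemma ip_diff: "x \<in> L \<Longrightarrow> y \<in> L \<Longrightarrow> z \<in> L \<Longrightarrow> ip (x - y) z = ip x z - ip y z"
  using ip_add[of x "-y" z] by (simp add: ip_neg)

lemma ip_diff_right: "x \<in> L \<Longrightarrow> y \<in> L \<Longrightarrow> z \<in> L \<Longrightarrow> ip z (x - y) = ip z x - ip z y"
  using ip_add_right[of x "-y" z] by (simp add: ip_neg_right)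

lemma ip_zero [simp]: "x \<in> L \<Longrightarrow> ip 0 x = 0"
  using ip_scale[of 0 x 0] by simp

lemma ip_zero_right [simp]: "x \<in> L \<Longrightarrow> ip x 0 = 0"
  using ip_scale_right[of x 0 0] by simp

lemmas ip_simps = ip_add ip_add_right ip_scale ip_scale_right ip_diff ip_diff_right ip_neg ip_neg_right

lemma N_zero [simp]: "N 0 = 0" by (simp add: N_def)

lemma N_scale: assumes "x \<in> L" shows "N (sc a x) = cmod a * N x"
proof -
  have "ip (sc a x) (sc a x) = a * cnj a * ip x x" using assms by (simp add: ip_simps)
  hence "Re (ip (sc a x) (sc a x)) = (cmod a)\<^sup>2 * Re (ip x x)"
    by (metis complex_norm_square ip_self assms of_real_mult Re_complex_of_real)
  thus ?thesis by (simp add: N_def real_sqrt_mult)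
qed

lemma N_minus [simp]: "x \<in> L \<Longrightarrow> N (- x) = N x"
  using N_scale[of x "-1"] by simp

lemma N_commute: "x \<in> L \<Longrightarrow> y \<in> L \<Longrightarrow> N (x - y) = N (y - x)"
  using N_minus[of "x - y"] by simp

lemma N_add_sq: assumes "x \<in> L" "y \<in> L"
  shows "(N (x + y))\<^sup>2 = (N x)\<^sup>2 + (N y)\<^sup>2 + 2 * Re (ip x y)"
  using assms by (simp add: N_sq ip_simps ip_cnj[of x y])

lemma N_diff_sq: assumes "x \<in> L" "y \<in> L"
  shows "(N (x - y))\<^sup>2 = (N x)\<^sup>2 + (N y)\<^sup>2 - 2 * Re (ip x y)"
  using assms by (simp add: N_sq ip_simps ip_cnj[of x y])

text \<open>The discriminant argument, with \<open>N y = 0\<close> as a separate case because a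
  seminorm may vanish at nonzero vectors; there the quadratic bound degenerates to a linear
  one.\<close>

lemma CS: assumes x: "x \<in> L" and y: "y \<in> L" shows "cmod (ip x y) \<le> N x * N y"
proof -
  define a where "a = ip x y"
  \<comment> \<open>The factor \<open>a\<close> in the multiple of \<open>y\<close> makes the cross
    term real, so a real parameter \<open>t\<close> is enough.\<close>
  have q: "0 \<le> (N x)\<^sup>2 - 2 * t * (cmod a)\<^sup>2 + t\<^sup>2 * (cmod a)\<^sup>2 * (N y)\<^sup>2" for t :: real
  proof -
    have "0 \<le> (N (x - sc (of_real t * a) y))\<^sup>2" by simp
    also have "... = (N x)\<^sup>2 + (cmod (of_real t * a) * N y)\<^sup>2 - 2 * Re (cnj (of_real t * a) * a)"
      using x y by (simp add: N_diff_sq N_scale ip_scale_right a_def)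
    also have "cnj (of_real t * a) * a = of_real (t * (cmod a)\<^sup>2)"
      by (metis (no_types, lifting) complex_cnj_complex_of_real complex_cnj_mult complex_norm_square mult.assoc mult.commute of_real_mult)
    finally show ?thesis by (simp add: norm_mult power_mult_distrib algebra_simps)
  qed
  show ?thesis
  proof (cases "N y = 0")
    case True
    have "a = 0"
    proof (rule ccontr)
      assume "a \<noteq> 0"
      hence p: "(cmod a)\<^sup>2 > 0" by simp
      \<comment> \<open>For \<open>N y = 0\<close> this value of \<open>t\<close> turns the
        right-hand side into -1.\<close>
      have "0 \<le> (N x)\<^sup>2 - 2 * (((N x)\<^sup>2 + 1) / (2 * (cmod a)\<^sup>2)) * (cmod a)\<^sup>2"
        using q[of "((N x)\<^sup>2 + 1) / (2 * (cmod a)\<^sup>2)"] True by simp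
      with p show False by simp
    qed
    thus ?thesis using True x y by (simp add: a_def)
  next
    case False
    hence p: "0 < (N y)\<^sup>2" by simp
    have "0 \<le> (N x)\<^sup>2 - (cmod a)\<^sup>2 / (N y)\<^sup>2"
      using q[of "1 / (N y)\<^sup>2"] False by (simp add: power2_eq_square field_simps)
    hence "(cmod a)\<^sup>2 \<le> (N x * N y)\<^sup>2" using p by (simp add: field_simps power_mult_distrib)
    thus ?thesis unfolding a_def using x y by (meson N_nonneg mult_nonneg_nonneg power2_le_imp_le)
  qed
qed

lemma N_triangle: assumes x: "x \<in> L" and y: "y \<in> L" shows "N (x + y) \<le> N x + N y"
proof -
  have "(N (x + y))\<^sup>2 \<le> (N x + N y)\<^sup>2"
    using CS[OF x y] complex_Re_le_cmod[of "ip x y"] x y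
    by (simp add: N_add_sq power2_sum)
  thus ?thesis using x y by (meson N_nonneg add_nonneg_nonneg power2_le_imp_le)
qed

lemma N_triangle_diff: "x \<in> L \<Longrightarrow> y \<in> L \<Longrightarrow> N (x - y) \<le> N x + N y"
  using N_triangle[of x "-y"] by simp

lemma N_triangle3: "x \<in> L \<Longrightarrow> y \<in> L \<Longrightarrow> z \<in> L \<Longrightarrow> N (x - z) \<le> N (x - y) + N (y - z)"
  using N_triangle[of "x - y" "y - z"] by simp

lemma N_abs_diff: assumes "x \<in> L" "y \<in> L" shows "\<bar>N x - N y\<bar> \<le> N (x - y)"
  using N_triangle3[of x y 0] N_triangle3[of y x 0] N_commute assms by force

lemma N_null_ip: "x \<in> L \<Longrightarrow> y \<in> L \<Longrightarrow> N x = 0 \<Longrightarrow> ip x y = 0"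
  using CS[of x y] by simp

lemma tends_const [simp]: "tends (\<lambda>n. x) x" by (simp add: tends_def)

lemma tends_null: assumes "tends u x" "\<And>n. u n \<in> L" "x \<in> L" "y \<in> L" "N (x - y) = 0"
  shows "tends u y"
  unfolding tends_def
proof (rule tendsto_sandwich[of "\<lambda>n. 0" _ _ "\<lambda>n. N (u n - x)"])
  show "\<forall>\<^sub>F n in sequentially. N (u n - y) \<le> N (u n - x)"
    using N_triangle3[OF assms(2) assms(3,4)] assms(5) by simp
qed (use assms in \<open>auto simp: tends_def\<close>)

lemma tends_le: assumes "tends u x" "\<And>n. u n \<in> L" "x \<in> L" "\<And>n. w n \<in> L" "y \<in> L"
   "\<And>n. N (w n - y) \<le> C * N (u n - x)"
  shows "tends w y"
  unfolding tends_def
proof (rule tendsto_sandwich[of "\<lambda>n. 0" _ _ "\<lambda>n. C * N (u n - x)"])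
  show "(\<lambda>n. C * N (u n - x)) \<longlonglongrightarrow> 0"
    using tendsto_mult_right_zero[of _ sequentially C] assms(1) unfolding tends_def by blast
qed (use assms in \<open>auto simp: tends_def\<close>)

lemma tends_scale: assumes "tends u x" "\<And>n. u n \<in> L" "x \<in> L"
  shows "tends (\<lambda>n. sc a (u n)) (sc a x)"
proof (rule tends_le[OF assms, of _ _ "cmod a"])
  show "N (sc a (u n) - sc a x) \<le> cmod a * N (u n - x)" for n
    using assms N_scale[of "u n - x" a] by (simp add: VS.scale_right_diff_distrib)
qed (use assms in auto)

lemma tends_add: assumes "tends u x" "\<And>n. u n \<in> L" "x \<in> L" "tends w y" "\<And>n. w n \<in> L" "y \<in> L"
  shows "tends (\<lambda>n. u n + w n) (x + y)"
  unfolding tends_def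
proof (rule tendsto_sandwich[of "\<lambda>n. 0" _ _ "\<lambda>n. N (u n - x) + N (w n - y)"])
  show "(\<lambda>n. N (u n - x) + N (w n - y)) \<longlonglongrightarrow> 0"
    using tendsto_add[of _ 0 sequentially _ 0] assms unfolding tends_def by force
  have "N (u n + w n - (x + y)) \<le> N (u n - x) + N (w n - y)" for n
    using N_triangle[of "u n - x" "w n - y"] assms by (simp add: algebra_simps)
  thus "\<forall>\<^sub>F n in sequentially. N (u n + w n - (x + y)) \<le> N (u n - x) + N (w n - y)" by simp
qed (use assms in auto)

lemma tends_diff: assumes "tends u x" "\<And>n. u n \<in> L" "x \<in> L" "tends w y" "\<And>n. w n \<in> L" "y \<in> L"
  shows "tends (\<lambda>n. u n - w n) (x - y)"
  using tends_add[OF assms(1-3), of "\<lambda>n. sc (-1) (w n)" "sc (-1) y"] tends_scale[OF assms(4-6), of "-1"] assms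
  by simp

lemma tends_N: assumes "tends u x" "\<And>n. u n \<in> L" "x \<in> L" shows "(\<lambda>n. N (u n)) \<longlonglongrightarrow> N x"
proof -
  have "(\<lambda>n. N (u n) - N x) \<longlonglongrightarrow> 0"
  proof (rule Lim_null_comparison[of _ "\<lambda>n. N (u n - x)"])
    show "\<forall>\<^sub>F n in sequentially. norm (N (u n) - N x) \<le> N (u n - x)"
      using N_abs_diff assms by simp
  qed (use assms in \<open>simp add: tends_def\<close>)
  thus ?thesis by (simp add: LIM_zero_iff)
qed

lemma tends_ip: assumes "tends u x" "\<And>n. u n \<in> L" "x \<in> L" "tends w y" "\<And>n. w n \<in> L" "y \<in> L"
  shows "(\<lambda>n. ip (u n) (w n)) \<longlonglongrightarrow> ip x y"
proof -
  have "(\<lambda>n. ip (u n) (w n) - ip x y) \<longlonglongrightarrow> 0"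
  proof (rule Lim_null_comparison[of _ "\<lambda>n. N (u n - x) * N (w n) + N x * N (w n - y)"])
    have "ip (u n) (w n) - ip x y = ip (u n - x) (w n) + ip x (w n - y)" for n
      using assms by (simp add: ip_simps)
    hence "norm (ip (u n) (w n) - ip x y) \<le> N (u n - x) * N (w n) + N x * N (w n - y)" for n
      using norm_triangle_mono[OF CS CS, of "u n - x" "w n" x "w n - y"] assms by simp
    thus "\<forall>\<^sub>F n in sequentially. norm (ip (u n) (w n) - ip x y) \<le> N (u n - x) * N (w n) + N x * N (w n - y)"
      by simp
    have "(\<lambda>n. N (u n - x) * N (w n) + N x * N (w n - y)) \<longlonglongrightarrow> 0 * N y + N x * 0"
      by (intro tendsto_intros tends_N) (use assms in \<open>auto simp: tends_def\<close>)
    thus "(\<lambda>n. N (u n - x) * N (w n) + N x * N (w n - y)) \<longlonglongrightarrow> 0" by simp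
  qed
  thus ?thesis by (simp add: LIM_zero_iff)
qed

lemma tends_unique: assumes "tends u x" "\<And>n. u n \<in> L" "x \<in> L" "tends u y" "y \<in> L"
  shows "N (x - y) = 0"
proof -
  have "tends (\<lambda>n. u n - u n) (x - y)" using assms by (intro tends_diff) auto
  hence "(\<lambda>n. N (u n - u n)) \<longlonglongrightarrow> N (x - y)" by (rule tends_N) (use assms in auto)
  thus ?thesis by (simp add: LIMSEQ_const_iff)
qed

lemma clo_iff: assumes "S \<subseteq> L"
  shows "x \<in> clo S \<longleftrightarrow> x \<in> L \<and> (\<exists>u. (\<forall>n. u n \<in> S) \<and> tends u x)"
proof safe
  assume x: "x \<in> clo S"
  thus xL: "x \<in> L" by (simp add: clo_def)
  have "\<forall>n. \<exists>s. s \<in> S \<and> N (x - s) < 1 / real (Suc n)"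
    using x unfolding clo_def by (auto simp: Bex_def)
  then obtain u where u: "\<And>n. u n \<in> S" "\<And>n. N (x - u n) < 1 / real (Suc n)" by metis
  have "tends u x" unfolding tends_def
  proof (rule tendsto_sandwich[of "\<lambda>n. 0" _ _ "\<lambda>n. 1 / real (Suc n)"])
    show "\<forall>\<^sub>F n in sequentially. 0 \<le> N (u n - x)" using u assms xL by (intro always_eventually) (meson L_diff N_nonneg subsetD)
    show "\<forall>\<^sub>F n in sequentially. N (u n - x) \<le> 1 / real (Suc n)"
      using u assms xL N_commute[of _ x] by (intro always_eventually) (metis less_imp_le subsetD)
    show "(\<lambda>n. 1 / real (Suc n)) \<longlonglongrightarrow> 0" using LIMSEQ_Suc[OF lim_1_over_n] by simp
  qed auto
  with u show "\<exists>u. (\<forall>n. u n \<in> S) \<and> tends u x" by blast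
next
  fix u assume xL: "x \<in> L" and u: "\<forall>n. u n \<in> S" and t: "tends u x"
  show "x \<in> clo S" unfolding clo_def
  proof safe
    fix \<delta> :: real assume "0 < \<delta>"
    have "\<forall>\<^sub>F n in sequentially. N (u n - x) < \<delta>"
      using t \<open>0 < \<delta>\<close> unfolding tends_def by (rule order_tendstoD(2))
    then obtain n where "N (u n - x) < \<delta>"
      by (auto simp: eventually_sequentially)
    thus "\<exists>s\<in>S. N (x - s) < \<delta>" using u assms xL N_commute[of x "u n"] by (metis subsetD)
  qed (rule xL)
qed

lemma clo_L: "clo S \<subseteq> L" by (auto simp: clo_def)

lemma clo_superset: "S \<subseteq> L \<Longrightarrow> S \<subseteq> clo S"
  unfolding clo_def by (auto intro: bexI[rotated])

lemma clo_mono: "S \<subseteq> T \<Longrightarrow> clo S \<subseteq> clo T"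
  unfolding clo_def by blast

lemma clo_clo: assumes "S \<subseteq> L" shows "clo (clo S) \<subseteq> clo S"
proof
  fix x assume x: "x \<in> clo (clo S)"
  hence xL: "x \<in> L" by (simp add: clo_def)
  show "x \<in> clo S" unfolding clo_def
  proof safe
    fix \<delta> :: real assume d: "0 < \<delta>"
    hence d2: "0 < \<delta>/2" by simp
    from x d2 obtain y where y: "y \<in> clo S" "N (x - y) < \<delta>/2" unfolding clo_def[of "clo S"] by blast
    from y d2 obtain s where s: "s \<in> S" "N (y - s) < \<delta>/2" unfolding clo_def by blast
    have "N (x - s) < \<delta>" using N_triangle3[of x y s] xL y s assms clo_L by fastforce
    with s show "\<exists>s\<in>S. N (x - s) < \<delta>" by blast
  qed (rule xL)
qed

lemma clo_subspace: assumes S: "VS.subspace S" "S \<subseteq> L" shows "VS.subspace (clo S)"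
proof (rule VS.subspaceI)
  show "0 \<in> clo S" using clo_superset[OF S(2)] VS.subspace_0[OF S(1)] by blast
next
  fix x y assume "x \<in> clo S" "y \<in> clo S"
  then obtain u w where "x \<in> L" "y \<in> L" "\<forall>n. u n \<in> S" "\<forall>n. w n \<in> S" "tends u x" "tends w y"
    unfolding clo_iff[OF S(2)] by blast
  thus "x + y \<in> clo S" unfolding clo_iff[OF S(2)]
    using tends_add[of u x w y] VS.subspace_add[OF S(1)] subsetD[OF S(2)]
    by (intro conjI exI[of _ "\<lambda>n. u n + w n"]) auto
next
  fix a x assume "x \<in> clo S"
  then obtain u where "x \<in> L" "\<forall>n. u n \<in> S" "tends u x"
    unfolding clo_iff[OF S(2)] by blast
  thus "sc a x \<in> clo S" unfolding clo_iff[OF S(2)]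
    using tends_scale[of u x a] VS.subspace_scale[OF S(1)] subsetD[OF S(2)] by (intro conjI exI[of _ "\<lambda>n. sc a (u n)"]) auto
qed

lemma clo_null: assumes "S \<subseteq> L" "x \<in> clo S" "y \<in> L" "N (x - y) = 0" shows "y \<in> clo S"
  using assms unfolding clo_iff[OF assms(1)] using tends_null[of _ x y] by (metis subsetD)

lemma span_L: assumes "A \<subseteq> L" shows "VS.span A \<subseteq> L"
  using VS.span_minimal[OF assms L_sub] .

lemma parallelogram: assumes "x \<in> L" "y \<in> L"
  shows "(N (x + y))\<^sup>2 + (N (x - y))\<^sup>2 = 2 * (N x)\<^sup>2 + 2 * (N y)\<^sup>2"
  using assms by (simp add: N_add_sq N_diff_sq)

end

locale semi_hilbert = semi_inner sc ip L
  for sc :: "complex \<Rightarrow> 'v::ab_group_add \<Rightarrow> 'v" and ip L +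
  assumes complete_ex: "(\<And>n::nat. X n \<in> L) \<Longrightarrow>
       (\<And>e. 0 < e \<Longrightarrow> \<exists>M. \<forall>m\<ge>M. \<forall>n\<ge>M. N (X m - X n) < e) \<Longrightarrow> \<exists>x\<in>L. tends X x"
begin

lemma complete: assumes "\<And>n::nat. X n \<in> L" "\<And>e. 0 < e \<Longrightarrow> \<exists>M. \<forall>m\<ge>M. \<forall>n\<ge>M. N (X m - X n) < e"
  obtains x where "x \<in> L" "tends X x"
  using complete_ex[OF assms] that by blast

text \<open>Minimising sequences for the distance to \<open>S\<close> are Cauchy by the
  parallelogram law. \<open>S\<close> is not assumed closed, so the nearest point is only found in
  \<open>clo S\<close>.\<close>

lemma projection:
  assumes S: "VS.subspace S" "S \<subseteq> L" and v: "v \<in> L"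
  obtains p where "p \<in> clo S" "\<And>e. e \<in> S \<Longrightarrow> ip (v - p) e = 0"
proof -
  define d where "d = Inf ((\<lambda>s. N (v - s)) ` S)"
  have ne: "(\<lambda>s. N (v - s)) ` S \<noteq> {}" using VS.subspace_0[OF S(1)] by blast
  have bb: "bdd_below ((\<lambda>s. N (v - s)) ` S)" using S v by (auto intro!: bdd_belowI2[of _ 0])
  have dle: "d \<le> N (v - s)" if "s \<in> S" for s unfolding d_def using bb that by (simp add: cInf_lower)
  have d0: "0 \<le> d" unfolding d_def using S v by (intro cInf_greatest[OF ne]) auto
  have "\<forall>n. \<exists>s. s \<in> S \<and> N (v - s) < d + 1 / real (Suc n)"
  proof
    fix n
    have "d < d + 1 / real (Suc n)" by simp
    thus "\<exists>s. s \<in> S \<and> N (v - s) < d + 1 / real (Suc n)"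
      unfolding d_def using cInf_lessD[OF ne] by (metis (no_types, lifting) imageE)
  qed
  then obtain s where s: "\<And>n. s n \<in> S" "\<And>n. N (v - s n) < d + 1 / real (Suc n)" by metis
  have sL: "s n \<in> L" for n using s S by blast
  have lim: "(\<lambda>n. N (v - s n)) \<longlonglongrightarrow> d"
  proof (rule tendsto_sandwich[of "\<lambda>n. d" _ _ "\<lambda>n. d + 1 / real (Suc n)"])
    have "(\<lambda>n. d + 1 / real (Suc n)) \<longlonglongrightarrow> d + 0"
      by (intro tendsto_intros) (use LIMSEQ_Suc[OF lim_1_over_n] in simp)
    thus "(\<lambda>n. d + 1 / real (Suc n)) \<longlonglongrightarrow> d" by simp
  qed (use s dle in \<open>auto intro!: always_eventually less_imp_le\<close>)
  have est: "(N (s m - s n))\<^sup>2 \<le> 2 * (N (v - s m))\<^sup>2 + 2 * (N (v - s n))\<^sup>2 - 4 * d\<^sup>2" for m n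
  proof -
    \<comment> \<open>The midpoint of two members of the sequence stays in \<open>S\<close>, so its
      distance from \<open>v\<close> is at least \<open>d\<close>.\<close>
    have m: "sc (1/2) (s m + s n) \<in> S" using s S by (simp add: VS.subspace_add VS.subspace_scale)
    have "sc 2 (v - sc (1/2) (s m + s n)) = (v - s m) + (v - s n)"
      using VS.scale_left_distrib[of 1 1 v]
      by (simp add: VS.scale_right_diff_distrib algebra_simps)
    hence "N ((v - s m) + (v - s n)) = 2 * N (v - sc (1/2) (s m + s n))"
      using N_scale[of "v - sc (1/2) (s m + s n)" 2] v sL by auto
    hence "2 * d \<le> N ((v - s m) + (v - s n))" using dle[OF m] by simp
    hence "4 * d\<^sup>2 \<le> (N ((v - s m) + (v - s n)))\<^sup>2"
      using d0 power_mono[of "2 * d" _ 2] by (simp add: power_mult_distrib)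
    moreover have "N ((v - s m) - (v - s n)) = N (s m - s n)"
      using N_commute[OF sL sL] by simp
    ultimately show ?thesis using parallelogram[of "v - s m" "v - s n"] v sL by simp
  qed
  have cau: "\<exists>M. \<forall>m\<ge>M. \<forall>n\<ge>M. N (s m - s n) < e" if e: "0 < e" for e
  proof -
    have "(\<lambda>n. (N (v - s n))\<^sup>2) \<longlonglongrightarrow> d\<^sup>2" using lim by (intro tendsto_intros)
    moreover have "d\<^sup>2 < d\<^sup>2 + e\<^sup>2 / 4" using e by simp
    ultimately have "\<forall>\<^sub>F n in sequentially. (N (v - s n))\<^sup>2 < d\<^sup>2 + e\<^sup>2 / 4" by (rule order_tendstoD(2))
    then obtain M where M: "\<And>n. n \<ge> M \<Longrightarrow> (N (v - s n))\<^sup>2 < d\<^sup>2 + e\<^sup>2 / 4"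
      by (auto simp: eventually_sequentially)
    have "N (s m - s n) < e" if "m \<ge> M" "n \<ge> M" for m n
    proof -
      have "(N (s m - s n))\<^sup>2 < e\<^sup>2" using est[of m n] M[OF that(1)] M[OF that(2)] by simp
      thus ?thesis using e by (simp add: power_less_imp_less_base)
    qed
    thus ?thesis by blast
  qed
  obtain p where p: "p \<in> L" "tends s p" using complete[OF sL cau] by blast
  have pS: "p \<in> clo S" unfolding clo_iff[OF S(2)] using p s by blast
  have vp: "N (v - p) = d"
  proof -
    have "tends (\<lambda>n. v - s n) (v - p)" using p v sL by (intro tends_diff) auto
    hence "(\<lambda>n. N (v - s n)) \<longlonglongrightarrow> N (v - p)" by (rule tends_N) (use v sL p in auto)
    thus ?thesis using lim LIMSEQ_unique by blast
  qed
  have low: "d \<le> N (v - p - e)" if e: "e \<in> S" for e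
  proof -
    have "e \<in> L" using e S by blast
    have "tends (\<lambda>n. v - s n - e) (v - p - e)" using p v sL \<open>e \<in> L\<close> by (intro tends_diff) auto
    hence "(\<lambda>n. N (v - s n - e)) \<longlonglongrightarrow> N (v - p - e)" by (rule tends_N) (use v sL p \<open>e \<in> L\<close> in auto)
    moreover have "d \<le> N (v - s n - e)" for n
      using dle[of "s n + e"] e s S by (simp add: VS.subspace_add algebra_simps)
    ultimately show ?thesis by (meson LIMSEQ_le_const)
  qed
  have "ip (v - p) e = 0" if e: "e \<in> S" for e
  proof (rule ccontr)
    define a where "a = ip (v - p) e"
    assume "ip (v - p) e \<noteq> 0"
    hence a0: "0 < (cmod a)\<^sup>2" by (simp add: a_def)
    have eL: "e \<in> L" using e S by blast
    have q: "2 * r * (cmod a)\<^sup>2 \<le> r\<^sup>2 * (cmod a)\<^sup>2 * (N e)\<^sup>2" for r :: real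
    proof -
      have "sc (of_real r * a) e \<in> S" using e S VS.subspace_scale by blast
      hence "d \<le> N (v - p - sc (of_real r * a) e)" by (rule low)
      hence "d\<^sup>2 \<le> (N (v - p - sc (of_real r * a) e))\<^sup>2" using d0 power_mono by blast
      also have "... = d\<^sup>2 + (cmod (of_real r * a) * N e)\<^sup>2 - 2 * Re (cnj (of_real r * a) * a)"
        using v p eL by (simp add: N_diff_sq N_scale ip_scale_right a_def vp)
      also have "cnj (of_real r * a) * a = of_real (r * (cmod a)\<^sup>2)"
        by (metis (no_types, lifting) complex_cnj_complex_of_real complex_cnj_mult complex_norm_square mult.assoc mult.commute of_real_mult)
      finally show ?thesis by (simp add: norm_mult power_mult_distrib algebra_simps)
    qed
    have q': "2 * r \<le> r\<^sup>2 * (N e)\<^sup>2" for r :: real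
    proof -
      have "(2 * r) * (cmod a)\<^sup>2 \<le> (r\<^sup>2 * (N e)\<^sup>2) * (cmod a)\<^sup>2" using q[of r] by (simp add: algebra_simps)
      thus ?thesis using a0 by simp
    qed
    \<comment> \<open>A small positive \<open>r\<close> contradicts \<open>q'\<close>; the summand 1
      covers the case \<open>N e = 0\<close>.\<close>
    have "2 * (1 / ((N e)\<^sup>2 + 1)) \<le> (1 / ((N e)\<^sup>2 + 1))\<^sup>2 * (N e)\<^sup>2" using q' by blast
    also have "... \<le> (1 / ((N e)\<^sup>2 + 1))\<^sup>2 * ((N e)\<^sup>2 + 1)" by (intro mult_left_mono) auto
    also have "... = 1 / ((N e)\<^sup>2 + 1)"
      by (simp add: power2_eq_square)
    finally have "2 * (1 / ((N e)\<^sup>2 + 1)) \<le> 1 / ((N e)\<^sup>2 + 1)" .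
    moreover have "0 < 1 / ((N e)\<^sup>2 + 1)" by (simp add: add_nonneg_pos)
    ultimately show False by linarith
  qed
  with pS that show thesis by blast
qed

end

context semi_inner
begin

lemma tends_bound: assumes "\<And>n. N (u n - x) \<le> b n" "b \<longlonglongrightarrow> 0" "\<And>n. u n \<in> L" "x \<in> L"
  shows "tends u x"
  unfolding tends_def
  by (rule tendsto_sandwich[of "\<lambda>n. 0" _ _ b]) (use assms in auto)

lemma tends_subseq: "tends u x \<Longrightarrow> strict_mono r \<Longrightarrow> tends (\<lambda>n. u (r n)) x"
  unfolding tends_def by (drule LIMSEQ_subseq_LIMSEQ) (auto simp: o_def)

lemma tends_Cauchy: assumes "tends u x" "\<And>n. u n \<in> L" "x \<in> L" "0 < e"
  shows "\<exists>M. \<forall>m\<ge>M. \<forall>n\<ge>M. N (u m - u n) < e"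
proof -
  have "\<forall>\<^sub>F n in sequentially. N (u n - x) < e/2"
    using assms(1,4) unfolding tends_def by (intro order_tendstoD(2)[of _ 0]) auto
  then obtain M where M: "\<And>n. n \<ge> M \<Longrightarrow> N (u n - x) < e/2" by (auto simp: eventually_sequentially)
  have "N (u m - u n) < e" if "m \<ge> M" "n \<ge> M" for m n
    using N_triangle3[of "u m" x "u n"] M[OF that(1)] M[OF that(2)] N_commute[of x "u n"] assms by simp
  thus ?thesis by blast
qed

lemma orth_clo: assumes "S \<subseteq> L" "w \<in> L" "\<And>s. s \<in> S \<Longrightarrow> ip w s = 0" "x \<in> clo S" shows "ip w x = 0"
proof -
  obtain u where u: "\<And>n. u n \<in> S" "tends u x" "x \<in> L" using assms clo_iff[OF assms(1)] by blast
  have "(\<lambda>n. ip w (u n)) \<longlonglongrightarrow> ip w x" by (rule tends_ip) (use u assms in auto)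
  moreover have "(\<lambda>n. ip w (u n)) = (\<lambda>n. 0)" using assms u by auto
  ultimately show ?thesis by (simp add: LIMSEQ_const_iff)
qed

end

locale sym_op = semi_hilbert sc ip L
  for sc :: "complex \<Rightarrow> 'v::ab_group_add \<Rightarrow> 'v" and ip L +
  fixes V :: "'v set" and D :: "'v \<Rightarrow> 'v"
  assumes V_sub: "VS.subspace V" and V_L: "V \<subseteq> L"
    and D_L: "u \<in> V \<Longrightarrow> D u \<in> L"
    and D_add: "u \<in> V \<Longrightarrow> w \<in> V \<Longrightarrow> D (u + w) = D u + D w"
    and D_scale: "u \<in> V \<Longrightarrow> D (sc a u) = sc a (D u)"
    and D_sym: "u \<in> V \<Longrightarrow> w \<in> V \<Longrightarrow> ip (D u) w = ip u (D w)"
begin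

text \<open>The graph of the closure of \<open>D\<close>, kept as a relation because limits are not
  unique.\<close>

definition G :: "('v \<times> 'v) set" where
  "G = {(x, y). x \<in> L \<and> y \<in> L \<and> (\<exists>u. (\<forall>n. u n \<in> V) \<and> tends u x \<and> tends (\<lambda>n. D (u n)) y)}"

lemma V_in_L [simp]: "u \<in> V \<Longrightarrow> u \<in> L" using V_L by blast
lemmas D_in_L [simp] = D_L
lemmas V_add = VS.subspace_add[OF V_sub]
lemmas V_scale = VS.subspace_scale[OF V_sub]

lemma V_diff: "u \<in> V \<Longrightarrow> w \<in> V \<Longrightarrow> u - w \<in> V"
  using VS.subspace_diff[OF V_sub] .

lemma D_diff: assumes "u \<in> V" "w \<in> V" shows "D (u - w) = D u - D w"
  using D_add[of u "sc (-1) w"] D_scale[of w "-1"] V_scale[of w "-1"] assms by simp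

lemma G_L: assumes "(x, y) \<in> G" shows "x \<in> L" "y \<in> L" using assms by (auto simp: G_def)

lemma G_V: "u \<in> V \<Longrightarrow> (u, D u) \<in> G"
  unfolding G_def by (auto intro!: exI[of _ "\<lambda>n. u"])

lemma G_add: assumes "(x, y) \<in> G" "(x', y') \<in> G" shows "(x + x', y + y') \<in> G"
proof -
  obtain u w where "x \<in> L" "y \<in> L" "x' \<in> L" "y' \<in> L" and u: "\<And>n. u n \<in> V" "tends u x" "tends (\<lambda>n. D (u n)) y"
    and w: "\<And>n. w n \<in> V" "tends w x'" "tends (\<lambda>n. D (w n)) y'"
    using assms unfolding G_def by blast
  moreover from this have "tends (\<lambda>n. u n + w n) (x + x')" "tends (\<lambda>n. D (u n + w n)) (y + y')"
    by (auto simp: D_add intro!: tends_add)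
  ultimately show ?thesis unfolding G_def using V_add by (auto intro!: exI[of _ "\<lambda>n. u n + w n"])
qed

lemma G_scale: assumes "(x, y) \<in> G" shows "(sc a x, sc a y) \<in> G"
proof -
  obtain u where "x \<in> L" "y \<in> L" and u: "\<And>n. u n \<in> V" "tends u x" "tends (\<lambda>n. D (u n)) y"
    using assms unfolding G_def by blast
  moreover from this have "tends (\<lambda>n. sc a (u n)) (sc a x)" "tends (\<lambda>n. D (sc a (u n))) (sc a y)"
    by (auto simp: D_scale intro!: tends_scale)
  ultimately show ?thesis unfolding G_def using V_scale by (auto intro!: exI[of _ "\<lambda>n. sc a (u n)"])
qed

lemma G_diff: assumes "(x, y) \<in> G" "(x', y') \<in> G" shows "(x - x', y - y') \<in> G"
  using G_add[OF assms(1) G_scale[OF assms(2), of "-1"]] by simp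

lemma G_approx: assumes "(x, y) \<in> G" "0 < d"
  obtains u where "u \<in> V" "N (u - x) < d" "N (D u - y) < d"
proof -
  obtain u where u: "\<And>n. u n \<in> V" "tends u x" "tends (\<lambda>n. D (u n)) y"
    using assms unfolding G_def by blast
  have "\<forall>\<^sub>F n in sequentially. N (u n - x) < d" "\<forall>\<^sub>F n in sequentially. N (D (u n) - y) < d"
    using u assms(2) unfolding tends_def by (auto intro: order_tendstoD(2)[of _ 0])
  hence "\<forall>\<^sub>F n in sequentially. N (u n - x) < d \<and> N (D (u n) - y) < d" by (rule eventually_conj)
  then obtain n where "N (u n - x) < d \<and> N (D (u n) - y) < d" by (auto simp: eventually_sequentially)
  with u that show thesis by blast
qed

lemma GI: assumes "x \<in> L" "y \<in> L" "\<And>d. 0 < d \<Longrightarrow> \<exists>u\<in>V. N (u - x) < d \<and> N (D u - y) < d"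
  shows "(x, y) \<in> G"
proof -
  have "\<forall>n. \<exists>u. u \<in> V \<and> N (u - x) < 1 / real (Suc n) \<and> N (D u - y) < 1 / real (Suc n)"
    using assms(3) by (metis of_nat_0_less_iff zero_less_Suc zero_less_divide_1_iff)
  then obtain u where u: "\<And>n. u n \<in> V" "\<And>n. N (u n - x) < 1 / real (Suc n)"
     "\<And>n. N (D (u n) - y) < 1 / real (Suc n)" by metis
  have l: "(\<lambda>n. 1 / real (Suc n)) \<longlonglongrightarrow> 0" using LIMSEQ_Suc[OF lim_1_over_n] by simp
  have "tends u x" "tends (\<lambda>n. D (u n)) y"
    using u assms by (auto intro!: tends_bound[OF _ l] less_imp_le)
  with u assms show ?thesis unfolding G_def by blast
qed

lemma G_closed: assumes g: "\<And>n. (x n, y n) \<in> G" and x: "tends x a" "a \<in> L" and y: "tends y b" "b \<in> L"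
  shows "(a, b) \<in> G"
proof (rule GI)
  fix d :: real assume d: "0 < d"
  have "\<forall>\<^sub>F n in sequentially. N (x n - a) < d/2" "\<forall>\<^sub>F n in sequentially. N (y n - b) < d/2"
    using x y d unfolding tends_def by (auto intro: order_tendstoD(2)[of _ 0])
  hence "\<forall>\<^sub>F n in sequentially. N (x n - a) < d/2 \<and> N (y n - b) < d/2" by (rule eventually_conj)
  then obtain n where n: "N (x n - a) < d/2" "N (y n - b) < d/2" by (auto simp: eventually_sequentially)
  obtain u where u: "u \<in> V" "N (u - x n) < d/2" "N (D u - y n) < d/2"
    using G_approx[OF g[of n], of "d/2"] d by auto
  have "N (u - a) < d" "N (D u - b) < d"
    using N_triangle3[of u "x n" a] N_triangle3[of "D u" "y n" b] n u x y G_L[OF g[of n]] by auto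
  with u show "\<exists>u\<in>V. N (u - a) < d \<and> N (D u - b) < d" by blast
qed (use x y in auto)

lemma G_null: assumes "(x, y) \<in> G" "x' \<in> L" "y' \<in> L" "N (x - x') = 0" "N (y - y') = 0"
  shows "(x', y') \<in> G"
  by (rule G_closed[of "\<lambda>n. x" "\<lambda>n. y"]) (use assms in \<open>auto simp: tends_def\<close>)

lemma G_sym: assumes "(x, y) \<in> G" "(x', y') \<in> G" shows "ip y x' = ip x y'"
proof -
  obtain u w where L: "x \<in> L" "y \<in> L" "x' \<in> L" "y' \<in> L" and u: "\<And>n. u n \<in> V" "tends u x" "tends (\<lambda>n. D (u n)) y"
    and w: "\<And>n. w n \<in> V" "tends w x'" "tends (\<lambda>n. D (w n)) y'"
    using assms unfolding G_def by blast
  have "(\<lambda>n. ip (D (u n)) (w n)) \<longlonglongrightarrow> ip y x'" by (rule tends_ip) (use L u w in auto)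
  moreover have "(\<lambda>n. ip (u n) (D (w n))) \<longlonglongrightarrow> ip x y'" by (rule tends_ip) (use L u w in auto)
  moreover have "(\<lambda>n. ip (u n) (D (w n))) = (\<lambda>n. ip (D (u n)) (w n))" using D_sym u w by auto
  ultimately show ?thesis by (simp add: LIMSEQ_unique)
qed

text \<open>By symmetry \<open>y\<close> is orthogonal to \<open>V\<close>. Since \<open>V\<close>
  need not be dense in \<open>L\<close>, membership of \<open>y\<close> in \<open>clo V\<close> is
  needed to conclude that \<open>y\<close> is orthogonal to itself.\<close>

lemma G_null_imp: assumes "(x, y) \<in> G" "N x = 0" "y \<in> clo V" shows "N y = 0"
proof -
  note L = G_L[OF assms(1)]
  have "ip y u = 0" if "u \<in> V" for u
    using G_sym[OF assms(1) G_V[OF that]] N_null_ip[of x "D u"] L assms that by simp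
  hence "ip y y = 0" using orth_clo[OF V_L L(2) _ assms(3)] by blast
  thus ?thesis by (simp add: N_def)
qed

definition Eig :: "'v set" where "Eig = {e \<in> L. \<exists>l::real. (e, sc (of_real l) e) \<in> G}"

end

text \<open>\<open>range\<close> is the criterion for essential self-adjointness on
  \<open>clo V\<close>, and \<open>compact\<close> amounts to compactness of the resolvent. Both are
  stated on \<open>V\<close> alone, where they can be checked for explicit functions.\<close>

locale compact_sym_op = sym_op sc ip L V D
  for sc :: "complex \<Rightarrow> 'v::ab_group_add \<Rightarrow> 'v" and ip L V D +
  assumes D_V: "u \<in> V \<Longrightarrow> D u \<in> V"
    and compact: "(\<And>n::nat. U n \<in> V) \<Longrightarrow> (\<And>n. N (U n) \<le> 1) \<Longrightarrow> (\<And>n. N (D (U n)) \<le> 1) \<Longrightarrow>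
       \<exists>r::nat \<Rightarrow> nat. strict_mono r \<and> (\<forall>e>0. \<exists>M. \<forall>m\<ge>M. \<forall>n\<ge>M. N (U (r m) - U (r n)) < e)"
    and range: "\<eta> = \<i> \<or> \<eta> = - \<i> \<Longrightarrow> v \<in> V \<Longrightarrow> 0 < \<delta> \<Longrightarrow> \<exists>u\<in>V. N (D u - sc \<eta> u - v) < \<delta>"
begin

abbreviation "LV \<equiv> clo V"

lemma LV_L [simp]: "x \<in> LV \<Longrightarrow> x \<in> L" using clo_L by blast
lemma LV_sub: "VS.subspace LV" by (rule clo_subspace[OF V_sub V_L])

lemma G_LV: assumes "(x, y) \<in> G" shows "x \<in> LV" "y \<in> LV"
proof -
  obtain u where u: "x \<in> L" "y \<in> L" "\<And>n. u n \<in> V" "tends u x" "tends (\<lambda>n. D (u n)) y"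
    using assms unfolding G_def by blast
  show "x \<in> LV" unfolding clo_iff[OF V_L] using u by (intro conjI exI[of _ u]) auto
  show "y \<in> LV" unfolding clo_iff[OF V_L] using u D_V by (intro conjI exI[of _ "\<lambda>n. D (u n)"]) auto
qed

text \<open>Symmetry makes \<open>ip y x\<close> real, so the cross term, which carries the factor
  \<open>\<i>\<close>, has real part 0.\<close>

lemma shift_norm: assumes "(x, y) \<in> G" "\<eta> = \<i> \<or> \<eta> = - \<i>"
  shows "(N (y - sc \<eta> x))\<^sup>2 = (N y)\<^sup>2 + (N x)\<^sup>2"
proof -
  note L = G_L[OF assms(1)]
  have "ip y x = ip x y" by (rule G_sym[OF assms(1,1)])
  hence "Im (ip y x) = 0" using ip_cnj[of x y] L
    by (metis Reals_cnj_iff complex_is_Real_iff)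
  thus ?thesis using L assms(2) by (auto simp: N_diff_sq N_scale ip_scale_right)
qed

text \<open>By \<open>shift_norm\<close> both \<open>u n\<close> and \<open>D (u n)\<close> are
  Cauchy as soon as \<open>D (u n) - sc \<eta> (u n)\<close> is, so approximate solutions from
  \<open>range\<close> converge to an exact solution in the graph of the closure.\<close>

lemma resolvent: assumes v: "v \<in> LV" and \<eta>: "\<eta> = \<i> \<or> \<eta> = - \<i>"
  shows "\<exists>x. (x, v + sc \<eta> x) \<in> G"
proof -
  have "\<forall>n. \<exists>u. u \<in> V \<and> N (D u - sc \<eta> u - v) < 1 / real (Suc n)"
  proof
    fix n
    define q where "q = 1 / real (Suc n)"
    have p: "0 < q / 2" by (simp add: q_def)
    obtain w where w: "w \<in> V" "N (v - w) < q / 2" using v p unfolding clo_def by blast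
    obtain u where u: "u \<in> V" "N (D u - sc \<eta> u - w) < q / 2" using range[OF \<eta> w(1) p] by blast
    have "N (D u - sc \<eta> u - v) \<le> N (D u - sc \<eta> u - w) + N (w - v)"
      using N_triangle3[of "D u - sc \<eta> u" w v] u w v by simp
    hence "N (D u - sc \<eta> u - v) < q"
      using u w N_commute[of v w] v by simp
    with u show "\<exists>u. u \<in> V \<and> N (D u - sc \<eta> u - v) < 1 / real (Suc n)" unfolding q_def by blast
  qed
  then obtain u where u: "\<And>n. u n \<in> V" "\<And>n. N (D (u n) - sc \<eta> (u n) - v) < 1 / real (Suc n)" by metis
  have l: "(\<lambda>n. 1 / real (Suc n)) \<longlonglongrightarrow> 0" using LIMSEQ_Suc[OF lim_1_over_n] by simp
  have t: "tends (\<lambda>n. D (u n) - sc \<eta> (u n)) v"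
    by (rule tends_bound[OF _ l]) (use u v in \<open>auto intro: less_imp_le\<close>)
  have le: "N (u m - u n) \<le> N ((D (u m) - sc \<eta> (u m)) - (D (u n) - sc \<eta> (u n)))"
     "N (D (u m) - D (u n)) \<le> N ((D (u m) - sc \<eta> (u m)) - (D (u n) - sc \<eta> (u n)))" for m n
  proof -
    have "(D (u m) - sc \<eta> (u m)) - (D (u n) - sc \<eta> (u n)) = (D (u m) - D (u n)) - sc \<eta> (u m - u n)"
      by (simp add: VS.scale_right_diff_distrib algebra_simps)
    hence *: "(N ((D (u m) - sc \<eta> (u m)) - (D (u n) - sc \<eta> (u n))))\<^sup>2 = (N (D (u m) - D (u n)))\<^sup>2 + (N (u m - u n))\<^sup>2"
      using shift_norm[OF G_V[OF V_diff[OF u(1)[of m] u(1)[of n]]] \<eta>] by (simp only: D_diff u)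
    show "N (u m - u n) \<le> N ((D (u m) - sc \<eta> (u m)) - (D (u n) - sc \<eta> (u n)))"
     "N (D (u m) - D (u n)) \<le> N ((D (u m) - sc \<eta> (u m)) - (D (u n) - sc \<eta> (u n)))"
      by (rule power2_le_imp_le; use u in \<open>simp add: * del: right_diff_distrib\<close>)+
  qed
  have c: "\<exists>M. \<forall>m\<ge>M. \<forall>n\<ge>M. N ((D (u m) - sc \<eta> (u m)) - (D (u n) - sc \<eta> (u n))) < e" if "0 < e" for e
    using tends_Cauchy[OF t _ _ that] u v by auto
  have c1: "\<exists>M. \<forall>m\<ge>M. \<forall>n\<ge>M. N (u m - u n) < e" if "0 < e" for e
    using c[OF that] le(1) by (meson le_less_trans)
  have c2: "\<exists>M. \<forall>m\<ge>M. \<forall>n\<ge>M. N (D (u m) - D (u n)) < e" if "0 < e" for e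
    using c[OF that] le(2) by (meson le_less_trans)
  obtain x where x: "x \<in> L" "tends u x"
    by (rule complete[of u]) (use u c1 in auto)
  obtain y where y: "y \<in> L" "tends (\<lambda>n. D (u n)) y"
    by (rule complete[of "\<lambda>n. D (u n)"]) (use u c2 in auto)
  have g: "(x, y) \<in> G" unfolding G_def using x y u by blast
  have "tends (\<lambda>n. D (u n) - sc \<eta> (u n)) (y - sc \<eta> x)"
    using x y u by (intro tends_diff tends_scale) auto
  from tends_unique[OF this _ _ t] have "N (y - sc \<eta> x - v) = 0" using x y u v by auto
  hence "N (y - (v + sc \<eta> x)) = 0" by (simp add: algebra_simps)
  hence "(x, v + sc \<eta> x) \<in> G" using G_null[OF g] x y v by auto
  thus ?thesis by blast
qed

text \<open>\<open>R\<close> and \<open>R'\<close> are the resolvents of the closure at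
  \<open>\<i>\<close> and \<open>- \<i>\<close>. The value is chosen among vectors differing by
  seminorm 0, so homogeneity holds only in the form of \<open>R_scale\<close>.\<close>

definition R where "R v = (SOME x. (x, v + sc \<i> x) \<in> G)"
definition R' where "R' v = (SOME x. (x, v + sc (-\<i>) x) \<in> G)"

lemma R: "v \<in> LV \<Longrightarrow> (R v, v + sc \<i> (R v)) \<in> G"
  unfolding R_def using resolvent[of v \<i>] by (metis (mono_tags, lifting) someI)
lemma R': "v \<in> LV \<Longrightarrow> (R' v, v + sc (-\<i>) (R' v)) \<in> G"
  unfolding R'_def using resolvent[of v "-\<i>"] by (metis (mono_tags, lifting) someI)

lemma R_LV [simp]: "v \<in> LV \<Longrightarrow> R v \<in> LV" "v \<in> LV \<Longrightarrow> R' v \<in> LV"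
  using G_LV(1)[OF R] G_LV(1)[OF R'] by auto

lemma R_adj: assumes "v \<in> LV" "w \<in> LV" shows "ip (R v) w = ip v (R' w)"
proof -
  have "ip (v + sc \<i> (R v)) (R' w) = ip (R v) (w + sc (-\<i>) (R' w))"
    by (rule G_sym[OF R[OF assms(1)] R'[OF assms(2)]])
  thus ?thesis using assms by (simp add: ip_simps del: VS.scale_minus_left)
qed

lemma bounded_by: assumes "(x, v + sc \<eta> x) \<in> G" "\<eta> = \<i> \<or> \<eta> = - \<i>" "v \<in> L"
  shows "N x \<le> N v" "N (v + sc \<eta> x) \<le> N v"
proof -
  note L = G_L[OF assms(1)]
  have *: "(N v)\<^sup>2 = (N (v + sc \<eta> x))\<^sup>2 + (N x)\<^sup>2"
    using shift_norm[OF assms(1,2)] by simp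
  show "N x \<le> N v" "N (v + sc \<eta> x) \<le> N v"
    by (rule power2_le_imp_le; use assms L in \<open>simp add: *\<close>)+
qed

lemma R_diff_le: assumes "v \<in> LV" "w \<in> LV" shows "N (R v - R w) \<le> N (v - w)" "N (R' v - R' w) \<le> N (v - w)"
proof -
  have "(R v - R w, (v - w) + sc \<i> (R v - R w)) \<in> G"
    using G_diff[OF R R, OF assms] by (simp add: VS.scale_right_diff_distrib algebra_simps)
  from bounded_by(1)[OF this] show "N (R v - R w) \<le> N (v - w)" using assms by auto
  have "(R' v - R' w, (v - w) + sc (-\<i>) (R' v - R' w)) \<in> G"
    using G_diff[OF R' R', OF assms] by (simp add: VS.scale_right_diff_distrib algebra_simps)
  from bounded_by(1)[OF this] show "N (R' v - R' w) \<le> N (v - w)" using assms by auto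
qed

lemma R_scale: assumes "v \<in> LV" shows "N (R' (sc a v) - sc a (R' v)) = 0" "N (R (sc a v) - sc a (R v)) = 0"
proof -
  have v: "sc a v \<in> LV" using assms LV_sub VS.subspace_scale by blast
  have "(R' (sc a v) - sc a (R' v), 0 + sc (-\<i>) (R' (sc a v) - sc a (R' v))) \<in> G"
    using G_diff[OF R'[OF v] G_scale[OF R'[OF assms], of a]]
    by (simp add: VS.scale_right_diff_distrib VS.scale_right_distrib algebra_simps)
  from bounded_by(1)[OF this] show "N (R' (sc a v) - sc a (R' v)) = 0" using assms v by (auto intro: antisym)
  have "(R (sc a v) - sc a (R v), 0 + sc \<i> (R (sc a v) - sc a (R v))) \<in> G"
    using G_diff[OF R[OF v] G_scale[OF R[OF assms], of a]]
    by (simp add: VS.scale_right_diff_distrib VS.scale_right_distrib algebra_simps)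
  from bounded_by(1)[OF this] show "N (R (sc a v) - sc a (R v)) = 0" using assms v by (auto intro: antisym)
qed

text \<open>Extends \<open>compact\<close> from \<open>V\<close> to the graph of the closure:
  elements of the graph are replaced by elements of \<open>V\<close> with errors tending to 0, which
  changes neither convergence nor the limit.\<close>

lemma compact_G: assumes g: "\<And>n::nat. (x n, y n) \<in> G" and b: "\<And>n. N (x n) \<le> 1" "\<And>n. N (y n) \<le> 1"
  shows "\<exists>(r::nat \<Rightarrow> nat) z. strict_mono r \<and> z \<in> L \<and> tends (\<lambda>n. x (r n)) z"
proof -
  have "\<forall>n. \<exists>u. u \<in> V \<and> N (u - x n) < 1 / real (Suc n) \<and> N (D u - y n) < 1 / real (Suc n)"
    using G_approx[OF g] by (metis of_nat_0_less_iff zero_less_Suc zero_less_divide_1_iff)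
  then obtain u where u: "\<And>n. u n \<in> V" "\<And>n. N (u n - x n) < 1 / real (Suc n)" "\<And>n. N (D (u n) - y n) < 1 / real (Suc n)"
    by metis
  note L = G_L[OF g]
  have one: "a \<le> 1" if "a < 1 / real (Suc n)" for n and a :: real
    using that by (rule order.strict_implies_order[OF order.strict_trans2]) simp
  have "N (u n) \<le> 2" "N (D (u n)) \<le> 2" for n
    using N_triangle[of "u n - x n" "x n"] N_triangle[of "D (u n) - y n" "y n"] L[of n] b[of n]
      one[OF u(2)[of n]] one[OF u(3)[of n]] u(1)[of n]
    by auto
  \<comment> \<open>The approximating vectors and their images have norm at most 2; halving them
    meets the bound 1 required by \<open>compact\<close>.\<close>
  hence "N (sc (1/2) (u n)) \<le> 1" "N (D (sc (1/2) (u n))) \<le> 1" for n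
    using u by (auto simp: N_scale D_scale)
  hence "\<exists>r::nat \<Rightarrow> nat. strict_mono r \<and> (\<forall>e>0. \<exists>M. \<forall>m\<ge>M. \<forall>n\<ge>M. N (sc (1/2) (u (r m)) - sc (1/2) (u (r n))) < e)"
    using compact[of "\<lambda>n. sc (1/2) (u n)"] V_scale[OF u(1)] by blast
  then obtain r :: "nat \<Rightarrow> nat" where r: "strict_mono r"
     and c: "\<And>e. 0 < e \<Longrightarrow> \<exists>M. \<forall>m\<ge>M. \<forall>n\<ge>M. N (sc (1/2) (u (r m)) - sc (1/2) (u (r n))) < e"
    by blast
  obtain z where z: "z \<in> L" "tends (\<lambda>n. sc (1/2) (u (r n))) z"
    by (rule complete[of "\<lambda>n. sc (1/2) (u (r n))"]) (use u c V_scale in auto)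
  have t: "tends (\<lambda>n. sc 2 (sc (1/2) (u (r n)))) (sc 2 z)"
    by (rule tends_scale) (use z u in auto)
  hence t: "tends (\<lambda>n. u (r n)) (sc 2 z)" by simp
  have t2: "tends (\<lambda>n. x n - u n) 0"
  proof (rule tends_bound[of _ _ "\<lambda>n. 1 / real (Suc n)"])
    show "(\<lambda>n. 1 / real (Suc n)) \<longlonglongrightarrow> 0" using LIMSEQ_Suc[OF lim_1_over_n] by simp
  qed (use u L N_commute in \<open>auto intro: less_imp_le simp: V_in_L\<close>)
  have "tends (\<lambda>n. u (r n) + (x (r n) - u (r n))) (sc 2 z + 0)"
    by (rule tends_add[OF t _ _ tends_subseq[OF t2 r]]) (use u L z in auto)
  thus ?thesis using r z by (intro exI[of _ r] exI[of _ "sc 2 z"]) auto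
qed

definition M where "M = {w \<in> LV. \<forall>e\<in>Eig. ip e w = 0}"

lemma M_LV: "w \<in> M \<Longrightarrow> w \<in> LV" by (simp add: M_def)
lemma Eig_L [simp]: "e \<in> Eig \<Longrightarrow> e \<in> L" by (simp add: Eig_def)

lemma M_sub: "VS.subspace M"
proof (rule VS.subspaceI)
  show "0 \<in> M" using VS.subspace_0[OF LV_sub] by (auto simp: M_def)
  show "x + y \<in> M" if "x \<in> M" "y \<in> M" for x y
    using that VS.subspace_add[OF LV_sub] by (auto simp: M_def ip_simps)
  show "sc a x \<in> M" if "x \<in> M" for a x
    using that VS.subspace_scale[OF LV_sub] by (auto simp: M_def ip_simps)
qed

text \<open>The orthogonal complement of the eigenvectors is invariant under both resolvents,
  because a real eigenvalue never equals \<open>cnj \<eta>\<close>.\<close>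

lemma R_M: assumes "w \<in> M" "(x, w + sc \<eta> x) \<in> G" "\<eta> = \<i> \<or> \<eta> = - \<i>" shows "x \<in> M"
proof -
  note L = G_L[OF assms(2)]
  have wL: "w \<in> L" using M_LV[OF assms(1)] by simp
  have "ip e x = 0" if e: "e \<in> Eig" for e
  proof -
    obtain l :: real where l: "(e, sc (of_real l) e) \<in> G" using e unfolding Eig_def by blast
    have "ip (sc (of_real l) e) x = ip e (w + sc \<eta> x)" by (rule G_sym[OF l assms(2)])
    hence "of_real l * ip e x = cnj \<eta> * ip e x"
      using e L wL assms(1) by (simp add: ip_simps M_def)
    moreover have "of_real l \<noteq> cnj \<eta>" using assms(3) by (auto simp: complex_eq_iff)
    ultimately show ?thesis by simp
  qed
  with G_LV[OF assms(2)] show ?thesis by (simp add: M_def)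
qed

lemma M_closed: assumes "\<And>n. x n \<in> M" "tends x z" "z \<in> L" shows "z \<in> M"
proof -
  have "z \<in> clo LV" using assms M_LV clo_iff[of LV z] clo_L by blast
  hence z: "z \<in> LV" using clo_clo[OF V_L] by blast
  have "ip e z = 0" if "e \<in> Eig" for e
  proof -
    have "(\<lambda>n. ip e (x n)) \<longlonglongrightarrow> ip e z" by (rule tends_ip) (use assms M_LV that in auto)
    moreover have "(\<lambda>n. ip e (x n)) = (\<lambda>n. 0)" using assms that by (auto simp: M_def)
    ultimately show ?thesis by (simp add: LIMSEQ_const_iff)
  qed
  with z show ?thesis by (simp add: M_def)
qed

text \<open>
  On \<open>M\<close> the norm \<open>\<rho>\<close> of the resolvent is attained at an eigenvector of \<open>R' R\<close>, that is, at
  some \<open>w\<close> with \<open>D\<^sup>2 w = l\<^sup>2 w\<close>; one of \<open>w\<close> and \<open>(D + l) w\<close> is then an eigenvector of \<open>D\<close>.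
\<close>

lemma M_null: assumes w0: "w0 \<in> M" shows "N w0 = 0"
proof (rule ccontr)
  assume nz: "N w0 \<noteq> 0"
  define K where "K = {N (R w) |w. w \<in> M \<and> N w \<le> 1}"
  define \<rho> where "\<rho> = Sup K"
  have RM: "R w \<in> M" "R' w \<in> M" if "w \<in> M" for w
    using R_M[OF that R] R_M[OF that R'] M_LV[OF that] by auto
  have MinL: "w \<in> L" if "w \<in> M" for w using M_LV[OF that] by simp
  have Rle: "N (R w) \<le> N w" if "w \<in> M" for w
    using bounded_by(1)[OF R[OF M_LV[OF that]]] MinL[OF that] by simp
  have bd: "bdd_above K" unfolding K_def by (rule bdd_aboveI[of _ 1]) (use Rle in force)
  have ne: "K \<noteq> {}" unfolding K_def using VS.subspace_0[OF M_sub] by force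
  have up: "N (R w) \<le> \<rho>" if "w \<in> M" "N w \<le> 1" for w
    unfolding \<rho>_def by (rule cSup_upper[OF _ bd]) (use that in \<open>auto simp: K_def\<close>)
  have up': "N (R w) \<le> \<rho> * N w" if w: "w \<in> M" for w
  proof (cases "N w = 0")
    case True thus ?thesis using Rle[OF w] by simp
  next
    case False
    define a where "a = complex_of_real (1 / N w)"
    have "sc a w \<in> M" using w M_sub VS.subspace_scale by blast
    moreover have "N (sc a w) = 1" using False MinL[OF w] by (simp add: N_scale a_def norm_divide)
    ultimately have "N (R (sc a w)) \<le> \<rho>" by (intro up) auto
    moreover have "N (sc a (R w)) \<le> N (R (sc a w))"
      using R_scale(2)[OF M_LV[OF w], of a] N_abs_diff[of "R (sc a w)" "sc a (R w)"] MinL[OF RM(1)[OF w]] MinL[OF RM(1)[OF \<open>sc a w \<in> M\<close>]]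
      by simp
    moreover have "N (sc a (R w)) = N (R w) / N w"
      using MinL[OF RM(1)[OF w]] MinL[OF w] by (simp add: N_scale a_def norm_divide)
    ultimately have "N (R w) / N w \<le> \<rho>" by simp
    thus ?thesis using False MinL[OF w] by (simp add: field_simps N_nonneg less_le)
  qed
  have "N (R w0) \<noteq> 0"
  proof
    assume z: "N (R w0) = 0"
    from G_null_imp[OF R[OF M_LV[OF w0]] z] have "N (w0 + sc \<i> (R w0)) = 0"
      using G_LV[OF R[OF M_LV[OF w0]]] by simp
    moreover have "N (sc \<i> (R w0)) = 0" using z MinL[OF RM(1)[OF w0]] by (simp add: N_scale)
    ultimately show False using N_triangle_diff[of "w0 + sc \<i> (R w0)" "sc \<i> (R w0)"] nz MinL[OF w0] MinL[OF RM(1)[OF w0]]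
      N_nonneg[OF MinL[OF w0]] by simp
  qed
  hence "0 < N (R w0)" using N_nonneg[OF MinL[OF RM(1)[OF w0]]] by simp
  hence "0 < \<rho> * N w0" using up'[OF w0] by simp
  moreover have "0 < N w0" using nz N_nonneg[OF MinL[OF w0]] by simp
  ultimately have \<rho>0: "0 < \<rho>" by (simp add: zero_less_mult_iff)
  have up'': "N (R' w) \<le> \<rho> * N w" if w: "w \<in> M" for w
  proof -
    have "(N (R' w))\<^sup>2 = cmod (ip (R' w) (R' w))" using ip_self[OF MinL[OF RM(2)[OF w]]] by (simp add: norm_power)
    also have "... = cmod (ip (R (R' w)) w)" using R_adj[OF M_LV[OF RM(2)[OF w]] M_LV[OF w]] by simp
    also have "... \<le> N (R (R' w)) * N w" by (rule CS) (use MinL RM w in auto)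
    also have "... \<le> \<rho> * N (R' w) * N w" by (rule mult_right_mono[OF up']) (use RM MinL w in auto)
    finally have "N (R' w) * N (R' w) \<le> \<rho> * N w * N (R' w)" by (simp add: power2_eq_square algebra_simps)
    moreover have "0 \<le> N (R' w)" "0 \<le> \<rho> * N w" using MinL[OF RM(2)[OF w]] \<rho>0 MinL[OF w] by auto
    ultimately show ?thesis by (cases "N (R' w) = 0") (auto simp: mult_le_cancel_right)
  qed
  have "\<forall>n. \<exists>w. w \<in> M \<and> N w \<le> 1 \<and> \<rho> - 1 / real (Suc n) < N (R w)"
  proof
    fix n
    have "\<rho> - 1 / real (Suc n) < Sup K" by (simp add: \<rho>_def)
    then obtain k where "k \<in> K" "\<rho> - 1 / real (Suc n) < k" using less_cSupD[OF ne] by blast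
    thus "\<exists>w. w \<in> M \<and> N w \<le> 1 \<and> \<rho> - 1 / real (Suc n) < N (R w)"
      unfolding K_def by blast
  qed
  then obtain w where w: "\<And>n. w n \<in> M" "\<And>n. N (w n) \<le> 1" "\<And>n. \<rho> - 1 / real (Suc n) < N (R (w n))" by metis
  have wb: "N (R (w n)) \<le> 1" "N (w n + sc \<i> (R (w n))) \<le> 1" for n
    using bounded_by[OF R[OF M_LV[OF w(1)[of n]]]] w(2)[of n] MinL[OF w(1)[of n]] by auto
  obtain r z where r: "strict_mono (r :: nat \<Rightarrow> nat)" and z: "z \<in> L" "tends (\<lambda>n. R (w (r n))) z"
    using compact_G[of "\<lambda>n. R (w n)" "\<lambda>n. w n + sc \<i> (R (w n))", OF R[OF M_LV[OF w(1)]] wb] by blast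
  have zM: "z \<in> M" using M_closed[of "\<lambda>n. R (w (r n))" z] z RM w by blast
  have lim: "(\<lambda>n. N (R (w (r n)))) \<longlonglongrightarrow> \<rho>"
  proof -
    have "(\<lambda>n. N (R (w n))) \<longlonglongrightarrow> \<rho>"
    proof (rule tendsto_sandwich[of "\<lambda>n. \<rho> - 1 / real (Suc n)" _ _ "\<lambda>n. \<rho>"])
      have "(\<lambda>n. \<rho> - 1 / real (Suc n)) \<longlonglongrightarrow> \<rho> - 0"
        by (intro tendsto_intros) (use LIMSEQ_Suc[OF lim_1_over_n] in simp)
      thus "(\<lambda>n. \<rho> - 1 / real (Suc n)) \<longlonglongrightarrow> \<rho>" by simp
    qed (use w(1,2) up less_imp_le[OF w(3)] in auto)
    thus ?thesis using LIMSEQ_subseq_LIMSEQ[OF _ r] by (auto simp: o_def)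
  qed
  have Nz: "N z = \<rho>" using tends_N[OF z(2) _ z(1)] LIMSEQ_unique[OF lim] MinL RM w by blast
  have tR': "tends (\<lambda>n. R' (R (w (r n)))) (R' z)"
    by (rule tends_le[OF z(2), of _ _ 1]) (use R_diff_le(2) M_LV RM w zM MinL z in auto)
  \<comment> \<open>Along a maximising sequence the norm bound is nearly an equality: the squared
    distance between \<open>\<rho>^2 w\<close> and \<open>R' (R w)\<close> is at most
    \<open>\<rho>^4 - \<rho>^2 (N (R w))^2\<close>, which tends to 0. Hence \<open>w\<close>
    converges, and not only \<open>R w\<close>.\<close>
  have tw: "tends (\<lambda>n. sc (of_real (\<rho>\<^sup>2)) (w (r n))) (R' z)"
  proof -
    have d: "(N (sc (of_real (\<rho>\<^sup>2)) (w n) - R' (R (w n))))\<^sup>2 \<le> \<rho>^4 - \<rho>\<^sup>2 * (N (R (w n)))\<^sup>2" for n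
    proof -
      have L: "w n \<in> L" "R (w n) \<in> L" "R' (R (w n)) \<in> L" using MinL RM w by auto
      have "ip (w n) (R' (R (w n))) = ip (R (w n)) (R (w n))" using R_adj M_LV w by auto
      hence e: "ip (w n) (R' (R (w n))) = of_real ((N (R (w n)))\<^sup>2)" using ip_self L by simp
      have "(N (R' (R (w n))))\<^sup>2 \<le> (\<rho> * N (R (w n)))\<^sup>2" using up''[OF RM(1)[OF w(1)]] L by (intro power_mono) auto
      moreover have "(\<rho>\<^sup>2 * N (w n))\<^sup>2 \<le> (\<rho>\<^sup>2)\<^sup>2" using w(2)[of n] L
        by (intro power_mono) (auto simp: mult_left_le)
      moreover have "(N (sc (of_real (\<rho>\<^sup>2)) (w n) - R' (R (w n))))\<^sup>2
          = (\<rho>\<^sup>2 * N (w n))\<^sup>2 + (N (R' (R (w n))))\<^sup>2 - 2 * \<rho>\<^sup>2 * (N (R (w n)))\<^sup>2"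
        using L by (simp add: N_diff_sq N_scale ip_scale e norm_mult norm_power del: of_real_power)
      ultimately show ?thesis by (simp add: power_mult_distrib)
    qed
    have "(\<lambda>n. sqrt (\<rho>^4 - \<rho>\<^sup>2 * (N (R (w (r n))))\<^sup>2)) \<longlonglongrightarrow> sqrt (\<rho>^4 - \<rho>\<^sup>2 * \<rho>\<^sup>2)"
      using lim by (intro tendsto_intros)
    hence b: "(\<lambda>n. sqrt (\<rho>^4 - \<rho>\<^sup>2 * (N (R (w (r n))))\<^sup>2)) \<longlonglongrightarrow> 0" by (simp flip: power_add)
    have "tends (\<lambda>n. sc (of_real (\<rho>\<^sup>2)) (w (r n)) - R' (R (w (r n)))) 0"
      by (rule tends_bound[OF _ b]) (use d MinL RM w in \<open>auto intro!: real_le_rsqrt simp del: of_real_power\<close>)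
    from tends_add[OF this _ _ tR'] show ?thesis using MinL RM w z zM by simp
  qed
  define v where "v = sc (of_real (1 / \<rho>\<^sup>2)) (R' z)"
  have vM: "v \<in> M" unfolding v_def using M_sub VS.subspace_scale RM zM by blast
  have tv: "tends (\<lambda>n. w (r n)) v"
  proof -
    have "tends (\<lambda>n. sc (of_real (1 / \<rho>\<^sup>2)) (sc (of_real (\<rho>\<^sup>2)) (w (r n)))) v"
      unfolding v_def by (rule tends_scale[OF tw]) (use MinL RM w zM in auto)
    moreover have "complex_of_real (1 / \<rho>\<^sup>2) * complex_of_real (\<rho>\<^sup>2) = 1"
      using \<rho>0 by (simp flip: of_real_mult)
    ultimately show ?thesis by (simp only: VS.scale_scale VS.scale_one)
  qed
  have "tends (\<lambda>n. R (w (r n))) (R v)"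
    by (rule tends_le[OF tv, of _ _ 1]) (use R_diff_le(1) M_LV RM w zM MinL vM in auto)
  from tends_unique[OF this _ _ z(2)] have zRv: "N (R v - z) = 0" using MinL RM w vM z by auto
  have g1: "(z, v + sc \<i> z) \<in> G"
  proof (rule G_null[OF R[OF M_LV[OF vM]]])
    have "(v + sc \<i> (R v)) - (v + sc \<i> z) = sc \<i> (R v - z)"
      by (simp add: VS.scale_right_diff_distrib algebra_simps)
    thus "N ((v + sc \<i> (R v)) - (v + sc \<i> z)) = 0" using zRv MinL[OF RM(1)[OF vM]] z by (simp add: N_scale)
  qed (use zRv z vM MinL in auto)
  define k where "k = 1 / \<rho>\<^sup>2"
  have g2: "(v, sc (of_real k) z - sc \<i> v) \<in> G"
  proof -
    have "(sc (of_real k) (R' z), sc (of_real k) (z + sc (-\<i>) (R' z))) \<in> G"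
      by (rule G_scale[OF R'[OF M_LV[OF zM]]])
    thus ?thesis by (simp add: v_def k_def VS.scale_right_distrib VS.scale_right_diff_distrib algebra_simps)
  qed
  have "\<rho> \<le> 1" using Nz tends_N[OF z(2) _ z(1)] wb(1) MinL RM w
     LIMSEQ_le_const2[OF lim, of 1] by auto
  hence k1: "1 \<le> k" using \<rho>0 by (simp add: k_def power_le_one)
  \<comment> \<open>The closure maps \<open>z\<close> to \<open>v + \<i> z\<close> and
    \<open>v\<close> to \<open>k z - \<i> v\<close>. Eliminating \<open>z\<close> gives
    \<open>D^2 v = (k - 1) v\<close>, so \<open>l\<close> and \<open>- l\<close> are the candidates
    for eigenvalues, and \<open>f\<close> below is \<open>(D + l) v\<close>.\<close>
  define l where "l = sqrt (k - 1)"
  have l2: "complex_of_real l * of_real l = of_real k - 1" using k1 by (simp add: l_def flip: of_real_mult)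
  define f where "f = sc (of_real k) z - sc \<i> v + sc (of_real l) v"
  have L: "v \<in> L" "z \<in> L" using vM MinL z by auto
  have fL: "f \<in> L" unfolding f_def using L by auto
  have fM: "f \<in> M" unfolding f_def
    using M_sub vM zM by (intro VS.subspace_add VS.subspace_diff VS.subspace_scale) auto
  have "(f, sc (of_real k) (v + sc \<i> z) - sc \<i> (sc (of_real k) z - sc \<i> v) + sc (of_real l) (sc (of_real k) z - sc \<i> v)) \<in> G"
    unfolding f_def by (intro G_add G_diff G_scale g1 g2)
  moreover have "sc (of_real k) (v + sc \<i> z) - sc \<i> (sc (of_real k) z - sc \<i> v) + sc (of_real l) (sc (of_real k) z - sc \<i> v) = sc (of_real l) f"
  proof -
    have "sc (of_real k) v + sc \<i> (sc \<i> v) = sc (of_real l) (sc (of_real l) v)"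
      using l2 by (simp flip: VS.scale_left_diff_distrib VS.scale_left_distrib add: VS.scale_left_diff_distrib)
    moreover have "sc (of_real k) (sc \<i> z) = sc \<i> (sc (of_real k) z)" by (simp add: mult.commute)
    ultimately show ?thesis unfolding f_def
      by (simp only: VS.scale_right_distrib VS.scale_right_diff_distrib) (simp add: algebra_simps)
  qed
  ultimately have "f \<in> Eig" unfolding Eig_def using fL by auto
  with fM have "ip f f = 0" by (simp add: M_def)
  hence Nf: "N f = 0" by (simp add: N_def)
  have "(v, sc (of_real (-l)) v) \<in> G"
  proof (rule G_null[OF g2])
    have "sc (of_real k) z - sc \<i> v - sc (of_real (-l)) v = f" by (simp add: f_def)
    thus "N (sc (of_real k) z - sc \<i> v - sc (of_real (-l)) v) = 0" using Nf by simp
  qed (use L in auto)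
  hence "v \<in> Eig" using L unfolding Eig_def by blast
  with vM have "ip v v = 0" by (simp add: M_def)
  hence "N v = 0" by (simp add: N_def)
  hence "N (R v) = 0" using Rle[OF vM] MinL[OF RM(1)[OF vM]] by (auto intro: antisym)
  hence "N z = 0" using N_abs_diff[of "R v" z] zRv L MinL[OF RM(1)[OF vM]] N_nonneg[OF L(2)] by auto
  with Nz \<rho>0 show False by simp
qed

text \<open>What remains of \<open>v\<close> after projection onto the closed span lies in
  \<open>M\<close> and so has seminorm 0.\<close>

theorem V_in_closed_span_Eig: "V \<subseteq> clo (VS.span Eig)"
proof
  fix v assume v: "v \<in> V"
  have EL: "Eig \<subseteq> L" by auto
  have "Eig \<subseteq> LV" unfolding Eig_def using G_LV by blast
  hence spLV: "VS.span Eig \<subseteq> LV" using VS.span_minimal LV_sub by blast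
  obtain p where p: "p \<in> clo (VS.span Eig)" "\<And>e. e \<in> VS.span Eig \<Longrightarrow> ip (v - p) e = 0"
    using projection[OF VS.subspace_span span_L[OF EL], of v] v by auto
  have pLV: "p \<in> LV" using p(1) clo_mono[OF spLV] clo_clo[OF V_L] by blast
  have vp: "v - p \<in> LV" using v clo_superset[OF V_L] pLV LV_sub VS.subspace_diff by blast
  have "ip e (v - p) = 0" if e: "e \<in> Eig" for e
    using p(2)[OF VS.span_base[OF e]] ip_cnj[of "v - p" e] e vp by simp
  hence "v - p \<in> M" using vp by (simp add: M_def)
  hence "N (v - p) = 0" by (rule M_null)
  thus "v \<in> clo (VS.span Eig)"
    using clo_null[OF span_L[OF EL] p(1)] N_commute[of v p] v pLV by auto
qed

end

context sym_op
begin

lemma Eig_orth: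
  assumes "(e, sc (of_real l) e) \<in> G" "(f, sc (of_real k) f) \<in> G" "l \<noteq> k" shows "ip e f = 0"
  using G_sym[OF assms(1,2)] G_L(1)[OF assms(1)] G_L(1)[OF assms(2)] assms(3) by (simp add: ip_simps)

definition Eigl :: "real \<Rightarrow> 'v set" where "Eigl l = {e. (e, sc (of_real l) e) \<in> G}"

lemma Eigl_sub: "VS.subspace (Eigl l)"
proof (rule VS.subspaceI)
  show "0 \<in> Eigl l" using G_V[of 0] D_scale[of 0 0] VS.subspace_0[OF V_sub] by (simp add: Eigl_def)
  show "x + y \<in> Eigl l" if "x \<in> Eigl l" "y \<in> Eigl l" for x y
    using that G_add[of x "sc l x" y "sc l y"] by (simp add: Eigl_def VS.scale_right_distrib)
  show "sc a x \<in> Eigl l" if "x \<in> Eigl l" for a x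
    using that G_scale[of x "sc l x" a] by (simp add: Eigl_def mult.commute)
qed

lemma Eigl_L: "Eigl l \<subseteq> L" using G_L by (auto simp: Eigl_def)

lemma Eigl_closed: "clo (Eigl l) \<subseteq> Eigl l"
proof
  fix x assume "x \<in> clo (Eigl l)"
  then obtain u where u: "x \<in> L" "\<And>n. u n \<in> Eigl l" "tends u x" unfolding clo_iff[OF Eigl_L] by blast
  have "(x, sc (of_real l) x) \<in> G"
    by (rule G_closed[of u "\<lambda>n. sc (of_real l) (u n)"])
      (use u Eigl_L[of l] in \<open>auto simp: Eigl_def intro!: tends_scale\<close>)
  thus "x \<in> Eigl l" by (simp add: Eigl_def)
qed

definition ONE :: "'v set \<Rightarrow> bool" where
  "ONE E \<longleftrightarrow> E \<subseteq> Eig \<and> (\<forall>e\<in>E. \<forall>f\<in>E. ip e f = (if e = f then 1 else 0))"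

text \<open>Orthonormality concerns two vectors at a time, and two members of a chain's union
  already lie in one member of the chain.\<close>

lemma maximal_ONE: "\<exists>E. ONE E \<and> (\<forall>E'. ONE E' \<longrightarrow> E \<subseteq> E' \<longrightarrow> E' = E)"
proof -
  have "\<exists>E\<in>Collect ONE. \<forall>E'\<in>Collect ONE. E \<subseteq> E' \<longrightarrow> E' = E"
  proof (rule subset_Zorn')
    fix C assume C: "subset.chain (Collect ONE) C"
    have in_one: "\<exists>E. ONE E \<and> e \<in> E \<and> f \<in> E" if "e \<in> \<Union>C" "f \<in> \<Union>C" for e f
    proof -
      from that obtain E F where E: "E \<in> C" "e \<in> E" and F: "F \<in> C" "f \<in> F" by blast
      have "E \<subseteq> F \<or> F \<subseteq> E" using C E F by (auto simp: subset_chain_def)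
      moreover have "ONE E" "ONE F" using C E F by (auto simp: subset_chain_def)
      ultimately show ?thesis using E F by blast
    qed
    have "\<Union>C \<subseteq> Eig" using in_one unfolding ONE_def by blast
    moreover have "ip e f = (if e = f then 1 else 0)" if "e \<in> \<Union>C" "f \<in> \<Union>C" for e f
      using in_one[OF that] unfolding ONE_def by blast
    ultimately show "\<Union>C \<in> Collect ONE" by (simp add: ONE_def)
  qed
  thus ?thesis by simp
qed

text \<open>Only the members of \<open>E\<close> with the eigenvalue of \<open>e\<close> matter: the
  part of \<open>e\<close> orthogonal to them is still in that eigenspace, hence orthogonal to all
  other members of \<open>E\<close>. Were it not null, it could be normalised and added to
  \<open>E\<close>.\<close>

lemma eig_in_closed_span:
  assumes E: "ONE E" and max: "\<And>E'. ONE E' \<Longrightarrow> E \<subseteq> E' \<Longrightarrow> E' = E" and e: "e \<in> Eig"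
  shows "e \<in> clo (VS.span E)"
proof -
  obtain l where l: "e \<in> Eigl l" using e by (auto simp: Eig_def Eigl_def)
  define F where "F = {f \<in> E. f \<in> Eigl l}"
  have FL: "F \<subseteq> L" using Eigl_L by (auto simp: F_def)
  have eL: "e \<in> L" using e by (simp add: Eig_def)
  obtain p where p: "p \<in> clo (VS.span F)" "\<And>f. f \<in> VS.span F \<Longrightarrow> ip (e - p) f = 0"
    using projection[OF VS.subspace_span span_L[OF FL] eL] by blast
  have "VS.span F \<subseteq> Eigl l" by (rule VS.span_minimal[OF _ Eigl_sub]) (auto simp: F_def)
  hence "p \<in> Eigl l" using p(1) clo_mono Eigl_closed by blast
  hence ep: "e - p \<in> Eigl l" using l VS.subspace_diff[OF Eigl_sub] by blast
  hence epL: "e - p \<in> L" using Eigl_L by blast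
  have EL: "E \<subseteq> L" using E by (auto simp: ONE_def Eig_def)
  have orth: "ip (e - p) f = 0" if f: "f \<in> E" for f
  proof (cases "f \<in> F")
    case True thus ?thesis using p(2) VS.span_base by blast
  next
    case False
    obtain k where k: "f \<in> Eigl k" using f E by (auto simp: ONE_def Eig_def Eigl_def)
    with False f have "k \<noteq> l" by (auto simp: F_def)
    thus ?thesis using Eig_orth k ep unfolding Eigl_def by blast
  qed
  have "N (e - p) = 0"
  proof (rule ccontr)
    assume nz: "N (e - p) \<noteq> 0"
    define x where "x = sc (of_real (1 / N (e - p))) (e - p)"
    have xE: "x \<in> Eigl l" unfolding x_def using ep VS.subspace_scale[OF Eigl_sub] by blast
    hence xL: "x \<in> L" using Eigl_L by blast
    have xn: "ip x x = 1"
    proof -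
      have "N x = 1" unfolding x_def using epL nz by (simp add: N_scale norm_divide)
      thus ?thesis using ip_self[OF xL] by simp
    qed
    have xo: "ip x f = 0" if "f \<in> E" for f using orth[OF that] EL that epL by (auto simp: x_def ip_scale)
    have xo': "ip f x = 0" if "f \<in> E" for f using xo[OF that] ip_cnj[of x f] xL EL that by auto
    have "ONE (insert x E)" unfolding ONE_def
    proof safe
      show "x \<in> Eig" using xE xL by (auto simp: Eig_def Eigl_def)
    qed (use E xn xo xo' in \<open>auto simp: ONE_def\<close>)
    hence "insert x E = E" using max by blast
    hence "x \<in> E" by blast
    hence "ip x x = 0" using xo by blast
    with xn show False by simp
  qed
  hence "e \<in> clo (VS.span F)"
    using clo_null[OF span_L[OF FL] p(1) eL] N_commute[of e p] eL p(1) clo_L by auto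
  moreover have "VS.span F \<subseteq> VS.span E" by (rule VS.span_mono) (auto simp: F_def)
  ultimately show ?thesis using clo_mono by blast
qed

theorem pure_point:
  assumes dense: "L \<subseteq> clo (VS.span Eig)"
  obtains E where "E \<subseteq> Eig" "\<And>e f. e \<in> E \<Longrightarrow> f \<in> E \<Longrightarrow> ip e f = (if e = f then 1 else 0)"
    "L \<subseteq> clo (VS.span E)"
proof -
  obtain E where E: "ONE E" "\<And>E'. ONE E' \<Longrightarrow> E \<subseteq> E' \<Longrightarrow> E' = E" using maximal_ONE by blast
  have EL: "E \<subseteq> L" using E by (auto simp: ONE_def Eig_def)
  have "Eig \<subseteq> clo (VS.span E)" using eig_in_closed_span[OF E] by blast
  hence "VS.span Eig \<subseteq> clo (VS.span E)"
    by (rule VS.span_minimal[OF _ clo_subspace[OF VS.subspace_span span_L[OF EL]]])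
  hence "clo (VS.span Eig) \<subseteq> clo (VS.span E)"
    using clo_mono clo_clo[OF span_L[OF EL]] by blast
  with dense E that show thesis by (auto simp: ONE_def)
qed

lemma closable_dense:
  assumes "L \<subseteq> clo V" "(x, y) \<in> G" "N x = 0" shows "N y = 0"
  using G_null_imp[OF assms(2,3)] G_L[OF assms(2)] assms(1) by blast

end

lemma (in sym_op) Eig_mono:
  assumes "sym_op sc ip L V' D" "V' \<subseteq> V"
  shows "sym_op.Eig sc ip L V' D \<subseteq> Eig"
proof -
  interpret A: sym_op sc ip L V' D by fact
  have "A.G \<subseteq> G" unfolding A.G_def G_def using assms(2) by blast
  thus ?thesis unfolding A.Eig_def Eig_def by blast
qed

text \<open>The graph over a piece is contained in the graph over \<open>V\<close>, so eigenvectors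
  found in a piece are eigenvectors of the whole closure. The pieces may overlap
  arbitrarily.\<close>

theorem (in sym_op) pure_point_of_pieces:
  assumes pieces: "\<And>W. W \<in> \<W> \<Longrightarrow> W \<subseteq> V \<and> compact_sym_op sc ip L W D"
    and dense: "L \<subseteq> clo (VS.span (\<Union>\<W>))"
  obtains E where "E \<subseteq> Eig" "\<And>e f. e \<in> E \<Longrightarrow> f \<in> E \<Longrightarrow> ip e f = (if e = f then 1 else 0)"
    "L \<subseteq> clo (VS.span E)"
proof (rule pure_point)
  have EL: "Eig \<subseteq> L" by (auto simp: Eig_def)
  have "W \<subseteq> clo (VS.span Eig)" if W: "W \<in> \<W>" for W
  proof -
    interpret A: compact_sym_op sc ip L W D using pieces[OF W] by blast
    have "A.Eig \<subseteq> Eig" by (rule Eig_mono[OF A.sym_op_axioms]) (use pieces[OF W] in blast)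
    thus ?thesis using A.V_in_closed_span_Eig clo_mono VS.span_mono by blast
  qed
  hence "\<Union>\<W> \<subseteq> clo (VS.span Eig)" by blast
  hence "VS.span (\<Union>\<W>) \<subseteq> clo (VS.span Eig)"
    by (rule VS.span_minimal[OF _ clo_subspace[OF VS.subspace_span span_L[OF EL]]])
  thus "L \<subseteq> clo (VS.span Eig)"
    using dense clo_mono clo_clo[OF span_L[OF EL]] by blast
qed (use that in blast)

section \<open>Smooth functions and a bump function\<close>

lemma Ck_SucI:
  assumes "\<And>x. (f has_derivative f' x) (at x)" "\<And>v. Ck k (\<lambda>x. f' x v)"
  shows "Ck (Suc k) f"
proof -
  have "frechet_derivative f (at x) = f' x" for x using frechet_derivative_at[OF assms(1)] by simp
  thus ?thesis using assms by (auto simp: differentiable_def)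
qed

lemma Ck_SucD:
  assumes "Ck (Suc k) f"
  shows "(f has_derivative frechet_derivative f (at x)) (at x)" "Ck k (\<lambda>x. frechet_derivative f (at x) v)"
  using assms by (auto simp: frechet_derivative_works)

lemma Ck_continuous: "Ck k f \<Longrightarrow> continuous_on UNIV f"
  by (cases k) (auto simp: continuous_on_eq_continuous_within differentiable_imp_continuous_within)

lemma Ck_Suc_imp: "Ck (Suc k) f \<Longrightarrow> Ck k f"
proof (induction k arbitrary: f)
  case 0 thus ?case using Ck_continuous by fastforce
next
  case (Suc k)
  have "\<forall>x. f differentiable at x" using Suc.prems by simp
  moreover have "Ck k (\<lambda>x. frechet_derivative f (at x) v)" for v
    by (rule Suc.IH) (rule Ck_SucD(2)[OF Suc.prems])
  ultimately show ?case by simp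
qed

lemma Ck_const: "Ck k (\<lambda>x. c)"
proof (induction k arbitrary: c)
  case (Suc k) show ?case by (rule Ck_SucI[of _ "\<lambda>x v. 0"]) (use Suc in auto)
qed simp

lemma Ck_bounded_linear: assumes "bounded_linear f" shows "Ck k f"
proof (cases k)
  case 0 thus ?thesis using assms by (simp add: linear_continuous_on)
next
  case (Suc j)
  have "Ck (Suc j) f"
    by (rule Ck_SucI[of _ "\<lambda>x v. f v"]) (rule bounded_linear.has_derivative[OF assms has_derivative_ident] Ck_const)+
  with Suc show ?thesis by simp
qed

lemma Ck_add: "Ck k f \<Longrightarrow> Ck k g \<Longrightarrow> Ck k (\<lambda>x. f x + g x)"
proof (induction k arbitrary: f g)
  case 0 thus ?case by (auto intro: continuous_on_add)
next
  case (Suc k)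
  show ?case
    by (rule Ck_SucI[OF has_derivative_add[OF Ck_SucD(1)[OF Suc.prems(1)] Ck_SucD(1)[OF Suc.prems(2)]]])
      (intro Suc.IH Ck_SucD Suc.prems)
qed

lemma Ck_sum: "(\<And>i. i \<in> I \<Longrightarrow> Ck k (f i)) \<Longrightarrow> Ck k (\<lambda>x. \<Sum>i\<in>I. f i x)"
  by (induction I rule: infinite_finite_induct) (auto intro: Ck_const Ck_add)

lemma Ck_linear_comp: "bounded_linear L \<Longrightarrow> Ck k f \<Longrightarrow> Ck k (\<lambda>x. L (f x))"
proof (induction k arbitrary: f)
  case 0 thus ?case
    using continuous_on_compose2[OF linear_continuous_on[of L UNIV], of UNIV f] by auto
next
  case (Suc k)
  show ?case
    by (rule Ck_SucI[OF bounded_linear.has_derivative[OF Suc.prems(1) Ck_SucD(1)[OF Suc.prems(2)]]])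
      (intro Suc.IH Suc.prems Ck_SucD)
qed

lemma Ck_bilinear: "bounded_bilinear p \<Longrightarrow> Ck k f \<Longrightarrow> Ck k g \<Longrightarrow> Ck k (\<lambda>x. p (f x) (g x))"
proof (induction k arbitrary: f g)
  case 0 thus ?case by (auto intro: bounded_bilinear.continuous_on)
next
  case (Suc k)
  show ?case
  proof (rule Ck_SucI[OF bounded_bilinear.FDERIV[OF Suc.prems(1) Ck_SucD(1)[OF Suc.prems(2)] Ck_SucD(1)[OF Suc.prems(3)]]])
    show "Ck k (\<lambda>x. p (f x) (frechet_derivative g (at x) v) + p (frechet_derivative f (at x) v) (g x))" for v
      by (intro Ck_add Suc.IH Suc.prems(1) Ck_SucD(2)[OF Suc.prems(2)] Ck_SucD(2)[OF Suc.prems(3)]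
           Ck_Suc_imp[OF Suc.prems(2)] Ck_Suc_imp[OF Suc.prems(3)])
  qed
qed

lemma Ck_compose_affine: "bounded_linear L \<Longrightarrow> Ck k f \<Longrightarrow> Ck k (\<lambda>x. f (L x + a))"
proof (induction k arbitrary: f)
  case 0
  have "continuous_on UNIV (\<lambda>x. L x + a)"
    by (intro continuous_intros linear_continuous_on 0)
  with 0 show ?case using continuous_on_compose2[of UNIV f UNIV "\<lambda>x. L x + a"] by auto
next
  case (Suc k)
  have d: "((\<lambda>x. L x + a) has_derivative L) (at x)" for x
    using has_derivative_add[OF bounded_linear.has_derivative[OF Suc.prems(1) has_derivative_ident] has_derivative_const, of a]
    by simp
  have "((\<lambda>x. f (L x + a)) has_derivative (\<lambda>v. frechet_derivative f (at (L x + a)) (L v))) (at x)" for x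
    using diff_chain_at[OF d Ck_SucD(1)[OF Suc.prems(2)]] by (simp add: o_def)
  thus ?case by (rule Ck_SucI) (intro Suc.IH Suc.prems(1) Ck_SucD(2)[OF Suc.prems(2)])
qed

text \<open>Needed because averages over integer translations are finite sums only locally.\<close>

lemma Ck_local:
  "(\<And>x. \<exists>U g. open U \<and> x \<in> U \<and> (\<forall>y\<in>U. f y = g y) \<and> Ck k g) \<Longrightarrow> Ck k f"
proof (induction k arbitrary: f)
  case 0
  have "isCont f x" for x
  proof -
    have "\<exists>U g. open U \<and> x \<in> U \<and> (\<forall>y\<in>U. f y = g y) \<and> Ck 0 g" by (rule 0)
    then obtain U g where U: "open U" "x \<in> U" "\<And>y. y \<in> U \<Longrightarrow> f y = g y" "Ck 0 g" by blast
    hence "continuous_on U g" using continuous_on_subset by fastforce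
    hence "continuous_on U f" using U by (simp cong: continuous_on_cong)
    thus ?thesis using U continuous_on_interior interior_open by metis
  qed
  thus ?case by (simp add: continuous_at_imp_continuous_on)
next
  case (Suc k)
  have ex: "\<exists>U g. open U \<and> x \<in> U \<and> (\<forall>y\<in>U. f y = g y) \<and> Ck (Suc k) g" for x by (rule Suc.prems)
  have D: "(f has_derivative frechet_derivative g (at y)) (at y)"
    if "open U" "y \<in> U" "\<forall>y\<in>U. f y = g y" "Ck (Suc k) g" for y U g
    using has_derivative_transform_within_open[OF Ck_SucD(1)[OF that(4), of y] that(1,2)] that(3) by simp
  have E: "frechet_derivative f (at y) = frechet_derivative g (at y)"
    if "open U" "y \<in> U" "\<forall>y\<in>U. f y = g y" "Ck (Suc k) g" for y U g
    using frechet_derivative_at[OF D[OF that]] by simp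
  have "f differentiable at x" for x
  proof -
    obtain U g where "open U" "x \<in> U" "\<forall>y\<in>U. f y = g y" "Ck (Suc k) g" using ex by blast
    from D[OF this] show ?thesis by (rule differentiableI)
  qed
  moreover have "Ck k (\<lambda>x. frechet_derivative f (at x) v)" for v
  proof (rule Suc.IH)
    fix x
    obtain U g where U: "open U" "x \<in> U" "\<forall>y\<in>U. f y = g y" "Ck (Suc k) g" using ex by blast
    hence "\<forall>y\<in>U. frechet_derivative f (at y) v = frechet_derivative g (at y) v" using E by metis
    thus "\<exists>U g. open U \<and> x \<in> U \<and> (\<forall>y\<in>U. frechet_derivative f (at y) v = g y) \<and> Ck k g"
      using U Ck_SucD(2)[OF U(4)] by (intro exI[of _ U] exI[of _ "\<lambda>y. frechet_derivative g (at y) v"]) auto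
  qed
  ultimately show ?case by simp
qed

lemma smooth_const [simp, intro]: "smooth (\<lambda>x. c)" by (simp add: smooth_def Ck_const)
lemma smooth_bounded_linear: "bounded_linear f \<Longrightarrow> smooth f" by (simp add: smooth_def Ck_bounded_linear)
lemma smooth_add: "smooth f \<Longrightarrow> smooth g \<Longrightarrow> smooth (\<lambda>x. f x + g x)" by (simp add: smooth_def Ck_add)
lemma smooth_sum: "(\<And>i. i \<in> I \<Longrightarrow> smooth (f i)) \<Longrightarrow> smooth (\<lambda>x. \<Sum>i\<in>I. f i x)"
  by (simp add: smooth_def Ck_sum)
lemma smooth_linear_comp: "bounded_linear L \<Longrightarrow> smooth f \<Longrightarrow> smooth (\<lambda>x. L (f x))"
  by (simp add: smooth_def Ck_linear_comp)
lemma smooth_bilinear: "bounded_bilinear p \<Longrightarrow> smooth f \<Longrightarrow> smooth g \<Longrightarrow> smooth (\<lambda>x. p (f x) (g x))"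
  by (simp add: smooth_def Ck_bilinear)
lemma smooth_compose_affine: "bounded_linear L \<Longrightarrow> smooth f \<Longrightarrow> smooth (\<lambda>x. f (L x + a))"
  by (simp add: smooth_def Ck_compose_affine)
lemma smooth_compose_linear: "bounded_linear L \<Longrightarrow> smooth f \<Longrightarrow> smooth (\<lambda>x. f (L x))"
  using smooth_compose_affine[of L f 0] by simp
lemma smooth_local:
  assumes "\<And>x. \<exists>U g. open U \<and> x \<in> U \<and> (\<forall>y\<in>U. f y = g y) \<and> smooth g" shows "smooth f"
  unfolding smooth_def
proof
  fix k show "Ck k f" by (rule Ck_local) (use assms in \<open>metis smooth_def\<close>)
qed
lemma smooth_continuous: "smooth f \<Longrightarrow> continuous_on UNIV f" using Ck_continuous by (auto simp: smooth_def)
lemma smooth_has_derivative: "smooth f \<Longrightarrow> (f has_derivative frechet_derivative f (at x)) (at x)"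
  using Ck_SucD(1)[of 0] by (auto simp: smooth_def simp del: Ck.simps)
lemma smooth_frechet: "smooth f \<Longrightarrow> smooth (\<lambda>x. frechet_derivative f (at x) v)"
  using Ck_SucD(2) by (auto simp: smooth_def simp del: Ck.simps)
lemma smooth_minus: "smooth f \<Longrightarrow> smooth (\<lambda>x. - f x)"
  using smooth_linear_comp[OF bounded_linear_minus[OF bounded_linear_ident]] by fast
lemma smooth_diff: "smooth f \<Longrightarrow> smooth g \<Longrightarrow> smooth (\<lambda>x. f x - g x)"
  using smooth_add[OF _ smooth_minus] by fastforce
lemma smooth_scaleR: "smooth f \<Longrightarrow> smooth g \<Longrightarrow> smooth (\<lambda>x. f x *\<^sub>R g x)"
  by (rule smooth_bilinear[OF bounded_bilinear_scaleR])
lemma smooth_mult: "smooth f \<Longrightarrow> smooth g \<Longrightarrow> smooth (\<lambda>x. f x * (g x :: 'a::real_normed_algebra))"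
  by (rule smooth_bilinear[OF bounded_bilinear_mult])

lemma smooth_of_derivs:
  assumes "\<And>k x. (F k has_vector_derivative F (Suc k) x) (at x)"
  shows "smooth (F k)"
proof -
  have "Ck j (F k)" for j k
  proof (induction j arbitrary: k)
    case 0
    have "isCont (F k) x" for x using assms has_vector_derivative_continuous by blast
    thus ?case by (simp add: continuous_at_imp_continuous_on)
  next
    case (Suc j)
    show ?case
      by (rule Ck_SucI[OF assms[unfolded has_vector_derivative_def]])
        (rule Ck_linear_comp[OF bounded_linear_scaleR_right Suc])
  qed
  thus ?thesis by (simp add: smooth_def)
qed

lemma smooth_power_fun: "smooth (\<lambda>t::real. t ^ k)"
proof (induction k)
  case (Suc k) thus ?case by (simp add: smooth_mult smooth_bounded_linear bounded_linear_ident)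
qed simp

lemma Ck_exp_linear:
  assumes "bounded_linear L" shows "Ck k (\<lambda>x. exp (L x :: complex))"
proof (induction k)
  case 0 show ?case using linear_continuous_on[OF assms, of UNIV] by (auto intro!: continuous_intros)
next
  case (Suc k)
  have "((\<lambda>x. exp (L x)) has_derivative (\<lambda>v. exp (L x) * L v)) (at x)" for x
  proof -
    have "(L has_derivative L) (at x)" using bounded_linear.has_derivative[OF assms has_derivative_ident] .
    moreover have "(exp has_derivative (\<lambda>h. exp (L x) * h)) (at (L x))"
      using DERIV_exp[of "L x"] by (simp add: has_field_derivative_def)
    ultimately show ?thesis using diff_chain_at by (fastforce simp: o_def)
  qed
  thus ?case by (rule Ck_SucI) (rule Ck_bilinear[OF bounded_bilinear_mult Suc Ck_const])
qed

lemma smooth_exp_linear: "bounded_linear L \<Longrightarrow> smooth (\<lambda>x. exp (L x :: complex))"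
  by (simp add: smooth_def Ck_exp_linear)

text \<open>The functions \<open>flat p\<close> are closed under differentiation, and \<open>flat 1\<close> is \<open>exp (- 1 / x)\<close>.\<close>

definition flat :: "real poly \<Rightarrow> real \<Rightarrow> real" where
  "flat p x = (if x \<le> 0 then 0 else poly p (inverse x) * exp (- inverse x))"

text \<open>With \<open>t = 1 / x\<close> this is the decay of \<open>t ^ i * exp (- t)\<close> at
  infinity.\<close>

lemma flat_tendsto_0: "((\<lambda>x. flat p x) \<longlongrightarrow> 0) (at 0)"
proof -
  have "((\<lambda>t. \<Sum>i\<le>degree p. coeff p i * (t ^ i / exp t)) \<longlongrightarrow> (\<Sum>i\<le>degree p. coeff p i * 0)) at_top"
    by (intro tendsto_intros tendsto_power_div_exp_0)
  hence "((\<lambda>t. poly p t * exp (- t)) \<longlongrightarrow> 0) at_top"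
    by (simp add: poly_altdef sum_divide_distrib exp_minus divide_inverse sum_distrib_right mult.assoc)
  hence "((\<lambda>x. poly p (inverse x) * exp (- inverse x)) \<longlongrightarrow> 0) (at_right 0)"
    using filterlim_compose filterlim_inverse_at_top_right by blast
  hence r: "(flat p \<longlongrightarrow> 0) (at_right 0)"
    by (rule Lim_transform_eventually) (auto simp: flat_def eventually_at_right_less[of 0] eventually_at_filter)
  have l: "(flat p \<longlongrightarrow> 0) (at_left 0)"
    by (rule tendsto_eventually) (auto simp: flat_def eventually_at_filter)
  show ?thesis using r l by (simp add: filterlim_split_at)
qed

text \<open>Differentiating \<open>1 / x\<close> produces the factor \<open>1 / x^2\<close>, which
  is the polynomial \<open>[:0, 0, 1:]\<close> evaluated at \<open>1 / x\<close>; the exponential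
  contributes \<open>p\<close> and the inner polynomial \<open>- pderiv p\<close>.\<close>

lemma flat_deriv:
  "(flat p has_vector_derivative flat ([:0, 0, 1:] * (p - pderiv p)) x) (at x)"
proof -
  consider "x < 0" | "x = 0" | "x > 0" by linarith
  thus ?thesis
  proof cases
    case 1
    have "((\<lambda>x. 0) has_vector_derivative 0) (at x)" by simp
    hence "(flat p has_vector_derivative 0) (at x)"
      by (rule has_vector_derivative_transform_within_open[of _ _ _ "{..<0}"]) (use 1 in \<open>auto simp: flat_def\<close>)
    thus ?thesis using 1 by (simp add: flat_def)
  next
    case 2
    \<comment> \<open>The difference quotient at 0 is again of this type: dividing by
      \<open>h\<close> multiplies the polynomial by its variable.\<close>
    have "((\<lambda>h. flat (pCons 0 p) h) \<longlongrightarrow> 0) (at 0)" by (rule flat_tendsto_0)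
    hence "((\<lambda>h. (flat p (0 + h) - flat p 0) / h) \<longlongrightarrow> 0) (at 0)"
      by (rule Lim_transform_eventually) (auto simp: flat_def eventually_at_filter field_simps)
    hence "(flat p has_field_derivative 0) (at 0)" by (simp add: DERIV_def)
    thus ?thesis using 2 by (simp add: has_real_derivative_iff_has_vector_derivative flat_def)
  next
    case 3
    have "((\<lambda>x. poly p (inverse x) * exp (- inverse x)) has_field_derivative
       (poly (pderiv p) (inverse x) * - (inverse x ^ Suc (Suc 0))) * exp (- inverse x) + exp (- inverse x) * - (- (inverse x ^ Suc (Suc 0))) * poly p (inverse x)) (at x)"
      by (rule derivative_eq_intros DERIV_inverse poly_DERIV[THEN DERIV_chain2] refl | use 3 in simp)+
    hence "((\<lambda>x. poly p (inverse x) * exp (- inverse x)) has_vector_derivative flat ([:0, 0, 1:] * (p - pderiv p)) x) (at x)"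
      using 3 by (simp add: flat_def has_real_derivative_iff_has_vector_derivative algebra_simps)
    thus ?thesis
      by (rule has_vector_derivative_transform_within_open[of _ _ _ "{0<..}"]) (use 3 in \<open>auto simp: flat_def\<close>)
  qed
qed

lemma smooth_flat: "smooth (flat p)"
proof -
  define F where "F k = flat (((\<lambda>p. [:0, 0, 1:] * (p - pderiv p)) ^^ k) p)" for k
  have "smooth (F 0)" by (rule smooth_of_derivs) (use flat_deriv in \<open>simp add: F_def\<close>)
  thus ?thesis by (simp add: F_def)
qed

definition bump :: "real \<Rightarrow> real" where "bump x = flat 1 (1 + x) * flat 1 (1 - x)"

lemma smooth_bump: "smooth bump"
proof -
  have a: "smooth (\<lambda>x. flat 1 (x + 1))"
    using smooth_compose_affine[OF bounded_linear_ident smooth_flat] by simp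
  have b: "smooth (\<lambda>x. flat 1 (- x + 1))"
    using smooth_compose_affine[OF bounded_linear_minus[OF bounded_linear_ident] smooth_flat] by simp
  show ?thesis using smooth_mult[OF a b] by (simp add: bump_def[abs_def] add.commute)
qed

lemma bump_pos: "\<bar>x\<bar> < 1 \<Longrightarrow> 0 < bump x" by (auto simp: bump_def flat_def)
lemma bump_zero: "1 \<le> \<bar>x\<bar> \<Longrightarrow> bump x = 0" by (auto simp: bump_def flat_def)
lemma bump_nonneg: "0 \<le> bump x" by (auto simp: bump_def flat_def)

section \<open>The matrix exponential and polynomial functions\<close>

lemma matrix_mult_scaleR_left: "(a *\<^sub>R A) ** B = a *\<^sub>R (A ** B)"
  and matrix_mult_scaleR_right: "A ** (a *\<^sub>R B) = a *\<^sub>R (A ** B)" for A B :: "real^'n^'n"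
  by (simp_all add: vec_eq_iff matrix_matrix_mult_def sum_distrib_left mult.assoc mult.left_commute)

lemma matrix_mult_add_left: "(A + B) ** C = A ** C + B ** C" for A B C :: "real^'n^'n"
  by (simp add: vec_eq_iff matrix_matrix_mult_def sum.distrib algebra_simps)

lemma matpow_scaleR: "matpow (t *\<^sub>R B) k = t ^ k *\<^sub>R matpow B k"
  by (induction k) (simp_all add: matrix_mult_scaleR_left matrix_mult_scaleR_right)

lemma matpow_entry_bound:
  fixes B :: "real^'n^'n"
  assumes "\<And>i j. \<bar>B $ i $ j\<bar> \<le> b"
  shows "\<bar>matpow B k $ i $ j\<bar> \<le> (real CARD('n) * b) ^ k"
proof (induction k arbitrary: i j)
  case 0 show ?case by (simp add: mat_def)
next
  case (Suc k)
  have "\<bar>matpow B (Suc k) $ i $ j\<bar> = \<bar>\<Sum>l\<in>UNIV. B $ i $ l * matpow B k $ l $ j\<bar>"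
    by (simp add: matrix_matrix_mult_def)
  also have "... \<le> (\<Sum>l\<in>UNIV. \<bar>B $ i $ l\<bar> * \<bar>matpow B k $ l $ j\<bar>)"
    by (rule order_trans[OF sum_abs]) (simp add: abs_mult)
  also have "... \<le> (\<Sum>l\<in>(UNIV::'n set). b * (real CARD('n) * b) ^ k)"
    by (intro sum_mono mult_mono assms Suc) (use order_trans[OF abs_ge_zero assms] in auto)
  finally show ?case by simp
qed

lemma norm_matrix_le: fixes M :: "real^'n^'n"
  assumes "\<And>i j. \<bar>M $ i $ j\<bar> \<le> b" shows "norm M \<le> real CARD('n) * (real CARD('n) * b)"
proof -
  have "norm (M $ i) \<le> real CARD('n) * b" for i
    using order_trans[OF norm_le_l1_cart[of "M $ i"] sum_mono[of UNIV _ "\<lambda>_. b"]] assms by simp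
  moreover have "norm M \<le> (\<Sum>i\<in>UNIV. norm (M $ i))" by (simp add: norm_vec_def L2_set_le_sum)
  ultimately show ?thesis using order_trans[OF _ sum_mono[of UNIV "\<lambda>i. norm (M $ i)" "\<lambda>_. real CARD('n) * b"]] by simp
qed

lemma mexp_summable: fixes B :: "real^'n^'n"
  shows "summable (\<lambda>k. (1 / fact k) *\<^sub>R matpow B k)"
proof -
  define b where "b = (\<Sum>i\<in>UNIV. \<Sum>j\<in>UNIV. \<bar>B $ i $ j\<bar>)"
  define K where "K = real CARD('n) * b"
  have "\<bar>B $ i $ j\<bar> \<le> b" for i j
  proof -
    have "\<bar>B $ i $ j\<bar> \<le> (\<Sum>j\<in>UNIV. \<bar>B $ i $ j\<bar>)" by (rule member_le_sum) auto
    also have "... \<le> b" unfolding b_def by (rule member_le_sum) (auto intro: sum_nonneg)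
    finally show ?thesis .
  qed
  hence e: "\<bar>matpow B k $ i $ j\<bar> \<le> K ^ k" for k i j unfolding K_def by (rule matpow_entry_bound)
  have "summable (\<lambda>k. (real CARD('n) * real CARD('n)) * (K ^ k / fact k))"
    using summable_exp_generic[of K] by (intro summable_mult) (simp add: field_simps)
  moreover have "norm ((1 / fact k) *\<^sub>R matpow B k) \<le> (real CARD('n) * real CARD('n)) * (K ^ k / fact k)" for k
    using divide_right_mono[OF norm_matrix_le[OF e, of k], of "fact k"] by (simp add: mult.assoc)
  ultimately show ?thesis by (rule summable_comparison_test'[of _ 0])
qed

lemma flow_series: "summable (\<lambda>k. (t ^ k / fact k) *\<^sub>R matpow B k)"
   "flow B t = (\<Sum>k. (t ^ k / fact k) *\<^sub>R matpow B k)"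
  using mexp_summable[of "t *\<^sub>R B"] by (simp_all add: flow_def mexp_def matpow_scaleR)

text \<open>Each entry is a real power series in \<open>t\<close>, to which termwise differentiation
  applies.\<close>

lemma flow_entry_series: fixes B :: "real^'n^'n" shows "summable (\<lambda>k. (matpow B k $ i $ j / fact k) * t ^ k)"
   "flow B t $ i $ j = (\<Sum>k. (matpow B k $ i $ j / fact k) * t ^ k)"
proof -
  have bl: "bounded_linear (\<lambda>M::real^'n^'n. M $ i $ j)"
    by (intro bounded_linear_compose[OF bounded_linear_vec_nth bounded_linear_vec_nth])
  show "summable (\<lambda>k. (matpow B k $ i $ j / fact k) * t ^ k)"
    using bounded_linear.summable[OF bl flow_series(1)[of t B]] by (simp add: field_simps)
  show "flow B t $ i $ j = (\<Sum>k. (matpow B k $ i $ j / fact k) * t ^ k)"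
    unfolding flow_series(2) using bounded_linear.suminf[OF bl flow_series(1)[of t B]] by (simp add: field_simps)
qed

lemma flow_0 [simp]: "flow B 0 = mat 1"
proof -
  have "(\<Sum>k. (matpow B k $ i $ j / fact k) * 0 ^ k) = mat 1 $ i $ j" for i j by (subst powser_zero) simp
  thus ?thesis by (simp only: vec_eq_iff flow_entry_series) simp
qed

text \<open>Recovers \<open>B\<close> from the flow before \<open>B\<close> is known to be
  nilpotent; it is the link from the group to the Lie algebra in \<open>matpow_nil\<close>.\<close>

lemma flow_entry_deriv_0: "DERIV (\<lambda>t. flow B t $ i $ j) 0 :> B $ i $ j"
proof -
  have "DERIV (\<lambda>t. \<Sum>k. (matpow B k $ i $ j / fact k) * t ^ k) 0 :> (\<Sum>n. diffs (\<lambda>k. matpow B k $ i $ j / fact k) n * 0 ^ n)"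
    by (rule termdiffs_strong[of _ 1]) (use flow_entry_series(1)[of B i j 1] in auto)
  hence "DERIV (\<lambda>t. flow B t $ i $ j) 0 :> diffs (\<lambda>k. matpow B k $ i $ j / fact k) 0"
    by (simp only: flow_entry_series powser_zero)
  thus ?thesis by (simp add: diffs_def)
qed

lemma matrix_mult_tendsto:
  fixes M N :: "'a \<Rightarrow> real^'n^'n"
  assumes "(M \<longlongrightarrow> A) F" "(N \<longlongrightarrow> C) F" shows "((\<lambda>x. M x ** N x) \<longlongrightarrow> A ** C) F"
  unfolding matrix_matrix_mult_def
  by (intro vec_tendstoI) (simp, intro tendsto_intros tendsto_vec_nth assms)

lemma matpow_tendsto: "(M \<longlongrightarrow> A) F \<Longrightarrow> ((\<lambda>x. matpow (M x) k) \<longlongrightarrow> matpow A k) F"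
  by (induction k) (auto intro: matrix_mult_tendsto)

definition is_poly :: "(real \<Rightarrow> real) \<Rightarrow> bool" where "is_poly f \<longleftrightarrow> (\<exists>p. \<forall>t. f t = poly p t)"

lemma is_poly_const [intro, simp]: "is_poly (\<lambda>t. c)" unfolding is_poly_def by (rule exI[of _ "[:c:]"]) simp
lemma is_poly_add [intro]: "is_poly f \<Longrightarrow> is_poly g \<Longrightarrow> is_poly (\<lambda>t. f t + g t)"
  unfolding is_poly_def by (metis poly_add)
lemma is_poly_mult [intro]: "is_poly f \<Longrightarrow> is_poly g \<Longrightarrow> is_poly (\<lambda>t. f t * g t)"
  unfolding is_poly_def by (metis poly_mult)
lemma is_poly_sum [intro]: "(\<And>i. i \<in> I \<Longrightarrow> is_poly (f i)) \<Longrightarrow> is_poly (\<lambda>t. \<Sum>i\<in>I. f i t)"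
  by (induction I rule: infinite_finite_induct) (auto)
lemma is_poly_prod [intro]: "(\<And>i. i \<in> I \<Longrightarrow> is_poly (f i)) \<Longrightarrow> is_poly (\<lambda>t. \<Prod>i\<in>I. f i t)"
  by (induction I rule: infinite_finite_induct) (auto)
lemma is_poly_power: "is_poly (\<lambda>t. t ^ k)"
  unfolding is_poly_def by (rule exI[of _ "monom 1 k"]) (simp add: poly_monom)

text \<open>A nonzero polynomial has finitely many roots. This carries facts known at integer times
  over to all times.\<close>

lemma is_poly_const_on_multiples:
  assumes "is_poly f" "j \<noteq> 0" "\<And>k::nat. f (j * real k) = c" shows "f t = c"
proof -
  obtain p where p: "\<And>t. f t = poly p t" using assms(1) by (auto simp: is_poly_def)
  have "p - [:c:] = 0"
  proof (rule ccontr)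
    assume "p - [:c:] \<noteq> 0"
    hence "finite {x. poly (p - [:c:]) x = 0}" by (rule poly_roots_finite)
    moreover have "range (\<lambda>k::nat. j * real k) \<subseteq> {x. poly (p - [:c:]) x = 0}" using p assms(3) by auto
    moreover have "infinite (range (\<lambda>k::nat. j * real k))"
      using assms(2) by (intro range_inj_infinite) (auto simp: inj_def)
    ultimately show False using finite_subset by blast
  qed
  thus ?thesis using p by (metis diff_eq_diff_eq diff_self poly_pCons poly_0 mult_zero_right add.right_neutral eq_iff_diff_eq_0)
qed

section \<open>Unipotent flows\<close>

locale nil_flow =
  fixes B :: "real^'n^'n"
  assumes nil: "nilpotent_group (sdp B)" and SL: "flow B 1 \<in> SL_int"
begin

sublocale Gr: group "sdp B" using nil by (simp add: nilpotent_group_def)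

lemma sdp_simps [simp]: "carrier (sdp B) = UNIV" "\<one>\<^bsub>sdp B\<^esub> = (0, 0)"
  "p \<otimes>\<^bsub>sdp B\<^esub> q = (fst p + flow B (snd p) *v fst q, snd p + snd q)"
  by (auto simp: sdp_def case_prod_unfold)

text \<open>Read off from associativity of the product, which is part of
  \<open>nilpotent_group\<close>, so no multiplication of series is needed.\<close>

lemma flow_add: "flow B (s + t) = flow B s ** flow B t"
proof -
  have "flow B (s + t) *v z = (flow B s ** flow B t) *v z" for z
    using Gr.m_assoc[of "(0, s)" "(0, t)" "(z, 0)"]
    by (simp add: matrix_vector_mul_assoc)
  thus ?thesis by (metis matrix_eq)
qed

lemma flow_neg: "flow B (- t) ** flow B t = mat 1" "flow B t ** flow B (- t) = mat 1"
  using flow_add[of "-t" t] flow_add[of t "-t"] by simp_all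

lemma inv_sdp: "inv\<^bsub>sdp B\<^esub> p = (- (flow B (- snd p) *v fst p), - snd p)"
  by (rule Gr.inv_equality) (simp_all add: matrix_vector_mul_assoc flow_neg)

text \<open>The commutator of \<open>(0, t)\<close> with \<open>(y, 0)\<close> is
  \<open>((flow B t - mat 1) *v y, 0)\<close>.\<close>

lemma matpow_lower_central: "(matpow (flow B t - mat 1) k *v w, 0) \<in> lower_central (sdp B) k"
proof (induction k)
  case (Suc k)
  let ?y = "(matpow (flow B t - mat 1) k *v w, 0)"
  have "(matpow (flow B t - mat 1) (Suc k) *v w, 0) =
     (0, t) \<otimes>\<^bsub>sdp B\<^esub> ?y \<otimes>\<^bsub>sdp B\<^esub> inv\<^bsub>sdp B\<^esub> (0, t) \<otimes>\<^bsub>sdp B\<^esub> inv\<^bsub>sdp B\<^esub> ?y"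
    by (simp add: inv_sdp matrix_vector_mul_assoc[symmetric] matrix_vector_mult_diff_rdistrib)
  with Suc show ?case unfolding lower_central.simps by (intro generate.incl CollectI exI[of _ "(0, t)"] exI[of _ ?y]) auto
qed simp

text \<open>Some fixed power of \<open>flow B t - mat 1\<close> vanishes for every \<open>t\<close>;
  dividing by the same power of \<open>t\<close> and letting \<open>t\<close> tend to 0 leaves that
  power of \<open>B\<close>.\<close>

lemma matpow_nil: "\<exists>k. matpow B k = 0"
proof -
  obtain k where k: "lower_central (sdp B) k = {(0, 0)}" using nil by (auto simp: nilpotent_group_def)
  have "matpow (flow B t - mat 1) k *v w = 0" for t w
    using matpow_lower_central[of t k w] k by simp
  hence z: "matpow (flow B t - mat 1) k = 0" for t by (simp add: matrix_eq)
  have "((\<lambda>t. (1 / t) *\<^sub>R (flow B t - mat 1)) \<longlongrightarrow> B) (at 0)"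
  proof (intro vec_tendstoI)
    fix i j
    show "((\<lambda>t. ((1 / t) *\<^sub>R (flow B t - mat 1)) $ i $ j) \<longlongrightarrow> B $ i $ j) (at 0)"
      using flow_entry_deriv_0[of B i j] by (simp add: DERIV_def)
  qed
  hence "((\<lambda>t. matpow ((1 / t) *\<^sub>R (flow B t - mat 1)) k) \<longlongrightarrow> matpow B k) (at 0)" by (rule matpow_tendsto)
  hence "((\<lambda>t. 0) \<longlongrightarrow> matpow B k) (at (0::real))" by (simp add: matpow_scaleR z)
  hence "matpow B k = 0" by (metis tendsto_const_iff trivial_limit_at)
  thus ?thesis by blast
qed

definition K where "K = (SOME k. matpow B k = 0)"

lemma matpow_ge_K: "K \<le> k \<Longrightarrow> matpow B k = 0"
proof (induction k rule: dec_induct)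
  case base show ?case unfolding K_def by (rule someI_ex[OF matpow_nil])
qed simp

lemma flow_poly: "flow B t = (\<Sum>k<K. (t ^ k / fact k) *\<^sub>R matpow B k)"
  unfolding flow_series by (rule suminf_finite) (auto simp: matpow_ge_K)

lemma matpow_commute: "B ** matpow B k = matpow B k ** B"
proof (induction k)
  case (Suc k) thus ?case by (metis matpow.simps(2) matrix_mul_assoc)
qed simp

lemma flow_commute: "B ** flow B t = flow B t ** B"
proof -
  have "B ** (\<Sum>k<m. c k *\<^sub>R matpow B k) = (\<Sum>k<m. c k *\<^sub>R matpow B k) ** B" for m :: nat and c :: "nat \<Rightarrow> real"
    by (induction m) (simp_all add: matrix_add_ldistrib matrix_mult_add_left matpow_commute matrix_mult_scaleR_left matrix_mult_scaleR_right)
  thus ?thesis by (simp add: flow_poly)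
qed

lemma flow_deriv: "(flow B has_vector_derivative flow B t ** B) (at t)"
proof -
  have 0: "(flow B has_vector_derivative B) (at 0)"
  proof -
    \<comment> \<open>Two extra terms, both 0 beyond \<open>K\<close>, ensure that the index 1
      occurs in the sum even for small \<open>K\<close>.\<close>
    have p: "flow B t = (\<Sum>k<K+2. (t ^ k * (1 / fact k)) *\<^sub>R matpow B k)" for t
      unfolding flow_poly by (rule sum.mono_neutral_cong_left) (auto simp: matpow_ge_K)
    have d: "((\<lambda>t. t ^ k * (1 / fact k)) has_real_derivative (if k = 1 then 1 else 0)) (at 0)" for k :: nat
      by (cases k; cases "k - 1") (auto intro!: derivative_eq_intros)
    have "((\<lambda>t. (t ^ k * (1 / fact k)) *\<^sub>R matpow B k) has_vector_derivative (if k = 1 then 1 else 0) *\<^sub>R matpow B k) (at 0)" for k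
      using has_vector_derivative_scaleR[OF d has_vector_derivative_const, of k "matpow B k"] by simp
    hence "((\<lambda>t. \<Sum>k<K+2. (t ^ k * (1 / fact k)) *\<^sub>R matpow B k) has_vector_derivative
        (\<Sum>k<K+2. (if k = 1 then 1 else 0) *\<^sub>R matpow B k)) (at 0)"
      by (intro has_vector_derivative_sum)
    moreover have "(\<Sum>k<K+2. (if k = 1 then 1 else 0) *\<^sub>R matpow B k) = (\<Sum>k<K+2. if k = 1 then matpow B k else 0)"
      by (intro sum.cong) auto
    moreover have "... = B" by (subst sum.delta) auto
    ultimately show ?thesis by (simp only: p[abs_def])
  qed
  have bl: "bounded_linear (\<lambda>M::real^'n^'n. flow B t ** M)"
    by (simp add: linear_conv_bounded_linear[symmetric] linear_iff matrix_add_ldistrib matrix_mult_scaleR_right)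
  have "((\<lambda>h. flow B t ** flow B h) has_vector_derivative flow B t ** B) (at 0)"
    by (rule bounded_linear.has_vector_derivative[OF bl 0])
  hence "((\<lambda>h. flow B (t + h)) has_vector_derivative flow B t ** B) (at 0)" by (simp add: flow_add)
  moreover have "((\<lambda>u. u - t) has_vector_derivative 1) (at t)" by (auto intro!: derivative_eq_intros)
  ultimately have "((\<lambda>h. flow B (t + h)) \<circ> (\<lambda>u. u - t) has_vector_derivative 1 *\<^sub>R (flow B t ** B)) (at t)"
    by (intro vector_diff_chain_at) auto
  thus ?thesis by (simp add: o_def)
qed

lemma smooth_flow: "smooth (flow B)"
proof -
  have "smooth (\<lambda>t. \<Sum>k<K. (t ^ k * (1 / fact k)) *\<^sub>R matpow B k)"
    by (intro smooth_sum smooth_scaleR smooth_mult smooth_power_fun smooth_const)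
  thus ?thesis by (simp add: flow_poly[abs_def])
qed

lemma is_poly_entry: "is_poly (\<lambda>t. flow B t $ i $ j)"
proof -
  have "is_poly (\<lambda>t. \<Sum>k<K. t ^ k * (matpow B k $ i $ j / fact k))"
    by (intro is_poly_sum is_poly_mult is_poly_power is_poly_const)
  thus ?thesis by (simp add: flow_poly)
qed

lemma det_flow_nat: "det (flow B (real k)) = 1"
proof (induction k)
  case (Suc k)
  have "flow B (real (Suc k)) = flow B (real k) ** flow B 1" using flow_add[of "real k" 1] by (simp add: add.commute)
  thus ?case using Suc SL by (simp add: det_mul SL_int_def)
qed (simp add: det_I)

text \<open>The determinant is a polynomial in \<open>t\<close>, and at natural numbers it is a
  power of \<open>det (flow B 1)\<close>.\<close>

lemma det_flow [simp]: "det (flow B t) = 1"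
proof (rule is_poly_const_on_multiples[of "\<lambda>t. det (flow B t)" 1 1 t])
  show "is_poly (\<lambda>t. det (flow B t))" unfolding det_def
    by (intro is_poly_sum is_poly_mult is_poly_prod is_poly_const is_poly_entry)
qed (use det_flow_nat in auto)

definition intvec :: "real^'n \<Rightarrow> bool" where "intvec x \<longleftrightarrow> (\<forall>i. x $ i \<in> \<int>)"

lemma intvec_mult: assumes "\<And>i j. A $ i $ j \<in> \<int>" "intvec x" shows "intvec (A *v x)"
  using assms by (auto simp: intvec_def matrix_vector_mult_def intro!: Ints_sum Ints_mult)

lemma intvec_flow_1: "intvec x \<Longrightarrow> intvec (flow B 1 *v x)"
  using SL by (intro intvec_mult) (auto simp: SL_int_def)

text \<open>Cramer's rule with determinant 1 expresses the inverse in integers.\<close>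

lemma intvec_flow_m1: assumes x: "intvec x" shows "intvec (flow B (-1) *v x)"
proof -
  have "flow B 1 *v (flow B (-1) *v x) = x" by (simp add: matrix_vector_mul_assoc flow_neg)
  hence "flow B (-1) *v x = (\<chi> k. det (\<chi> i j. if j = k then x $ i else flow B 1 $ i $ j) / det (flow B 1))"
    by (subst (asm) cramer) auto
  moreover have "det (\<chi> i j. if j = k then x $ i else flow B 1 $ i $ j) \<in> \<int>" for k
    using SL x by (auto simp: det_def SL_int_def intvec_def intro!: Ints_sum Ints_mult Ints_prod)
  ultimately show ?thesis by (simp add: intvec_def)
qed

lemma intvec_flow: assumes "intvec x" shows "intvec (flow B (of_int k) *v x)"
proof (induction k rule: int_induct[of _ 0])
  case base thus ?case using assms by simp
next
  case (step1 i)
  have "flow B (of_int (i + 1)) *v x = flow B 1 *v (flow B (of_int i) *v x)"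
    using flow_add[of 1 "of_int i"] by (simp add: add.commute matrix_vector_mul_assoc)
  thus ?case using step1 intvec_flow_1 by simp
next
  case (step2 i)
  have "flow B (of_int (i - 1)) *v x = flow B (-1) *v (flow B (of_int i) *v x)"
    using flow_add[of "-1" "of_int i"] by (simp add: matrix_vector_mul_assoc)
  thus ?case using step2 intvec_flow_m1 by simp
qed

text \<open>At height \<open>t\<close> the left-invariant field of \<open>w\<close> is
  \<open>flow B t *v w\<close>, so this is the rate at which the character \<open>l\<close> turns
  along that field.\<close>

definition freq :: "real^'n \<Rightarrow> real^'n \<Rightarrow> real \<Rightarrow> real" where "freq l w t = l \<bullet> (flow B t *v w)"

definition fixed :: "real^'n \<Rightarrow> bool" where "fixed l \<longleftrightarrow> (\<forall>t w. freq l w t = l \<bullet> w)"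

lemma is_poly_freq: "is_poly (freq l w)"
  unfolding freq_def[abs_def] inner_vec_def matrix_vector_mult_def
  by (auto intro!: is_poly_sum is_poly_mult is_poly_entry)

lemma freq_deriv: "(freq l w has_real_derivative freq l (B *v w) t) (at t)"
proof -
  have bl: "bounded_linear (\<lambda>M::real^'n^'n. l \<bullet> (M *v w))"
    by (simp add: linear_conv_bounded_linear[symmetric] linear_iff matrix_vector_mult_add_rdistrib inner_add_right scaleR_matrix_vector_assoc[symmetric])
  have "((\<lambda>t. l \<bullet> (flow B t *v w)) has_vector_derivative l \<bullet> ((flow B t ** B) *v w)) (at t)"
    by (rule bounded_linear.has_vector_derivative[OF bl flow_deriv])
  thus ?thesis by (simp add: freq_def[abs_def] has_real_derivative_iff_has_vector_derivative matrix_vector_mul_assoc)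
qed

lemma freq_0 [simp]: "freq l w 0 = l \<bullet> w" by (simp add: freq_def)

lemma fixed_iff: "fixed l \<longleftrightarrow> (\<forall>w. l \<bullet> (B *v w) = 0)"
proof
  assume f: "fixed l"
  show "\<forall>w. l \<bullet> (B *v w) = 0"
  proof
    fix w
    have "freq l w = (\<lambda>t. l \<bullet> w)" using f by (auto simp: fixed_def)
    hence "(freq l w has_real_derivative 0) (at 0)" by simp
    thus "l \<bullet> (B *v w) = 0" using DERIV_unique[OF freq_deriv[of l w 0]] by simp
  qed
next
  assume z: "\<forall>w. l \<bullet> (B *v w) = 0"
  have "freq l (B *v w) t = 0" for w t
    using z by (simp add: freq_def matrix_vector_mul_assoc flow_commute[symmetric]) (simp flip: matrix_vector_mul_assoc)
  hence "freq l w t = freq l w 0" for w t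
    using freq_deriv[of l w] DERIV_isconst_all[of "freq l w" t 0] by simp
  thus "fixed l" by (auto simp: fixed_def)
qed

text \<open>A single return time gives equality at all its multiples, and frequencies are
  polynomials in time.\<close>

lemma fixed_of_period:
  assumes "j \<noteq> 0" "\<And>w. freq l w j = l \<bullet> w" shows "fixed l"
proof -
  have "freq l w (j * real k) = l \<bullet> w" for w k
  proof (induction k)
    case (Suc k)
    have "freq l w (j * real (Suc k)) = freq l (flow B (j * real k) *v w) j"
      using flow_add[of j "j * real k"] by (simp add: freq_def algebra_simps matrix_vector_mul_assoc)
    also have "... = freq l w (j * real k)" by (simp only: assms(2)) (simp add: freq_def)
    finally show ?case using Suc by simp
  qed simp
  thus ?thesis using is_poly_const_on_multiples[OF is_poly_freq assms(1)] unfolding fixed_def by blast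
qed

text \<open>Differentiating a constant frequency repeatedly replaces \<open>w\<close> by
  \<open>B *v w\<close>, so \<open>l\<close> annihilates all positive powers of \<open>B\<close>
  applied to \<open>W\<close>. This property survives brackets, hence holds on the whole Lie
  algebra, and there its first instance is \<open>fixed_iff\<close>.\<close>

lemma fixed_of_bracket_generating:
  assumes bg: "bracket_generating B W" and b: "bvec \<in> W" and W: "subspace W"
    and const: "\<And>v t. v \<in> W \<Longrightarrow> snd v = 0 \<Longrightarrow> freq l (fst v) t = l \<bullet> fst v"
  shows "fixed l"
proof -
  define P where "P = {v::(real^'n) \<times> real. \<forall>j. l \<bullet> (matpow B (Suc j) *v fst v) = 0}"
  have sP: "subspace P"
    unfolding subspace_def P_def
    by (auto simp: matrix_vector_right_distrib inner_add_right matrix_vector_mult_scaleR)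
  have WP: "W \<subseteq> P"
  proof
    fix v assume v: "v \<in> W"
    \<comment> \<open>Subtracting a multiple of \<open>bvec\<close> moves \<open>v\<close> into the
      ideal without changing its first component.\<close>
    have w: "(fst v, 0) \<in> W"
      using subspace_diff[OF W v subspace_scale[OF W b, of "snd v"]] by (simp add: bvec_def minus_prod_def scaleR_prod_def)
    have c: "freq l (matpow B j *v fst v) t = l \<bullet> (matpow B j *v fst v)" for j t
    proof (induction j arbitrary: t)
      case 0 show ?case using const[OF w] by simp
    next
      case (Suc j)
      have "freq l (matpow B j *v fst v) = (\<lambda>t. l \<bullet> (matpow B j *v fst v))" using Suc by auto
      hence "(freq l (matpow B j *v fst v) has_real_derivative 0) (at t)" for t by simp
      hence "freq l (B *v (matpow B j *v fst v)) t = 0" for t using DERIV_unique[OF freq_deriv] by blast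
      from this[of t] this[of 0] show ?case by (simp add: matrix_vector_mul_assoc)
    qed
    have "l \<bullet> (matpow B (Suc j) *v fst v) = 0" for j
    proof -
      have "freq l (matpow B j *v fst v) = (\<lambda>t. l \<bullet> (matpow B j *v fst v))" using c by auto
      hence "(freq l (matpow B j *v fst v) has_real_derivative 0) (at 0)" by simp
      hence "freq l (B *v (matpow B j *v fst v)) 0 = 0" using DERIV_unique[OF freq_deriv] by blast
      thus ?thesis by (simp add: matrix_vector_mul_assoc)
    qed
    thus "v \<in> P" unfolding P_def by blast
  qed
  have br: "bracket B v w \<in> P" if "v \<in> P" "w \<in> P" for v w
  proof -
    have "l \<bullet> (matpow B (Suc j) *v (B *v fst u)) = 0" if "u \<in> P" for u j
    proof -
      have "matpow B (Suc j) *v (B *v fst u) = matpow B (Suc (Suc j)) *v fst u"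
        using matpow_commute[of "Suc j"] by (simp only: matpow.simps matrix_vector_mul_assoc)
      moreover have "l \<bullet> (matpow B (Suc (Suc j)) *v fst u) = 0" using that unfolding P_def by blast
      ultimately show ?thesis by simp
    qed
    thus ?thesis using that by (simp add: P_def bracket_def matrix_vector_mult_diff_distrib inner_diff_right matrix_vector_mult_scaleR del: matpow.simps)
  qed
  have "iterated_brackets B W k \<subseteq> P" for k
  proof (induction k)
    case (Suc k)
    have "{bracket B v w |v w. v \<in> W \<and> w \<in> iterated_brackets B W k} \<subseteq> P" using WP Suc br by blast
    thus ?case unfolding iterated_brackets.simps by (rule span_minimal[OF _ sP])
  qed (use WP in simp)
  hence "span (\<Union>k\<le>CARD('n). iterated_brackets B W k) \<subseteq> P" by (intro span_minimal[OF _ sP]) blast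
  hence "P = UNIV" using bg by (auto simp: bracket_generating_def)
  hence "(w, 0) \<in> P" for w by blast
  hence "l \<bullet> (matpow B (Suc 0) *v fst (w, 0::real)) = 0" for w unfolding P_def by blast
  hence "l \<bullet> (B *v w) = 0" for w by simp
  thus ?thesis by (simp add: fixed_iff)
qed

end

lemma has_vector_derivative_compose:
  assumes "(F has_derivative F') (at (c t))" "(c has_vector_derivative v) (at t)"
  shows "((\<lambda>t. F (c t)) has_vector_derivative F' v) (at t)"
proof -
  interpret F': bounded_linear F' using assms(1) by (rule has_derivative_bounded_linear)
  have "(F \<circ> c has_derivative F' \<circ> (\<lambda>h. h *\<^sub>R v)) (at t)"
    by (rule diff_chain_at) (use assms in \<open>auto simp: has_vector_derivative_def\<close>)
  thus ?thesis by (simp add: has_vector_derivative_def o_def F'.scaleR)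
qed

lemma has_vector_derivative_quotient:
  assumes "(f has_vector_derivative X) (at 0)"
  shows "((\<lambda>t. (1 / t) *\<^sub>R (f t - f 0)) \<longlongrightarrow> X) (at 0)"
proof -
  have "((\<lambda>t. norm (f (0 + t) - f 0 - t *\<^sub>R X) / norm t) \<longlongrightarrow> 0) (at 0)"
    using assms unfolding has_vector_derivative_def has_derivative_at by blast
  hence "((\<lambda>t. norm ((1 / t) *\<^sub>R (f t - f 0) - X)) \<longlongrightarrow> 0) (at 0)"
  proof (rule Lim_transform_eventually)
    have "norm (f (0 + t) - f 0 - t *\<^sub>R X) / norm t = norm ((1 / t) *\<^sub>R (f t - f 0) - X)" if "t \<noteq> 0" for t
    proof -
      have "(1 / t) *\<^sub>R (f t - f 0) - X = (1 / t) *\<^sub>R (f t - f 0 - t *\<^sub>R X)"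
        using that by (simp add: scaleR_diff_right)
      thus ?thesis by simp
    qed
    thus "\<forall>\<^sub>F t in at 0. norm (f (0 + t) - f 0 - t *\<^sub>R X) / norm t = norm ((1 / t) *\<^sub>R (f t - f 0) - X)"
      by (simp add: eventually_at_filter)
  qed
  thus ?thesis by (simp add: tendsto_norm_zero_iff LIM_zero_iff)
qed

section \<open>The lattice, its cosets and left-invariant fields\<close>

context nil_flow
begin

declare sdp_simps(2,3) [simp del]

abbreviation mul (infixl "\<odot>" 70) where "p \<odot> q \<equiv> p \<otimes>\<^bsub>sdp B\<^esub> q"
abbreviation "\<Gamma> \<equiv> lattice_sub :: ((real^'n) \<times> real) set"
abbreviation "cst p \<equiv> lattice_sub #>\<^bsub>sdp B\<^esub> p"

lemma lat_iff: "p \<in> \<Gamma> \<longleftrightarrow> intvec (fst p) \<and> snd p \<in> \<int>"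
  by (cases p) (auto simp: lattice_sub_def intvec_def)

lemma intvec_add: "intvec x \<Longrightarrow> intvec y \<Longrightarrow> intvec (x + y)" by (simp add: intvec_def)
lemma intvec_neg: "intvec x \<Longrightarrow> intvec (- x)" by (simp add: intvec_def)

lemma subgroup_lat: "subgroup \<Gamma> (sdp B)"
proof
  show "\<Gamma> \<subseteq> carrier (sdp B)" by simp
  show "\<one>\<^bsub>sdp B\<^esub> \<in> \<Gamma>" by (simp add: sdp_simps lat_iff intvec_def)
  show "x \<odot> y \<in> \<Gamma>" if xy: "x \<in> \<Gamma>" "y \<in> \<Gamma>" for x y
  proof -
    obtain k where "snd x = of_int k" using xy(1) by (auto simp: lat_iff elim: Ints_cases)
    thus ?thesis using xy intvec_flow[of "fst y" k] by (auto simp: sdp_simps lat_iff intvec_add)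
  qed
  show "inv\<^bsub>sdp B\<^esub> x \<in> \<Gamma>" if x: "x \<in> \<Gamma>" for x
  proof -
    obtain k where "snd x = of_int k" using x by (auto simp: lat_iff elim: Ints_cases)
    thus ?thesis using x intvec_flow[of "fst x" "-k"] by (auto simp: lat_iff intvec_neg inv_sdp)
  qed
qed

lemma mem_cst: "q \<in> cst p \<longleftrightarrow> (\<exists>\<gamma>\<in>\<Gamma>. q = \<gamma> \<odot> p)" by (auto simp: r_coset_def)

text \<open>The same choice of representative as in \<open>L2_inner\<close>.\<close>

definition rep :: "((real^'n) \<times> real) set \<Rightarrow> (real^'n) \<times> real" where "rep C = (SOME p. p \<in> C)"

lemma rep_cst: "\<exists>\<gamma>\<in>\<Gamma>. rep (cst p) = \<gamma> \<odot> p"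
proof -
  have "p \<in> cst p" using Gr.rcos_self[OF _ subgroup_lat, of p] by simp
  hence "rep (cst p) \<in> cst p" unfolding rep_def by (rule someI)
  thus ?thesis by (simp only: mem_cst)
qed

definition invariant :: "((real^'n) \<times> real \<Rightarrow> 'b) \<Rightarrow> bool" where
  "invariant F \<longleftrightarrow> (\<forall>\<gamma>\<in>\<Gamma>. \<forall>p. F (\<gamma> \<odot> p) = F p)"

lemma invariant_rep: "invariant F \<Longrightarrow> F (rep (cst p)) = F p"
  using rep_cst[of p] unfolding invariant_def by (metis (no_types))

lemma quotient_space_eq: "quotient_space B = range cst"
  by (auto simp: quotient_space_def RCOSETS_def)

lemma cst_eq_iff: "cst p = cst q \<longleftrightarrow> (\<exists>\<gamma>\<in>\<Gamma>. q = \<gamma> \<odot> p)"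
proof
  assume "cst p = cst q"
  moreover have "q \<in> cst q" using Gr.rcos_self[OF _ subgroup_lat, of q] by simp
  ultimately have "q \<in> cst p" by simp
  thus "\<exists>\<gamma>\<in>\<Gamma>. q = \<gamma> \<odot> p" by (simp only: mem_cst)
next
  assume "\<exists>\<gamma>\<in>\<Gamma>. q = \<gamma> \<odot> p"
  hence "q \<in> cst p" by (simp only: mem_cst)
  thus "cst p = cst q" using Gr.repr_independence[OF _ _ subgroup_lat] by simp
qed

lemma continuous_flow_mult: "continuous_on S f \<Longrightarrow> continuous_on S g \<Longrightarrow> continuous_on S (\<lambda>x. flow B (f x) *v g x)"
proof -
  assume a: "continuous_on S f" "continuous_on S g"
  have "continuous_on UNIV (flow B)" by (rule smooth_continuous[OF smooth_flow])
  hence "continuous_on S (\<lambda>x. flow B (f x))" using continuous_on_compose2[OF _ a(1)] by blast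
  thus ?thesis unfolding matrix_vector_mult_def
    by (intro continuous_on_vec_lambda continuous_intros continuous_on_component a)
qed

lemma continuous_left: "continuous_on UNIV (\<lambda>p. q \<odot> p)"
  by (simp add: sdp_simps continuous_intros continuous_flow_mult)
lemma continuous_right: "continuous_on UNIV (\<lambda>p. p \<odot> q)"
  by (simp add: sdp_simps continuous_intros continuous_flow_mult)

text \<open>Two points of the ball are less than 1 apart. This forces the integral height of
  \<open>\<gamma>\<close> to be 0, after which \<open>\<gamma>\<close> is a translation by an
  integral vector of norm below 1. Hence \<open>cst\<close> is injective on balls of this
  radius.\<close>

lemma ball_injective:
  assumes "p \<in> ball c (1/2)" "\<gamma> \<odot> p \<in> ball c (1/2)" "\<gamma> \<in> \<Gamma>" shows "\<gamma> \<odot> p = p"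
proof -
  have d: "dist (\<gamma> \<odot> p) p < 1"
    using dist_triangle_less_add[of "\<gamma> \<odot> p" c "1/2" p "1/2"] assms by (simp add: dist_commute)
  obtain k where k: "snd \<gamma> = of_int k" using assms(3) by (auto simp: lat_iff elim: Ints_cases)
  have "\<bar>snd \<gamma>\<bar> < 1" using d dist_snd_le[of "\<gamma> \<odot> p" p] by (simp add: sdp_simps dist_real_def)
  hence k0: "snd \<gamma> = 0" using k by simp
  have "norm (fst \<gamma>) < 1" using d dist_fst_le[of "\<gamma> \<odot> p" p] k0 by (simp add: sdp_simps dist_norm)
  hence "\<bar>fst \<gamma> $ i\<bar> < 1" for i using component_le_norm_cart[of "fst \<gamma>" i] by simp
  moreover have "fst \<gamma> $ i \<in> \<int>" for i using assms(3) by (simp add: lat_iff intvec_def)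
  ultimately have "fst \<gamma> $ i = 0" for i by (metis Ints_nonzero_abs_less1)
  hence "fst \<gamma> = 0" by (simp add: vec_eq_iff)
  thus ?thesis using k0 by (simp add: sdp_simps prod_eq_iff)
qed

lemma dleft_eq: "dleft B p q v = (flow B (snd p) *v fst v, snd v)"
proof -
  have bl: "bounded_linear (\<lambda>v. (flow B (snd p) *v fst v, snd v))"
    by (intro bounded_linear_Pair bounded_linear_compose[OF matrix_vector_mul_bounded_linear] bounded_linear_fst bounded_linear_snd)
  have "(\<lambda>r. p \<odot> r) = (\<lambda>r. p + (flow B (snd p) *v fst r, snd r))" by (auto simp: sdp_simps prod_eq_iff)
  hence "((\<lambda>r. p \<odot> r) has_derivative (\<lambda>v. (flow B (snd p) *v fst v, snd v))) (at q)"
    using has_derivative_add[OF has_derivative_const bounded_linear.has_derivative[OF bl has_derivative_ident], of p]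
    by simp
  from frechet_derivative_at[OF this] show ?thesis unfolding dleft_def by (rule fun_cong[OF sym])
qed

lemma left_field_formula: "left_field B v p = (flow B (snd p) *v fst v, snd v)"
  unfolding left_field_def by (rule dleft_eq)

end

type_synonym 'n pt = "(real^('n::finite)) \<times> real"

section \<open>Integration over the quotient\<close>

locale quot = nil_flow B for B :: "real^'n^'n" +
  fixes \<mu> :: "'n pt set measure"
  assumes mu: "normalised_invariant_measure B \<mu>"
begin

lemma sets_mu: "sets \<mu> = sets (quotient_borel B)" using mu by (simp add: normalised_invariant_measure_def)

lemma gen_sub: "{U. U \<subseteq> quotient_space B \<and> open {p. cst p \<in> U}} \<subseteq> Pow (quotient_space B)" by blast

lemma space_mu: "space \<mu> = range cst"
  using sets_eq_imp_space_eq[OF sets_mu] unfolding quotient_borel_def space_measure_of[OF gen_sub]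
  by (simp add: quotient_space_eq)

lemma sets_mu_sigma: "sets \<mu> = sigma_sets (range cst) {U. U \<subseteq> range cst \<and> open {p. cst p \<in> U}}"
  unfolding sets_mu quotient_borel_def sets_measure_of[OF gen_sub] by (simp add: quotient_space_eq)

lemma emeasure_one: "emeasure \<mu> (space \<mu>) = 1" using mu by (simp add: normalised_invariant_measure_def)

sublocale finite_measure \<mu>
  by (rule finite_measureI) (simp add: emeasure_one)

lemma rep_in: "C \<in> space \<mu> \<Longrightarrow> cst (rep C) = C"
proof -
  assume "C \<in> space \<mu>"
  then obtain p where p: "C = cst p" by (auto simp: space_mu)
  obtain \<gamma> where "\<gamma> \<in> \<Gamma>" "rep (cst p) = \<gamma> \<odot> p" using rep_cst by blast
  hence "cst p = cst (rep (cst p))" unfolding cst_eq_iff by blast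
  thus ?thesis using p by simp
qed

lemma image_open: assumes "open T" shows "cst ` T \<in> sets \<mu>"
proof -
  have "{p. cst p \<in> cst ` T} = (\<Union>\<gamma>\<in>\<Gamma>. {p. \<gamma> \<odot> p \<in> T})"
  proof safe
    fix p q assume "cst p = cst q" "q \<in> T"
    thus "p \<in> (\<Union>\<gamma>\<in>\<Gamma>. {p. \<gamma> \<odot> p \<in> T})" unfolding cst_eq_iff by blast
  next
    fix \<gamma> p assume "\<gamma> \<in> \<Gamma>" "\<gamma> \<odot> p \<in> T"
    moreover from this(1) have "cst p = cst (\<gamma> \<odot> p)" unfolding cst_eq_iff by blast
    ultimately show "cst p \<in> cst ` T" by blast
  qed
  moreover have "open {p. \<gamma> \<odot> p \<in> T}" for \<gamma>
    using open_vimage[OF assms continuous_left[of \<gamma>]] by (simp add: vimage_def)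
  ultimately have "open {p. cst p \<in> cst ` T}" by (simp add: open_UN)
  thus ?thesis unfolding sets_mu_sigma by (intro sigma_sets.Basic) blast
qed

text \<open>Images do not commute with complements in general; on a ball of radius 1/2 they do,
  since \<open>cst\<close> is injective there, and induction over the generated sigma-algebra goes
  through.\<close>

lemma image_ball: assumes "T \<in> sets borel" shows "cst ` (T \<inter> ball c (1/2)) \<in> sets \<mu>"
proof -
  have "T \<in> sigma_sets UNIV {S. open S}" using assms by (simp add: borel_def)
  thus ?thesis
  proof induction
    case (Basic a) thus ?case by (intro image_open) auto
  next
    case Empty thus ?case by simp
  next
    case (Compl a)
    have "cst ` ((UNIV - a) \<inter> ball c (1/2)) = cst ` ball c (1/2) - cst ` (a \<inter> ball c (1/2))"
    proof (intro equalityI subsetI)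
      fix C assume "C \<in> cst ` ((UNIV - a) \<inter> ball c (1/2))"
      then obtain p where p: "C = cst p" "p \<notin> a" "p \<in> ball c (1/2)" by blast
      have "C \<notin> cst ` (a \<inter> ball c (1/2))"
      proof
        assume "C \<in> cst ` (a \<inter> ball c (1/2))"
        then obtain q where q: "cst p = cst q" "q \<in> a" "q \<in> ball c (1/2)" using p(1) by blast
        then obtain \<gamma> where "\<gamma> \<in> \<Gamma>" "q = \<gamma> \<odot> p" unfolding cst_eq_iff by blast
        thus False using ball_injective[OF p(3), of \<gamma>] q p by simp
      qed
      thus "C \<in> cst ` ball c (1/2) - cst ` (a \<inter> ball c (1/2))" using p by blast
    qed blast
    thus ?case using Compl image_open[OF open_ball] by simp
  next
    case (Union a)
    have "cst ` (\<Union> (range a) \<inter> ball c (1/2)) = (\<Union>i::nat. cst ` (a i \<inter> ball c (1/2)))" by blast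
    thus ?case using Union by simp
  qed
qed

text \<open>Countably many balls of radius 1/2 cover the group.\<close>

lemma image_borel: assumes "T \<in> sets borel" shows "cst ` T \<in> sets \<mu>"
proof -
  obtain D :: "'n pt set" where D: "countable D" "\<And>X. open X \<Longrightarrow> X \<noteq> {} \<Longrightarrow> \<exists>d\<in>D. d \<in> X"
    using countable_dense_exists[where ?'a="'n pt"] by blast
  have "T = (\<Union>c\<in>D. T \<inter> ball c (1/2))"
  proof safe
    fix a b assume "(a, b) \<in> T"
    obtain c where "c \<in> D" "c \<in> ball (a, b) (1/2)" using D(2)[of "ball (a, b) (1/2)"] by auto
    thus "(a, b) \<in> (\<Union>c\<in>D. T \<inter> ball c (1/2))" using \<open>(a, b) \<in> T\<close> by (auto simp: dist_commute)
  qed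
  hence "cst ` T = (\<Union>c\<in>D. cst ` (T \<inter> ball c (1/2)))" by blast
  moreover have "(\<Union>c\<in>D. cst ` (T \<inter> ball c (1/2))) \<in> sets \<mu>"
    using D(1) image_ball[OF assms] by (intro sets.countable_UN') auto
  ultimately show ?thesis by simp
qed

lemma measurable_rep:
  fixes F :: "'n pt \<Rightarrow> 'b::topological_space"
  assumes F: "invariant F" "F \<in> borel_measurable borel"
  shows "(\<lambda>C. F (rep C)) \<in> borel_measurable \<mu>"
proof (rule measurableI)
  fix A assume A: "A \<in> sets (borel :: 'b measure)"
  have "(\<lambda>C. F (rep C)) -` A \<inter> space \<mu> = cst ` (F -` A)"
  proof (intro equalityI subsetI)
    fix C assume "C \<in> (\<lambda>C. F (rep C)) -` A \<inter> space \<mu>"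
    thus "C \<in> cst ` (F -` A)" using rep_in[of C] by (intro image_eqI[of _ _ "rep C"]) auto
  next
    fix C assume "C \<in> cst ` (F -` A)"
    thus "C \<in> (\<lambda>C. F (rep C)) -` A \<inter> space \<mu>" using invariant_rep[OF F(1)] by (auto simp: space_mu)
  qed
  moreover have "F -` A \<in> sets borel" using measurable_sets[OF F(2) A] by simp
  ultimately show "(\<lambda>C. F (rep C)) -` A \<inter> space \<mu> \<in> sets \<mu>" using image_borel by simp
qed simp

lemma right_measurable: "(\<lambda>C. C #>\<^bsub>sdp B\<^esub> q) \<in> measurable \<mu> \<mu>"
proof -
  have cc: "cst p #>\<^bsub>sdp B\<^esub> q = cst (p \<odot> q)" for p
    using Gr.coset_mult_assoc[of \<Gamma> p q] by simp
  have "(\<lambda>C. C #>\<^bsub>sdp B\<^esub> q) \<in> measurable \<mu> (sigma (range cst) {U. U \<subseteq> range cst \<and> open {p. cst p \<in> U}})"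
  proof (rule measurable_measure_of)
    show "{U. U \<subseteq> range cst \<and> open {p. cst p \<in> U}} \<subseteq> Pow (range cst)" by blast
    show "(\<lambda>C. C #>\<^bsub>sdp B\<^esub> q) \<in> space \<mu> \<rightarrow> range cst" using cc by (auto simp: space_mu)
    fix U assume U: "U \<in> {U. U \<subseteq> range cst \<and> open {p. cst p \<in> U}}"
    have "(\<lambda>C. C #>\<^bsub>sdp B\<^esub> q) -` U \<inter> space \<mu> = cst ` {p. cst (p \<odot> q) \<in> U}"
      by (auto simp: space_mu cc)
    moreover have "open {p. cst (p \<odot> q) \<in> U}"
      using open_vimage[OF _ continuous_right[of q], of "{p. cst p \<in> U}"] U by (simp add: vimage_def)
    ultimately show "(\<lambda>C. C #>\<^bsub>sdp B\<^esub> q) -` U \<inter> space \<mu> \<in> sets \<mu>" using image_open by simp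
  qed
  moreover have "sets (sigma (range cst) {U. U \<subseteq> range cst \<and> open {p. cst p \<in> U}}) = sets \<mu>"
    unfolding sets_mu_sigma by (rule sets_measure_of) blast
  ultimately show ?thesis using measurable_cong_sets by blast
qed

text \<open>Invariance of the measure is given for images of sets, the push-forward uses preimages;
  the two are exchanged by passing to the inverse translation.\<close>

lemma distr_right: "distr \<mu> \<mu> (\<lambda>C. C #>\<^bsub>sdp B\<^esub> q) = \<mu>"
proof (rule measure_eqI)
  fix A assume A0: "A \<in> sets (distr \<mu> \<mu> (\<lambda>C. C #>\<^bsub>sdp B\<^esub> q))"
  hence A: "A \<in> sets \<mu>" by simp
  have cc: "cst p #>\<^bsub>sdp B\<^esub> q = cst (p \<odot> q)" for p q
    using Gr.coset_mult_assoc[of \<Gamma> p q] by simp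
  let ?q = "inv\<^bsub>sdp B\<^esub> q"
  have A': "A \<subseteq> range cst" using sets.sets_into_space[OF A] by (simp add: space_mu)
  have c1: "cst p #>\<^bsub>sdp B\<^esub> q #>\<^bsub>sdp B\<^esub> ?q = cst p" "cst p #>\<^bsub>sdp B\<^esub> ?q #>\<^bsub>sdp B\<^esub> q = cst p" for p
    unfolding cc by (simp_all add: Gr.m_assoc Gr.r_inv Gr.l_inv)
  have "(\<lambda>C. C #>\<^bsub>sdp B\<^esub> q) -` A \<inter> space \<mu> = (\<lambda>C. C #>\<^bsub>sdp B\<^esub> ?q) ` A"
  proof (intro equalityI subsetI)
    fix C assume "C \<in> (\<lambda>C. C #>\<^bsub>sdp B\<^esub> q) -` A \<inter> space \<mu>"
    then obtain p where "C = cst p" "C #>\<^bsub>sdp B\<^esub> q \<in> A" by (auto simp: space_mu)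
    thus "C \<in> (\<lambda>C. C #>\<^bsub>sdp B\<^esub> ?q) ` A" using c1(1)[of p] by (metis image_eqI)
  next
    fix C assume "C \<in> (\<lambda>C. C #>\<^bsub>sdp B\<^esub> ?q) ` A"
    then obtain p where p: "C = cst p #>\<^bsub>sdp B\<^esub> ?q" "cst p \<in> A" using A' by blast
    hence "C #>\<^bsub>sdp B\<^esub> q = cst p" using c1(2) by simp
    moreover have "C \<in> space \<mu>" unfolding p space_mu cc by blast
    ultimately show "C \<in> (\<lambda>C. C #>\<^bsub>sdp B\<^esub> q) -` A \<inter> space \<mu>" using p by simp
  qed
  thus "emeasure (distr \<mu> \<mu> (\<lambda>C. C #>\<^bsub>sdp B\<^esub> q)) A = emeasure \<mu> A"
    using mu A unfolding emeasure_distr[OF right_measurable A] normalised_invariant_measure_def by metis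
qed simp

abbreviation "Xd v \<equiv> dir_deriv (left_field B v)"

definition integ :: "('n pt \<Rightarrow> 'b::{banach, second_countable_topology}) \<Rightarrow> 'b" where
  "integ F = (LINT C|\<mu>. F (rep C))"

lemma invariant_right: "invariant F \<Longrightarrow> invariant (\<lambda>p. F (p \<odot> q))"
  unfolding invariant_def
proof (intro ballI allI)
  fix \<gamma> p assume a: "\<forall>\<gamma>\<in>\<Gamma>. \<forall>p. F (\<gamma> \<odot> p) = F p" "\<gamma> \<in> \<Gamma>"
  have "\<gamma> \<odot> p \<odot> q = \<gamma> \<odot> (p \<odot> q)" by (rule Gr.m_assoc) auto
  with a show "F (\<gamma> \<odot> p \<odot> q) = F (p \<odot> q)" by metis
qed

lemma integ_right:
  assumes F: "invariant F" "F \<in> borel_measurable borel"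
  shows "integ (\<lambda>p. F (p \<odot> q)) = integ F"
proof -
  have "integ F = (LINT C|distr \<mu> \<mu> (\<lambda>C. C #>\<^bsub>sdp B\<^esub> q). F (rep C))" by (simp add: integ_def distr_right)
  also have "... = (LINT C|\<mu>. F (rep (C #>\<^bsub>sdp B\<^esub> q)))"
    by (rule integral_distr[OF right_measurable measurable_rep[OF F]])
  also have "... = (LINT C|\<mu>. F (rep C \<odot> q))"
  proof (rule Bochner_Integration.integral_cong[OF refl])
    fix C assume C: "C \<in> space \<mu>"
    have "C #>\<^bsub>sdp B\<^esub> q = cst (rep C) #>\<^bsub>sdp B\<^esub> q" using rep_in[OF C] by simp
    also have "... = cst (rep C \<odot> q)" using Gr.coset_mult_assoc[of \<Gamma> "rep C" q] by simp
    finally show "F (rep (C #>\<^bsub>sdp B\<^esub> q)) = F (rep C \<odot> q)" using invariant_rep[OF F(1)] by simp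
  qed
  finally show ?thesis by (simp add: integ_def)
qed

text \<open>The unit cube is compact and meets every orbit of the lattice.\<close>

lemma invariant_bounded:
  fixes F :: "'n pt \<Rightarrow> 'b::real_normed_vector"
  assumes F: "invariant F" "continuous_on UNIV F"
  obtains b where "\<And>p. norm (F p) \<le> b"
proof -
  define K :: "'n pt set" where "K = cbox 0 (\<chi> i. 1) \<times> cbox 0 1"
  have "compact K" by (simp add: K_def compact_Times)
  hence "compact (F ` K)" using F(2) by (meson compact_continuous_image continuous_on_subset subset_UNIV)
  then obtain b where b: "\<And>p. p \<in> K \<Longrightarrow> norm (F p) \<le> b" by (meson bounded_iff compact_imp_bounded imageI)
  have "norm (F p) \<le> b" for p
  proof -
    \<comment> \<open>The height is adjusted first, because this also moves the first component by
      the flow; the second correction then leaves the height alone.\<close>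
    define \<gamma>1 :: "'n pt" where "\<gamma>1 = (0, of_int (- \<lfloor>snd p\<rfloor>))"
    define q where "q = \<gamma>1 \<odot> p"
    define \<gamma>2 :: "'n pt" where "\<gamma>2 = (\<chi> i. of_int (- \<lfloor>fst q $ i\<rfloor>), 0)"
    have g: "\<gamma>1 \<in> \<Gamma>" "\<gamma>2 \<in> \<Gamma>" by (auto simp: lat_iff intvec_def \<gamma>1_def \<gamma>2_def)
    have "snd q = snd p - of_int \<lfloor>snd p\<rfloor>" by (simp add: sdp_simps q_def \<gamma>1_def)
    hence "\<gamma>2 \<odot> q \<in> K"
      by (auto simp: sdp_simps K_def \<gamma>2_def mem_box_cart) linarith+
    hence "norm (F (\<gamma>2 \<odot> q)) \<le> b" by (rule b)
    thus ?thesis using F(1) g unfolding q_def invariant_def by simp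
  qed
  thus thesis using that by blast
qed

lemma integrable_invariant:
  fixes F :: "'n pt \<Rightarrow> 'b::{banach, second_countable_topology}"
  assumes F: "invariant F" "continuous_on UNIV F"
  shows "integrable \<mu> (\<lambda>C. F (rep C))"
proof -
  obtain b where "\<And>p. norm (F p) \<le> b" using invariant_bounded[OF F] by blast
  moreover have "(\<lambda>C. F (rep C)) \<in> borel_measurable \<mu>"
    by (rule measurable_rep[OF F(1) borel_measurable_continuous_onI[OF F(2)]])
  ultimately show ?thesis by (intro integrable_const_bound[of _ b]) auto
qed

text \<open>\<open>opath v\<close> is the one-parameter group of \<open>v\<close>, for \<open>v\<close> in the ideal or a multiple of \<open>b\<close>.\<close>

definition opath :: "'n pt \<Rightarrow> real \<Rightarrow> 'n pt" where "opath v t = (t *\<^sub>R fst v, t * snd v)"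

lemma opath_deriv:
  assumes "fst v = 0 \<or> snd v = 0"
  shows "((\<lambda>t. p \<odot> opath v t) has_vector_derivative left_field B v (p \<odot> opath v t)) (at t)"
proof -
  have "((\<lambda>t. p + t *\<^sub>R (flow B (snd p) *v fst v, snd v)) has_vector_derivative (flow B (snd p) *v fst v, snd v)) (at t)"
    by (auto intro!: derivative_eq_intros simp: has_vector_derivative_def)
  moreover have "(\<lambda>t. p + t *\<^sub>R (flow B (snd p) *v fst v, snd v)) = (\<lambda>t. p \<odot> opath v t)"
    by (auto simp: sdp_simps opath_def prod_eq_iff matrix_vector_mult_scaleR)
  moreover have "left_field B v (p \<odot> opath v t) = (flow B (snd p) *v fst v, snd v)"
    using assms by (auto simp: sdp_simps left_field_formula opath_def)
  ultimately show ?thesis by simp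
qed

lemma opath_0 [simp]: "p \<odot> opath v 0 = p" by (simp add: sdp_simps opath_def)

lemma deriv_along_path:
  assumes "fst v = 0 \<or> snd v = 0" "\<And>p. F differentiable (at p)"
  shows "((\<lambda>t. F (p \<odot> opath v t)) has_vector_derivative Xd v F (p \<odot> opath v t)) (at t)"
  unfolding dir_deriv_def
  by (rule has_vector_derivative_compose[OF _ opath_deriv[OF assms(1)]])
    (rule frechet_derivative_works[THEN iffD1, OF assms(2)])

text \<open>The paths run by right multiplication, which commutes with the left action of the
  lattice.\<close>

lemma invariant_dir_deriv:
  assumes "fst v = 0 \<or> snd v = 0" "\<And>p. F differentiable (at p)" "invariant F"
  shows "invariant (Xd v F)"
  unfolding invariant_def
proof safe
  fix \<gamma> a b assume g: "\<gamma> \<in> \<Gamma>"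
  have "((\<lambda>t. F (\<gamma> \<odot> (a, b) \<odot> opath v t)) has_vector_derivative Xd v F (\<gamma> \<odot> (a, b))) (at 0)"
    using deriv_along_path[OF assms(1,2), of "\<gamma> \<odot> (a, b)" 0] by simp
  moreover have "F (\<gamma> \<odot> (a, b) \<odot> x) = F ((a, b) \<odot> x)" for x
    using invariant_right[OF assms(3), of x] g unfolding invariant_def by blast
  ultimately have "((\<lambda>t. F ((a, b) \<odot> opath v t)) has_vector_derivative Xd v F (\<gamma> \<odot> (a, b))) (at 0)"
    by simp
  moreover have "((\<lambda>t. F ((a, b) \<odot> opath v t)) has_vector_derivative Xd v F (a, b)) (at 0)"
    using deriv_along_path[OF assms(1,2), of "(a, b)" 0] by simp
  ultimately show "Xd v F (\<gamma> \<odot> (a, b)) = Xd v F (a, b)"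
    using vector_derivative_unique_at by blast
qed

text \<open>The derivative is a limit of difference quotients along right translations. Their
  integrals vanish by right invariance, and they are bounded by the supremum of the derivative, so
  dominated convergence applies.\<close>

lemma integ_dir_deriv:
  fixes F :: "'n pt \<Rightarrow> 'b::{banach, second_countable_topology}"
  assumes v: "fst v = 0 \<or> snd v = 0" and F: "\<And>p. F differentiable (at p)" "invariant F"
    and X: "continuous_on UNIV (Xd v F)"
  shows "integ (Xd v F) = 0"
proof -
  let ?X = "Xd v F"
  obtain b where b: "\<And>p. norm (?X p) \<le> b"
    using invariant_bounded[OF invariant_dir_deriv[OF v F] X] by blast
  have cF: "continuous_on UNIV F" using F(1) by (simp add: continuous_at_imp_continuous_on differentiable_imp_continuous_within)
  define g where "g n p = real (Suc n) *\<^sub>R (F (p \<odot> opath v (1 / real (Suc n))) - F p)" for n p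
  have mv: "norm (F (p \<odot> opath v t) - F p) \<le> b * \<bar>t\<bar>" for p t
  proof -
    have "norm ((\<lambda>t. F (p \<odot> opath v t)) t - (\<lambda>t. F (p \<odot> opath v t)) 0) \<le> b * norm (t - 0)"
    proof (rule differentiable_bound[of UNIV _ "\<lambda>t h. h *\<^sub>R ?X (p \<odot> opath v t)"])
      show "((\<lambda>t. F (p \<odot> opath v t)) has_derivative (\<lambda>h. h *\<^sub>R ?X (p \<odot> opath v x))) (at x)" for x
        using deriv_along_path[OF v F(1)] by (simp add: has_vector_derivative_def)
      show "onorm (\<lambda>h. h *\<^sub>R ?X (p \<odot> opath v x)) \<le> b" for x
        by (rule onorm_le) (use b[of "p \<odot> opath v x"] in \<open>simp add: mult.commute[of b] mult_left_mono\<close>)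
    qed auto
    thus ?thesis by simp
  qed
  have gb: "norm (g n p) \<le> b" for n p
    using mult_left_mono[OF mv[of p "1 / real (Suc n)"], of "real (Suc n)"] by (simp add: g_def)
  have gl: "(\<lambda>n. g n p) \<longlonglongrightarrow> ?X p" for p
  proof -
    have "((\<lambda>t. F (p \<odot> opath v t)) has_vector_derivative ?X p) (at 0)"
      using deriv_along_path[OF v F(1), of p 0] by simp
    from has_vector_derivative_quotient[OF this]
    have "((\<lambda>t. (1 / t) *\<^sub>R (F (p \<odot> opath v t) - F p)) \<longlongrightarrow> ?X p) (at 0)" by simp
    moreover have "filterlim (\<lambda>n. 1 / real (Suc n)) (at 0) sequentially"
      using LIMSEQ_Suc[OF lim_1_over_n] by (simp add: filterlim_at)
    ultimately have "(\<lambda>n. (1 / (1 / real (Suc n))) *\<^sub>R (F (p \<odot> opath v (1 / real (Suc n))) - F p)) \<longlonglongrightarrow> ?X p"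
      by (rule filterlim_compose)
    thus ?thesis by (simp add: g_def)
  qed
  have g0: "integ (g n) = 0" for n
  proof -
    have i: "invariant (\<lambda>p. F (p \<odot> opath v (1 / real (Suc n))))" by (rule invariant_right[OF F(2)])
    have c: "continuous_on UNIV (\<lambda>p. F (p \<odot> opath v (1 / real (Suc n))))"
      using continuous_on_compose2[OF cF continuous_right] by blast
    have "integ (g n) = real (Suc n) *\<^sub>R (integ (\<lambda>p. F (p \<odot> opath v (1 / real (Suc n)))) - integ F)"
      unfolding integ_def g_def
      using integrable_invariant[OF i c] integrable_invariant[OF F(2) cF] by simp
    thus ?thesis using integ_right[OF F(2) borel_measurable_continuous_onI[OF cF]] by simp
  qed
  have "(\<lambda>n. LINT C|\<mu>. g n (rep C)) \<longlonglongrightarrow> (LINT C|\<mu>. ?X (rep C))"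
  proof (rule integral_dominated_convergence[of _ _ _ "\<lambda>C. b"])
    have ix: "invariant ?X" by (rule invariant_dir_deriv[OF v F])
    show "(\<lambda>C. ?X (rep C)) \<in> borel_measurable \<mu>" by (rule measurable_rep[OF ix borel_measurable_continuous_onI[OF X]])
    show "(\<lambda>C. g n (rep C)) \<in> borel_measurable \<mu>" for n
    proof (rule measurable_rep)
      show "invariant (g n)" using F(2) invariant_right[OF F(2)] unfolding g_def invariant_def by simp
      have "continuous_on UNIV (g n)" unfolding g_def
        by (intro continuous_intros continuous_on_compose2[OF cF continuous_right] cF subset_UNIV)
      thus "g n \<in> borel_measurable borel" by (rule borel_measurable_continuous_onI)
    qed
  qed (use gl gb in auto)
  thus ?thesis using g0 by (simp add: integ_def LIMSEQ_const_iff)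
qed

end

section \<open>Hermitian inner products on the spinor module\<close>

lemma scaleR_eq_smult: "a *\<^sub>R x = complex_of_real a *s (x :: complex^'m)"
  by (simp add: vec_eq_iff complex_eq_iff)

lemma smult_bounded_bilinear: "bounded_bilinear (\<lambda>(a::complex) (x::complex^'m). a *s x)"
proof -
  have "norm (a *s x) \<le> norm a * norm x * 1" for a and x :: "complex^'m"
    by (simp add: norm_vec_def norm_mult L2_set_right_distrib)
  thus ?thesis
    by (intro bounded_bilinear.intro) (auto simp: vec_eq_iff algebra_simps intro: exI[of _ 1])
qed

lemma smult_norm: "norm (a *s x) = cmod a * norm (x :: complex^'m)"
  by (simp add: norm_vec_def norm_mult L2_set_right_distrib)

locale herm =
  fixes h :: "complex^'m \<Rightarrow> complex^'m \<Rightarrow> complex"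
  assumes herm: "hermitian_inner_product h"
begin

lemma h_lin: "h (a *s x + y) z = a * h x z + h y z"
  and h_cnj: "h y x = cnj (h x y)"
  and h_pos: "x \<noteq> 0 \<Longrightarrow> 0 < Re (h x x)"
  using herm unfolding hermitian_inner_product_def by blast+

lemma h_add: "h (x + y) z = h x z + h y z" using h_lin[of 1 x y z] by simp
lemma h_zero [simp]: "h 0 z = 0" using h_add[of 0 0 z] by simp
lemma h_scale: "h (a *s x) z = a * h x z" using h_lin[of a x 0 z] by simp
lemma h_add_right: "h z (x + y) = h z x + h z y"
  by (simp only: h_cnj[of z "x + y"] h_cnj[of z x] h_cnj[of z y] h_add complex_cnj_add)
lemma h_scale_right: "h z (a *s x) = cnj a * h z x"
  by (simp only: h_cnj[of z "a *s x"] h_cnj[of z x] h_scale complex_cnj_mult)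
lemma h_zero_right [simp]: "h z 0 = 0" using h_cnj[of z 0] by simp
lemma h_minus: "h (- x) z = - h x z" using h_add[of x "-x" z] by (simp add: add_eq_0_iff2)
lemma h_minus_right: "h z (- x) = - h z x" using h_add_right[of z x "-x"] by (simp add: add_eq_0_iff2)
lemma h_diff: "h (x - y) z = h x z - h y z" using h_add[of x "-y" z] by (simp add: h_minus)
lemma h_diff_right: "h z (x - y) = h z x - h z y" using h_add_right[of z x "-y"] by (simp add: h_minus_right)
lemma h_scaleR: "h (a *\<^sub>R x) z = a *\<^sub>R h x z"
  by (simp only: scaleR_eq_smult[of a x] h_scale scaleR_conv_of_real[of a "h x z"])
lemma h_scaleR_right: "h z (a *\<^sub>R x) = a *\<^sub>R h z x"
  by (simp only: scaleR_eq_smult[of a x] h_scale_right scaleR_conv_of_real[of a "h z x"] complex_cnj_complex_of_real)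
lemma h_sum: "h (\<Sum>i\<in>I. f i) z = (\<Sum>i\<in>I. h (f i) z)"
  by (induction I rule: infinite_finite_induct) (auto simp: h_add)
lemma h_sum_right: "h z (\<Sum>i\<in>I. f i) = (\<Sum>i\<in>I. h z (f i))"
  by (induction I rule: infinite_finite_induct) (auto simp: h_add_right)

lemmas h_simps = h_add h_add_right h_scale h_scale_right h_minus h_minus_right h_diff h_diff_right h_scaleR h_scaleR_right

definition n2 :: "complex^'m \<Rightarrow> real" where "n2 x = Re (h x x)"

lemma n2_nonneg [simp]: "0 \<le> n2 x" using h_pos[of x] by (cases "x = 0") (auto simp: n2_def)
lemma n2_eq_0 [simp]: "n2 x = 0 \<longleftrightarrow> x = 0"
  using h_pos[of x] by (cases "x = 0") (simp_all add: n2_def)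
lemma h_self: "h x x = of_real (n2 x)"
proof -
  have "Im (h x x) = 0" using h_cnj[of x x] by (metis Reals_cnj_iff complex_is_Real_iff)
  thus ?thesis by (simp add: n2_def complex_eq_iff)
qed

lemma n2_add: "n2 (x + y) = n2 x + n2 y + 2 * Re (h x y)"
  using h_cnj[of x y] by (simp add: n2_def h_simps)
lemma n2_diff: "n2 (x - y) = n2 x + n2 y - 2 * Re (h x y)"
  using h_cnj[of x y] by (simp add: n2_def h_simps)
lemma n2_scale: "n2 (a *s x) = (cmod a)\<^sup>2 * n2 x"
proof -
  have "h (a *s x) (a *s x) = (a * cnj a) * h x x" by (simp only: h_scale h_scale_right mult.assoc mult.left_commute)
  also have "... = of_real ((cmod a)\<^sup>2 * n2 x)" by (simp only: h_self complex_norm_square[symmetric] of_real_mult)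
  finally show ?thesis by (simp only: n2_def Re_complex_of_real)
qed
lemma n2_scaleR: "n2 (a *\<^sub>R x) = a\<^sup>2 * n2 x" by (simp add: scaleR_eq_smult n2_scale)
lemma n2_minus [simp]: "n2 (- x) = n2 x" by (simp add: n2_def h_simps)

lemma n2_add_le: "n2 (x + y) \<le> 2 * n2 x + 2 * n2 y"
  using n2_nonneg[of "x - y"] by (simp add: n2_add n2_diff)

text \<open>Positivity of \<open>n2 (x - a *s y)\<close> for the unit scalar \<open>a\<close> that
  makes the mixed term equal to the modulus.\<close>

lemma h_amgm: "2 * cmod (h x y) \<le> n2 x + n2 y"
proof (cases "h x y = 0")
  case False
  define a where "a = h x y / of_real (cmod (h x y))"
  have a: "cmod a = 1" using False by (simp add: a_def norm_divide)
  have "cnj a * h x y = of_real (cmod (h x y))"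
    using False by (simp add: a_def complex_norm_square[symmetric] power2_eq_square mult.commute)
  hence "Re (h x (a *s y)) = cmod (h x y)" by (simp add: h_scale_right)
  thus ?thesis using n2_nonneg[of "x - a *s y"] a by (simp add: n2_diff n2_scale)
qed (simp add: add_nonneg_nonneg)

lemma axis_expand: "x = (\<Sum>i\<in>UNIV. x $ i *s axis i 1)" for x :: "complex^'m"
  by (simp add: vec_eq_iff axis_def if_distrib cong: if_cong)

lemma h_expand: "h x y = (\<Sum>i\<in>UNIV. \<Sum>j\<in>UNIV. x $ i * cnj (y $ j) * h (axis i 1) (axis j 1))"
proof -
  have "h x y = h (\<Sum>i\<in>UNIV. x $ i *s axis i 1) (\<Sum>j\<in>UNIV. y $ j *s axis j 1)"
    by (metis axis_expand)
  also have "... = (\<Sum>i\<in>UNIV. \<Sum>j\<in>UNIV. x $ i * cnj (y $ j) * h (axis i 1) (axis j 1))"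
    by (simp only: h_sum) (simp add: h_sum_right h_scale h_scale_right sum_distrib_left algebra_simps)
  finally show ?thesis .
qed

lemma h_bounded: "\<exists>K. \<forall>x y. cmod (h x y) \<le> norm x * norm y * K"
proof (intro exI allI)
  fix x y
  have "cmod (h x y) \<le> (\<Sum>i\<in>UNIV. \<Sum>j\<in>UNIV. cmod (x $ i * cnj (y $ j) * h (axis i 1) (axis j 1)))"
    unfolding h_expand[of x y] by (rule order_trans[OF norm_sum sum_mono[OF norm_sum]])
  also have "... \<le> (\<Sum>i\<in>UNIV. \<Sum>j\<in>UNIV. norm x * norm y * cmod (h (axis i 1) (axis j 1)))"
    by (intro sum_mono) (auto simp: norm_mult intro!: mult_right_mono mult_mono Finite_Cartesian_Product.norm_nth_le)
  finally show "cmod (h x y) \<le> norm x * norm y * (\<Sum>i\<in>UNIV. \<Sum>j\<in>UNIV. cmod (h (axis i 1) (axis j 1)))"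
    by (simp add: sum_distrib_left)
qed

lemma h_bilinear: "bounded_bilinear h"
  using h_bounded by (intro bounded_bilinear.intro) (auto simp: h_simps)

lemma h_continuous: "continuous_on S f \<Longrightarrow> continuous_on S g \<Longrightarrow> continuous_on S (\<lambda>x. h (f x) (g x))"
  by (rule bounded_bilinear.continuous_on[OF h_bilinear])

lemma n2_continuous: "continuous_on S f \<Longrightarrow> continuous_on S (\<lambda>x. n2 (f x))"
  unfolding n2_def by (intro continuous_intros h_continuous)

lemma n2_upper: obtains C where "0 < C" "\<And>x. n2 x \<le> C * (norm x)\<^sup>2"
proof -
  obtain K where K: "\<And>x y. cmod (h x y) \<le> norm x * norm y * K" using h_bounded by blast
  have "n2 x \<le> max K 1 * (norm x)\<^sup>2" for x
  proof -
    have "n2 x \<le> cmod (h x x)" unfolding n2_def by (rule complex_Re_le_cmod)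
    also have "... \<le> norm x * norm x * K" by (rule K)
    also have "... \<le> norm x * norm x * max K 1" by (intro mult_left_mono) auto
    finally show ?thesis by (simp add: power2_eq_square mult.commute)
  qed
  thus thesis by (intro that[of "max K 1"]) auto
qed

text \<open>The minimum of \<open>n2\<close> on the compact unit sphere is positive; scaling does
  the rest.\<close>

lemma n2_lower: obtains c where "0 < c" "\<And>x. c * (norm x)\<^sup>2 \<le> n2 x"
proof -
  have "sphere (0::complex^'m) 1 \<noteq> {}" by simp
  then obtain x0 where x0: "x0 \<in> sphere (0::complex^'m) 1" "\<And>x. x \<in> sphere 0 1 \<Longrightarrow> n2 x0 \<le> n2 x"
    using continuous_attains_inf[OF compact_sphere _ n2_continuous[OF continuous_on_id]] by blast
  have p: "0 < n2 x0" using x0(1) n2_nonneg[of x0] n2_eq_0[of x0] by (auto simp del: n2_eq_0 simp: less_le)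
  have "n2 x0 * (norm x)\<^sup>2 \<le> n2 x" for x
  proof (cases "x = 0")
    case False
    have "n2 x0 \<le> n2 ((1 / norm x) *\<^sub>R x)" by (rule x0(2)) (use False in simp)
    thus ?thesis using False by (simp add: n2_scaleR field_simps)
  qed (simp add: n2_def)
  with p show thesis using that by blast
qed

end

lemma clinear_bounded:
  fixes f :: "complex^'m \<Rightarrow> complex^'m"
  assumes "\<And>a x y. f (a *s x + y) = a *s f x + f y"
  shows "bounded_linear f"
proof -
  have a: "f (x + y) = f x + f y" for x y using assms[of 1 x y] by simp
  have "f 0 = 0" using a[of 0 0] by simp
  hence "f (c *\<^sub>R x) = c *\<^sub>R f x" for c x using assms[of "of_real c" x 0] by (simp add: scaleR_eq_smult)
  hence "linear f" using a by (simp add: linear_iff)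
  thus ?thesis by (simp add: linear_conv_bounded_linear)
qed

lemma sum_fun_apply: "(sum f I) x = (\<Sum>i\<in>I. f i x)"
  by (induction I rule: infinite_finite_induct) auto

lemma amgm_aux: "0 < a \<Longrightarrow> (a\<^sup>2 * y\<^sup>2 + 1) / a = a * y\<^sup>2 + 1 / (a::real)"
  by (simp add: add_divide_distrib power2_eq_square)

lemma smult_measurable: "f \<in> borel_measurable M \<Longrightarrow> (\<lambda>x. a *s (f x :: complex^'m)) \<in> borel_measurable M"
  using borel_measurable_continuous_onI[OF linear_continuous_on[OF bounded_bilinear.bounded_linear_right[OF smult_bounded_bilinear, of a], of UNIV]]
    measurable_compose by blast

section \<open>Square integrable spinor fields\<close>

locale spinor_l2 = quot B \<mu> + herm h
  for B :: "real^'n^'n" and \<mu> and h :: "complex^'m \<Rightarrow> complex^'m \<Rightarrow> complex" +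
  fixes \<epsilon> :: "'n pt \<Rightarrow> int"
begin

definition phase :: "'n pt \<Rightarrow> complex" where "phase \<gamma> = exp (\<i> * of_real pi * of_int (\<epsilon> \<gamma>))"

lemma phase_norm [simp]: "cmod (phase \<gamma>) = 1"
proof -
  have "phase \<gamma> = cis (pi * of_int (\<epsilon> \<gamma>))" by (simp add: phase_def cis_conv_exp algebra_simps)
  thus ?thesis by simp
qed

lemma phase_nz [simp]: "phase \<gamma> \<noteq> 0" using phase_norm[of \<gamma>] by (metis norm_zero zero_neq_one)

abbreviation "equi \<equiv> equivariant B \<epsilon> :: ('n pt \<Rightarrow> complex^'m) \<Rightarrow> bool"

lemma equi_iff: "equi \<psi> \<longleftrightarrow> (\<forall>\<gamma>\<in>\<Gamma>. \<forall>y. \<psi> (\<gamma> \<odot> y) = phase \<gamma> *s \<psi> y)"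
  unfolding equivariant_def phase_def ..

lemma equi_h: assumes "equi \<psi>" "equi \<phi>" shows "invariant (\<lambda>p. h (\<psi> p) (\<phi> p))"
  unfolding invariant_def
proof safe
  fix \<gamma> a b assume g: "\<gamma> \<in> \<Gamma>"
  have "phase \<gamma> * cnj (phase \<gamma>) = 1" by (simp add: complex_norm_square[symmetric])
  thus "h (\<psi> (\<gamma> \<odot> (a, b))) (\<phi> (\<gamma> \<odot> (a, b))) = h (\<psi> (a, b)) (\<phi> (a, b))"
    using assms g unfolding equi_iff by (simp add: h_scale h_scale_right mult.assoc[symmetric] mult.commute)
qed

lemma equi_n2: assumes "equi \<psi>" shows "invariant (\<lambda>p. n2 (\<psi> p))"
  using equi_h[OF assms assms] by (simp add: invariant_def n2_def)

lemma equi_add: "equi \<psi> \<Longrightarrow> equi \<phi> \<Longrightarrow> equi (\<lambda>p. \<psi> p + \<phi> p)"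
  by (simp add: equi_iff vector_add_ldistrib)
lemma equi_smult: "equi \<psi> \<Longrightarrow> equi (\<lambda>p. a *s \<psi> p)"
  by (simp add: equi_iff mult.commute)
lemma equi_diff: "equi \<psi> \<Longrightarrow> equi \<phi> \<Longrightarrow> equi (\<lambda>p. \<psi> p - \<phi> p)"
  by (simp add: equi_iff vector_ssub_ldistrib)
lemma equi_zero: "equi (\<lambda>p. 0)" by (simp add: equi_iff)

abbreviation "ip \<equiv> L2_inner \<mu> h :: ('n pt \<Rightarrow> complex^'m) \<Rightarrow> ('n pt \<Rightarrow> complex^'m) \<Rightarrow> complex"

lemma ip_eq: "ip \<psi> \<phi> = integ (\<lambda>p. h (\<psi> p) (\<phi> p))"
  by (simp add: L2_inner_def integ_def rep_def Let_def)

text \<open>The ambient space of all square-integrable equivariant Borel maps. Completeness is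
  proved here, and \<open>L2_space\<close> inherits it as the closure of the continuous
  maps.\<close>

definition M2 :: "('n pt \<Rightarrow> complex^'m) set" where
  "M2 = {\<psi>. \<psi> \<in> borel_measurable borel \<and> equi \<psi> \<and> integrable \<mu> (\<lambda>C. n2 (\<psi> (rep C)))}"

lemma h_measurable: "f \<in> borel_measurable M \<Longrightarrow> g \<in> borel_measurable M \<Longrightarrow> (\<lambda>x. h (f x) (g x)) \<in> borel_measurable M"
  by (rule borel_measurable_continuous_Pair) (auto intro!: h_continuous continuous_intros)

lemma n2_measurable: "f \<in> borel_measurable M \<Longrightarrow> (\<lambda>x. n2 (f x)) \<in> borel_measurable M"
  by (rule measurable_compose[OF _ borel_measurable_continuous_onI[OF n2_continuous[OF continuous_on_id]]])

lemma M2_h: assumes "\<psi> \<in> M2" "\<phi> \<in> M2" shows "integrable \<mu> (\<lambda>C. h (\<psi> (rep C)) (\<phi> (rep C)))"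
proof (rule Bochner_Integration.integrable_bound[of _ "\<lambda>C. n2 (\<psi> (rep C)) + n2 (\<phi> (rep C))"])
  show "integrable \<mu> (\<lambda>C. n2 (\<psi> (rep C)) + n2 (\<phi> (rep C)))" using assms by (simp add: M2_def)
  show "(\<lambda>C. h (\<psi> (rep C)) (\<phi> (rep C))) \<in> borel_measurable \<mu>"
    using assms by (intro measurable_rep[of "\<lambda>p. h (\<psi> p) (\<phi> p)"] equi_h h_measurable) (auto simp: M2_def)
  have "cmod (h x y) \<le> \<bar>n2 x + n2 y\<bar>" for x y using h_amgm[of x y] norm_ge_zero[of "h x y"] by linarith
  thus "AE C in \<mu>. norm (h (\<psi> (rep C)) (\<phi> (rep C))) \<le> norm (n2 (\<psi> (rep C)) + n2 (\<phi> (rep C)))" by simp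
qed

abbreviation sc :: "complex \<Rightarrow> ('n pt \<Rightarrow> complex^'m) \<Rightarrow> ('n pt \<Rightarrow> complex^'m)" where
  "sc a \<psi> \<equiv> (\<lambda>p. a *s \<psi> p)"

lemma sc_vs: "vector_space sc"
  by unfold_locales (auto simp: fun_eq_iff vector_add_ldistrib vector_sadd_rdistrib vector_smult_assoc)

sublocale VS: vector_space sc by (rule sc_vs)

lemma M2_add: assumes "\<psi> \<in> M2" "\<phi> \<in> M2" shows "\<psi> + \<phi> \<in> M2"
proof -
  have "integrable \<mu> (\<lambda>C. n2 (\<psi> (rep C)) + n2 (\<phi> (rep C)) + 2 * Re (h (\<psi> (rep C)) (\<phi> (rep C))))"
    using assms M2_h[OF assms] by (simp add: M2_def)
  thus ?thesis using assms unfolding M2_def plus_fun_def by (simp add: n2_add equi_add borel_measurable_add)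
qed

lemma M2_n2_measurable: "\<psi> \<in> M2 \<Longrightarrow> (\<lambda>C. n2 (\<psi> (rep C))) \<in> borel_measurable \<mu>"
  by (rule measurable_rep[of "\<lambda>p. n2 (\<psi> p)", OF equi_n2 n2_measurable]) (auto simp: M2_def)

lemma M2_sub: "VS.subspace M2"
proof (rule VS.subspaceI)
  show "0 \<in> M2" by (simp add: M2_def zero_fun_def equi_zero n2_def)
  show "\<psi> + \<phi> \<in> M2" if "\<psi> \<in> M2" "\<phi> \<in> M2" for \<psi> \<phi> by (rule M2_add[OF that])
  show "sc a \<psi> \<in> M2" if "\<psi> \<in> M2" for a \<psi>
    using that by (simp add: M2_def n2_scale equi_smult smult_measurable)
qed

sublocale M: semi_inner sc ip M2
proof
  show "VS.subspace M2" by (rule M2_sub)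
  fix \<psi> \<phi> \<theta> :: "'n pt \<Rightarrow> complex^'m" and a :: complex
  assume p: "\<psi> \<in> M2"
  show "0 \<le> Re (ip \<psi> \<psi>)"
    unfolding ip_eq integ_def integral_Re[OF M2_h[OF p p], symmetric] n2_def[symmetric]
    by (rule integral_nonneg_AE) simp
  assume q: "\<phi> \<in> M2"
  show "ip (sc a \<psi>) \<phi> = a * ip \<psi> \<phi>" by (simp add: ip_eq integ_def h_scale)
  show "ip \<phi> \<psi> = cnj (ip \<psi> \<phi>)"
  proof -
    have "h x y = cnj (h y x)" for x y by (rule h_cnj)
    hence "ip \<phi> \<psi> = integ (\<lambda>p. cnj (h (\<psi> p) (\<phi> p)))" unfolding ip_eq by metis
    thus ?thesis using Bochner_Integration.integral_bounded_linear[OF bounded_linear_cnj M2_h[OF p q]] by (simp add: ip_eq integ_def)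
  qed
  assume r: "\<theta> \<in> M2"
  show "ip (\<psi> + \<phi>) \<theta> = ip \<psi> \<theta> + ip \<phi> \<theta>"
    using M2_h[OF p r] M2_h[OF q r] by (simp add: ip_eq integ_def h_add)
qed

lemma N_eq: "M.N = L2_norm \<mu> h" by (rule ext) (simp add: M.N_def L2_norm_def)

lemma N_sq_integral: assumes "\<psi> \<in> M2" shows "(M.N \<psi>)\<^sup>2 = (LINT C|\<mu>. n2 (\<psi> (rep C)))"
  unfolding M.N_sq[OF assms] ip_eq integ_def n2_def by (rule integral_Re[OF M2_h[OF assms assms], symmetric])

lemma cont_M2: assumes "continuous_on UNIV \<psi>" "equi \<psi>" shows "\<psi> \<in> M2"
  unfolding M2_def
proof safe
  show "\<psi> \<in> borel_measurable borel" by (rule borel_measurable_continuous_onI[OF assms(1)])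
  show "integrable \<mu> (\<lambda>C. n2 (\<psi> (rep C)))"
    by (rule integrable_invariant[OF equi_n2[OF assms(2)] n2_continuous[OF assms(1)]])
qed (rule assms)

definition Ceq :: "('n pt \<Rightarrow> complex^'m) set" where "Ceq = {\<psi>. continuous_on UNIV \<psi> \<and> equi \<psi>}"

lemma Ceq_M2: "Ceq \<subseteq> M2" using cont_M2 by (auto simp: Ceq_def)

lemma Ceq_sub: "VS.subspace Ceq"
proof (rule VS.subspaceI)
  show "0 \<in> Ceq" by (simp add: Ceq_def zero_fun_def equi_zero)
  show "\<psi> + \<phi> \<in> Ceq" if "\<psi> \<in> Ceq" "\<phi> \<in> Ceq" for \<psi> \<phi>
    using that by (simp add: Ceq_def plus_fun_def equi_add continuous_on_add)
  show "sc a \<psi> \<in> Ceq" if "\<psi> \<in> Ceq" for a \<psi>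
    using that by (simp add: Ceq_def equi_smult bounded_bilinear.continuous_on[OF smult_bounded_bilinear])
qed

abbreviation "L2 \<equiv> L2_space B \<epsilon> \<mu> h :: ('n pt \<Rightarrow> complex^'m) set"

lemma L2_M2: "L2 \<subseteq> M2"
proof
  fix \<psi> :: "'n pt \<Rightarrow> complex^'m" assume "\<psi> \<in> L2"
  hence p: "\<psi> \<in> borel_measurable borel" "equi \<psi>" "integrable \<mu> (\<lambda>C. h (\<psi> (rep C)) (\<psi> (rep C)))"
    by (auto simp: L2_space_def rep_def Let_def)
  thus "\<psi> \<in> M2" using integrable_Re[OF p(3)] by (simp add: M2_def n2_def)
qed

lemma L2_eq: "L2 = M.clo Ceq"
proof (intro equalityI subsetI)
  fix \<psi> assume p: "\<psi> \<in> L2"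
  then obtain u where u: "\<And>m. continuous_on UNIV (u m) \<and> equi (u m)" "(\<lambda>m. L2_norm \<mu> h (\<lambda>p. u m p - \<psi> p)) \<longlonglongrightarrow> 0"
    by (auto simp: L2_space_def)
  have "(\<lambda>p. u m p - \<psi> p) = u m - \<psi>" for m by (simp add: fun_diff_def)
  thus "\<psi> \<in> M.clo Ceq" unfolding M.clo_iff[OF Ceq_M2] M.tends_def N_eq
    using u p L2_M2 by (intro conjI exI[of _ u]) (auto simp: Ceq_def)
next
  fix \<psi> assume p: "\<psi> \<in> M.clo Ceq"
  then obtain u where u: "\<And>m. u m \<in> Ceq" "(\<lambda>m. L2_norm \<mu> h (u m - \<psi>)) \<longlonglongrightarrow> 0" and m: "\<psi> \<in> M2"
    unfolding M.clo_iff[OF Ceq_M2] M.tends_def N_eq by blast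
  have "(\<lambda>p. u m p - \<psi> p) = u m - \<psi>" for m by (simp add: fun_diff_def)
  moreover have "integrable \<mu> (\<lambda>C. let p = SOME p. p \<in> C in h (\<psi> p) (\<psi> p))"
    using M2_h[OF m m] by (simp add: rep_def Let_def)
  ultimately show "\<psi> \<in> L2" using m u by (auto simp: L2_space_def M2_def Ceq_def intro!: exI[of _ u])
qed

lemma L2_sub: "VS.subspace L2" unfolding L2_eq by (rule M.clo_subspace[OF Ceq_sub Ceq_M2])

lemma nn_N: assumes "\<psi> \<in> M2" shows "(\<integral>\<^sup>+C. ennreal (n2 (\<psi> (rep C))) \<partial>\<mu>) = ennreal ((M.N \<psi>)\<^sup>2)"
  unfolding N_sq_integral[OF assms] using assms by (intro nn_integral_eq_integral) (auto simp: M2_def)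

text \<open>The increments have summable integrals, so their sum is finite almost everywhere and the
  pointwise series converges absolutely.\<close>

lemma fast_ae_convergent:
  assumes X: "\<And>k::nat. X k \<in> M2" and fast: "\<And>k. M.N (X (Suc k) - X k) \<le> (1/2)^k"
  shows "AE C in \<mu>. convergent (\<lambda>k. X k (rep C))"
proof -
  obtain c where c: "0 < c" "\<And>x. c * (norm x)\<^sup>2 \<le> n2 x" using n2_lower by blast
  define g where "g k C = sqrt (n2 ((X (Suc k) - X k) (rep C)))" for k C
  have d: "X (Suc k) - X k \<in> M2" for k using M.L_diff X by blast
  have mn: "(\<lambda>C. n2 ((X (Suc k) - X k) (rep C))) \<in> borel_measurable \<mu>" for k
    by (rule M2_n2_measurable[OF d])
  have mg: "g k \<in> borel_measurable \<mu>" for k unfolding g_def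
    by (rule measurable_compose[OF mn borel_measurable_continuous_onI[OF continuous_on_real_sqrt[OF continuous_on_id]]])
  have ig: "(\<integral>\<^sup>+C. ennreal (g k C) \<partial>\<mu>) \<le> ennreal ((1/2)^k)" for k
  proof -
    \<comment> \<open>This weight in the inequality of arithmetic and geometric means balances a
      squared norm of order \<open>(1/4)^k\<close> against a constant, so both halves are of order
      \<open>(1/2)^k\<close>.\<close>
    let ?a = "2 ^ k :: real"
    have pt: "g k C \<le> (?a * n2 ((X (Suc k) - X k) (rep C)) + (1/2)^k) / 2" for C
    proof -
      have "0 \<le> (?a * g k C - 1)\<^sup>2" by simp
      hence "2 * (?a * g k C) \<le> ?a\<^sup>2 * (g k C)\<^sup>2 + 1" by (simp add: power2_diff power_mult_distrib)
      hence "2 * (?a * g k C) / ?a \<le> (?a\<^sup>2 * (g k C)\<^sup>2 + 1) / ?a" by (intro divide_right_mono) auto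
      moreover have "(?a\<^sup>2 * (g k C)\<^sup>2 + 1) / ?a = ?a * (g k C)\<^sup>2 + (1/2)^k"
        using amgm_aux[of ?a "g k C"] by (simp only: power_one_over) simp
      moreover have "(g k C)\<^sup>2 = n2 ((X (Suc k) - X k) (rep C))" by (simp add: g_def)
      ultimately show ?thesis by simp
    qed
    have I: "integrable \<mu> (\<lambda>C. (?a * n2 ((X (Suc k) - X k) (rep C)) + (1/2)^k) / 2)"
      using d[of k] by (intro Bochner_Integration.integrable_divide Bochner_Integration.integrable_add Bochner_Integration.integrable_mult_right) (auto simp: M2_def)
    have "(\<integral>\<^sup>+C. ennreal (g k C) \<partial>\<mu>) \<le> (\<integral>\<^sup>+C. ennreal ((?a * n2 ((X (Suc k) - X k) (rep C)) + (1/2)^k) / 2) \<partial>\<mu>)"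
      using pt by (intro nn_integral_mono ennreal_leI)
    also have "... = ennreal (LINT C|\<mu>. (?a * n2 ((X (Suc k) - X k) (rep C)) + (1/2)^k) / 2)"
      by (rule nn_integral_eq_integral[OF I]) auto
    also have "(LINT C|\<mu>. (?a * n2 ((X (Suc k) - X k) (rep C)) + (1/2)^k) / 2) = (?a * (M.N (X (Suc k) - X k))\<^sup>2 + (1/2)^k) / 2"
    proof -
      have "measure \<mu> (space \<mu>) = 1" using emeasure_one by (simp add: measure_def)
      thus ?thesis using d[of k] unfolding N_sq_integral[OF d[of k]] by (simp add: M2_def)
    qed
    also have "(?a * (M.N (X (Suc k) - X k))\<^sup>2 + (1/2)^k) / 2 \<le> (1/2)^k"
    proof -
      have "(M.N (X (Suc k) - X k))\<^sup>2 \<le> ((1/2)^k)\<^sup>2" using fast d by (intro power_mono) auto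
      hence "?a * (M.N (X (Suc k) - X k))\<^sup>2 \<le> ?a * ((1/2)^k)\<^sup>2" by (intro mult_left_mono) auto
      also have "?a * ((1/2)^k)\<^sup>2 = (1/2)^k" by (simp add: power2_eq_square power_one_over)
      finally show ?thesis by simp
    qed
    finally show ?thesis by (simp add: ennreal_leI)
  qed
  have "(\<integral>\<^sup>+C. (\<Sum>k. ennreal (g k C)) \<partial>\<mu>) = (\<Sum>k. \<integral>\<^sup>+C. ennreal (g k C) \<partial>\<mu>)"
    using mg by (intro nn_integral_suminf) auto
  also have "... \<le> (\<Sum>k. ennreal ((1/2)^k))" by (intro suminf_le ig) auto
  also have "... = ennreal (\<Sum>k. (1/2)^k)" by (intro suminf_ennreal2) (auto intro: summable_geometric)
  finally have "(\<integral>\<^sup>+C. (\<Sum>k. ennreal (g k C)) \<partial>\<mu>) \<noteq> \<infinity>" by (auto simp: top_unique)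
  hence "AE C in \<mu>. (\<Sum>k. ennreal (g k C)) \<noteq> \<infinity>"
    using mg by (intro nn_integral_PInf_AE) auto
  thus ?thesis
  proof (rule AE_mp, intro AE_I2 impI)
    fix C assume fin: "(\<Sum>k. ennreal (g k C)) \<noteq> \<infinity>"
    have sg: "summable (\<lambda>k. g k C)" using fin by (intro summable_suminf_not_top) (auto simp: g_def)
    have "norm (X (Suc k) (rep C) - X k (rep C)) \<le> g k C / sqrt c" for k
    proof -
      have "sqrt (c * (norm (X (Suc k) (rep C) - X k (rep C)))\<^sup>2) \<le> g k C"
        unfolding g_def using c(2) by (simp add: fun_diff_def)
      thus ?thesis using c(1) by (simp add: real_sqrt_mult field_simps)
    qed
    hence "summable (\<lambda>k. X (Suc k) (rep C) - X k (rep C))"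
      by (intro summable_comparison_test'[OF summable_divide[OF sg, of "sqrt c"], of 0]) auto
    hence "convergent (\<lambda>n. \<Sum>k<n. X (Suc k) (rep C) - X k (rep C))" by (simp add: summable_iff_convergent)
    hence "convergent (\<lambda>n. X n (rep C) - X 0 (rep C))"
      by (simp only: sum_lessThan_telescope[of "\<lambda>k. X k (rep C)"])
    hence "convergent (\<lambda>n. (X n (rep C) - X 0 (rep C)) + X 0 (rep C))" by (intro convergent_add convergent_const)
    thus "convergent (\<lambda>k. X k (rep C))" by simp
  qed
qed

text \<open>Fatou's lemma bounds the distance from \<open>X k\<close> to the pointwise limit by the
  limes inferior of the distances to \<open>X j\<close>.\<close>

lemma limit_in_M2:
  assumes X: "\<And>k::nat. X k \<in> M2" and ae: "AE C in \<mu>. convergent (\<lambda>k. X k (rep C))"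
    and cau: "\<And>e. 0 < e \<Longrightarrow> \<exists>K. \<forall>k\<ge>K. \<forall>j\<ge>K. M.N (X k - X j) < e"
  shows "\<exists>\<psi>\<in>M2. M.tends X \<psi>"
proof -
  \<comment> \<open>The set of convergence is invariant under the lattice, so the value 0 outside it
    keeps the limit equivariant everywhere and not only almost everywhere.\<close>
  define \<psi> where "\<psi> p = (if convergent (\<lambda>k. X k p) then lim (\<lambda>k. X k p) else 0)" for p
  have mX [measurable]: "X k \<in> borel_measurable borel" for k using X by (simp add: M2_def)
  have eX: "equi (X k)" for k using X by (simp add: M2_def)
  have m\<psi>: "\<psi> \<in> borel_measurable borel"
  proof -
    have "{p. convergent (\<lambda>k. X k p)} = {p \<in> space borel. Cauchy (\<lambda>k. X k p)}"
      by (simp add: Cauchy_convergent_iff)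
    moreover have "{p \<in> space borel. Cauchy (\<lambda>k. X k p)} \<in> sets borel" by (rule sets_Collect_Cauchy[OF mX])
    ultimately have "{p \<in> space borel. convergent (\<lambda>k. X k p)} \<in> sets borel" by simp
    from measurable_If[OF borel_measurable_lim_metric[OF mX] measurable_const this, of 0]
    show ?thesis by (simp add: \<psi>_def[abs_def])
  qed
  have sl: "(\<lambda>k. a *s x k) \<longlonglongrightarrow> a *s y" if "x \<longlonglongrightarrow> y" for a and x :: "nat \<Rightarrow> complex^'m" and y
    using bounded_linear.tendsto[OF bounded_bilinear.bounded_linear_right[OF smult_bounded_bilinear] that] .
  have e\<psi>: "equi \<psi>" unfolding equi_iff
  proof (intro ballI allI)
    fix \<gamma> p assume g: "\<gamma> \<in> \<Gamma>"
    have Xg: "X k (\<gamma> \<odot> p) = phase \<gamma> *s X k p" for k using eX g unfolding equi_iff by blast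
    show "\<psi> (\<gamma> \<odot> p) = phase \<gamma> *s \<psi> p"
    proof (cases "convergent (\<lambda>k. X k p)")
      case True
      hence l: "(\<lambda>k. X k p) \<longlonglongrightarrow> lim (\<lambda>k. X k p)" by (simp add: convergent_LIMSEQ_iff)
      from sl[OF this, of "phase \<gamma>"] have "(\<lambda>k. X k (\<gamma> \<odot> p)) \<longlonglongrightarrow> phase \<gamma> *s lim (\<lambda>k. X k p)" by (simp only: Xg)
      hence "lim (\<lambda>k. X k (\<gamma> \<odot> p)) = phase \<gamma> *s lim (\<lambda>k. X k p)" "convergent (\<lambda>k. X k (\<gamma> \<odot> p))"
        by (auto simp: limI convergent_def)
      thus ?thesis using True by (simp add: \<psi>_def)
    next
      case False
      have "\<not> convergent (\<lambda>k. X k (\<gamma> \<odot> p))"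
      proof
        assume "convergent (\<lambda>k. X k (\<gamma> \<odot> p))"
        then obtain y where "(\<lambda>k. phase \<gamma> *s X k p) \<longlonglongrightarrow> y" by (auto simp: convergent_def Xg)
        from sl[OF this, of "inverse (phase \<gamma>)"] have "(\<lambda>k. X k p) \<longlonglongrightarrow> inverse (phase \<gamma>) *s y" by simp
        thus False using False by (auto simp: convergent_def)
      qed
      thus ?thesis using False by (simp add: \<psi>_def)
    qed
  qed
  have fatou: "(\<integral>\<^sup>+C. ennreal (n2 ((X k - \<psi>) (rep C))) \<partial>\<mu>) \<le> ennreal (e\<^sup>2)"
    if k: "\<And>j. j \<ge> K \<Longrightarrow> M.N (X k - X j) \<le> e" for k K e
  proof -
    have "AE C in \<mu>. ennreal (n2 ((X k - \<psi>) (rep C))) \<le> liminf (\<lambda>j. ennreal (n2 ((X k - X j) (rep C))))"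
      using ae
    proof (rule AE_mp, intro AE_I2 impI)
      fix C assume c: "convergent (\<lambda>k. X k (rep C))"
      hence "(\<lambda>k. X k (rep C)) \<longlonglongrightarrow> \<psi> (rep C)" by (simp add: \<psi>_def convergent_LIMSEQ_iff)
      hence "(\<lambda>j. X k (rep C) - X j (rep C)) \<longlonglongrightarrow> X k (rep C) - \<psi> (rep C)" by (intro tendsto_intros)
      moreover have "isCont n2 x" for x
        using n2_continuous[OF continuous_on_id, of UNIV] by (simp add: continuous_on_eq_continuous_at)
      ultimately have "(\<lambda>j. n2 (X k (rep C) - X j (rep C))) \<longlonglongrightarrow> n2 (X k (rep C) - \<psi> (rep C))"
        using isCont_tendsto_compose by blast
      hence t: "(\<lambda>j. ennreal (n2 ((X k - X j) (rep C)))) \<longlonglongrightarrow> ennreal (n2 ((X k - \<psi>) (rep C)))"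
        by (simp add: fun_diff_def)
      show "ennreal (n2 ((X k - \<psi>) (rep C))) \<le> liminf (\<lambda>j. ennreal (n2 ((X k - X j) (rep C))))"
        unfolding lim_imp_Liminf[OF trivial_limit_sequentially t] by (rule order_refl)
    qed
    hence "(\<integral>\<^sup>+C. ennreal (n2 ((X k - \<psi>) (rep C))) \<partial>\<mu>) \<le> (\<integral>\<^sup>+C. liminf (\<lambda>j. ennreal (n2 ((X k - X j) (rep C)))) \<partial>\<mu>)"
      by (rule nn_integral_mono_AE)
    also have "... \<le> liminf (\<lambda>j. \<integral>\<^sup>+C. ennreal (n2 ((X k - X j) (rep C))) \<partial>\<mu>)"
    proof (rule nn_integral_liminf)
      fix j
      have "X k - X j \<in> M2" using M.L_diff X by blast
      hence "(\<lambda>C. n2 ((X k - X j) (rep C))) \<in> borel_measurable \<mu>" by (rule M2_n2_measurable)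
      thus "(\<lambda>C. ennreal (n2 ((X k - X j) (rep C)))) \<in> borel_measurable \<mu>" by simp
    qed
    also have "... = liminf (\<lambda>j. ennreal ((M.N (X k - X j))\<^sup>2))" by (simp only: nn_N[OF M.L_diff[OF X X]])
    also have "... \<le> liminf (\<lambda>j. ennreal (e\<^sup>2))"
    proof (rule Liminf_mono)
      show "\<forall>\<^sub>F j in sequentially. ennreal ((M.N (X k - X j))\<^sup>2) \<le> ennreal (e\<^sup>2)"
        unfolding eventually_sequentially using k X by (intro exI[of _ K] allI impI ennreal_leI power_mono) auto
    qed
    also have "... = ennreal (e\<^sup>2)" by (simp add: Liminf_const)
    finally show ?thesis .
  qed
  have XpM: "X k - \<psi> \<in> M2" if k: "\<And>j. j \<ge> K \<Longrightarrow> M.N (X k - X j) \<le> e" for k K e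
  proof -
    have m: "X k - \<psi> \<in> borel_measurable borel" unfolding fun_diff_def using m\<psi> by simp
    have eq: "equi (X k - \<psi>)" unfolding fun_diff_def by (intro equi_diff eX e\<psi>)
    have "(\<lambda>C. n2 ((X k - \<psi>) (rep C))) \<in> borel_measurable \<mu>" by (intro measurable_rep equi_n2 n2_measurable m eq)
    hence "integrable \<mu> (\<lambda>C. n2 ((X k - \<psi>) (rep C)))"
      using fatou[OF k] by (intro integrableI_bounded) (auto simp: less_top[symmetric] top_unique)
    thus ?thesis using m eq by (simp add: M2_def)
  qed
  have Nle: "M.N (X k - \<psi>) \<le> e" if k: "\<And>j. j \<ge> K \<Longrightarrow> M.N (X k - X j) \<le> e" and e: "0 < e" for k K e
  proof -
    have "ennreal ((M.N (X k - \<psi>))\<^sup>2) \<le> ennreal (e\<^sup>2)" using fatou[OF k] nn_N[OF XpM[OF k]] by simp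
    hence "(M.N (X k - \<psi>))\<^sup>2 \<le> e\<^sup>2" by (simp add: ennreal_le_iff)
    thus ?thesis by (rule power2_le_imp_le) (use e in simp)
  qed
  obtain K1 where K1: "\<And>k j. k \<ge> K1 \<Longrightarrow> j \<ge> K1 \<Longrightarrow> M.N (X k - X j) < 1" using cau[of 1] by auto
  have "X K1 - \<psi> \<in> M2" by (rule XpM[of K1]) (use K1 in \<open>auto intro: less_imp_le\<close>)
  hence "X K1 - (X K1 - \<psi>) \<in> M2" using M.L_diff X by blast
  hence \<psi>M: "\<psi> \<in> M2" by simp
  have "M.tends X \<psi>" unfolding M.tends_def
  proof (rule LIMSEQ_I)
    fix e :: real assume e: "0 < e"
    obtain K where K: "\<And>k j. k \<ge> K \<Longrightarrow> j \<ge> K \<Longrightarrow> M.N (X k - X j) < e/2" using cau[of "e/2"] e by auto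
    have "M.N (X k - \<psi>) \<le> e/2" if "k \<ge> K" for k
      by (rule Nle[of K]) (use K that e in \<open>auto intro: less_imp_le\<close>)
    thus "\<exists>no. \<forall>n\<ge>no. norm (M.N (X n - \<psi>) - 0) < e"
      using e X \<psi>M by (intro exI[of _ K]) (fastforce simp: M.L_diff)
  qed
  with \<psi>M show ?thesis by blast
qed

lemma M2_complete:
  assumes X: "\<And>n::nat. X n \<in> M2" and cau: "\<And>e. 0 < e \<Longrightarrow> \<exists>K. \<forall>k\<ge>K. \<forall>j\<ge>K. M.N (X k - X j) < e"
  shows "\<exists>\<psi>\<in>M2. M.tends X \<psi>"
proof -
  have "\<forall>i::nat. \<exists>K. \<forall>k\<ge>K. \<forall>j\<ge>K. M.N (X k - X j) < (1/2)^i" using cau by simp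
  then obtain K where K: "\<And>i k j. K i \<le> k \<Longrightarrow> K i \<le> j \<Longrightarrow> M.N (X k - X j) < (1/2)^i" by metis
  \<comment> \<open>Strictly increasing and at least \<open>K i\<close> at stage \<open>i\<close>,
    so that consecutive members of the subsequence differ by at most \<open>(1/2)^i\<close>.\<close>
  define r where "r = rec_nat (K 0) (\<lambda>i x. max (Suc x) (K (Suc i)))"
  have rS: "r (Suc i) = max (Suc (r i)) (K (Suc i))" for i by (simp add: r_def)
  have rK: "K i \<le> r i" for i by (cases i) (auto simp: rS, simp add: r_def)
  have sm: "strict_mono r" unfolding strict_mono_Suc_iff by (simp add: rS less_max_iff_disj)
  have fast: "M.N (X (r (Suc i)) - X (r i)) \<le> (1/2)^i" for i
  proof -
    have "r i \<le> r (Suc i)" by (simp add: rS)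
    thus ?thesis using K[OF order_trans[OF rK] rK] by (simp add: less_imp_le)
  qed
  have ae: "AE C in \<mu>. convergent (\<lambda>k. X (r k) (rep C))"
    by (rule fast_ae_convergent[of "\<lambda>k. X (r k)"]) (use X fast in auto)
  have c2: "\<exists>K. \<forall>k\<ge>K. \<forall>j\<ge>K. M.N (X (r k) - X (r j)) < e" if "0 < e" for e
    using cau[OF that] sm by (meson order_trans seq_suble)
  obtain \<psi> where \<psi>: "\<psi> \<in> M2" "M.tends (\<lambda>k. X (r k)) \<psi>"
    using limit_in_M2[of "\<lambda>k. X (r k)"] X ae c2 by blast
  have "M.tends X \<psi>" unfolding M.tends_def
  proof (rule LIMSEQ_I)
    fix e :: real assume e: "0 < e"
    obtain K1 where K1: "\<And>k j. k \<ge> K1 \<Longrightarrow> j \<ge> K1 \<Longrightarrow> M.N (X k - X j) < e/2" using cau[of "e/2"] e by auto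
    have "\<forall>\<^sub>F k in sequentially. M.N (X (r k) - \<psi>) < e/2"
      using \<psi>(2) e unfolding M.tends_def by (intro order_tendstoD(2)[of _ 0]) auto
    then obtain k0 where k0: "\<And>k. k \<ge> k0 \<Longrightarrow> M.N (X (r k) - \<psi>) < e/2" by (auto simp: eventually_sequentially)
    define k where "k = max k0 K1"
    have k: "K1 \<le> r k" "M.N (X (r k) - \<psi>) < e/2" using seq_suble[OF sm, of k] k0[of k] by (auto simp: k_def)
    have "M.N (X n - \<psi>) < e" if "n \<ge> K1" for n
      using M.N_triangle3[OF X X \<psi>(1), of n "r k"] K1[OF that k(1)] k(2) by simp
    thus "\<exists>no. \<forall>n\<ge>no. norm (M.N (X n - \<psi>) - 0) < e"
      using X \<psi>(1) by (intro exI[of _ K1]) (auto simp: M.L_diff)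
  qed
  with \<psi>(1) show ?thesis by blast
qed

sublocale L: semi_hilbert sc ip L2
proof -
  interpret A: semi_inner sc ip L2
  proof
    note sub = subsetD[OF L2_M2]
    show "VS.subspace L2" by (rule L2_sub)
    fix \<psi> \<phi> \<theta> :: "'n pt \<Rightarrow> complex^'m" and a :: complex
    assume p: "\<psi> \<in> L2"
    show "0 \<le> Re (ip \<psi> \<psi>)" by (rule M.ip_pos[OF sub[OF p]])
    assume q: "\<phi> \<in> L2"
    show "ip (sc a \<psi>) \<phi> = a * ip \<psi> \<phi>" by (rule M.ip_scale[OF sub[OF p] sub[OF q]])
    show "ip \<phi> \<psi> = cnj (ip \<psi> \<phi>)" by (rule M.ip_cnj[OF sub[OF p] sub[OF q]])
    assume r: "\<theta> \<in> L2"
    show "ip (\<psi> + \<phi>) \<theta> = ip \<psi> \<theta> + ip \<phi> \<theta>" by (rule M.ip_add[OF sub[OF p] sub[OF q] sub[OF r]])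
  qed
  show "semi_hilbert sc ip L2"
  proof
    fix X :: "nat \<Rightarrow> 'n pt \<Rightarrow> complex^'m"
    assume X: "\<And>n. X n \<in> L2" and c: "\<And>e. 0 < e \<Longrightarrow> \<exists>K. \<forall>k\<ge>K. \<forall>j\<ge>K. A.N (X k - X j) < e"
    obtain \<psi> where \<psi>: "\<psi> \<in> M2" "M.tends X \<psi>"
      using M2_complete[of X] X L2_M2 c by blast
    have "\<psi> \<in> M.clo L2" unfolding M.clo_iff[OF L2_M2] using \<psi> X by blast
    hence "\<psi> \<in> L2" unfolding L2_eq using M.clo_clo[OF Ceq_M2] by blast
    thus "\<exists>\<psi>\<in>L2. A.tends X \<psi>" using \<psi>(2) by blast
  qed
qed

lemma LN_eq: "L.N = L2_norm \<mu> h" by (rule ext) (simp add: L.N_def L2_norm_def)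

lemma Ceq_L2: "Ceq \<subseteq> L2" unfolding L2_eq by (rule M.clo_superset[OF Ceq_M2])

lemma L2_dense: assumes "Ceq \<subseteq> L.clo S" "S \<subseteq> L2" shows "L2 \<subseteq> L.clo S"
proof -
  have "M.clo Ceq \<subseteq> L.clo Ceq"
  proof
    fix x assume x: "x \<in> M.clo Ceq"
    hence "x \<in> L2" by (simp only: L2_eq)
    moreover have "\<forall>\<delta>>0. \<exists>s\<in>Ceq. M.N (x - s) < \<delta>" using x unfolding M.clo_def by blast
    ultimately show "x \<in> L.clo Ceq" unfolding L.clo_def by blast
  qed
  hence "L2 \<subseteq> L.clo (L.clo S)" using L2_eq L.clo_mono[OF assms(1)] by blast
  thus ?thesis using L.clo_clo[OF assms(2)] by blast
qed

lemma LN_sup: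
  assumes "\<psi> \<in> Ceq" "\<And>p. norm (\<psi> p) \<le> \<delta>" "\<And>x. n2 x \<le> C * (norm x)\<^sup>2" "0 \<le> C"
  shows "L.N \<psi> \<le> sqrt C * \<delta>"
proof -
  have m: "\<psi> \<in> M2" using assms(1) Ceq_M2 by blast
  have d0: "0 \<le> \<delta>" using order_trans[OF norm_ge_zero assms(2)] .
  have "n2 (\<psi> p) \<le> C * \<delta>\<^sup>2" for p
    using order_trans[OF assms(3) mult_left_mono[OF power_mono[OF assms(2) norm_ge_zero] assms(4)]] .
  hence "(M.N \<psi>)\<^sup>2 \<le> (LINT C'|\<mu>. C * \<delta>\<^sup>2)"
    unfolding N_sq_integral[OF m] using m by (intro integral_mono) (auto simp: M2_def)
  moreover have "measure \<mu> (space \<mu>) = 1" using emeasure_one by (simp add: measure_def)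
  ultimately have "(M.N \<psi>)\<^sup>2 \<le> (sqrt C * \<delta>)\<^sup>2" using assms(4) by (simp add: power_mult_distrib)
  thus ?thesis by (rule power2_le_imp_le) (use d0 assms(4) in simp)
qed

end

section \<open>Left-invariant fields, their divergence and rules for derivatives\<close>

lemma smooth_Pair: "smooth f \<Longrightarrow> smooth g \<Longrightarrow> smooth (\<lambda>x. (f x, g x))"
proof -
  assume f: "smooth f" and g: "smooth g"
  have "smooth (\<lambda>x. (f x, 0) + (0, g x))"
    by (intro smooth_add smooth_linear_comp[OF _ f] smooth_linear_comp[OF _ g] bounded_linear_Pair bounded_linear_zero bounded_linear_ident)
  thus ?thesis by simp
qed

lemma smooth_flow_snd:
  fixes B :: "real^'n^'n"
  assumes "nil_flow B" shows "smooth (\<lambda>p::'n pt. flow B (snd p) *v w)"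
proof -
  interpret nil_flow B by fact
  have bl: "bounded_linear (\<lambda>M::real^'n^'n. M *v w)"
    by (simp add: linear_conv_bounded_linear[symmetric] linear_iff matrix_vector_mult_add_rdistrib scaleR_matrix_vector_assoc[symmetric])
  show ?thesis by (intro smooth_linear_comp[OF bl] smooth_compose_linear[OF bounded_linear_snd smooth_flow])
qed

context nil_flow
begin

lemma smooth_left_field: "smooth (left_field B v)"
  unfolding left_field_formula[abs_def]
  by (intro smooth_Pair smooth_flow_snd smooth_const) (rule nil_flow_axioms)

lemma push_left_field: "push_field B p (left_field B v) = left_field B v"
proof
  fix q
  have "snd (inv\<^bsub>sdp B\<^esub> p \<odot> q) = snd q - snd p" by (simp add: sdp_simps inv_sdp)
  moreover have "flow B (snd p) ** flow B (snd q - snd p) = flow B (snd q)"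
    using flow_add[of "snd p" "snd q - snd p"] by simp
  ultimately show "push_field B p (left_field B v) q = left_field B v q"
    by (simp add: push_field_def Let_def dleft_eq left_field_formula matrix_vector_mul_assoc)
qed

lemma push_at: "push_field B p X p = dleft B p (0, 0) (X (0, 0))"
proof -
  have "inv\<^bsub>sdp B\<^esub> p \<odot> p = (0, 0)" using Gr.l_inv[of p] by (simp add: sdp_simps(2))
  thus ?thesis by (simp add: push_field_def Let_def)
qed

lemma mul_one [simp]: "p \<odot> (0, 0) = p" by (simp add: sdp_simps)

text \<open>The density is constant because the flow has determinant 1. The field depends on the
  height only, so derivatives along the ideal vanish, and its vertical component is
  constant.\<close>

lemma divergence_left_field: "divergence B (left_field B v) p = 0"
proof -
  have "frechet_derivative (\<lambda>q. vol_density B q * (left_field B v q \<bullet> u)) (at p) u = 0" if u: "u \<in> Basis" for u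
  proof -
    define f where "f t = (flow B t *v fst v, snd v) \<bullet> u" for t
    have e: "(\<lambda>q. vol_density B q * (left_field B v q \<bullet> u)) = (\<lambda>q. f (snd q))"
      by (simp add: vol_density_def left_field_formula f_def)
    have blf: "bounded_linear (\<lambda>M::real^'n^'n. (M *v fst v) \<bullet> fst u)"
      by (simp add: linear_conv_bounded_linear[symmetric] linear_iff matrix_vector_mult_add_rdistrib inner_add_left scaleR_matrix_vector_assoc[symmetric])
    have "((\<lambda>t. (flow B t *v fst v) \<bullet> fst u + snd v * snd u) has_vector_derivative ((flow B t ** B) *v fst v) \<bullet> fst u + 0) (at t)" for t
      by (intro has_vector_derivative_add bounded_linear.has_vector_derivative[OF blf flow_deriv] has_vector_derivative_const)
    hence "(f has_vector_derivative ((flow B t ** B) *v fst v) \<bullet> fst u) (at t)" for t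
      by (simp add: f_def[abs_def] inner_prod_def)
    hence "(f has_derivative (\<lambda>x. x *\<^sub>R (((flow B (snd p) ** B) *v fst v) \<bullet> fst u))) (at (snd p))"
      by (simp add: has_vector_derivative_def)
    from diff_chain_at[OF bounded_linear.has_derivative[OF bounded_linear_snd has_derivative_ident] this]
    have "((\<lambda>q. f (snd q)) has_derivative (\<lambda>x. snd x *\<^sub>R (((flow B (snd p) ** B) *v fst v) \<bullet> fst u))) (at p)"
      by (simp add: o_def)
    from frechet_derivative_at[OF this]
    have "frechet_derivative (\<lambda>q. f (snd q)) (at p) u = snd u *\<^sub>R (((flow B (snd p) ** B) *v fst v) \<bullet> fst u)"
      by (rule fun_cong[OF sym])
    moreover have "snd u = 0 \<or> fst u = 0" using u by (auto simp: Basis_prod_def)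
    ultimately show ?thesis unfolding e by auto
  qed
  thus ?thesis by (simp add: divergence_def)
qed

end

lemma frechet_bilinear:
  assumes "bounded_bilinear b" "f differentiable (at p)" "g differentiable (at p)"
  shows "frechet_derivative (\<lambda>x. b (f x) (g x)) (at p) v
     = b (f p) (frechet_derivative g (at p) v) + b (frechet_derivative f (at p) v) (g p)"
proof -
  have "((\<lambda>x. b (f x) (g x)) has_derivative (\<lambda>v. b (f p) (frechet_derivative g (at p) v) + b (frechet_derivative f (at p) v) (g p))) (at p)"
    by (rule bounded_bilinear.FDERIV[OF assms(1)]) (use assms frechet_derivative_works in auto)
  from frechet_derivative_at[OF this] show ?thesis by (rule fun_cong[OF sym])
qed

lemma frechet_linear:
  assumes "bounded_linear L" "f differentiable (at p)"
  shows "frechet_derivative (\<lambda>x. L (f x)) (at p) v = L (frechet_derivative f (at p) v)"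
proof -
  have "((\<lambda>x. L (f x)) has_derivative (\<lambda>v. L (frechet_derivative f (at p) v))) (at p)"
    by (rule bounded_linear.has_derivative[OF assms(1)]) (use assms(2) frechet_derivative_works in blast)
  from frechet_derivative_at[OF this] show ?thesis by (rule fun_cong[OF sym])
qed

lemma frechet_add:
  assumes "f differentiable (at p)" "g differentiable (at p)"
  shows "frechet_derivative (\<lambda>x. f x + g x) (at p) v = frechet_derivative f (at p) v + frechet_derivative g (at p) v"
proof -
  have "((\<lambda>x. f x + g x) has_derivative (\<lambda>v. frechet_derivative f (at p) v + frechet_derivative g (at p) v)) (at p)"
    by (rule has_derivative_add[OF assms[THEN frechet_derivative_works[THEN iffD1]]])
  from frechet_derivative_at[OF this] show ?thesis by (rule fun_cong[OF sym])
qed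

lemma smooth_dir_deriv:
  fixes f :: "'a::euclidean_space \<Rightarrow> 'b::real_normed_vector"
  assumes "smooth f" "smooth X" shows "smooth (dir_deriv X f)"
proof -
  have "dir_deriv X f p = (\<Sum>b\<in>Basis. (X p \<bullet> b) *\<^sub>R frechet_derivative f (at p) b)" for p
  proof -
    have bl: "bounded_linear (frechet_derivative f (at p))"
      using smooth_has_derivative[OF assms(1)] has_derivative_bounded_linear by blast
    have "dir_deriv X f p = frechet_derivative f (at p) (\<Sum>b\<in>Basis. (X p \<bullet> b) *\<^sub>R b)"
      by (simp add: dir_deriv_def euclidean_representation)
    thus ?thesis
      by (simp only: linear_sum[OF bounded_linear.linear[OF bl]] linear_scale[OF bounded_linear.linear[OF bl]])
  qed
  moreover have "smooth (\<lambda>p. \<Sum>b\<in>Basis. (X p \<bullet> b) *\<^sub>R frechet_derivative f (at p) b)"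
    by (intro smooth_sum smooth_scaleR smooth_linear_comp[OF bounded_linear_inner_left] assms smooth_frechet)
  ultimately show ?thesis by presburger
qed

lemma smooth_differentiable: "smooth f \<Longrightarrow> f differentiable (at p)"
  using smooth_has_derivative differentiableI by blast

section \<open>The sub-Dirac operator\<close>

locale dirac_setting = spinor_l2 B \<mu> h \<epsilon>
  for B :: "real^'n^'n" and \<mu> and h :: "complex^'m \<Rightarrow> complex^'m \<Rightarrow> complex" and \<epsilon> +
  fixes d :: nat
    and H :: "'n pt \<Rightarrow> 'n pt set"
    and g :: "'n pt \<Rightarrow> 'n pt \<Rightarrow> 'n pt \<Rightarrow> real"
    and nabla :: "('n pt \<Rightarrow> 'n pt) \<Rightarrow> ('n pt \<Rightarrow> 'n pt)
                    \<Rightarrow> ('n pt \<Rightarrow> 'n pt)"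
    and cl :: "'n pt \<Rightarrow> complex^'m \<Rightarrow> complex^'m"
    and s :: "nat \<Rightarrow> 'n pt"
    and Ore :: "(nat \<Rightarrow> 'n pt) set"
  assumes lid: "left_invariant_distribution B d H"
    and bg: "bracket_generating B (H (0, 0))"
    and bH: "bvec \<in> H (0, 0)"
    and lim: "left_invariant_metric B H g"
    and mc: "metric_connection H g nabla"
    and lic: "left_invariant_connection B H nabla"
    and dc: "divergence_condition B d H g nabla"
    and hom: "lattice_hom B \<epsilon>"
    and spin: "spinor_representation (H (0, 0)) (g (0, 0)) cl h"
    and ab: "adapted_basis d (H (0, 0)) (g (0, 0)) Ore s"
begin

declare One_nat_def [simp del]

lemma H_sub: "subspace (H p)" using lid unfolding left_invariant_distribution_def by blast

lemma s_span: "span (s ` {1..d}) = H (0, 0)" using ab by (auto simp: adapted_basis_def ordered_basis_def)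

lemma s_H: "i \<in> {1..d} \<Longrightarrow> s i \<in> H (0, 0)" using s_span span_base[of "s i" "s ` {1..d}"] by auto

lemma s_ideal: "i \<in> {1..<d} \<Longrightarrow> snd (s i) = 0" using ab by (auto simp: adapted_basis_def ideal_n_def)

lemma s_orth: "i \<in> {1..d} \<Longrightarrow> j \<in> {1..d} \<Longrightarrow> g (0, 0) (s i) (s j) = (if i = j then 1 else 0)"
  using ab by (auto simp: adapted_basis_def orthonormal_def)

lemma d_pos: "1 \<le> d"
proof (rule ccontr)
  assume "\<not> 1 \<le> d"
  hence "H (0, 0) = {0}" using s_span by simp
  thus False using bH by (simp add: bvec_def prod_eq_iff)
qed

lemma d_in: "d \<in> {1..d}" using d_pos by simp

definition cc where "cc = snd (s d)"

lemma s_d: "s d = (0, cc)" "0 < cc"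
  using ab by (auto simp: adapted_basis_def cc_def bvec_def scaleR_prod_def)

lemma s_path: "i \<in> {1..d} \<Longrightarrow> fst (s i) = 0 \<or> snd (s i) = 0"
  using s_ideal[of i] s_d(1) by (cases "i = d") auto

abbreviation "X i \<equiv> left_field B (s i)"

lemma X_section: assumes "i \<in> {1..d}" shows "X i \<in> sections H"
proof -
  have "X i p \<in> H p" for p
  proof -
    have "dleft B p (0, 0) ` H (0, 0) = H p" using lid mul_one[of p] unfolding left_invariant_distribution_def by metis
    thus ?thesis using s_H[OF assms] unfolding left_field_def sdp_simps(2) by blast
  qed
  thus ?thesis by (simp add: sections_def smooth_left_field)
qed

lemma g_left: assumes "v \<in> H (0, 0)" "w \<in> H (0, 0)"
  shows "g p (dleft B p (0, 0) v) (dleft B p (0, 0) w) = g (0, 0) v w"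
  using lim assms mul_one[of p] unfolding left_invariant_metric_def by metis

lemma g_ip: "inner_product_on (H p) (g p)" using lim unfolding left_invariant_metric_def by blast
lemma g_sym: "v \<in> H p \<Longrightarrow> w \<in> H p \<Longrightarrow> g p v w = g p w v" using g_ip[of p] unfolding inner_product_on_def by blast
lemma g_lin: "u \<in> H p \<Longrightarrow> v \<in> H p \<Longrightarrow> w \<in> H p \<Longrightarrow> g p (a *\<^sub>R u + v) w = a * g p u w + g p v w"
  using g_ip[of p] unfolding inner_product_on_def by blast

definition G\<Gamma> :: "nat \<Rightarrow> nat \<Rightarrow> nat \<Rightarrow> real" where "G\<Gamma> i j k = christoffel B g nabla s i j k (0, 0)"

lemma X_one: "X i (0, 0) = s i" by (simp add: left_field_formula)

lemma X_dleft: "X i p = dleft B p (0, 0) (s i)" unfolding left_field_def sdp_simps(2) ..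

lemma nabla_section: "i \<in> {1..d} \<Longrightarrow> j \<in> {1..d} \<Longrightarrow> nabla (X i) (X j) \<in> sections H"
  using mc X_section unfolding metric_connection_def by blast

lemma nabla_left: assumes "i \<in> {1..d}" "j \<in> {1..d}"
  shows "nabla (X i) (X j) p = dleft B p (0, 0) (nabla (X i) (X j) (0, 0))"
proof -
  have "nabla (push_field B p (X i)) (push_field B p (X j)) = push_field B p (nabla (X i) (X j))"
    using lic X_section assms unfolding left_invariant_connection_def by blast
  hence "nabla (X i) (X j) = push_field B p (nabla (X i) (X j))" by (simp only: push_left_field)
  thus ?thesis using push_at by metis
qed

text \<open>The connection, the frame and the metric are all left-invariant, so everything is
  transported to the identity.\<close>

lemma christoffel_const: assumes "i \<in> {1..d}" "j \<in> {1..d}" "k \<in> {1..d}"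
  shows "christoffel B g nabla s i j k p = G\<Gamma> i j k"
proof -
  have "nabla (X i) (X j) (0, 0) \<in> H (0, 0)" using nabla_section assms by (auto simp: sections_def)
  hence "christoffel B g nabla s i j k p = g (0, 0) (nabla (X i) (X j) (0, 0)) (s k)"
    unfolding christoffel_def nabla_left[OF assms(1,2), of p] X_dleft[of k p] using s_H[OF assms(3)] by (rule g_left)
  thus ?thesis by (simp add: G\<Gamma>_def christoffel_def X_one)
qed

lemma g_X: "i \<in> {1..d} \<Longrightarrow> j \<in> {1..d} \<Longrightarrow> g p (X i p) (X j p) = (if i = j then 1 else 0)"
  unfolding X_dleft by (simp add: g_left s_H s_orth)

text \<open>Metric compatibility applied to the constant products of an orthonormal frame.\<close>

lemma \<Gamma>_antisym: assumes "i \<in> {1..d}" "j \<in> {1..d}" "k \<in> {1..d}" shows "G\<Gamma> i j k = - G\<Gamma> i k j"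
proof -
  have "dir_deriv (X i) (\<lambda>q. g q (X j q) (X k q)) (0, 0) =
      g (0, 0) (nabla (X i) (X j) (0, 0)) (X k (0, 0)) + g (0, 0) (X j (0, 0)) (nabla (X i) (X k) (0, 0))"
    using mc X_section assms unfolding metric_connection_def by blast
  moreover have "dir_deriv (X i) (\<lambda>q. g q (X j q) (X k q)) (0, 0) = 0"
    by (simp only: g_X[OF assms(2,3)] dir_deriv_def) (simp add: frechet_derivative_const)
  moreover have "g (0, 0) (X j (0, 0)) (nabla (X i) (X k) (0, 0)) = G\<Gamma> i k j"
    unfolding G\<Gamma>_def christoffel_def using X_section nabla_section assms by (intro g_sym) (auto simp: sections_def)
  ultimately show ?thesis by (simp add: G\<Gamma>_def christoffel_def)
qed

lemma \<Gamma>_trace: assumes "j \<in> {1..d}" shows "(\<Sum>i=1..d. G\<Gamma> i j i) = 0"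
proof -
  have o: "\<forall>p\<in>UNIV. orthonormal d (g p) (\<lambda>i. X i p)" by (simp add: orthonormal_def g_X)
  have "divergence B (X j) (0, 0) = (\<Sum>i=1..d. g (0, 0) (nabla (X i) (X j) (0, 0)) (X i (0, 0)))"
    using dc[unfolded divergence_condition_def, rule_format, of "X j" UNIV X "(0, 0)"] X_section assms o by simp
  thus ?thesis by (simp add: divergence_left_field G\<Gamma>_def christoffel_def)
qed

lemmas spin' = spin[unfolded spinor_representation_def]

lemma cl_lin: "v \<in> H (0, 0) \<Longrightarrow> cl v (a *s x + y) = a *s cl v x + cl v y"
  by (rule spin'[THEN conjunct1, rule_format])
lemma cl_vec: "v \<in> H (0, 0) \<Longrightarrow> w \<in> H (0, 0) \<Longrightarrow> cl (a *\<^sub>R v + w) x = a *\<^sub>R cl v x + cl w x"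
  by (rule spin'[THEN conjunct2, THEN conjunct1, rule_format])
lemma cl_sq: "v \<in> H (0, 0) \<Longrightarrow> cl v (cl v x) = - (g (0, 0) v v *\<^sub>R x)"
  by (rule spin'[THEN conjunct2, THEN conjunct2, THEN conjunct1, rule_format])
lemma cl_anti: "v \<in> H (0, 0) \<Longrightarrow> h (cl v x) y = - h x (cl v y)"
  by (rule spin'[THEN conjunct2, THEN conjunct2, THEN conjunct2, THEN conjunct2, THEN conjunct2, rule_format])

lemma cl_bl: "v \<in> H (0, 0) \<Longrightarrow> bounded_linear (cl v)" by (rule clinear_bounded[OF cl_lin])

lemma cl_add: "v \<in> H (0, 0) \<Longrightarrow> cl v (x + y) = cl v x + cl v y"
  using linear_add[OF bounded_linear.linear[OF cl_bl]] .
lemma cl_smult: "v \<in> H (0, 0) \<Longrightarrow> cl v (a *s x) = a *s cl v x"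
  using cl_lin[of v a x 0] linear_0[OF bounded_linear.linear[OF cl_bl]] by simp
lemma cl_scaleR: "v \<in> H (0, 0) \<Longrightarrow> cl v (a *\<^sub>R x) = a *\<^sub>R cl v x"
  using linear_scale[OF bounded_linear.linear[OF cl_bl]] .

text \<open>Polarisation of \<open>cl_sq\<close>.\<close>

lemma clifford: assumes v: "v \<in> H (0, 0)" and w: "w \<in> H (0, 0)"
  shows "cl v (cl w x) + cl w (cl v x) = - (2 * g (0, 0) v w) *\<^sub>R x"
proof -
  have vw: "v + w \<in> H (0, 0)" using subspace_add[OF H_sub] v w by blast
  have c: "cl (v + w) y = cl v y + cl w y" for y using cl_vec[OF v w, of 1 y] by simp
  have "g (0, 0) (v + w) (v + w) = g (0, 0) v (v + w) + g (0, 0) w (v + w)" using g_lin[OF v w vw, of 1] by simp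
  also have "g (0, 0) v (v + w) = g (0, 0) v v + g (0, 0) w v" using g_sym[OF v vw] g_lin[OF v w v, of 1] by simp
  also have "g (0, 0) w (v + w) = g (0, 0) v w + g (0, 0) w w" using g_sym[OF w vw] g_lin[OF v w w, of 1] by simp
  finally have gg: "g (0, 0) (v + w) (v + w) = g (0, 0) v v + 2 * g (0, 0) v w + g (0, 0) w w" using g_sym[OF v w] by simp
  have "cl (v + w) (cl (v + w) x) = cl v (cl v x) + cl v (cl w x) + (cl w (cl v x) + cl w (cl w x))"
    by (simp add: c cl_add v w)
  hence "- (g (0, 0) (v + w) (v + w) *\<^sub>R x) = - (g (0, 0) v v *\<^sub>R x) + cl v (cl w x) + (cl w (cl v x) + - (g (0, 0) w w *\<^sub>R x))"
    by (simp only: cl_sq[OF vw] cl_sq[OF v] cl_sq[OF w])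
  thus ?thesis unfolding gg by (simp add: scaleR_add_left algebra_simps)
qed

abbreviation "c i \<equiv> cl (s i)"

lemma c_anticomm: assumes "i \<in> {1..d}" "j \<in> {1..d}"
  shows "c i (c j x) = - c j (c i x) - (if i = j then 2 else 0) *\<^sub>R x"
  using clifford[OF s_H[OF assms(1)] s_H[OF assms(2)], of x] s_orth[OF assms] by (auto simp: algebra_simps eq_neg_iff_add_eq_0)

definition W :: "complex^'m \<Rightarrow> complex^'m" where
  "W x = (1/4) *\<^sub>R (\<Sum>i=1..d. \<Sum>j=1..d. \<Sum>k=1..d. G\<Gamma> i j k *\<^sub>R c i (c j (c k x)))"

lemma W_lin: "W (a *s x + y) = a *s W x + W y"
proof -
  have sm: "a *s (r *\<^sub>R z) = r *\<^sub>R (a *s z)" for r and z :: "complex^'m" by (simp add: scaleR_eq_smult mult.commute)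
  have ss: "a *s (\<Sum>i\<in>I. f i) = (\<Sum>i\<in>I. a *s f i)" for I and f :: "nat \<Rightarrow> complex^'m"
    by (induction I rule: infinite_finite_induct) (auto simp: vector_add_ldistrib)
  have "c i (c j (c k (a *s x + y))) = a *s c i (c j (c k x)) + c i (c j (c k y))"
    if "i \<in> {1..d}" "j \<in> {1..d}" "k \<in> {1..d}" for i j k
    by (simp only: cl_lin[OF s_H[OF that(1)]] cl_lin[OF s_H[OF that(2)]] cl_lin[OF s_H[OF that(3)]])
  hence t: "G\<Gamma> i j k *\<^sub>R c i (c j (c k (a *s x + y))) = a *s (G\<Gamma> i j k *\<^sub>R c i (c j (c k x))) + G\<Gamma> i j k *\<^sub>R c i (c j (c k y))"
    if "i \<in> {1..d}" "j \<in> {1..d}" "k \<in> {1..d}" for i j k using that by (simp only: sm scaleR_add_right)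
  have "(\<Sum>i=1..d. \<Sum>j=1..d. \<Sum>k=1..d. G\<Gamma> i j k *\<^sub>R c i (c j (c k (a *s x + y)))) =
     (\<Sum>i=1..d. \<Sum>j=1..d. \<Sum>k=1..d. a *s (G\<Gamma> i j k *\<^sub>R c i (c j (c k x))) + G\<Gamma> i j k *\<^sub>R c i (c j (c k y)))"
    by (intro sum.cong refl t)
  also have "... = a *s (\<Sum>i=1..d. \<Sum>j=1..d. \<Sum>k=1..d. G\<Gamma> i j k *\<^sub>R c i (c j (c k x)))
      + (\<Sum>i=1..d. \<Sum>j=1..d. \<Sum>k=1..d. G\<Gamma> i j k *\<^sub>R c i (c j (c k y)))"
    by (simp only: sum.distrib ss)
  finally show ?thesis unfolding W_def by (simp only: scaleR_add_right sm)
qed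

text \<open>Reversing a product of three anticommuting factors takes three transpositions, hence the
  opposite sign; each transposition leaves a contraction when the two indices agree.\<close>

lemma c_triple: assumes i: "i \<in> {1..d}" and j: "j \<in> {1..d}" and k: "k \<in> {1..d}"
  shows "c k (c j (c i x)) + c i (c j (c k x)) =
     (if i = k then 2 else 0) *\<^sub>R c j x - (if j = k then 2 else 0) *\<^sub>R c i x - (if i = j then 2 else 0) *\<^sub>R c k x"
proof -
  note l = linear_diff[OF bounded_linear.linear[OF cl_bl[OF s_H]]] linear_neg[OF bounded_linear.linear[OF cl_bl[OF s_H]]] cl_scaleR[OF s_H]
  have 1: "c k (c j (c i x)) = - c k (c i (c j x)) - (if j = i then 2 else 0) *\<^sub>R c k x"
    by (subst c_anticomm[OF j i]) (simp only: l[OF k])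
  have 2: "c k (c i (c j x)) = - c i (c k (c j x)) - (if k = i then 2 else 0) *\<^sub>R c j x" by (rule c_anticomm[OF k i])
  have 3: "c i (c k (c j x)) = - c i (c j (c k x)) - (if k = j then 2 else 0) *\<^sub>R c i x"
    by (subst c_anticomm[OF k j]) (simp only: l[OF i])
  show ?thesis unfolding 1 2 3 by auto
qed

text \<open>The adjoint of \<open>c i\<close>, \<open>c j\<close>, \<open>c k\<close> in this order
  is minus the reversed product, so only contractions of the Christoffel symbols are left over.
  Those with \<open>j = k\<close> vanish by antisymmetry, those with \<open>i = k\<close> by the
  divergence condition, and those with \<open>i = j\<close> by both together.\<close>

lemma W_herm: "h (W x) y = h x (W y)"
proof -
  have t: "h (c i (c j (c k x))) y = - h x (c k (c j (c i y)))"
    if "i \<in> {1..d}" "j \<in> {1..d}" "k \<in> {1..d}" for i j k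
    by (simp only: cl_anti[OF s_H[OF that(1)]] cl_anti[OF s_H[OF that(2)]] cl_anti[OF s_H[OF that(3)]] minus_minus)
  let ?S = "\<lambda>F. (\<Sum>i=1..d. \<Sum>j=1..d. \<Sum>k=1..d. F i j k) :: complex^'m"
  have "h (W x) y = (1/4) *\<^sub>R (\<Sum>i=1..d. \<Sum>j=1..d. \<Sum>k=1..d. G\<Gamma> i j k *\<^sub>R (- h x (c k (c j (c i y)))))"
    unfolding W_def h_scaleR h_sum using t by (intro arg_cong[of _ _ "(*\<^sub>R) (1/4)"] sum.cong refl) simp
  also have "... = h x ((1/4) *\<^sub>R ?S (\<lambda>i j k. G\<Gamma> i j k *\<^sub>R (- c k (c j (c i y)))))"
    by (simp add: h_scaleR_right h_sum_right h_minus_right)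
  also have "?S (\<lambda>i j k. G\<Gamma> i j k *\<^sub>R (- c k (c j (c i y)))) = ?S (\<lambda>i j k. G\<Gamma> i j k *\<^sub>R c i (c j (c k y)))"
  proof -
    have "?S (\<lambda>i j k. G\<Gamma> i j k *\<^sub>R c i (c j (c k y))) - ?S (\<lambda>i j k. G\<Gamma> i j k *\<^sub>R (- c k (c j (c i y))))
       = ?S (\<lambda>i j k. G\<Gamma> i j k *\<^sub>R (c k (c j (c i y)) + c i (c j (c k y))))"
      by (simp add: sum_subtractf[symmetric] scaleR_add_right add.commute)
    also have "... = ?S (\<lambda>i j k. (if i = k then (2 * G\<Gamma> i j k) *\<^sub>R c j y else 0)
        - (if j = k then (2 * G\<Gamma> i j k) *\<^sub>R c i y else 0) - (if i = j then (2 * G\<Gamma> i j k) *\<^sub>R c k y else 0))"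
      by (intro sum.cong refl) (simp only: c_triple, auto simp: algebra_simps)
    also have "... = (\<Sum>i=1..d. \<Sum>j=1..d. (2 * G\<Gamma> i j i) *\<^sub>R c j y) - (\<Sum>i=1..d. \<Sum>j=1..d. (2 * G\<Gamma> i j j) *\<^sub>R c i y)
        - (\<Sum>i=1..d. \<Sum>k=1..d. (2 * G\<Gamma> i i k) *\<^sub>R c k y)"
    proof -
      have a: "(\<Sum>j=1..d. \<Sum>k=1..d. if i = j then F i j k else 0) = (\<Sum>k=1..d. F i i k)" if "i \<in> {1..d}" for i and F :: "nat \<Rightarrow> nat \<Rightarrow> nat \<Rightarrow> complex^'m"
      proof -
        have "(\<Sum>j=1..d. \<Sum>k=1..d. if i = j then F i j k else 0) = (\<Sum>j=1..d. if i = j then \<Sum>k=1..d. F i j k else 0)"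
          by (intro sum.cong refl) auto
        also have "... = (\<Sum>k=1..d. F i i k)" using that by (subst sum.delta') auto
        finally show ?thesis .
      qed
      have e1: "(\<Sum>i=1..d. \<Sum>j=1..d. \<Sum>k=1..d. if i = k then F i j k else 0) = (\<Sum>i=1..d. \<Sum>j=1..d. F i j i)" for F :: "nat \<Rightarrow> nat \<Rightarrow> nat \<Rightarrow> complex^'m"
        by (intro sum.cong refl) (simp add: sum.delta')
      have e2: "(\<Sum>i=1..d. \<Sum>j=1..d. \<Sum>k=1..d. if j = k then F i j k else 0) = (\<Sum>i=1..d. \<Sum>j=1..d. F i j j)" for F :: "nat \<Rightarrow> nat \<Rightarrow> nat \<Rightarrow> complex^'m"
        by (intro sum.cong refl) (simp add: sum.delta')
      have e3: "(\<Sum>i=1..d. \<Sum>j=1..d. \<Sum>k=1..d. if i = j then F i j k else 0) = (\<Sum>i=1..d. \<Sum>k=1..d. F i i k)" for F :: "nat \<Rightarrow> nat \<Rightarrow> nat \<Rightarrow> complex^'m"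
        by (intro sum.cong refl a)
      show ?thesis by (simp only: sum_subtractf e1 e2 e3)
    qed
    also have "(\<Sum>i=1..d. \<Sum>j=1..d. (2 * G\<Gamma> i j i) *\<^sub>R c j y) = (\<Sum>j=1..d. (2 * (\<Sum>i=1..d. G\<Gamma> i j i)) *\<^sub>R c j y)"
      by (subst sum.swap) (simp add: scaleR_sum_left sum_distrib_left)
    also have "... = 0" by (simp add: \<Gamma>_trace)
    also have "(\<Sum>i=1..d. \<Sum>j=1..d. (2 * G\<Gamma> i j j) *\<^sub>R c i y) = 0"
    proof -
      have "G\<Gamma> i j j = 0" if "i \<in> {1..d}" "j \<in> {1..d}" for i j using \<Gamma>_antisym[OF that that(2)] by simp
      thus ?thesis by simp
    qed
    also have "(\<Sum>i=1..d. \<Sum>k=1..d. (2 * G\<Gamma> i i k) *\<^sub>R c k y) = (\<Sum>k=1..d. (2 * - (\<Sum>i=1..d. G\<Gamma> i k i)) *\<^sub>R c k y)"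
    proof -
      have "(\<Sum>i=1..d. \<Sum>k=1..d. (2 * G\<Gamma> i i k) *\<^sub>R c k y) = (\<Sum>i=1..d. \<Sum>k=1..d. (2 * - G\<Gamma> i k i) *\<^sub>R c k y)"
        by (intro sum.cong refl) (metis \<Gamma>_antisym)
      also have "... = (\<Sum>k=1..d. (2 * - (\<Sum>i=1..d. G\<Gamma> i k i)) *\<^sub>R c k y)"
        by (subst sum.swap) (simp add: scaleR_sum_left sum_distrib_left sum_negf)
      finally show ?thesis .
    qed
    also have "... = 0" by (simp add: \<Gamma>_trace)
    finally show ?thesis by simp
  qed
  also have "h x ((1/4) *\<^sub>R ?S (\<lambda>i j k. G\<Gamma> i j k *\<^sub>R c i (c j (c k y)))) = h x (W y)" by (simp add: W_def)
  finally show ?thesis .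
qed

abbreviation "Dsub \<equiv> sub_dirac B d g nabla cl s :: ('n pt \<Rightarrow> complex^'m) \<Rightarrow> _"

lemma Dsub_eq: "Dsub \<psi> p = (\<Sum>i=1..d. c i (dir_deriv (X i) \<psi> p)) + W (\<psi> p)"
  unfolding sub_dirac_def W_def
  by (intro arg_cong2[where f = "(+)"] arg_cong[where f = "(*\<^sub>R) (1/4)"] sum.cong refl) (simp only: christoffel_const)

abbreviation "SS \<equiv> smooth_spinors B \<epsilon> :: ('n pt \<Rightarrow> complex^'m) set"

lemma SS_D: "\<psi> \<in> SS \<Longrightarrow> smooth \<psi>" "\<psi> \<in> SS \<Longrightarrow> equi \<psi>" by (auto simp: smooth_spinors_def)

lemma SS_Ceq: "SS \<subseteq> Ceq" by (auto simp: smooth_spinors_def Ceq_def smooth_continuous)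

lemma SS_sub: "VS.subspace SS"
proof (rule VS.subspaceI)
  show "0 \<in> SS" by (simp add: smooth_spinors_def zero_fun_def equi_zero)
  show "\<psi> + \<phi> \<in> SS" if "\<psi> \<in> SS" "\<phi> \<in> SS" for \<psi> \<phi>
    using that by (simp add: smooth_spinors_def plus_fun_def equi_add smooth_add)
  show "sc a \<psi> \<in> SS" if "\<psi> \<in> SS" for a \<psi>
    using that by (simp add: smooth_spinors_def equi_smult smooth_bilinear[OF smult_bounded_bilinear smooth_const])
qed

lemma equi_dir_deriv:
  assumes v: "fst v = 0 \<or> snd v = 0" and "smooth \<psi>" "equi \<psi>" shows "equi (Xd v \<psi>)"
  unfolding equi_iff
proof (intro ballI allI)
  fix \<gamma> p assume g: "\<gamma> \<in> \<Gamma>"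
  note dp = deriv_along_path[OF v smooth_differentiable[OF assms(2)]]
  have "((\<lambda>t. \<psi> (\<gamma> \<odot> p \<odot> opath v t)) has_vector_derivative Xd v \<psi> (\<gamma> \<odot> p)) (at 0)"
    using dp[of "\<gamma> \<odot> p" 0] by simp
  moreover have "\<psi> (\<gamma> \<odot> p \<odot> x) = phase \<gamma> *s \<psi> (p \<odot> x)" for x
  proof -
    have "\<gamma> \<odot> p \<odot> x = \<gamma> \<odot> (p \<odot> x)" by (rule Gr.m_assoc) auto
    thus ?thesis using assms(3) g unfolding equi_iff by metis
  qed
  ultimately have "((\<lambda>t. phase \<gamma> *s \<psi> (p \<odot> opath v t)) has_vector_derivative Xd v \<psi> (\<gamma> \<odot> p)) (at 0)"
    by (simp only:)
  moreover have "((\<lambda>t. phase \<gamma> *s \<psi> (p \<odot> opath v t)) has_vector_derivative phase \<gamma> *s Xd v \<psi> p) (at 0)"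
    by (rule bounded_linear.has_vector_derivative[OF bounded_bilinear.bounded_linear_right[OF smult_bounded_bilinear]])
      (use dp[of p 0] in simp)
  ultimately show "Xd v \<psi> (\<gamma> \<odot> p) = phase \<gamma> *s Xd v \<psi> p"
    using vector_derivative_unique_at by blast
qed

lemma equi_clin:
  assumes "\<And>a x y. f (a *s x + y) = a *s f x + f y" "equi \<psi>" shows "equi (\<lambda>p. f (\<psi> p))"
proof -
  have "f (a *s x) = a *s f x" for a x
    using assms(1)[of a x 0] linear_0[OF bounded_linear.linear[OF clinear_bounded[OF assms(1)]]] by simp
  thus ?thesis using assms(2) by (simp add: equi_iff)
qed

lemma equi_sum: "(\<And>i. i \<in> I \<Longrightarrow> equi (\<psi> i)) \<Longrightarrow> equi (\<lambda>p. \<Sum>i\<in>I. \<psi> i p)"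
  by (induction I rule: infinite_finite_induct) (auto simp: equi_zero intro: equi_add)

lemma D_SS: assumes "\<psi> \<in> SS" shows "Dsub \<psi> \<in> SS"
proof -
  note p = SS_D[OF assms]
  have "smooth (Dsub \<psi>)" unfolding Dsub_eq[abs_def]
    by (intro smooth_add smooth_sum smooth_linear_comp[OF cl_bl[OF s_H]] smooth_linear_comp[OF clinear_bounded[OF W_lin]]
        smooth_dir_deriv smooth_left_field p)
  moreover have "equi (Dsub \<psi>)" unfolding Dsub_eq[abs_def]
    by (intro equi_add equi_sum equi_clin[OF cl_lin[OF s_H]] equi_clin[OF W_lin] equi_dir_deriv p s_path)
  ultimately show ?thesis by (simp add: smooth_spinors_def)
qed

text \<open>Pointwise, the difference of the two products is the sum of the derivatives of
  \<open>h (c i (\<psi> p)) (\<phi> p)\<close> along the frame, and each of these integrates to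
  0.\<close>

lemma D_sym: assumes "\<psi> \<in> SS" "\<phi> \<in> SS" shows "ip (Dsub \<psi>) \<phi> = ip \<psi> (Dsub \<phi>)"
proof -
  note p = SS_D[OF assms(1)] and q = SS_D[OF assms(2)]
  define F where "F i p = h (c i (\<psi> p)) (\<phi> p)" for i p
  have sF: "smooth (F i)" if "i \<in> {1..d}" for i unfolding F_def[abs_def]
    by (intro smooth_bilinear[OF h_bilinear] smooth_linear_comp[OF cl_bl[OF s_H[OF that]]] p q)
  have iF: "invariant (F i)" if "i \<in> {1..d}" for i unfolding F_def[abs_def]
    by (intro equi_h equi_clin[OF cl_lin[OF s_H[OF that]]] p q)
  have cXF: "continuous_on UNIV (dir_deriv (X i) (F i))" if "i \<in> {1..d}" for i
    by (intro smooth_continuous smooth_dir_deriv sF smooth_left_field that)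
  have iXF: "invariant (dir_deriv (X i) (F i))" if "i \<in> {1..d}" for i
    by (rule invariant_dir_deriv[OF s_path[OF that] smooth_differentiable[OF sF[OF that]] iF[OF that]])
  have XF: "dir_deriv (X i) (F i) p = h (c i (\<psi> p)) (dir_deriv (X i) \<phi> p) + h (c i (dir_deriv (X i) \<psi> p)) (\<phi> p)"
    if i: "i \<in> {1..d}" for i p
    unfolding dir_deriv_def F_def
    unfolding frechet_bilinear[OF h_bilinear smooth_differentiable[OF smooth_linear_comp[OF cl_bl[OF s_H[OF i]] p(1)]] smooth_differentiable[OF q(1)]]
      frechet_linear[OF cl_bl[OF s_H[OF i]] smooth_differentiable[OF p(1)]] ..
  have pt: "h (Dsub \<psi> p) (\<phi> p) - h (\<psi> p) (Dsub \<phi> p) = (\<Sum>i=1..d. dir_deriv (X i) (F i) p)" for p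
    by (simp add: Dsub_eq h_add h_add_right h_sum h_sum_right W_herm XF cl_anti s_H sum.distrib sum_negf sum_subtractf)
  have M: "Dsub \<psi> \<in> M2" "Dsub \<phi> \<in> M2" "\<psi> \<in> M2" "\<phi> \<in> M2" using D_SS assms SS_Ceq Ceq_M2 by blast+
  have "ip (Dsub \<psi>) \<phi> - ip \<psi> (Dsub \<phi>) = (LINT C|\<mu>. h (Dsub \<psi> (rep C)) (\<phi> (rep C)) - h (\<psi> (rep C)) (Dsub \<phi> (rep C)))"
    unfolding ip_eq integ_def using M2_h M by simp
  also have "... = (LINT C|\<mu>. (\<Sum>i=1..d. dir_deriv (X i) (F i) (rep C)))" by (simp only: pt)
  also have "... = (\<Sum>i=1..d. integ (dir_deriv (X i) (F i)))"
    unfolding integ_def by (intro Bochner_Integration.integral_sum integrable_invariant iXF cXF)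
  also have "... = 0"
    by (intro sum.neutral ballI integ_dir_deriv s_path smooth_differentiable sF iF cXF)
  finally show ?thesis by simp
qed

lemma D_add: assumes "\<psi> \<in> SS" "\<phi> \<in> SS" shows "Dsub (\<psi> + \<phi>) = Dsub \<psi> + Dsub \<phi>"
proof
  fix p
  note sp = smooth_differentiable[OF SS_D(1)[OF assms(1)]] and sq = smooth_differentiable[OF SS_D(1)[OF assms(2)]]
  have e: "dir_deriv (X i) (\<psi> + \<phi>) p = dir_deriv (X i) \<psi> p + dir_deriv (X i) \<phi> p" for i
    unfolding dir_deriv_def plus_fun_def by (rule frechet_add[OF sp sq])
  have "W (x + y) = W x + W y" for x y using W_lin[of 1 x y] by simp
  thus "Dsub (\<psi> + \<phi>) p = (Dsub \<psi> + Dsub \<phi>) p"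
    by (simp add: Dsub_eq e cl_add s_H sum.distrib)
qed

lemma D_scale: assumes "\<psi> \<in> SS" shows "Dsub (sc a \<psi>) = sc a (Dsub \<psi>)"
proof
  fix p
  have e: "dir_deriv (X i) (sc a \<psi>) p = a *s dir_deriv (X i) \<psi> p" for i
    unfolding dir_deriv_def
    by (rule frechet_linear[OF bounded_bilinear.bounded_linear_right[OF smult_bounded_bilinear] smooth_differentiable[OF SS_D(1)[OF assms]]])
  have w: "W (a *s x) = a *s W x" for x
    using W_lin[of a x 0] linear_0[OF bounded_linear.linear[OF clinear_bounded[OF W_lin]]] by simp
  have ss: "a *s (\<Sum>i\<in>I. f i) = (\<Sum>i\<in>I. a *s f i)" for I and f :: "nat \<Rightarrow> complex^'m"
    by (induction I rule: infinite_finite_induct) (auto simp: vector_add_ldistrib)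
  show "Dsub (sc a \<psi>) p = a *s Dsub \<psi> p"
    by (simp add: Dsub_eq e w cl_smult s_H vector_add_ldistrib ss)
qed

lemma SS_L2: "SS \<subseteq> L2" using SS_Ceq Ceq_L2 by blast

sublocale S: sym_op sc ip L2 SS Dsub
proof
  show "VS.subspace SS" by (rule SS_sub)
  show "SS \<subseteq> L2" by (rule SS_L2)
qed (use D_SS SS_L2 D_add D_scale D_sym in blast)+

end

section \<open>Dirac operators on the line\<close>

definition antid :: "real \<Rightarrow> (real \<Rightarrow> 'a::banach) \<Rightarrow> real \<Rightarrow> 'a" where
  "antid a f t = (if a \<le> t then integral {a..t} f else - integral {t..a} f)"

lemma antid_eq:
  assumes f: "continuous_on UNIV f" and c: "c \<le> a" "c \<le> t"
  shows "antid a f t = integral {c..t} f - integral {c..a} f"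
proof -
  have i: "f integrable_on {x..y}" for x y
    using f by (intro integrable_continuous_real) (rule continuous_on_subset, auto)
  show ?thesis
  proof (cases "a \<le> t")
    case True
    thus ?thesis using Henstock_Kurzweil_Integration.integral_combine[OF c(1) True i] by (simp add: antid_def algebra_simps)
  next
    case False
    thus ?thesis using Henstock_Kurzweil_Integration.integral_combine[OF c(2) _ i, of a] by (simp add: antid_def algebra_simps)
  qed
qed

lemma antid_deriv:
  assumes f: "continuous_on UNIV f" shows "(antid a f has_vector_derivative f t) (at t)"
proof -
  define c where "c = min a t - 1"
  have c: "c < a" "c < t" by (auto simp: c_def)
  have "((\<lambda>u. integral {c..u} f) has_vector_derivative f t) (at t within {c..t+1})"
    by (rule integral_has_vector_derivative) (use f c continuous_on_subset in auto)
  hence "((\<lambda>u. integral {c..u} f) has_vector_derivative f t) (at t)"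
    using c by (simp add: at_within_Icc_at)
  hence "((\<lambda>u. integral {c..u} f - integral {c..a} f) has_vector_derivative f t) (at t)"
    by (auto intro!: derivative_eq_intros)
  thus ?thesis
    by (rule has_vector_derivative_transform_within_open[of _ _ _ "{c<..}"])
      (use c antid_eq[OF f, of c a] in auto)
qed

lemma antid_base [simp]: "antid a f a = 0" by (simp add: antid_def)

lemma antid_cont: "continuous_on UNIV f \<Longrightarrow> continuous_on UNIV (antid a f)"
  using antid_deriv has_vector_derivative_continuous by (blast intro: continuous_at_imp_continuous_on)

lemma power_has_integral:
  "a \<le> t \<Longrightarrow> ((\<lambda>s. (s - a) ^ j) has_integral (t - a) ^ Suc j / real (Suc j)) {a..t}"
  "t \<le> a \<Longrightarrow> ((\<lambda>s. (a - s) ^ j) has_integral (a - t) ^ Suc j / real (Suc j)) {t..a}"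
proof -
  assume t: "a \<le> t"
  have d: "((\<lambda>s. (s - a) ^ Suc j / real (Suc j)) has_vector_derivative (x - a) ^ j) (at x within {a..t})" for x
  proof -
    have "((\<lambda>s. (s - a) ^ Suc j / real (Suc j)) has_real_derivative (x - a) ^ j) (at x within {a..t})"
      by (auto intro!: derivative_eq_intros simp del: power_Suc of_nat_Suc)
    thus ?thesis by (simp only: has_real_derivative_iff_has_vector_derivative)
  qed
  show "((\<lambda>s. (s - a) ^ j) has_integral (t - a) ^ Suc j / real (Suc j)) {a..t}"
    using fundamental_theorem_of_calculus[OF t d] by simp
next
  assume t: "t \<le> a"
  have d: "((\<lambda>s. - ((a - s) ^ Suc j) / real (Suc j)) has_vector_derivative (a - x) ^ j) (at x within {t..a})" for x
  proof -
    have "((\<lambda>s. - ((a - s) ^ Suc j) / real (Suc j)) has_real_derivative (a - x) ^ j) (at x within {t..a})"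
      by (auto intro!: derivative_eq_intros simp del: power_Suc of_nat_Suc)
    thus ?thesis by (simp only: has_real_derivative_iff_has_vector_derivative)
  qed
  show "((\<lambda>s. (a - s) ^ j) has_integral (a - t) ^ Suc j / real (Suc j)) {t..a}"
    using fundamental_theorem_of_calculus[OF t d] by simp
qed

text \<open>Each integration raises the power by one and divides by it; iterating yields the
  factorials that make the Picard series converge.\<close>

lemma antid_bound:
  assumes f: "continuous_on UNIV f" and b: "\<And>s. \<bar>s - a\<bar> \<le> \<bar>t - a\<bar> \<Longrightarrow> norm (f s) \<le> M * \<bar>s - a\<bar> ^ j"
  shows "norm (antid a f t) \<le> M * (\<bar>t - a\<bar> ^ Suc j / real (Suc j))"
proof (cases "a \<le> t")
  case True
  have "norm (integral {a..t} f) \<le> integral {a..t} (\<lambda>s. M * (s - a) ^ j)"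
  proof (rule integral_norm_bound_integral)
    show "f integrable_on {a..t}" using f continuous_on_subset by (blast intro: integrable_continuous_real)
    show "(\<lambda>s. M * (s - a) ^ j) integrable_on {a..t}" by (intro integrable_continuous_real continuous_intros)
    fix s assume "s \<in> {a..t}"
    thus "norm (f s) \<le> M * (s - a) ^ j" using b[of s] by simp
  qed
  also have "... = M * ((t - a) ^ Suc j / real (Suc j))"
    using has_integral_mult_right[OF power_has_integral(1)[OF True]] by (rule integral_unique)
  finally show ?thesis using True by (simp add: antid_def)
next
  case False
  have "norm (integral {t..a} f) \<le> integral {t..a} (\<lambda>s. M * (a - s) ^ j)"
  proof (rule integral_norm_bound_integral)
    show "f integrable_on {t..a}" using f continuous_on_subset by (blast intro: integrable_continuous_real)
    show "(\<lambda>s. M * (a - s) ^ j) integrable_on {t..a}" by (intro integrable_continuous_real continuous_intros)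
    fix s assume "s \<in> {t..a}"
    hence "\<bar>s - a\<bar> = a - s" "\<bar>t - a\<bar> = a - t" "\<bar>s - a\<bar> \<le> \<bar>t - a\<bar>" by auto
    thus "norm (f s) \<le> M * (a - s) ^ j" using b[of s] by simp
  qed
  also have "... = M * ((a - t) ^ Suc j / real (Suc j))"
    using has_integral_mult_right[OF power_has_integral(2)] False by (intro integral_unique) auto
  finally show ?thesis using False by (simp add: antid_def)
qed

text \<open>Picard iteration written as a series: term \<open>j + 1\<close> is the integral of
  \<open>A\<close> applied to term \<open>j\<close>. By linearity the bounds
  \<open>M L^j |t - t0|^j / j!\<close> hold on any bounded interval, which makes the solution
  global.\<close>

theorem linear_ode:
  fixes A :: "real \<Rightarrow> 'a::banach \<Rightarrow>\<^sub>L 'a" and b :: "real \<Rightarrow> 'a"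
  assumes A: "continuous_on UNIV A" and b: "continuous_on UNIV b"
  shows "\<exists>u. u t0 = x0 \<and> (\<forall>t. (u has_vector_derivative A t (u t) + b t) (at t))"
proof -
  define T where "T = rec_nat (\<lambda>t. x0 + antid t0 b t) (\<lambda>j X. antid t0 (\<lambda>s. A s (X s)))"
  have T0: "T 0 = (\<lambda>t. x0 + antid t0 b t)" and TS: "T (Suc j) = antid t0 (\<lambda>s. A s (T j s))" for j
    by (simp_all add: T_def)
  have cAX: "continuous_on UNIV (\<lambda>s. A s (X s))" if "continuous_on UNIV X" for X :: "real \<Rightarrow> 'a"
    using A that by (intro continuous_intros) auto
  have cT: "continuous_on UNIV (T j)" for j
    by (induction j) (auto simp: T0 TS intro!: continuous_intros antid_cont b cAX)
  \<comment> \<open>The termwise derivatives. The inhomogeneity \<open>b\<close> enters only at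
    index 0, which causes the shifts of index below.\<close>
  define T' where "T' j t = (case j of 0 \<Rightarrow> b t | Suc i \<Rightarrow> A t (T i t))" for j t
  have dT: "(T j has_vector_derivative T' j t) (at t)" for j t
  proof (cases j)
    case 0
    thus ?thesis using has_vector_derivative_add[OF has_vector_derivative_const antid_deriv[OF b]]
      by (simp add: T0 T'_def)
  next
    case (Suc i)
    thus ?thesis using antid_deriv[OF cAX[OF cT]] by (simp add: TS T'_def)
  qed
  define u where "u t = (\<Sum>j. T j t)" for t
  have main: "(\<lambda>j. T j t) sums u t \<and> (u has_vector_derivative A t (u t) + b t) (at t)" for t
  proof -
    \<comment> \<open>The extra 1 puts \<open>t\<close> in the interior of \<open>S\<close>.\<close>
    define R where "R = \<bar>t - t0\<bar> + 1"
    define S where "S = {t0 - R..t0 + R}"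
    have cS: "compact S" by (simp add: S_def)
    have R0: "0 < R" by (simp add: R_def)
    obtain L where L: "\<And>s. s \<in> S \<Longrightarrow> norm (A s) \<le> L"
      using compact_continuous_image[OF continuous_on_subset[OF A] cS] compact_imp_bounded
      by (metis bounded_iff imageI subset_UNIV)
    obtain M where M: "\<And>s. s \<in> S \<Longrightarrow> norm (T 0 s) \<le> M"
      using compact_continuous_image[OF continuous_on_subset[OF cT] cS] compact_imp_bounded
      by (metis bounded_iff imageI subset_UNIV)
    have t0S: "t0 \<in> S" using R0 by (simp add: S_def)
    have L0: "0 \<le> L" using order_trans[OF norm_ge_zero L[OF t0S]] .
    have M0: "0 \<le> M" using order_trans[OF norm_ge_zero M[OF t0S]] .
    have bd: "norm (T j s) \<le> (M * L ^ j / fact j) * \<bar>s - t0\<bar> ^ j" if "s \<in> S" for j s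
      using that
    proof (induction j arbitrary: s)
      case 0 thus ?case using M by simp
    next
      case (Suc j)
      have "norm (antid t0 (\<lambda>s. A s (T j s)) s) \<le> (M * L ^ Suc j / fact j) * (\<bar>s - t0\<bar> ^ Suc j / real (Suc j))"
      proof (rule antid_bound[OF cAX[OF cT]])
        fix r assume "\<bar>r - t0\<bar> \<le> \<bar>s - t0\<bar>"
        hence r: "r \<in> S" using Suc.prems by (auto simp: S_def abs_if split: if_splits)
        have "norm (A r (T j r)) \<le> norm (A r) * norm (T j r)" by (rule norm_blinfun)
        also have "... \<le> L * ((M * L ^ j / fact j) * \<bar>r - t0\<bar> ^ j)"
          by (intro mult_mono L Suc.IH r L0) auto
        finally show "norm (A r (T j r)) \<le> (M * L ^ Suc j / fact j) * \<bar>r - t0\<bar> ^ j" by (simp add: algebra_simps)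
      qed
      also have "(M * L ^ Suc j / fact j) * (\<bar>s - t0\<bar> ^ Suc j / real (Suc j)) = (M * L ^ Suc j / fact (Suc j)) * \<bar>s - t0\<bar> ^ Suc j"
        by (simp add: field_simps)
      finally show ?case by (simp only: TS)
    qed
    have bd2: "norm (T j s) \<le> M * ((L * R) ^ j / fact j)" if "s \<in> S" for j s
    proof -
      have "\<bar>s - t0\<bar> ^ j \<le> R ^ j" using that by (intro power_mono) (auto simp: S_def)
      hence "(M * L ^ j / fact j) * \<bar>s - t0\<bar> ^ j \<le> (M * L ^ j / fact j) * R ^ j"
        using L0 M0 by (intro mult_left_mono) auto
      thus ?thesis using bd[OF that, of j] by (simp add: power_mult_distrib)
    qed
    have sm: "summable (\<lambda>j. M * ((L * R) ^ j / fact j))"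
      using summable_exp_generic[of "L * R"] by (intro summable_mult) (simp add: field_simps)
    have sT: "summable (\<lambda>j. T j s)" if "s \<in> S" for s
      by (rule summable_comparison_test'[OF sm, of 0]) (use bd2 that in auto)
    have sums: "(\<lambda>j. T j s) sums u s" if "s \<in> S" for s
      using sT[OF that] by (simp add: u_def summable_sums)
    have AsumsT: "(\<lambda>j. T' j s) sums (A s (u s) + b s)" if "s \<in> S" for s
    proof -
      have "(\<lambda>j. A s (T j s)) sums A s (u s)" by (rule bounded_linear.sums[OF blinfun.bounded_linear_right sums[OF that]])
      hence "(\<lambda>j. T' (Suc j) s) sums A s (u s)" by (simp add: T'_def)
      thus ?thesis using sums_Suc[of "\<lambda>j. T' j s"] by (auto simp: T'_def)
    qed
    have T'b: "norm (T' (Suc j) s) \<le> L * (M * ((L * R) ^ j / fact j))" if "s \<in> S" for j s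
      using order_trans[OF norm_blinfun mult_mono[OF L[OF that] bd2[OF that] L0 norm_ge_zero]] by (simp add: T'_def)
    have ul: "uniform_limit S (\<lambda>n s. \<Sum>j<n. T' (Suc j) s) (\<lambda>s. \<Sum>j. T' (Suc j) s) sequentially"
      by (rule Weierstrass_m_test[OF T'b]) (use summable_mult[OF sm, of L] in auto)
    have g'S: "(\<Sum>j. T' (Suc j) s) = A s (u s)" if "s \<in> S" for s
      using bounded_linear.sums[OF blinfun.bounded_linear_right sums[OF that], of "A s"]
      by (simp add: T'_def sums_iff)
    have der: "\<exists>g. \<forall>x\<in>S. (\<lambda>n. T n x) sums g x \<and> (g has_derivative (\<lambda>h. h *\<^sub>R (A x (u x) + b x))) (at x within S)"
    proof (rule has_derivative_series[where f' = "\<lambda>n x h. h *\<^sub>R T' n x"])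
      show "convex S" by (simp add: S_def)
      show "(T n has_derivative (\<lambda>h. h *\<^sub>R T' n x)) (at x within S)" if "x \<in> S" for n x
        using has_vector_derivative_at_within[OF dT] by (simp add: has_vector_derivative_def)
      show "t0 \<in> S" by (rule t0S)
      show "(\<lambda>n. T n t0) sums u t0" by (rule sums[OF t0S])
      fix e :: real assume e: "0 < e"
      from uniform_limitD[OF ul e] obtain n0 where n0: "\<And>n s. n \<ge> n0 \<Longrightarrow> s \<in> S \<Longrightarrow> norm ((\<Sum>j<n. T' (Suc j) s) - A s (u s)) < e"
        unfolding eventually_sequentially dist_norm using g'S by fastforce
      show "\<forall>\<^sub>F n in sequentially. \<forall>x\<in>S. \<forall>h. norm ((\<Sum>i<n. h *\<^sub>R T' i x) - h *\<^sub>R (A x (u x) + b x)) \<le> e * norm h"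
        unfolding eventually_sequentially
      proof (intro exI[of _ "Suc n0"] allI impI ballI)
        fix n x and h :: real assume n: "Suc n0 \<le> n" and x: "x \<in> S"
        obtain m where m: "n = Suc m" "n0 \<le> m" using n by (cases n) auto
        have "(\<Sum>i<n. T' i x) = b x + (\<Sum>i<m. T' (Suc i) x)"
          unfolding m by (subst sum.lessThan_Suc_shift) (simp add: T'_def)
        hence "(\<Sum>i<n. h *\<^sub>R T' i x) - h *\<^sub>R (A x (u x) + b x) = h *\<^sub>R ((\<Sum>i<m. T' (Suc i) x) - A x (u x))"
          by (simp add: scaleR_sum_right[symmetric] algebra_simps)
        thus "norm ((\<Sum>i<n. h *\<^sub>R T' i x) - h *\<^sub>R (A x (u x) + b x)) \<le> e * norm h"
          using n0[OF m(2) x] by (simp add: mult.commute[of e] mult_left_mono)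
      qed
    qed
    then obtain g where g: "\<And>x. x \<in> S \<Longrightarrow> (\<lambda>n. T n x) sums g x"
        "\<And>x. x \<in> S \<Longrightarrow> (g has_derivative (\<lambda>h. h *\<^sub>R (A x (u x) + b x))) (at x within S)" by blast
    have gu: "g x = u x" if "x \<in> S" for x using g(1)[OF that] sums[OF that] sums_unique2 by blast
    have tS: "t \<in> S" "t \<in> interior S" by (auto simp: S_def R_def abs_if)
    have "(g has_vector_derivative A t (u t) + b t) (at t)"
      using g(2)[OF tS(1)] by (simp only: has_vector_derivative_def at_within_interior[OF tS(2)])
    hence "(u has_vector_derivative A t (u t) + b t) (at t)"
      by (rule has_vector_derivative_transform_within_open[of _ _ _ "interior S"])
        (use tS gu interior_subset in auto)
    thus ?thesis using sums[OF tS(1)] by blast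
  qed
  have "T j t0 = (if j = 0 then x0 else 0)" for j by (cases j) (auto simp: T0 TS)
  hence "(\<lambda>j. T j t0) = (\<lambda>j. if j = 0 then x0 else 0)" by auto
  hence "u t0 = x0" using sums_single[of 0 "\<lambda>_. x0"] by (auto simp: u_def sums_iff)
  with main show ?thesis by blast
qed

lemma Ck_of_vector_derivative:
  assumes "\<And>t. (u has_vector_derivative w t) (at t)" "Ck k w" shows "Ck (Suc k) u"
  by (rule Ck_SucI[OF assms(1)[unfolded has_vector_derivative_def]])
    (rule Ck_linear_comp[OF bounded_linear_scaleR_right assms(2)])

lemma vector_derivative_smooth:
  fixes f :: "real \<Rightarrow> 'b::real_normed_vector"
  assumes "smooth f"
  shows "(f has_vector_derivative vector_derivative f (at t)) (at t)"
    "smooth (\<lambda>t. vector_derivative f (at t))"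
proof -
  have d: "(f has_vector_derivative frechet_derivative f (at t) 1) (at t)" for t
  proof -
    interpret L: bounded_linear "frechet_derivative f (at t)"
      using smooth_has_derivative[OF assms] has_derivative_bounded_linear by blast
    have "frechet_derivative f (at t) x = x *\<^sub>R frechet_derivative f (at t) 1" for x
      using L.scaleR[of x 1] by simp
    hence "frechet_derivative f (at t) = (\<lambda>x. x *\<^sub>R frechet_derivative f (at t) 1)" by (rule ext)
    thus ?thesis using smooth_has_derivative[OF assms, of t] unfolding has_vector_derivative_def by metis
  qed
  hence e: "vector_derivative f (at t) = frechet_derivative f (at t) 1" for t by (simp add: vector_derivative_at)
  show "(f has_vector_derivative vector_derivative f (at t)) (at t)" using d e by simp
  show "smooth (\<lambda>t. vector_derivative f (at t))" unfolding e by (rule smooth_frechet[OF assms])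
qed

section \<open>Smooth functions of compact support on the line\<close>

definition Cc :: "(real \<Rightarrow> 'b::real_normed_vector) set" where
  "Cc = {f. smooth f \<and> (\<exists>R. \<forall>t. R < \<bar>t\<bar> \<longrightarrow> f t = 0)}"

lemma CcI: "smooth f \<Longrightarrow> (\<And>t. R < \<bar>t\<bar> \<Longrightarrow> f t = 0) \<Longrightarrow> f \<in> Cc" by (auto simp: Cc_def)
lemma Cc_smooth: "f \<in> Cc \<Longrightarrow> smooth f" by (simp add: Cc_def)
lemma Cc_bound: assumes "f \<in> Cc" obtains R where "0 < R" "\<And>t. R < \<bar>t\<bar> \<Longrightarrow> f t = 0"
proof -
  obtain R where R: "\<forall>t. R < \<bar>t\<bar> \<longrightarrow> f t = 0" using assms by (auto simp: Cc_def)
  hence "\<And>t. max R 1 < \<bar>t\<bar> \<Longrightarrow> f t = 0" by simp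
  thus thesis using that[of "max R 1"] by simp
qed
lemma Cc_continuous: "f \<in> Cc \<Longrightarrow> continuous_on UNIV f" by (simp add: Cc_smooth smooth_continuous)
lemma Cc_diff: assumes "f \<in> Cc" "g \<in> Cc" shows "(\<lambda>t. f t - g t) \<in> Cc"
proof -
  obtain R where "\<And>t. R < \<bar>t\<bar> \<Longrightarrow> f t = 0" using Cc_bound[OF assms(1)] by blast
  moreover obtain R' where "\<And>t. R' < \<bar>t\<bar> \<Longrightarrow> g t = 0" using Cc_bound[OF assms(2)] by blast
  ultimately show ?thesis by (intro CcI[OF smooth_diff[OF Cc_smooth[OF assms(1)] Cc_smooth[OF assms(2)]], of "max R R'"]) auto
qed

lemma vector_derivative_zero:
  assumes "\<And>t. R < \<bar>t\<bar> \<Longrightarrow> f t = 0" "R < \<bar>t\<bar>" shows "vector_derivative f (at t) = 0"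
proof (rule vector_derivative_at)
  have o: "open {t::real. R < \<bar>t\<bar>}" by (intro open_Collect_less continuous_intros)
  show "(f has_vector_derivative 0) (at t)"
    by (rule has_vector_derivative_transform_within_open[where f = "\<lambda>_. 0" and S = "{t. R < \<bar>t\<bar>}", OF _ o])
      (use assms in auto)
qed

lemma Cc_deriv: assumes "f \<in> Cc" shows "(\<lambda>t. vector_derivative f (at t)) \<in> Cc"
proof -
  obtain R where "\<And>t. R < \<bar>t\<bar> \<Longrightarrow> f t = 0" using Cc_bound[OF assms] by blast
  thus ?thesis
    by (intro CcI[OF vector_derivative_smooth(2)[OF Cc_smooth[OF assms]], of R] vector_derivative_zero[of R]) auto
qed

lemma integral_UNIV_restrict:
  fixes F :: "real \<Rightarrow> 'b::banach"
  assumes "continuous_on UNIV F" "\<And>t. R < \<bar>t\<bar> \<Longrightarrow> F t = 0"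
  shows "integral UNIV F = integral {-R..R} F" "F integrable_on UNIV"
proof -
  have i: "F integrable_on {-R..R}" using assms(1) continuous_on_subset by (blast intro: integrable_continuous_real)
  have "(F has_integral integral {-R..R} F) UNIV"
    by (rule has_integral_on_superset[OF integrable_integral[OF i]]) (use assms(2) in \<open>auto simp: abs_le_iff\<close>)
  thus "integral UNIV F = integral {-R..R} F" "F integrable_on UNIV" by (auto simp: integral_unique)
qed

section \<open>Boundary value problems and density of the ranges\<close>

locale dirac_ode = herm h for h :: "complex^'m \<Rightarrow> complex^'m \<Rightarrow> complex" +
  fixes e :: "complex^'m \<Rightarrow> complex^'m" and c :: real and Q :: "real \<Rightarrow> complex^'m \<Rightarrow> complex^'m"
  assumes c: "0 < c"
    and e_lin: "e (a *s x + y) = a *s e x + e y"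
    and ee: "e (e x) = - x"
    and e_anti: "h (e x) y = - h x (e y)"
    and Q_lin: "Q t (a *s x + y) = a *s Q t x + Q t y"
    and Q_herm: "h (Q t x) y = h x (Q t y)"
    and Q_smooth: "smooth (\<lambda>t. Q t x)"
begin

definition Dop :: "(real \<Rightarrow> complex^'m) \<Rightarrow> real \<Rightarrow> complex^'m" where
  "Dop f t = c *\<^sub>R e (vector_derivative f (at t)) + Q t (f t)"

lemma e_bl: "bounded_linear e" by (rule clinear_bounded[OF e_lin])
lemma Q_bl: "bounded_linear (Q t)" by (rule clinear_bounded[OF Q_lin])
sublocale e: bounded_linear e by (rule e_bl)
lemma e_scale: "e (a *s x) = a *s e x" using e_lin[of a x 0] by (simp add: e.zero)
lemma Q_scale: "Q t (a *s x) = a *s Q t x" using Q_lin[of t a x 0] linear_0[OF bounded_linear.linear[OF Q_bl], of t] by simp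
lemmas Q_add = linear_add[OF bounded_linear.linear[OF Q_bl]]
lemmas Q_scaleR = linear_scale[OF bounded_linear.linear[OF Q_bl]]
lemmas Q_zero = linear_0[OF bounded_linear.linear[OF Q_bl]]

lemma e_n2: "n2 (e x) = n2 x" by (simp add: n2_def e_anti ee h_minus_right)

lemma Q_basis: "Q t x = (\<Sum>i\<in>Basis. (x \<bullet> i) *\<^sub>R Q t i)"
proof -
  have "Q t x = Q t (\<Sum>i\<in>Basis. (x \<bullet> i) *\<^sub>R i)" by (simp add: euclidean_representation)
  also have "... = (\<Sum>i\<in>Basis. (x \<bullet> i) *\<^sub>R Q t i)"
    by (simp only: linear_sum[OF bounded_linear.linear[OF Q_bl]] Q_scaleR)
  finally show ?thesis .
qed

lemma Ck_Q: assumes "Ck k u" shows "Ck k (\<lambda>t. Q t (u t))"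
  unfolding Q_basis[of _ "u _"]
  by (intro Ck_sum Ck_bilinear[OF bounded_bilinear_scaleR] Ck_linear_comp[OF bounded_linear_inner_left] assms)
    (use Q_smooth in \<open>simp add: smooth_def\<close>)

lemma smooth_Q: "smooth u \<Longrightarrow> smooth (\<lambda>t. Q t (u t))"
  unfolding smooth_def using Ck_Q by blast

lemma smooth_Dop: "smooth f \<Longrightarrow> smooth (Dop f)"
  unfolding Dop_def[abs_def]
  by (intro smooth_add smooth_linear_comp[OF bounded_linear_scaleR_right] smooth_linear_comp[OF e_bl] vector_derivative_smooth smooth_Q)

lemma Cc_Dop: assumes "f \<in> Cc" shows "Dop f \<in> Cc"
proof -
  obtain R where "\<And>t. R < \<bar>t\<bar> \<Longrightarrow> f t = 0" using Cc_bound[OF assms] by blast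
  thus ?thesis
    by (intro CcI[OF smooth_Dop[OF Cc_smooth[OF assms]], of R]) (auto simp: Dop_def vector_derivative_zero[of R] e.zero Q_zero)
qed

text \<open>Because \<open>e (e x) = - x\<close>, the equation can be solved for the derivative and
  becomes a linear system. Smoothness follows by bootstrapping: the right-hand side is as regular as
  \<open>u\<close>.\<close>

lemma ode_solution:
  assumes v: "smooth v"
  shows "\<exists>u. u t0 = x0 \<and> smooth u \<and> (\<forall>t. Dop u t - z *s u t = v t)"
proof -
  define A where "A t = Blinfun (\<lambda>x. (- 1 / c) *\<^sub>R e (z *s x - Q t x))" for t
  have zbl: "bounded_linear (\<lambda>x::complex^'m. z *s x)" for z
    by (rule bounded_bilinear.bounded_linear_right[OF smult_bounded_bilinear])
  have Abl: "bounded_linear (\<lambda>x. (- 1 / c) *\<^sub>R e (z *s x - Q t x))" for t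
    by (intro bounded_linear_compose[OF bounded_linear_scaleR_right] bounded_linear_compose[OF e_bl] bounded_linear_sub zbl Q_bl)
  have Aap: "A t x = (- 1 / c) *\<^sub>R e (z *s x - Q t x)" for t x
    unfolding A_def by (simp only: bounded_linear_Blinfun_apply[OF Abl])
  have cA: "continuous_on UNIV A"
  proof (rule continuous_on_blinfun_componentwise)
    fix i :: "complex^'m"
    have "continuous_on UNIV (\<lambda>t. e (z *s i - Q t i))"
      by (rule continuous_on_compose2[OF linear_continuous_on[OF e_bl, of UNIV]])
        (auto intro!: continuous_intros smooth_continuous[OF Q_smooth])
    thus "continuous_on UNIV (\<lambda>t. A t i)" unfolding Aap by (intro continuous_intros)
  qed
  define b where "b t = (- 1 / c) *\<^sub>R e (v t)" for t
  have sb: "smooth b" unfolding b_def[abs_def]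
    by (intro smooth_linear_comp[OF bounded_linear_scaleR_right] smooth_linear_comp[OF e_bl] v)
  obtain u where u: "u t0 = x0" "\<And>t. (u has_vector_derivative A t (u t) + b t) (at t)"
    using linear_ode[OF cA smooth_continuous[OF sb]] by blast
  have "Ck k u" for k
  proof (induction k)
    case 0
    show ?case using u(2) has_vector_derivative_continuous by (force intro: continuous_at_imp_continuous_on)
  next
    case (Suc k)
    show ?case
    proof (rule Ck_of_vector_derivative[OF u(2)])
      show "Ck k (\<lambda>t. A t (u t) + b t)" unfolding Aap diff_conv_add_uminus
        by (intro Ck_add Ck_linear_comp[OF bounded_linear_scaleR_right] Ck_linear_comp[OF e_bl] Ck_linear_comp[OF zbl]
           Ck_linear_comp[OF bounded_linear_minus[OF bounded_linear_ident]] Suc Ck_Q)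
          (use sb in \<open>simp add: smooth_def\<close>)
    qed
  qed
  hence su: "smooth u" by (simp add: smooth_def)
  have "Dop u t - z *s u t = v t" for t
  proof -
    have "vector_derivative u (at t) = A t (u t) + b t" by (rule vector_derivative_at[OF u(2)])
    hence "c *\<^sub>R e (vector_derivative u (at t)) = - e (e (z *s u t - Q t (u t))) - e (e (v t))"
      using c by (simp add: Aap b_def e.add e.diff e.neg e.scaleR scaleR_add_right scaleR_diff_right)
    thus ?thesis by (simp add: Dop_def ee)
  qed
  with u(1) su show ?thesis by blast
qed

lemma h_has_derivative:
  assumes "(f has_vector_derivative f') (at t)" "(g has_vector_derivative g') (at t)"
  shows "((\<lambda>t. h (f t) (g t)) has_vector_derivative h (f t) g' + h f' (g t)) (at t)"
  by (rule bounded_bilinear.has_vector_derivative[OF h_bilinear assms])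

text \<open>
  With the boundary conditions \<open>e u = z u\<close> at \<open>-N\<close> and \<open>e u = - z u\<close> at \<open>N\<close> the boundary terms
  of the energy identity have the favourable sign.
\<close>

lemma energy:
  assumes z: "z = \<i> \<or> z = - \<i>" and N: "0 \<le> N" and u: "smooth u"
    and bc: "e (u (-N)) = z *s u (-N)" "e (u N) = - (z *s u N)"
    and eq: "\<And>t. t \<in> {-N..N} \<Longrightarrow> Dop u t - z *s u t = v t" and v: "continuous_on UNIV v"
  shows "integral {-N..N} (\<lambda>t. n2 (u t)) \<le> integral {-N..N} (\<lambda>t. n2 (v t))"
proof -
  define \<eta> where "\<eta> = Im z"
  have z\<eta>: "z = \<i> * of_real \<eta>" "\<eta> = 1 \<or> \<eta> = -1" using z by (auto simp: \<eta>_def)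
  let ?u' = "\<lambda>t. vector_derivative u (at t)"
  have cu: "continuous_on UNIV u" by (rule smooth_continuous[OF u])
  have der: "((\<lambda>t. \<eta> * c * Im (h (e (u t)) (u t))) has_vector_derivative 2 * (\<eta> * Im (h (v t) (u t)) + n2 (u t))) (at t within {-N..N})"
    if t: "t \<in> {-N..N}" for t
  proof -
    have d: "(u has_vector_derivative ?u' t) (at t)" by (rule vector_derivative_smooth(1)[OF u])
    have de: "((\<lambda>t. e (u t)) has_vector_derivative e (?u' t)) (at t)" by (rule bounded_linear.has_vector_derivative[OF e_bl d])
    have "((\<lambda>t. h (e (u t)) (u t)) has_vector_derivative h (e (u t)) (?u' t) + h (e (?u' t)) (u t)) (at t)"
      by (rule h_has_derivative[OF de d])
    hence "((\<lambda>t. (\<eta> * c) * Im (h (e (u t)) (u t))) has_vector_derivative (\<eta> * c) * Im (h (e (u t)) (?u' t) + h (e (?u' t)) (u t))) (at t)"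
      by (intro bounded_linear.has_vector_derivative[OF bounded_linear_mult_right] bounded_linear.has_vector_derivative[OF bounded_linear_Im])
    moreover have "(\<eta> * c) * Im (h (e (u t)) (?u' t) + h (e (?u' t)) (u t)) = 2 * (\<eta> * Im (h (v t) (u t)) + n2 (u t))"
    proof -
      have "c *\<^sub>R e (?u' t) = v t + z *s u t - Q t (u t)" using eq[OF t] by (simp add: Dop_def algebra_simps)
      hence 1: "c * Im (h (e (?u' t)) (u t)) = Im (h (v t + z *s u t - Q t (u t)) (u t))"
        by (metis h_scaleR scaleR_complex.simps(2))
      have "Im (h (Q t (u t)) (u t)) = 0"
        using Q_herm[of t "u t" "u t"] h_cnj[of "u t" "Q t (u t)"] by (metis Reals_cnj_iff complex_is_Real_iff)
      hence 2: "c * Im (h (e (?u' t)) (u t)) = Im (h (v t) (u t)) + \<eta> * n2 (u t)"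
        unfolding 1 by (simp add: h_simps z\<eta> h_self)
      have 3: "Im (h (e (u t)) (?u' t)) = Im (h (e (?u' t)) (u t))"
        using h_cnj[of "e (?u' t)" "u t"] by (simp add: e_anti[of "u t"])
      have "\<eta> * \<eta> = 1" using z\<eta>(2) by auto
      have "(\<eta> * c) * Im (h (e (u t)) (?u' t) + h (e (?u' t)) (u t)) = 2 * \<eta> * (c * Im (h (e (?u' t)) (u t)))"
        using 3 by simp
      also have "... = 2 * (\<eta> * Im (h (v t) (u t)) + (\<eta> * \<eta>) * n2 (u t))" unfolding 2 by (simp add: algebra_simps)
      finally show ?thesis using \<open>\<eta> * \<eta> = 1\<close> by simp
    qed
    ultimately show ?thesis using has_vector_derivative_at_within by force
  qed
  have "((\<lambda>t. 2 * (\<eta> * Im (h (v t) (u t)) + n2 (u t))) has_integral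
      \<eta> * c * Im (h (e (u N)) (u N)) - \<eta> * c * Im (h (e (u (-N))) (u (-N)))) {-N..N}"
    by (rule fundamental_theorem_of_calculus[OF _ der]) (use N in auto)
  hence I: "integral {-N..N} (\<lambda>t. 2 * (\<eta> * Im (h (v t) (u t)) + n2 (u t))) =
      \<eta> * c * Im (h (e (u N)) (u N)) - \<eta> * c * Im (h (e (u (-N))) (u (-N)))" by (rule integral_unique)
  have "\<eta> * Im (h (e (u N)) (u N)) = - n2 (u N)" "\<eta> * Im (h (e (u (-N))) (u (-N))) = n2 (u (-N))"
    using z\<eta>(2) by (auto simp: bc h_simps z\<eta>(1) h_self)
  hence "c * (\<eta> * Im (h (e (u N)) (u N))) - c * (\<eta> * Im (h (e (u (-N))) (u (-N)))) = - c * (n2 (u N) + n2 (u (-N)))"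
    by (simp only:) (simp add: algebra_simps)
  hence "\<eta> * c * Im (h (e (u N)) (u N)) - \<eta> * c * Im (h (e (u (-N))) (u (-N))) = - c * (n2 (u N) + n2 (u (-N)))"
    by (simp only: mult.assoc mult.left_commute[of c])
  also have "... \<le> 0" using c by (simp add: mult_nonneg_nonneg add_nonneg_nonneg)
  finally have le0: "integral {-N..N} (\<lambda>t. 2 * (\<eta> * Im (h (v t) (u t)) + n2 (u t))) \<le> 0" using I by simp
  have ci: "f integrable_on {-N..N}" if "continuous_on UNIV f" for f :: "real \<Rightarrow> real"
    using that continuous_on_subset by (blast intro: integrable_continuous_real)
  have c1: "continuous_on UNIV (\<lambda>t. n2 (u t))" "continuous_on UNIV (\<lambda>t. n2 (v t))"
    by (intro n2_continuous cu v)+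
  have "integral {-N..N} (\<lambda>t. n2 (u t) - n2 (v t)) \<le> integral {-N..N} (\<lambda>t. 2 * (\<eta> * Im (h (v t) (u t)) + n2 (u t)))"
  proof (rule integral_le)
    show "(\<lambda>t. n2 (u t) - n2 (v t)) integrable_on {-N..N}" by (intro ci continuous_intros c1)
    show "(\<lambda>t. 2 * (\<eta> * Im (h (v t) (u t)) + n2 (u t))) integrable_on {-N..N}"
      by (intro ci continuous_intros c1 h_continuous v cu)
    fix t
    have "\<bar>Im (h (v t) (u t))\<bar> \<le> cmod (h (v t) (u t))" by (rule abs_Im_le_cmod)
    hence "- (2 * (\<eta> * Im (h (v t) (u t)))) \<le> n2 (v t) + n2 (u t)"
      using h_amgm[of "v t" "u t"] z\<eta>(2) by (auto simp: abs_le_iff)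
    thus "n2 (u t) - n2 (v t) \<le> 2 * (\<eta> * Im (h (v t) (u t)) + n2 (u t))" unfolding distrib_left by linarith
  qed
  thus ?thesis using le0 c1 by (simp add: integral_diff ci)
qed

text \<open>Solutions are parametrised by their value at \<open>- N\<close>, so the boundary
  conditions form a linear system between spaces of equal finite dimension. \<open>energy\<close>
  with \<open>v = 0\<close> gives uniqueness, and uniqueness gives existence.\<close>

lemma bvp:
  assumes z: "z = \<i> \<or> z = - \<i>" and N: "0 < N" and v: "smooth v"
  shows "\<exists>u. smooth u \<and> e (u (-N)) = z *s u (-N) \<and> e (u N) = - (z *s u N) \<and> (\<forall>t. Dop u t - z *s u t = v t)"
proof -
  have zz: "z * z = -1" using z by auto
  have "\<forall>i. \<exists>u. u (-N) = i \<and> smooth u \<and> (\<forall>t. Dop u t - z *s u t = 0)"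
    using ode_solution[OF smooth_const] by blast
  then obtain U where U: "\<And>i. U i (-N) = i" "\<And>i. smooth (U i)" "\<And>i t. Dop (U i) t - z *s U i t = 0" by metis
  define S where "S a t = (\<Sum>i\<in>Basis. (a \<bullet> i) *\<^sub>R U i t)" for a t
  have S0: "S a (-N) = a" for a by (simp add: S_def U euclidean_representation)
  have Ss: "smooth (S a)" for a unfolding S_def[abs_def]
    by (intro smooth_sum smooth_scaleR smooth_const U)
  have Dadd: "Dop (\<lambda>t. f t + g t) t = Dop f t + Dop g t" if "smooth f" "smooth g" for f g t
  proof -
    have "vector_derivative (\<lambda>t. f t + g t) (at t) = vector_derivative f (at t) + vector_derivative g (at t)"
      by (intro vector_derivative_at has_vector_derivative_add vector_derivative_smooth(1) that)
    thus ?thesis by (simp add: Dop_def e.add Q_add scaleR_add_right)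
  qed
  have Dsc: "Dop (\<lambda>t. r *\<^sub>R f t) t = r *\<^sub>R Dop f t" if "smooth f" for f t and r :: real
  proof -
    have "vector_derivative (\<lambda>t. r *\<^sub>R f t) (at t) = r *\<^sub>R vector_derivative f (at t)"
      by (intro vector_derivative_at bounded_linear.has_vector_derivative[OF bounded_linear_scaleR_right] vector_derivative_smooth(1) that)
    thus ?thesis by (simp add: Dop_def e.scaleR Q_scaleR scaleR_add_right mult.commute)
  qed
  have SD: "Dop (S a) t - z *s S a t = 0" for a t
  proof -
    have "Dop (\<lambda>t. \<Sum>i\<in>I. (a \<bullet> i) *\<^sub>R U i t) t - z *s (\<Sum>i\<in>I. (a \<bullet> i) *\<^sub>R U i t) = 0" if "finite I" for I
      using that
    proof (induction I)
      case empty
      have "vector_derivative (\<lambda>t. 0::complex^'m) (at t) = 0" by (rule vector_derivative_at) simp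
      thus ?case by (simp add: Dop_def e.zero Q_zero)
    next
      case (insert i I)
      have s: "smooth (\<lambda>t. (a \<bullet> i) *\<^sub>R U i t)" "smooth (\<lambda>t. \<Sum>i\<in>I. (a \<bullet> i) *\<^sub>R U i t)"
        by (intro smooth_sum smooth_scaleR smooth_const U)+
      have "z *s ((a \<bullet> i) *\<^sub>R U i t) = (a \<bullet> i) *\<^sub>R (z *s U i t)" by (simp add: scaleR_eq_smult mult.commute)
      moreover have "Dop (U i) t = z *s U i t" using U(3)[of i t] by simp
      ultimately show ?case using insert Dadd[OF s, of t] Dsc[OF U(2)] by (simp add: vector_add_ldistrib)
    qed
    thus ?thesis by (simp add: S_def[abs_def])
  qed
  \<comment> \<open>As \<open>e\<close> and \<open>z\<close> both square to -1, \<open>e\<close> has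
    the eigenvalues \<open>z\<close> and \<open>- z\<close>, and these maps are up to a scalar the
    projections onto the two eigenspaces. The boundary conditions read \<open>Bm u = 0\<close> at
    \<open>- N\<close> and \<open>Bp u = 0\<close> at \<open>N\<close>.\<close>
  define Bp where "Bp x = e x + z *s x" for x
  define Bm where "Bm x = e x - z *s x" for x
  have zbl: "bounded_linear (\<lambda>x::complex^'m. z *s x)"
    by (rule bounded_bilinear.bounded_linear_right[OF smult_bounded_bilinear])
  have blp: "bounded_linear Bp" "bounded_linear Bm" unfolding Bp_def[abs_def] Bm_def[abs_def]
    by (intro bounded_linear_add bounded_linear_sub e_bl zbl)+
  interpret Bp: bounded_linear Bp by (rule blp)
  interpret Bm: bounded_linear Bm by (rule blp)
  have BpBm: "Bp (Bm x) = 0" for x by (simp add: Bp_def Bm_def e.diff ee e_scale zz vector_ssub_ldistrib)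
  have BmBp: "Bm (Bp x) = 0" for x by (simp add: Bp_def Bm_def e.add ee e_scale zz vector_add_ldistrib)
  have two: "(2 * z) *s x = Bp x - Bm x" for x by (simp add: Bp_def Bm_def vec_eq_iff)
  have split0: "x = 0 \<and> y = 0" if "x = Bm a" "y = Bp b" "x + y = 0" for x y a b
  proof -
    have "(2 * z) *s x = 0"
    proof -
      have "Bp x = 0" using BpBm that by simp
      moreover have "x = - y" using that(3) by (simp only: eq_neg_iff_add_eq_0)
      hence "Bm x = Bm (- y)" by simp
      hence "Bm x = 0" using BmBp that by (simp add: Bm.neg)
      ultimately show ?thesis using two[of x] by simp
    qed
    moreover have "2 * z \<noteq> 0" using zz by auto
    ultimately have "x = 0" by (simp add: vec_eq_iff)
    thus ?thesis using that(3) by simp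
  qed
  \<comment> \<open>Both boundary conditions in one vector; \<open>split0\<close> separates them
    again, since the ranges of \<open>Bm\<close> and \<open>Bp\<close> meet only in 0.\<close>
  define \<Phi> where "\<Phi> a = Bm a + Bp (S a N)" for a
  have Slin: "S (a + b) t = S a t + S b t" "S (r *\<^sub>R a) t = r *\<^sub>R S a t" for a b r t
    by (simp_all add: S_def inner_add_left scaleR_add_left sum.distrib scaleR_sum_right)
  have lin: "linear \<Phi>"
    by (rule linearI) (simp_all add: \<Phi>_def Slin Bm.add Bp.add Bm.scaleR Bp.scaleR scaleR_add_right)
  have "inj \<Phi>"
    unfolding linear_injective_0[OF lin]
  proof (intro allI impI)
    fix a assume "\<Phi> a = 0"
    hence b: "Bm a = 0" "Bp (S a N) = 0" using split0[OF refl refl] unfolding \<Phi>_def by blast+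
    have "integral {-N..N} (\<lambda>t. n2 (S a t)) \<le> integral {-N..N} (\<lambda>t. n2 0)"
      by (rule energy[OF z _ Ss, where v = "\<lambda>_. 0"])
        (use N b S0 SD in \<open>auto simp: Bm_def Bp_def eq_neg_iff_add_eq_0\<close>)
    hence "integral {-N..N} (\<lambda>t. n2 (S a t)) \<le> 0" by (simp add: n2_def)
    moreover have c: "continuous_on {-N..N} (\<lambda>t. n2 (S a t))"
      by (intro n2_continuous continuous_on_subset[OF smooth_continuous[OF Ss]]) auto
    ultimately have "integral {-N..N} (\<lambda>t. n2 (S a t)) = 0"
      using integral_nonneg[OF integrable_continuous_real[OF c]] by force
    hence "\<forall>t\<in>{-N..N}. n2 (S a t) = 0"
      using integral_eq_0_iff[OF c] N by simp
    hence "n2 (S a (-N)) = 0" using N by (auto simp del: n2_eq_0)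
    thus "a = 0" by (simp add: S0)
  qed
  hence sur: "surj \<Phi>" using linear_injective_imp_surjective[OF lin] by blast
  obtain w where w: "w (-N) = 0" "smooth w" "\<And>t. Dop w t - z *s w t = v t"
    using ode_solution[OF v, of "-N" 0 z] by blast
  obtain a where a: "\<Phi> a = - Bp (w N)" using sur by (metis surjD)
  define u where "u t = S a t + w t" for t
  have "Bm a + Bp (S a N + w N) = 0" using a by (simp add: \<Phi>_def Bp.add add.assoc[symmetric])
  hence "Bm a = 0" "Bp (u N) = 0" using split0[OF refl refl] unfolding u_def by blast+
  moreover have "u (-N) = a" by (simp add: u_def S0 w)
  moreover have "smooth u" unfolding u_def[abs_def] by (intro smooth_add Ss w)
  moreover have "Dop u t - z *s u t = v t" for t
    using SD[of a t] w(3)[of t] unfolding u_def[abs_def] Dadd[OF Ss w(2)] by (simp add: vector_add_ldistrib algebra_simps)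
  ultimately show ?thesis by (intro exI[of _ u]) (auto simp: Bm_def Bp_def eq_neg_iff_add_eq_0)
qed

text \<open>Solve on a long interval and cut off. The cutoff costs a term with its derivative, of
  order \<open>1 / N\<close>, while the norm of the solution is bounded by that of \<open>v\<close>
  independently of \<open>N\<close>.\<close>

theorem dense_range:
  assumes z: "z = \<i> \<or> z = - \<i>" and v: "v \<in> Cc" and \<delta>: "0 < \<delta>"
  shows "\<exists>u\<in>Cc. integral UNIV (\<lambda>t. n2 (Dop u t - z *s u t - v t)) < \<delta>"
proof -
  obtain R where R: "0 < R" "\<And>t. R < \<bar>t\<bar> \<Longrightarrow> v t = 0" using Cc_bound[OF v] by blast
  define \<xi> where "\<xi> t = bump t / bump 0" for t
  have b0: "0 < bump 0" by (rule bump_pos) simp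
  have s\<xi>: "smooth \<xi>" unfolding \<xi>_def[abs_def]
    using smooth_linear_comp[OF bounded_linear_divide smooth_bump] by blast
  have \<xi>1: "\<xi> 0 = 1" using b0 by (simp add: \<xi>_def)
  have \<xi>0: "1 \<le> \<bar>t\<bar> \<Longrightarrow> \<xi> t = 0" for t by (simp add: \<xi>_def bump_zero)
  let ?\<xi>' = "\<lambda>t. vector_derivative \<xi> (at t)"
  have d\<xi>: "(\<xi> has_vector_derivative ?\<xi>' t) (at t)" for t by (rule vector_derivative_smooth[OF s\<xi>])
  have "\<xi> \<in> Cc" by (rule CcI[OF s\<xi>, of 1]) (simp add: \<xi>0)
  hence cc': "?\<xi>' \<in> Cc" by (rule Cc_deriv)
  obtain K where K: "\<And>t. \<bar>?\<xi>' t\<bar> \<le> K"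
  proof -
    obtain R' where R': "\<And>t. R' < \<bar>t\<bar> \<Longrightarrow> ?\<xi>' t = 0" using Cc_bound[OF cc'] by blast
    have "compact (?\<xi>' ` {-R'..R'})"
      by (intro compact_continuous_image continuous_on_subset[OF Cc_continuous[OF cc']]) auto
    then obtain K where K: "\<And>t. t \<in> {-R'..R'} \<Longrightarrow> \<bar>?\<xi>' t\<bar> \<le> K"
      using compact_imp_bounded by (fastforce simp: bounded_iff)
    have "\<bar>?\<xi>' t\<bar> \<le> max K 0" for t
    proof (cases "R' < \<bar>t\<bar>")
      case False
      hence "t \<in> {-R'..R'}" by auto
      thus ?thesis using K[of t] by simp
    qed (simp add: R')
    thus thesis by (rule that)
  qed
  have K0: "0 \<le> K" using order_trans[OF abs_ge_zero K[of 0]] .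
  define V where "V = integral UNIV (\<lambda>t. n2 (v t))"
  \<comment> \<open>The first summand stems from the factor \<open>\<theta> t - 1\<close> on
    \<open>v\<close>, the second from the derivative of the cutoff; the leading factors 2 come from
    \<open>n2_add_le\<close>.\<close>
  define C where "C = 2 * (K * R)\<^sup>2 + 2 * (c * K)\<^sup>2"
  have C0: "0 \<le> C" by (simp add: C_def)
  have nv: "continuous_on UNIV (\<lambda>t. n2 (v t))" by (intro n2_continuous Cc_continuous v)
  have V0: "0 \<le> V" unfolding V_def
    by (rule Henstock_Kurzweil_Integration.integral_nonneg[OF integral_UNIV_restrict(2)[OF nv, of R]])
      (simp_all only: R n2_nonneg n2_eq_0)
  define N where "N = max R (max 1 (C * V / \<delta> + 1))"
  have N: "R \<le> N" "1 \<le> N" "C * V / \<delta> < N" by (auto simp: N_def)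
  hence N0: "0 < N" by simp
  have NV: "integral {-N..N} (\<lambda>t. n2 (v t)) = V"
    unfolding V_def by (rule integral_UNIV_restrict(1)[OF nv, symmetric]) (use R N in \<open>auto simp: n2_def\<close>)
  obtain u where u: "smooth u" "e (u (-N)) = z *s u (-N)" "e (u N) = - (z *s u N)" "\<And>t. Dop u t - z *s u t = v t"
    using bvp[OF z N0 Cc_smooth[OF v]] by blast
  have Ie: "integral {-N..N} (\<lambda>t. n2 (u t)) \<le> V"
    using energy[OF z _ u(1-3) u(4) Cc_continuous[OF v]] N0 NV by simp
  define \<theta> where "\<theta> t = \<xi> (t / N)" for t
  have s\<theta>: "smooth \<theta>" unfolding \<theta>_def[abs_def] by (rule smooth_compose_linear[OF bounded_linear_divide s\<xi>])
  have \<theta>0: "N \<le> \<bar>t\<bar> \<Longrightarrow> \<theta> t = 0" for t unfolding \<theta>_def by (rule \<xi>0) (use N0 in \<open>simp add: field_simps\<close>)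
  have d\<theta>: "(\<theta> has_vector_derivative ?\<xi>' (t / N) / N) (at t)" for t
  proof -
    have "((\<lambda>t. t / N) has_vector_derivative 1 / N) (at t)" by (auto intro!: derivative_eq_intros)
    from vector_diff_chain_at[OF this d\<xi>] show ?thesis by (simp add: \<theta>_def[abs_def] o_def)
  qed
  define w where "w t = \<theta> t *\<^sub>R u t" for t
  have sw: "smooth w" unfolding w_def[abs_def] by (intro smooth_scaleR s\<theta> u)
  have wCc: "w \<in> Cc" by (rule CcI[OF sw, of N]) (simp add: w_def \<theta>0)
  \<comment> \<open>The cutoff is not constant 1 on the support of \<open>v\<close>, whence the term
    with \<open>\<theta> t - 1\<close>; there it is small because \<open>\<xi>\<close> is Lipschitz
    with \<open>\<xi> 0 = 1\<close>.\<close>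
  have dw: "Dop w t - z *s w t - v t = (\<theta> t - 1) *\<^sub>R v t + (c * (?\<xi>' (t / N) / N)) *\<^sub>R e (u t)" for t
  proof -
    have "vector_derivative w (at t) = \<theta> t *\<^sub>R vector_derivative u (at t) + (?\<xi>' (t / N) / N) *\<^sub>R u t"
      unfolding w_def[abs_def]
      by (intro vector_derivative_at bounded_bilinear.has_vector_derivative[OF bounded_bilinear_scaleR] d\<theta> vector_derivative_smooth(1) u)
    hence "Dop w t - z *s w t = \<theta> t *\<^sub>R (Dop u t - z *s u t) + (c * (?\<xi>' (t / N) / N)) *\<^sub>R e (u t)"
      by (simp add: Dop_def w_def e.add e.scaleR Q_scaleR scaleR_add_right scaleR_diff_right mult.commute)
        (simp add: scaleR_eq_smult algebra_simps)
    thus ?thesis by (simp add: u(4) algebra_simps)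
  qed
  have pt: "n2 (Dop w t - z *s w t - v t) \<le> (2 * (K * R)\<^sup>2 * n2 (v t) + 2 * (c * K)\<^sup>2 * n2 (u t)) / N\<^sup>2" for t
  proof -
    have "\<bar>\<xi> s - 1\<bar> \<le> K * \<bar>s\<bar>" for s
    proof -
      have "norm (\<xi> s - \<xi> 0) \<le> K * norm (s - 0)"
      proof (rule differentiable_bound[of UNIV _ "\<lambda>t h. h *\<^sub>R ?\<xi>' t"])
        show "onorm (\<lambda>h. h *\<^sub>R ?\<xi>' x) \<le> K" for x
          by (rule onorm_le) (use K[of x] in \<open>simp add: abs_mult mult.commute[of K] mult_left_mono\<close>)
      qed (use d\<xi> in \<open>auto simp: has_vector_derivative_def\<close>)
      thus ?thesis by (simp add: \<xi>1)
    qed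
    from this[of "t / N"] have t1: "\<bar>\<theta> t - 1\<bar> \<le> K * \<bar>t\<bar> / N" using N0 by (simp add: \<theta>_def)
    have "(\<theta> t - 1)\<^sup>2 * n2 (v t) \<le> (K * R / N)\<^sup>2 * n2 (v t)"
    proof (cases "R < \<bar>t\<bar>")
      case True thus ?thesis by (simp add: R n2_def)
    next
      case False
      have "K * \<bar>t\<bar> / N \<le> K * R / N" using False K0 N0 by (intro divide_right_mono mult_left_mono) auto
      hence "\<bar>\<theta> t - 1\<bar> \<le> \<bar>K * R / N\<bar>" using t1 K0 N0 R by simp
      hence "(\<theta> t - 1)\<^sup>2 \<le> (K * R / N)\<^sup>2" by (rule abs_le_square_iff[THEN iffD1])
      thus ?thesis by (rule mult_right_mono) simp
    qed
    moreover have "(c * (?\<xi>' (t / N) / N))\<^sup>2 * n2 (u t) \<le> (c * K / N)\<^sup>2 * n2 (u t)"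
    proof (rule mult_right_mono)
      have "\<bar>c * (?\<xi>' (t / N) / N)\<bar> \<le> \<bar>c * K / N\<bar>"
        using K[of "t / N"] c N0 K0 by (simp add: abs_mult divide_right_mono mult_left_mono)
      thus "(c * (?\<xi>' (t / N) / N))\<^sup>2 \<le> (c * K / N)\<^sup>2" by (rule abs_le_square_iff[THEN iffD1])
    qed simp
    moreover have "n2 (Dop w t - z *s w t - v t) \<le> 2 * ((\<theta> t - 1)\<^sup>2 * n2 (v t)) + 2 * ((c * (?\<xi>' (t / N) / N))\<^sup>2 * n2 (u t))"
      unfolding dw using n2_add_le[of "(\<theta> t - 1) *\<^sub>R v t" "(c * (?\<xi>' (t / N) / N)) *\<^sub>R e (u t)"] by (simp add: n2_scaleR e_n2)
    ultimately have "n2 (Dop w t - z *s w t - v t) \<le> 2 * ((K * R / N)\<^sup>2 * n2 (v t)) + 2 * ((c * K / N)\<^sup>2 * n2 (u t))" by linarith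
    also have "... = (2 * (K * R)\<^sup>2 * n2 (v t) + 2 * (c * K)\<^sup>2 * n2 (u t)) / N\<^sup>2"
      by (simp add: power_divide add_divide_distrib)
    finally show ?thesis .
  qed
  define F where "F t = n2 (Dop w t - z *s w t - v t)" for t
  have "(\<lambda>t. Dop w t - z *s w t - v t) \<in> Cc"
  proof -
    have "smooth (\<lambda>t. z *s w t)" by (rule smooth_bilinear[OF smult_bounded_bilinear smooth_const sw])
    hence "(\<lambda>t. z *s w t) \<in> Cc" by (rule CcI[of _ N]) (simp add: w_def \<theta>0)
    thus ?thesis by (intro Cc_diff Cc_Dop wCc v) auto
  qed
  hence cF: "continuous_on UNIV F" unfolding F_def by (intro n2_continuous Cc_continuous)
  have zF: "F t = 0" if "N < \<bar>t\<bar>" for t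
  proof -
    have "w s = 0" if "N < \<bar>s\<bar>" for s using that by (simp add: w_def \<theta>0)
    hence "Dop w t = 0" using that by (simp add: Dop_def vector_derivative_zero[of N] e.zero Q_zero)
    thus ?thesis using that R N by (simp add: F_def w_def \<theta>0 n2_def)
  qed
  have "integral UNIV F = integral {-N..N} F" by (rule integral_UNIV_restrict(1)[OF cF zF])
  also have "... \<le> integral {-N..N} (\<lambda>t. (2 * (K * R)\<^sup>2 / N\<^sup>2) * n2 (v t) + (2 * (c * K)\<^sup>2 / N\<^sup>2) * n2 (u t))"
  proof (rule integral_le)
    show "F integrable_on {-N..N}" using cF continuous_on_subset by (blast intro: integrable_continuous_real)
    show "(\<lambda>t. (2 * (K * R)\<^sup>2 / N\<^sup>2) * n2 (v t) + (2 * (c * K)\<^sup>2 / N\<^sup>2) * n2 (u t)) integrable_on {-N..N}"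
      by (intro integrable_continuous_real continuous_intros n2_continuous continuous_on_subset[OF Cc_continuous[OF v]] continuous_on_subset[OF smooth_continuous[OF u(1)]]) auto
    show "F t \<le> (2 * (K * R)\<^sup>2 / N\<^sup>2) * n2 (v t) + (2 * (c * K)\<^sup>2 / N\<^sup>2) * n2 (u t)" for t
      using pt[of t] by (simp add: F_def add_divide_distrib)
  qed
  also have "... = (2 * (K * R)\<^sup>2 / N\<^sup>2) * V + (2 * (c * K)\<^sup>2 / N\<^sup>2) * integral {-N..N} (\<lambda>t. n2 (u t))"
    unfolding NV[symmetric]
    by (subst integral_add)
      (use N0 in \<open>auto intro!: integrable_continuous_real continuous_intros n2_continuous continuous_on_subset[OF Cc_continuous[OF v]] continuous_on_subset[OF smooth_continuous[OF u(1)]]\<close>)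
  also have "... \<le> (2 * (K * R)\<^sup>2 / N\<^sup>2) * V + (2 * (c * K)\<^sup>2 / N\<^sup>2) * V"
    by (intro add_left_mono mult_left_mono Ie) auto
  also have "... = C * V / N\<^sup>2" by (simp add: C_def add_divide_distrib distrib_right)
  also have "... \<le> C * V / N"
    using N C0 V0 by (intro divide_left_mono) (auto simp: power2_eq_square)
  also have "... < \<delta>" using N(3) N0 \<delta> by (simp add: field_simps)
  finally show ?thesis using wCc unfolding F_def by blast
qed

end

text \<open>\<open>Q\<close> is split into a part \<open>P\<close> that anticommutes with
  \<open>e\<close> and has square \<open>q\<close>, and a constant part \<open>W\<close>.
  \<open>P'_bound\<close> lets the derivative of \<open>P\<close> that arises from integration by
  parts be absorbed into half of \<open>q\<close>.\<close>

locale dirac_ode_potential = dirac_ode h e c Q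
  for h :: "complex^'m \<Rightarrow> complex^'m \<Rightarrow> complex" and e c Q +
  fixes P P' :: "real \<Rightarrow> complex^'m \<Rightarrow> complex^'m" and W :: "complex^'m \<Rightarrow> complex^'m"
    and q :: "real \<Rightarrow> real" and C0 :: real
  assumes Q_eq: "Q t x = P t x + W x"
    and W_lin: "W (a *s x + y) = a *s W x + W y"
    and P_lin: "P t (a *s x + y) = a *s P t x + P t y"
    and P_deriv: "((\<lambda>t. P t x) has_vector_derivative P' t x) (at t)"
    and P_herm: "h (P t x) y = h x (P t y)"
    and eP: "e (P t x) = - P t (e x)"
    and P_n2: "n2 (P t x) = q t * n2 x"
    and P'_bound: "c * \<bar>Re (h (e x) (P' t x))\<bar> \<le> (q t / 2 + C0) * n2 x"
    and C0: "0 \<le> C0"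
    and q_cont: "continuous_on UNIV q"
    and q_nonneg: "0 \<le> q t"
    and q_lim: "\<exists>T. \<forall>t. T \<le> \<bar>t\<bar> \<longrightarrow> M \<le> q t"
begin

lemma P_bl: "bounded_linear (P t)" by (rule clinear_bounded[OF P_lin])

lemma P_basis: "P t x = (\<Sum>i\<in>Basis. (x \<bullet> i) *\<^sub>R P t i)"
proof -
  have "P t x = P t (\<Sum>i\<in>Basis. (x \<bullet> i) *\<^sub>R i)" by (simp add: euclidean_representation)
  also have "... = (\<Sum>i\<in>Basis. (x \<bullet> i) *\<^sub>R P t i)"
    by (simp only: linear_sum[OF bounded_linear.linear[OF P_bl]] linear_scale[OF bounded_linear.linear[OF P_bl]])
  finally show ?thesis .
qed

lemma P'_basis: "P' t x = (\<Sum>i\<in>Basis. (x \<bullet> i) *\<^sub>R P' t i)"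
proof -
  have "((\<lambda>t. \<Sum>i\<in>Basis. (x \<bullet> i) *\<^sub>R P t i) has_vector_derivative (\<Sum>i\<in>Basis. (x \<bullet> i) *\<^sub>R P' t i)) (at t)"
    by (intro has_vector_derivative_sum bounded_linear.has_vector_derivative[OF bounded_linear_scaleR_right] P_deriv)
  hence "((\<lambda>t. P t x) has_vector_derivative (\<Sum>i\<in>Basis. (x \<bullet> i) *\<^sub>R P' t i)) (at t)" by (simp only: P_basis[of _ x])
  thus ?thesis using P_deriv vector_derivative_unique_at by blast
qed

lemma P_along:
  assumes "(f has_vector_derivative f') (at t)"
  shows "((\<lambda>t. P t (f t)) has_vector_derivative P' t (f t) + P t f') (at t)"
proof -
  have "((\<lambda>t. \<Sum>i\<in>Basis. (f t \<bullet> i) *\<^sub>R P t i) has_vector_derivative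
     (\<Sum>i\<in>Basis. (f t \<bullet> i) *\<^sub>R P' t i + (f' \<bullet> i) *\<^sub>R P t i)) (at t)"
    by (intro has_vector_derivative_sum bounded_bilinear.has_vector_derivative[OF bounded_bilinear_scaleR]
        bounded_linear.has_vector_derivative[OF bounded_linear_inner_left] P_deriv assms)
  moreover have "(\<Sum>i\<in>Basis. (f t \<bullet> i) *\<^sub>R P' t i + (f' \<bullet> i) *\<^sub>R P t i) = P' t (f t) + P t f'"
    by (simp only: sum.distrib P'_basis[of t "f t", symmetric] P_basis[of t f', symmetric])
  ultimately show ?thesis by (simp only: P_basis[of _ "f _", symmetric])
qed

abbreviation "I F \<equiv> integral UNIV (F :: real \<Rightarrow> real)"

lemma n2_Cc:
  assumes "f \<in> Cc"
  shows "continuous_on UNIV (\<lambda>t. n2 (f t))" "continuous_on UNIV (\<lambda>t. q t * n2 (f t))"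
    "(\<lambda>t. n2 (f t)) integrable_on UNIV" "(\<lambda>t. q t * n2 (f t)) integrable_on UNIV"
proof -
  show c: "continuous_on UNIV (\<lambda>t. n2 (f t))" "continuous_on UNIV (\<lambda>t. q t * n2 (f t))"
    by (intro n2_continuous continuous_intros Cc_continuous q_cont assms)+
  obtain R where R: "\<And>t. R < \<bar>t\<bar> \<Longrightarrow> f t = 0" using Cc_bound[OF assms] by blast
  show "(\<lambda>t. n2 (f t)) integrable_on UNIV" "(\<lambda>t. q t * n2 (f t)) integrable_on UNIV"
    by (rule integral_UNIV_restrict(2)[OF c(1), of R] integral_UNIV_restrict(2)[OF c(2), of R]; simp add: R n2_def)+
qed

lemma W_bound: obtains w where "0 \<le> w" "\<And>x. n2 (W x) \<le> w * n2 x"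
proof -
  obtain C where C: "0 < C" "\<And>x. n2 x \<le> C * (norm x)\<^sup>2" using n2_upper by blast
  obtain c1 where c1: "0 < c1" "\<And>x. c1 * (norm x)\<^sup>2 \<le> n2 x" using n2_lower by blast
  obtain K where K: "\<And>x. norm (W x) \<le> norm x * K"
    using bounded_linear.bounded[OF clinear_bounded[OF W_lin]] by blast
  have "n2 (W x) \<le> (C * K\<^sup>2 / c1) * n2 x" for x
  proof -
    have "(norm (W x))\<^sup>2 \<le> (norm x * K)\<^sup>2" using K[of x] by (intro power_mono) auto
    hence "n2 (W x) \<le> C * (norm x * K)\<^sup>2" using C(2)[of "W x"] C(1) by (meson mult_left_mono less_imp_le order_trans)
    also have "... = (C * K\<^sup>2 / c1) * (c1 * (norm x)\<^sup>2)" using c1(1) by (simp add: power_mult_distrib)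
    also have "... \<le> (C * K\<^sup>2 / c1) * n2 x" using C c1 by (intro mult_left_mono) auto
    finally show ?thesis .
  qed
  thus thesis using C c1 by (intro that[of "C * K\<^sup>2 / c1"]) auto
qed

text \<open>
  Since \<open>e\<close> anticommutes with \<open>P\<close>, the cross term in \<open>n2 (c e f' + P f)\<close> is a total derivative up to
  a term without derivatives of \<open>f\<close>.
\<close>

lemma apriori:
  assumes w: "\<And>x. n2 (W x) \<le> w * n2 x" and f: "f \<in> Cc"
  shows "c\<^sup>2 * I (\<lambda>t. n2 (vector_derivative f (at t))) + (1/2) * I (\<lambda>t. q t * n2 (f t))
     \<le> 2 * I (\<lambda>t. n2 (Dop f t)) + (2 * w + C0) * I (\<lambda>t. n2 (f t))"
proof -
  let ?f' = "\<lambda>t. vector_derivative f (at t)"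
  have d: "(f has_vector_derivative ?f' t) (at t)" for t by (rule vector_derivative_smooth(1)[OF Cc_smooth[OF f]])
  obtain R where R: "0 < R" "\<And>t. R < \<bar>t\<bar> \<Longrightarrow> f t = 0" using Cc_bound[OF f] by blast
  \<comment> \<open>The derivative of \<open>c Re h (e f, P f)\<close>. Its first part is the cross
    term of \<open>n2 (c e f' + P f)\<close>: the two ways of differentiating a factor
    \<open>f\<close> contribute equally, since \<open>e\<close> is antisymmetric, \<open>P\<close>
    hermitian, and they anticommute.\<close>
  define g' where "g' t = 2 * c * Re (h (e (?f' t)) (P t (f t))) + c * Re (h (e (f t)) (P' t (f t)))" for t
  have der: "((\<lambda>t. c * Re (h (e (f t)) (P t (f t)))) has_vector_derivative g' t) (at t)" for t
  proof -
    have de: "((\<lambda>t. e (f t)) has_vector_derivative e (?f' t)) (at t)" by (rule bounded_linear.has_vector_derivative[OF e_bl d])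
    have "((\<lambda>t. h (e (f t)) (P t (f t))) has_vector_derivative h (e (f t)) (P' t (f t) + P t (?f' t)) + h (e (?f' t)) (P t (f t))) (at t)"
      by (rule h_has_derivative[OF de P_along[OF d]])
    hence "((\<lambda>t. c * Re (h (e (f t)) (P t (f t)))) has_vector_derivative c * Re (h (e (f t)) (P' t (f t) + P t (?f' t)) + h (e (?f' t)) (P t (f t)))) (at t)"
      by (intro bounded_linear.has_vector_derivative[OF bounded_linear_mult_right] bounded_linear.has_vector_derivative[OF bounded_linear_Re])
    moreover have "Re (h (e (f t)) (P t (?f' t))) = Re (h (e (?f' t)) (P t (f t)))"
    proof -
      have "h (e (f t)) (P t (?f' t)) = h (P t (e (f t))) (?f' t)" by (simp add: P_herm)
      also have "... = h (P t (f t)) (e (?f' t))"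
      proof -
        have "P t (e (f t)) = - e (P t (f t))" using eP[of t "f t"] by simp
        thus ?thesis by (simp only: h_minus e_anti minus_minus)
      qed
      finally show ?thesis using h_cnj[of "P t (f t)" "e (?f' t)"] by simp
    qed
    ultimately show ?thesis by (simp add: g'_def h_add_right algebra_simps)
  qed
  let ?N = "R + 1"
  have I0: "(g' has_integral 0) {-?N..?N}"
  proof -
    have "(g' has_integral c * Re (h (e (f ?N)) (P ?N (f ?N))) - c * Re (h (e (f (-?N))) (P (-?N) (f (-?N))))) {-?N..?N}"
      by (rule fundamental_theorem_of_calculus) (use R in \<open>auto intro: has_vector_derivative_at_within der\<close>)
    thus ?thesis using R by (simp add: e.zero)
  qed
  have pt: "c\<^sup>2 * n2 (?f' t) + (1/2) * (q t * n2 (f t)) \<le> 2 * n2 (Dop f t) + (2 * w + C0) * n2 (f t) - g' t" for t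
  proof -
    let ?D0 = "c *\<^sub>R e (?f' t) + P t (f t)"
    have "n2 ?D0 = c\<^sup>2 * n2 (?f' t) + q t * n2 (f t) + 2 * c * Re (h (e (?f' t)) (P t (f t)))"
      by (simp add: n2_add n2_scaleR e_n2 P_n2 h_scaleR)
    hence 1: "n2 ?D0 = c\<^sup>2 * n2 (?f' t) + q t * n2 (f t) + g' t - c * Re (h (e (f t)) (P' t (f t)))"
      by (simp add: g'_def)
    have "c * Re (h (e (f t)) (P' t (f t))) \<le> c * \<bar>Re (h (e (f t)) (P' t (f t)))\<bar>" using c by (intro mult_left_mono) auto
    also note P'_bound[of "f t" t]
    finally have 2: "c * Re (h (e (f t)) (P' t (f t))) \<le> (q t / 2 + C0) * n2 (f t)" .
    have "?D0 = Dop f t + - W (f t)" by (simp add: Dop_def Q_eq)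
    hence "n2 ?D0 \<le> 2 * n2 (Dop f t) + 2 * n2 (W (f t))" using n2_add_le[of "Dop f t" "- W (f t)"] by simp
    also have "... \<le> 2 * n2 (Dop f t) + 2 * (w * n2 (f t))" using w[of "f t"] by simp
    finally show ?thesis using 1 2 by (simp add: algebra_simps)
  qed
  have fR: "f t = 0" "?f' t = 0" "Dop f t = 0" if "?N < \<bar>t\<bar>" for t
  proof -
    show "f t = 0" using R that by simp
    show "?f' t = 0" using vector_derivative_zero[of R f t] R that by simp
    thus "Dop f t = 0" using R that by (simp add: Dop_def e.zero Q_zero)
  qed
  note c1 = n2_Cc(1)[OF Cc_deriv[OF f]] and c2 = n2_Cc(1,2)[OF f] and c3 = n2_Cc(1)[OF Cc_Dop[OF f]]
  have io: "F integrable_on {-?N..?N}" if "continuous_on UNIV F" for F :: "real \<Rightarrow> real"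
    using that continuous_on_subset by (blast intro: integrable_continuous_real)
  have e1: "I (\<lambda>t. n2 (?f' t)) = integral {-?N..?N} (\<lambda>t. n2 (?f' t))"
    by (rule integral_UNIV_restrict(1)[OF c1]) (simp only: fR n2_eq_0)
  have e2: "I (\<lambda>t. n2 (f t)) = integral {-?N..?N} (\<lambda>t. n2 (f t))"
    by (rule integral_UNIV_restrict(1)[OF c2(1)]) (simp only: fR n2_eq_0)
  have e3: "I (\<lambda>t. q t * n2 (f t)) = integral {-?N..?N} (\<lambda>t. q t * n2 (f t))"
    by (rule integral_UNIV_restrict(1)[OF c2(2)]) (simp add: fR n2_def)
  have e4: "I (\<lambda>t. n2 (Dop f t)) = integral {-?N..?N} (\<lambda>t. n2 (Dop f t))"
    by (rule integral_UNIV_restrict(1)[OF c3]) (simp only: fR n2_eq_0)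
  have "((\<lambda>t. c\<^sup>2 * n2 (?f' t) + (1/2) * (q t * n2 (f t))) has_integral
      c\<^sup>2 * I (\<lambda>t. n2 (?f' t)) + (1/2) * I (\<lambda>t. q t * n2 (f t))) {-?N..?N}"
    unfolding e1 e3 by (intro has_integral_add has_integral_mult_right integrable_integral io c1 c2)
  moreover have "((\<lambda>t. 2 * n2 (Dop f t) + (2 * w + C0) * n2 (f t) - g' t) has_integral
      2 * I (\<lambda>t. n2 (Dop f t)) + (2 * w + C0) * I (\<lambda>t. n2 (f t)) - 0) {-?N..?N}"
    unfolding e2 e4 by (intro has_integral_add has_integral_diff has_integral_mult_right integrable_integral io c2 c3 I0)
  ultimately have "c\<^sup>2 * I (\<lambda>t. n2 (?f' t)) + (1/2) * I (\<lambda>t. q t * n2 (f t)) \<le>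
     2 * I (\<lambda>t. n2 (Dop f t)) + (2 * w + C0) * I (\<lambda>t. n2 (f t)) - 0"
    by (rule has_integral_le) (use pt in auto)
  thus ?thesis by simp
qed

lemma I_nonneg: "f \<in> Cc \<Longrightarrow> 0 \<le> I (\<lambda>t. n2 (f t))" "f \<in> Cc \<Longrightarrow> 0 \<le> I (\<lambda>t. q t * n2 (f t))"
  by (rule Henstock_Kurzweil_Integration.integral_nonneg[OF n2_Cc(3)], auto)
    (rule Henstock_Kurzweil_Integration.integral_nonneg[OF n2_Cc(4)], auto simp: q_nonneg)

lemma sub_integral:
  fixes F :: "real \<Rightarrow> real"
  assumes "F integrable_on UNIV" "\<And>t. 0 \<le> F t" "continuous_on UNIV F"
  shows "integral {a..b} F \<le> I F"
proof (rule integral_subset_le)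
  show "F integrable_on {a..b}" using assms(3) continuous_on_subset by (blast intro: integrable_continuous_real)
qed (use assms in auto)

text \<open>The one-dimensional Sobolev inequality: the derivative of \<open>n2 (f t)\<close> is at
  most the sum of the two integrands, and \<open>f\<close> vanishes far to the left.\<close>

lemma sup_bound: assumes f: "f \<in> Cc"
  shows "n2 (f x) \<le> I (\<lambda>t. n2 (f t)) + I (\<lambda>t. n2 (vector_derivative f (at t)))"
proof -
  let ?f' = "\<lambda>t. vector_derivative f (at t)"
  have d: "(f has_vector_derivative ?f' t) (at t)" for t by (rule vector_derivative_smooth(1)[OF Cc_smooth[OF f]])
  obtain R where R: "0 < R" "\<And>t. R < \<bar>t\<bar> \<Longrightarrow> f t = 0" using Cc_bound[OF f] by blast
  \<comment> \<open>A point to the left of \<open>x\<close> and outside the support of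
    \<open>f\<close>.\<close>
  define a where "a = - max (R + 1) (\<bar>x\<bar>)"
  have a: "a \<le> x" "f a = 0 \<or> a = x" using R by (auto simp: a_def)
  have a': "f a = 0 \<or> f x = 0"
  proof (cases "R < \<bar>a\<bar>")
    case True thus ?thesis using R by simp
  next
    case False thus ?thesis using R by (simp add: a_def max_def abs_if split: if_splits)
  qed
  show ?thesis
  proof (cases "f x = 0")
    case True thus ?thesis using I_nonneg(1)[OF f] I_nonneg(1)[OF Cc_deriv[OF f]] by (simp add: n2_def)
  next
    case False
    hence fa: "f a = 0" using a' by simp
    have der: "((\<lambda>t. n2 (f t)) has_vector_derivative 2 * Re (h (?f' t) (f t))) (at t)" for t
    proof -
      have "((\<lambda>t. Re (h (f t) (f t))) has_vector_derivative Re (h (f t) (?f' t) + h (?f' t) (f t))) (at t)"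
        by (rule bounded_linear.has_vector_derivative[OF bounded_linear_Re h_has_derivative[OF d d]])
      thus ?thesis using h_cnj[of "f t" "?f' t"] by (simp add: n2_def)
    qed
    have hi: "((\<lambda>t. 2 * Re (h (?f' t) (f t))) has_integral n2 (f x) - n2 (f a)) {a..x}"
      by (rule fundamental_theorem_of_calculus[OF a(1)]) (auto intro: has_vector_derivative_at_within der)
    note c1 = n2_Cc(1)[OF f] n2_Cc(1)[OF Cc_deriv[OF f]]
    have io: "F integrable_on {a..x}" if "continuous_on UNIV F" for F :: "real \<Rightarrow> real"
      using that continuous_on_subset by (blast intro: integrable_continuous_real)
    have "n2 (f x) - n2 (f a) \<le> integral {a..x} (\<lambda>t. n2 (f t)) + integral {a..x} (\<lambda>t. n2 (?f' t))"
    proof (rule has_integral_le[OF hi])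
      show "((\<lambda>t. n2 (f t) + n2 (?f' t)) has_integral integral {a..x} (\<lambda>t. n2 (f t)) + integral {a..x} (\<lambda>t. n2 (?f' t))) {a..x}"
        by (intro has_integral_add integrable_integral io c1)
      show "2 * Re (h (?f' t) (f t)) \<le> n2 (f t) + n2 (?f' t)" for t
        using h_amgm[of "?f' t" "f t"] complex_Re_le_cmod[of "h (?f' t) (f t)"] by linarith
    qed
    also have "... \<le> I (\<lambda>t. n2 (f t)) + I (\<lambda>t. n2 (?f' t))"
      by (intro add_mono sub_integral n2_Cc f Cc_deriv) auto
    finally show ?thesis using fa by (simp add: n2_def)
  qed
qed

text \<open>Integrate \<open>y \<le> a y^2 + 1 / (4 a)\<close> for the norm \<open>y\<close> of the
  derivative. Keeping \<open>a\<close> free replaces the square root of the Hoelder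
  estimate.\<close>

lemma increment:
  assumes f: "f \<in> Cc" and c1: "0 < c1" "\<And>x. c1 * (norm x)\<^sup>2 \<le> n2 x" and a: "0 < a" and st: "s \<le> t"
  shows "norm (f t - f s) \<le> a * (I (\<lambda>t. n2 (vector_derivative f (at t))) / c1) + (t - s) / (4 * a)"
proof -
  let ?f' = "\<lambda>t. vector_derivative f (at t)"
  have d: "(f has_vector_derivative ?f' t) (at t)" for t by (rule vector_derivative_smooth(1)[OF Cc_smooth[OF f]])
  have hi: "(?f' has_integral f t - f s) {s..t}"
    by (rule fundamental_theorem_of_calculus[OF st]) (auto intro: has_vector_derivative_at_within d)
  note cn = n2_Cc(1)[OF Cc_deriv[OF f]]
  have hg: "((\<lambda>x. (a / c1) * n2 (?f' x) + 1 / (4 * a)) has_integral (a / c1) * integral {s..t} (\<lambda>t. n2 (?f' t)) + (t - s) *\<^sub>R (1 / (4 * a))) {s..t}"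
    by (intro has_integral_add has_integral_mult_right integrable_integral integrable_continuous_real continuous_on_subset[OF cn])
      (use has_integral_const_real[of "1 / (4 * a)" s t] st in auto)
  have "norm (integral {s..t} ?f') \<le> integral {s..t} (\<lambda>x. (a / c1) * n2 (?f' x) + 1 / (4 * a))"
  proof (rule integral_norm_bound_integral)
    show "?f' integrable_on {s..t}" using hi by (rule has_integral_integrable)
    show "(\<lambda>x. (a / c1) * n2 (?f' x) + 1 / (4 * a)) integrable_on {s..t}" using hg by (rule has_integral_integrable)
    fix x
    define y where "y = norm (?f' x)"
    have "0 \<le> (2 * a * y - 1)\<^sup>2" by simp
    hence "4 * a * y \<le> 4 * a * (a * y\<^sup>2) + 1" by (simp add: power2_eq_square algebra_simps)
    hence "y \<le> a * y\<^sup>2 + 1 / (4 * a)" using a by (simp add: field_simps)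
    also have "a * y\<^sup>2 \<le> (a / c1) * n2 (?f' x)"
      using mult_left_mono[OF c1(2)[of "?f' x"], of "a / c1"] a c1(1) by (simp add: y_def)
    finally show "norm (?f' x) \<le> (a / c1) * n2 (?f' x) + 1 / (4 * a)" by (simp add: y_def)
  qed
  also have "... = (a / c1) * integral {s..t} (\<lambda>t. n2 (?f' t)) + (t - s) / (4 * a)"
    using integral_unique[OF hg] by simp
  also have "... \<le> (a / c1) * I (\<lambda>t. n2 (?f' t)) + (t - s) / (4 * a)"
    using a c1(1) by (intro add_right_mono mult_left_mono sub_integral n2_Cc Cc_deriv f) auto
  finally show ?thesis using integral_unique[OF hi] by simp
qed

lemma increment_abs:
  assumes f: "f \<in> Cc" and c1: "0 < c1" "\<And>x. c1 * (norm x)\<^sup>2 \<le> n2 x" and a: "0 < a"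
    and K: "I (\<lambda>t. n2 (vector_derivative f (at t))) \<le> K"
  shows "norm (f t - f s) \<le> a * (K / c1) + \<bar>t - s\<bar> / (4 * a)"
proof -
  have "a * (I (\<lambda>t. n2 (vector_derivative f (at t))) / c1) \<le> a * (K / c1)"
    using K a c1(1) by (intro mult_left_mono divide_right_mono) auto
  thus ?thesis
    using increment[OF f c1 a, of s t] increment[OF f c1 a, of t s] norm_minus_commute[of "f t" "f s"]
    by (cases "s \<le> t") auto
qed

text \<open>A Rellich argument. \<open>apriori\<close> bounds the derivatives and the integrals
  weighted with \<open>q\<close>. Pointwise bounds give a subsequence converging at all rationals;
  equicontinuity makes it uniformly Cauchy on a bounded interval, and outside it the size of
  \<open>q\<close> makes the mass uniformly small.\<close>

theorem compact_sequence:
  assumes f: "\<And>n. f n \<in> Cc" "\<And>n. I (\<lambda>t. n2 (f n t)) \<le> 1" "\<And>n. I (\<lambda>t. n2 (Dop (f n) t)) \<le> 1"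
  shows "\<exists>r::nat \<Rightarrow> nat. strict_mono r \<and> (\<forall>\<epsilon>>0. \<exists>M. \<forall>m\<ge>M. \<forall>n\<ge>M. I (\<lambda>t. n2 (f (r m) t - f (r n) t)) < \<epsilon>)"
proof -
  obtain w where w: "0 \<le> w" "\<And>x. n2 (W x) \<le> w * n2 x" using W_bound by blast
  obtain C where C: "0 < C" "\<And>x. n2 x \<le> C * (norm x)\<^sup>2" using n2_upper by blast
  obtain c1 where c1: "0 < c1" "\<And>x. c1 * (norm x)\<^sup>2 \<le> n2 x" using n2_lower by blast
  define K0 where "K0 = 2 + (2 * w + C0)"
  define K where "K = K0 / c\<^sup>2"
  have K00: "0 \<le> K0" "0 \<le> K" using w C0 by (auto simp: K0_def K_def)
  have ap: "c\<^sup>2 * I (\<lambda>t. n2 (vector_derivative (f n) (at t))) + (1/2) * I (\<lambda>t. q t * n2 (f n t)) \<le> K0" for n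
  proof -
    have "2 * I (\<lambda>t. n2 (Dop (f n) t)) + (2 * w + C0) * I (\<lambda>t. n2 (f n t)) \<le> 2 * 1 + (2 * w + C0) * 1"
      by (intro add_mono mult_left_mono f) (use w C0 in auto)
    thus ?thesis using order_trans[OF apriori[OF w(2) f(1)[of n]]] by (simp add: K0_def)
  qed
  have K: "I (\<lambda>t. n2 (vector_derivative (f n) (at t))) \<le> K" for n
  proof -
    have "c\<^sup>2 * I (\<lambda>t. n2 (vector_derivative (f n) (at t))) \<le> K0" using ap[of n] I_nonneg(2)[OF f(1)[of n]] by linarith
    thus ?thesis using c by (simp add: K_def field_simps)
  qed
  have Kq: "I (\<lambda>t. q t * n2 (f n t)) \<le> 2 * K0" for n
    using ap[of n] mult_nonneg_nonneg[OF zero_le_power2[of c] I_nonneg(1)[OF Cc_deriv[OF f(1)[of n]]]] by linarith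
  have pb: "norm (f n x) \<le> sqrt ((1 + K) / c1)" for n x
  proof -
    have "c1 * (norm (f n x))\<^sup>2 \<le> 1 + K" using c1(2)[of "f n x"] sup_bound[OF f(1)[of n], of x] f(2)[of n] K[of n] by linarith
    hence "(norm (f n x))\<^sup>2 \<le> (1 + K) / c1" using c1(1) by (simp add: field_simps)
    thus ?thesis by (rule real_le_rsqrt)
  qed
  obtain r where r: "strict_mono (r :: nat \<Rightarrow> nat)" and conv: "\<And>x. x \<in> \<rat> \<Longrightarrow> \<exists>l. (\<lambda>n. f (r n) x) \<longlonglongrightarrow> l"
    using function_convergent_subsequence[OF countable_rat, of f "sqrt ((1 + K) / c1)"] pb by blast
  have "\<exists>M. \<forall>m\<ge>M. \<forall>n\<ge>M. I (\<lambda>t. n2 (f (r m) t - f (r n) t)) < \<epsilon>" if \<epsilon>: "0 < \<epsilon>" for \<epsilon>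
  proof -
    \<comment> \<open>The mass outside the interval is at most \<open>8 * K0 / Q0\<close>, which
      this value keeps below \<open>\<epsilon> / 4\<close>; \<open>K0 + 1\<close> avoids the case
      \<open>K0 = 0\<close>.\<close>
    define Q0 where "Q0 = 32 * (K0 + 1) / \<epsilon>"
    have Q0: "0 < Q0" using \<epsilon> K00 by (simp add: Q0_def)
    obtain T0 where T0: "\<And>t. T0 \<le> \<bar>t\<bar> \<Longrightarrow> Q0 \<le> q t" using q_lim by blast
    define T where "T = max T0 1"
    have T: "1 \<le> T" "\<And>t. T \<le> \<bar>t\<bar> \<Longrightarrow> Q0 \<le> q t" using T0 by (auto simp: T_def)
    \<comment> \<open>Differences on the interval of length \<open>2 * T\<close> will be at most
      \<open>3 * \<eta>\<close>, hence the 9; this value makes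
      \<open>9 * C * \<eta>^2 * 2 * T\<close> equal to \<open>\<epsilon> / 4\<close>.\<close>
    define \<eta> where "\<eta> = sqrt (\<epsilon> / (8 * T * C * 9))"
    have \<eta>: "0 < \<eta>" using \<epsilon> T C by (simp add: \<eta>_def)
    \<comment> \<open>Makes the derivative term of \<open>increment_abs\<close> at most
      \<open>\<eta> / 2\<close>; the mesh width \<open>1 / p\<close> chosen below does the same for
      its other term.\<close>
    define a where "a = \<eta> * c1 / (2 * (K + 1))"
    have a: "0 < a" using \<eta> c1 K00 by (simp add: a_def)
    have aK: "a * (K / c1) \<le> \<eta> / 2"
    proof -
      have "a * (K / c1) = (\<eta> / 2) * (K / (K + 1))" using c1 by (simp add: a_def)
      also have "... \<le> (\<eta> / 2) * 1" using \<eta> K00 by (intro mult_left_mono) auto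
      finally show ?thesis by simp
    qed
    obtain p :: nat where p: "1 / (2 * a * \<eta>) < real p" using reals_Archimedean2 by blast
    have p0: "0 < real p" using p a \<eta> by (meson divide_pos_pos less_trans mult_pos_pos zero_less_numeral zero_less_one)
    have ap: "(1 / real p) / (4 * a) \<le> \<eta> / 2" using p p0 a \<eta> by (simp add: field_simps)
    \<comment> \<open>A finite grid of rational points; the margin of one index on each side leaves
      room for rounding down at the ends of the interval.\<close>
    define S where "S = (\<lambda>k. of_int k / real p) ` {- \<lceil>T * p\<rceil> - 1..\<lceil>T * p\<rceil> + 1}"
    have fS: "finite S" and SQ: "S \<subseteq> \<rat>" by (auto simp: S_def)
    have near: "\<exists>s\<in>S. \<bar>t - s\<bar> \<le> 1 / real p" if t: "\<bar>t\<bar> \<le> T" for t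
    proof -
      have "\<bar>t * real p\<bar> \<le> T * real p" using t p0 by (simp add: abs_mult)
      hence "\<lfloor>t * p\<rfloor> \<in> {- \<lceil>T * p\<rceil> - 1..\<lceil>T * p\<rceil> + 1}" by (auto simp: abs_le_iff) linarith+
      hence "of_int \<lfloor>t * p\<rfloor> / real p \<in> S" unfolding S_def by blast
      moreover have "\<bar>t - of_int \<lfloor>t * p\<rfloor> / real p\<bar> \<le> 1 / real p"
      proof -
        have "t - of_int \<lfloor>t * p\<rfloor> / real p = (t * p - of_int \<lfloor>t * p\<rfloor>) / real p" using p0 by (simp add: field_simps)
        moreover have "\<bar>t * p - of_int \<lfloor>t * p\<rfloor>\<bar> \<le> 1" by linarith
        ultimately show ?thesis using p0 by (simp add: divide_right_mono)
      qed
      ultimately show ?thesis by blast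
    qed
    have "\<forall>s\<in>S. \<exists>M. \<forall>m\<ge>M. \<forall>n\<ge>M. norm (f (r m) s - f (r n) s) < \<eta>"
    proof
      fix s assume "s \<in> S"
      hence "Cauchy (\<lambda>n. f (r n) s)" using conv SQ LIMSEQ_imp_Cauchy by blast
      thus "\<exists>M. \<forall>m\<ge>M. \<forall>n\<ge>M. norm (f (r m) s - f (r n) s) < \<eta>" using \<eta> by (rule CauchyD)
    qed
    then obtain M where M: "\<And>s m n. s \<in> S \<Longrightarrow> M s \<le> m \<Longrightarrow> M s \<le> n \<Longrightarrow> norm (f (r m) s - f (r n) s) < \<eta>" by metis
    define M0 where "M0 = Max (insert 0 (M ` S))"
    have M0: "M s \<le> M0" if "s \<in> S" for s unfolding M0_def using fS that by (intro Max_ge) auto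
    have "I (\<lambda>t. n2 (f (r m) t - f (r n) t)) < \<epsilon>" if mn: "M0 \<le> m" "M0 \<le> n" for m n
    proof -
      define g where "g t = f (r m) t - f (r n) t" for t
      have gC: "g \<in> Cc" unfolding g_def[abs_def] by (intro Cc_diff f)
      have gb: "norm (g t) \<le> 3 * \<eta>" if t: "\<bar>t\<bar> \<le> T" for t
      proof -
        obtain s where s: "s \<in> S" "\<bar>t - s\<bar> \<le> 1 / real p" using near[OF t] by blast
        have inc: "norm (f j t - f j s) \<le> \<eta>" for j
        proof -
          have "\<bar>t - s\<bar> / (4 * a) \<le> (1 / real p) / (4 * a)" using s a by (intro divide_right_mono) auto
          thus ?thesis using increment_abs[OF f(1) c1 a K, of j t s] aK ap by linarith
        qed
        have "g t = (f (r m) t - f (r m) s) + (f (r m) s - f (r n) s) - (f (r n) t - f (r n) s)" by (simp add: g_def)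
        hence "norm (g t) \<le> norm (f (r m) t - f (r m) s) + norm (f (r m) s - f (r n) s) + norm (f (r n) t - f (r n) s)"
          using norm_triangle_ineq4[of "(f (r m) t - f (r m) s) + (f (r m) s - f (r n) s)" "f (r n) t - f (r n) s"]
            norm_triangle_ineq[of "f (r m) t - f (r m) s" "f (r m) s - f (r n) s"] by simp
        thus ?thesis using inc[of "r m"] inc[of "r n"] M[OF s(1), of m n] M0[OF s(1)] mn by linarith
      qed
      have n2g: "n2 (g t) \<le> 2 * n2 (f (r m) t) + 2 * n2 (f (r n) t)" for t
        using n2_add_le[of "f (r m) t" "- f (r n) t"] by (simp add: g_def)
      obtain R where R: "0 < R" "\<And>t. R < \<bar>t\<bar> \<Longrightarrow> g t = 0" using Cc_bound[OF gC] by blast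
      define k where "k t = (if t \<in> {-T..T} then 9 * C * \<eta>\<^sup>2 else 0)" for t :: real
      have hk: "(k has_integral (9 * C * \<eta>\<^sup>2) * (2 * T)) UNIV"
      proof -
        have "((\<lambda>t. 9 * C * \<eta>\<^sup>2) has_integral (T - (-T)) *\<^sub>R (9 * C * \<eta>\<^sup>2)) {-T..T}"
          by (rule has_integral_const_real[THEN has_integral_eq_rhs]) (use T in simp)
        hence "((\<lambda>t. if t \<in> {-T..T} then 9 * C * \<eta>\<^sup>2 else 0) has_integral (T - (-T)) *\<^sub>R (9 * C * \<eta>\<^sup>2)) UNIV"
          by (simp only: has_integral_restrict_UNIV)
        moreover have "(T - (-T)) *\<^sub>R (9 * C * \<eta>\<^sup>2) = (9 * C * \<eta>\<^sup>2) * (2 * T)" by simp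
        ultimately show ?thesis by (simp only: k_def[abs_def])
      qed
      have "I (\<lambda>t. n2 (g t)) \<le> (9 * C * \<eta>\<^sup>2) * (2 * T) + (1 / Q0) * (2 * I (\<lambda>t. q t * n2 (f (r m) t)) + 2 * I (\<lambda>t. q t * n2 (f (r n) t)))"
      proof (rule has_integral_le)
        show "((\<lambda>t. n2 (g t)) has_integral I (\<lambda>t. n2 (g t))) UNIV" by (rule integrable_integral[OF n2_Cc(3)[OF gC]])
        show "((\<lambda>t. k t + (1 / Q0) * (2 * (q t * n2 (f (r m) t)) + 2 * (q t * n2 (f (r n) t)))) has_integral
           (9 * C * \<eta>\<^sup>2) * (2 * T) + (1 / Q0) * (2 * I (\<lambda>t. q t * n2 (f (r m) t)) + 2 * I (\<lambda>t. q t * n2 (f (r n) t)))) UNIV"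
          by (intro has_integral_add has_integral_mult_right hk integrable_integral n2_Cc f)
        fix t :: real
        have nn: "0 \<le> (1 / Q0) * (2 * (q t * n2 (f (r m) t)) + 2 * (q t * n2 (f (r n) t)))"
          using Q0 q_nonneg[of t] by (intro mult_nonneg_nonneg add_nonneg_nonneg) auto
        show "n2 (g t) \<le> k t + (1 / Q0) * (2 * (q t * n2 (f (r m) t)) + 2 * (q t * n2 (f (r n) t)))"
        proof (cases "t \<in> {-T..T}")
          case True
          hence "\<bar>t\<bar> \<le> T" by auto
          hence "(norm (g t))\<^sup>2 \<le> (3 * \<eta>)\<^sup>2" using gb by (intro power_mono) auto
          hence "C * (norm (g t))\<^sup>2 \<le> C * (3 * \<eta>)\<^sup>2" using C(1) by (intro mult_left_mono) auto
          hence "n2 (g t) \<le> C * (3 * \<eta>)\<^sup>2" using C(2)[of "g t"] by linarith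
          also have "... = k t" using True by (simp add: k_def power_mult_distrib)
          finally show ?thesis using nn by linarith
        next
          case False
          hence "T \<le> \<bar>t\<bar>" by auto
          hence "Q0 \<le> q t" by (rule T(2))
          hence "Q0 * n2 (g t) \<le> q t * (2 * n2 (f (r m) t) + 2 * n2 (f (r n) t))"
            using n2g[of t] q_nonneg[of t] by (intro mult_mono) auto
          hence "n2 (g t) \<le> (1 / Q0) * (q t * (2 * n2 (f (r m) t) + 2 * n2 (f (r n) t)))" using Q0 by (simp add: field_simps)
          moreover have "k t = 0" using False by (simp only: k_def if_False)
          ultimately show ?thesis by (simp add: algebra_simps)
        qed
      qed
      also have "... \<le> (9 * C * \<eta>\<^sup>2) * (2 * T) + (1 / Q0) * (2 * (2 * K0) + 2 * (2 * K0))"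
        using Kq[of "r m"] Kq[of "r n"] Q0 by (intro add_left_mono mult_left_mono) auto
      also have "(9 * C * \<eta>\<^sup>2) * (2 * T) = \<epsilon> / 4" using \<epsilon> C T by (simp add: \<eta>_def)
      also have "(1 / Q0) * (2 * (2 * K0) + 2 * (2 * K0)) = (\<epsilon> / 4) * (K0 / (K0 + 1))" using \<epsilon> K00 by (simp add: Q0_def field_simps)
      also have "\<epsilon> / 4 + (\<epsilon> / 4) * (K0 / (K0 + 1)) \<le> \<epsilon> / 4 + (\<epsilon> / 4) * 1"
        using \<epsilon> K00 by (intro add_left_mono mult_left_mono) auto
      also have "... < \<epsilon>" using \<epsilon> by simp
      finally show ?thesis by (simp add: g_def)
    qed
    thus ?thesis by blast
  qed
  with r show ?thesis by blast
qed

end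

section \<open>Trigonometric approximation\<close>

definition ex :: "real \<Rightarrow> complex" where "ex t = exp (2 * of_real pi * \<i> * of_real t)"

lemma ex_add: "ex (s + t) = ex s * ex t" by (simp add: ex_def exp_add[symmetric] algebra_simps)
lemma ex_0 [simp]: "ex 0 = 1" by (simp add: ex_def)
lemma ex_cis: "ex t = cis (2 * pi * t)" by (simp add: ex_def cis_conv_exp algebra_simps)
lemma ex_norm [simp]: "cmod (ex t) = 1" by (simp add: ex_cis)
lemma ex_nz [simp]: "ex t \<noteq> 0" by (simp add: ex_def)
lemma ex_neg: "ex (- t) = cnj (ex t)" by (simp add: ex_cis cis_cnj)
lemma ex_cnj_mult [simp]: "ex t * cnj (ex t) = 1" by (simp add: complex_norm_square[symmetric])
lemma ex_eq_1: "ex t = 1 \<longleftrightarrow> t \<in> \<int>"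
proof
  assume "ex t = 1"
  hence "exp (2 * of_real pi * \<i> * of_real t) = 1" by (simp add: ex_def)
  then obtain n :: int where "Im (2 * of_real pi * \<i> * of_real t) = of_int (2 * n) * pi" by (auto simp: exp_eq_1)
  hence "t = of_int n" by simp
  thus "t \<in> \<int>" by simp
next
  assume "t \<in> \<int>"
  then obtain n where "t = of_int n" by (elim Ints_cases)
  thus "ex t = 1" by (simp add: ex_def exp_eq_1)
qed
lemma ex_continuous: "continuous_on S f \<Longrightarrow> continuous_on S (\<lambda>x. ex (f x))"
  unfolding ex_def by (intro continuous_intros)
lemma ex_deriv: "(ex has_vector_derivative 2 * of_real pi * \<i> * ex t) (at t)"
proof -
  have "((\<lambda>t. exp (of_real t * (2 * of_real pi * \<i>))) has_vector_derivative (2 * of_real pi * \<i>) * exp (of_real t * (2 * of_real pi * \<i>))) (at t)"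
    by (rule has_vector_derivative_real_field) (auto intro!: derivative_eq_intros)
  thus ?thesis by (simp add: ex_def[abs_def] mult.commute mult.left_commute)
qed
lemma ex_smooth: assumes "bounded_linear l" shows "smooth (\<lambda>x. ex (l x))"
proof -
  have "bounded_linear (\<lambda>x. (2 * of_real pi * \<i>) * complex_of_real (l x))"
    by (intro bounded_linear_compose[OF bounded_linear_mult_right] bounded_linear_compose[OF bounded_linear_of_real] assms)
  from smooth_exp_linear[OF this] show ?thesis by (simp add: ex_def)
qed

definition Lat :: "'a::euclidean_space set" where "Lat = {\<kappa>. \<forall>b\<in>Basis. \<kappa> \<bullet> b \<in> \<int>}"

lemma Lat_add: "\<kappa> \<in> Lat \<Longrightarrow> \<kappa>' \<in> Lat \<Longrightarrow> \<kappa> + \<kappa>' \<in> Lat" by (simp add: Lat_def inner_add_left)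
lemma Lat_0: "0 \<in> Lat" by (simp add: Lat_def)
lemma Lat_neg: "\<kappa> \<in> Lat \<Longrightarrow> - \<kappa> \<in> Lat" by (simp add: Lat_def)
lemma Lat_Basis: "b \<in> Basis \<Longrightarrow> b \<in> Lat" by (simp add: Lat_def inner_Basis)

inductive ctrig :: "('a::euclidean_space \<Rightarrow> complex) \<Rightarrow> bool" where
  base: "\<kappa> \<in> Lat \<Longrightarrow> ctrig (\<lambda>x. a * ex (\<kappa> \<bullet> x))"
| add: "ctrig f \<Longrightarrow> ctrig g \<Longrightarrow> ctrig (\<lambda>x. f x + g x)"

inductive vtrig :: "('a::euclidean_space \<Rightarrow> complex^'m) \<Rightarrow> bool" where
  base: "\<kappa> \<in> Lat \<Longrightarrow> vtrig (\<lambda>x. ex (\<kappa> \<bullet> x) *s w)"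
| add: "vtrig f \<Longrightarrow> vtrig g \<Longrightarrow> vtrig (\<lambda>x. f x + g x)"

lemma ctrig_const: "ctrig (\<lambda>x. a)" using ctrig.base[OF Lat_0, of a] by simp

lemma ctrig_mult: "ctrig f \<Longrightarrow> ctrig g \<Longrightarrow> ctrig (\<lambda>x. f x * g x)"
proof (induction f rule: ctrig.induct)
  case (base \<kappa> a)
  from base(2,1) show ?case
  proof (induction g rule: ctrig.induct)
    case (base \<kappa>' a')
    have "(\<lambda>x. a * ex (\<kappa> \<bullet> x) * (a' * ex (\<kappa>' \<bullet> x))) = (\<lambda>x. (a * a') * ex ((\<kappa> + \<kappa>') \<bullet> x))"
      by (simp add: ex_add inner_add_left algebra_simps)
    thus ?case using ctrig.base[OF Lat_add] base by metis
  next
    case (add f g)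
    thus ?case using ctrig.add by (simp add: distrib_left)
  qed
next
  case (add f f')
  thus ?case using ctrig.add by (simp add: distrib_right)
qed

lemma ctrig_sum: "(\<And>i. i \<in> I \<Longrightarrow> ctrig (f i)) \<Longrightarrow> ctrig (\<lambda>x. \<Sum>i\<in>I. f i x)"
  by (induction I rule: infinite_finite_induct) (auto intro: ctrig_const ctrig.add)

lemma vtrig_const: "vtrig (\<lambda>x. 0)" using vtrig.base[OF Lat_0, of 0] by simp
lemma vtrig_sum: "(\<And>i. i \<in> I \<Longrightarrow> vtrig (f i)) \<Longrightarrow> vtrig (\<lambda>x. \<Sum>i\<in>I. f i x)"
  by (induction I rule: infinite_finite_induct) (auto intro: vtrig_const vtrig.add)

lemma ctrig_smult: "ctrig f \<Longrightarrow> vtrig (\<lambda>x. f x *s w)"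
proof (induction f rule: ctrig.induct)
  case (base \<kappa> a)
  have "(\<lambda>x. (a * ex (\<kappa> \<bullet> x)) *s w) = (\<lambda>x. ex (\<kappa> \<bullet> x) *s (a *s w))" by (simp add: mult.commute)
  thus ?case using vtrig.base[OF base] by metis
next
  case (add f g) thus ?case using vtrig.add by (simp add: vector_sadd_rdistrib)
qed

lemma ctrig_cos: "b \<in> Basis \<Longrightarrow> ctrig (\<lambda>x. of_real (cos (2 * pi * (x \<bullet> b))))"
proof -
  assume b: "b \<in> Basis"
  have "of_real (cos (2 * pi * (x \<bullet> b))) = (1/2) * ex (b \<bullet> x) + (1/2) * ex ((- b) \<bullet> x)" for x
    by (simp add: ex_cis complex_eq_iff inner_commute)
  thus ?thesis using ctrig.add[OF ctrig.base[OF Lat_Basis[OF b]] ctrig.base[OF Lat_neg[OF Lat_Basis[OF b]]]] by presburger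
qed

lemma ctrig_sin: "b \<in> Basis \<Longrightarrow> ctrig (\<lambda>x. of_real (sin (2 * pi * (x \<bullet> b))))"
proof -
  assume b: "b \<in> Basis"
  have "of_real (sin (2 * pi * (x \<bullet> b))) = (- \<i>/2) * ex (b \<bullet> x) + (\<i>/2) * ex ((- b) \<bullet> x)" for x
    by (simp add: ex_cis complex_eq_iff inner_commute)
  thus ?thesis using ctrig.add[OF ctrig.base[OF Lat_Basis[OF b]] ctrig.base[OF Lat_neg[OF Lat_Basis[OF b]]]] by presburger
qed

text \<open>Embeds the torus in a Euclidean space by cosines and sines. Polynomials in these
  coordinates are trigonometric polynomials, so the Weierstrass theorem for polynomial functions
  becomes applicable.\<close>

definition torus :: "'a::euclidean_space \<Rightarrow> 'a \<times> 'a" where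
  "torus x = (\<Sum>b\<in>Basis. cos (2 * pi * (x \<bullet> b)) *\<^sub>R b, \<Sum>b\<in>Basis. sin (2 * pi * (x \<bullet> b)) *\<^sub>R b)"

lemma torus_continuous: "continuous_on S torus"
  unfolding torus_def by (intro continuous_intros)

lemma ctrig_poly: "real_polynomial_function p \<Longrightarrow> ctrig (\<lambda>x. of_real (p (torus x)))"
proof (induction p rule: real_polynomial_function.induct)
  case (linear f)
  have l: "linear f" using linear by (rule bounded_linear.linear)
  have "f (torus x) = (\<Sum>b\<in>Basis. cos (2 * pi * (x \<bullet> b)) * f (b, 0)) + (\<Sum>b\<in>Basis. sin (2 * pi * (x \<bullet> b)) * f (0, b))" for x
  proof -
    have t: "torus x = (\<Sum>b\<in>Basis. cos (2 * pi * (x \<bullet> b)) *\<^sub>R (b, 0)) + (\<Sum>b\<in>Basis. sin (2 * pi * (x \<bullet> b)) *\<^sub>R (0, b))"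
      by (simp add: torus_def prod_eq_iff fst_sum snd_sum)
    have "f (a *\<^sub>R z) = a * f z" for a z using linear_scale[OF l, of a z] by simp
    thus ?thesis unfolding t by (simp only: linear_add[OF l] linear_sum[OF l])
  qed
  moreover have "ctrig (\<lambda>x. (\<Sum>b\<in>Basis. of_real (cos (2 * pi * (x \<bullet> b))) * of_real (f (b, 0))) + (\<Sum>b\<in>Basis. of_real (sin (2 * pi * (x \<bullet> b))) * of_real (f (0, b))))"
    by (intro ctrig.add ctrig_sum ctrig_mult ctrig_cos ctrig_sin ctrig_const)
  ultimately show ?case by simp
next
  case (const c) thus ?case by (rule ctrig_const)
next
  case (add f g) thus ?case using ctrig.add by simp
next
  case (mult f g) thus ?case using ctrig_mult by simp
qed

lemma periodic_lattice:
  assumes per: "\<And>b x. b \<in> Basis \<Longrightarrow> F (x + b) = F x" and I: "I \<subseteq> Basis"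
  shows "F (x + (\<Sum>b\<in>I. of_int (n b) *\<^sub>R b)) = F x"
proof -
  have one: "F (y + of_int k *\<^sub>R b) = F y" if "b \<in> Basis" for b k y
  proof (induction k rule: int_induct[of _ 0])
    case (step1 i)
    thus ?case using per[OF that, of "y + of_int i *\<^sub>R b"] by (simp add: scaleR_add_left algebra_simps)
  next
    case (step2 i)
    thus ?case using per[OF that, of "y + of_int (i - 1) *\<^sub>R b"] by (simp add: algebra_simps)
  qed simp
  have "finite I" using I finite_Basis finite_subset by blast
  thus ?thesis using I
  proof (induction I)
    case (insert b I)
    thus ?case using one[of b "x + (\<Sum>b\<in>I. of_int (n b) *\<^sub>R b)" "n b"] by (simp add: algebra_simps)
  qed simp
qed

lemma torus_eq_imp:
  assumes "torus x = torus y" shows "\<exists>n. y = x + (\<Sum>b\<in>Basis. of_int (n b) *\<^sub>R b)"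
proof -
  have "\<exists>k::int. y \<bullet> b = x \<bullet> b + of_int k" if b: "b \<in> Basis" for b
  proof -
    have "cos (2 * pi * (x \<bullet> b)) = cos (2 * pi * (y \<bullet> b))" "sin (2 * pi * (x \<bullet> b)) = sin (2 * pi * (y \<bullet> b))"
      using arg_cong[OF assms, of "\<lambda>z. fst z \<bullet> b"] arg_cong[OF assms, of "\<lambda>z. snd z \<bullet> b"] b
      by (simp_all add: torus_def)
    hence "cis (2 * pi * (y \<bullet> b)) = cis (2 * pi * (x \<bullet> b))" by (simp add: complex_eq_iff)
    hence "ex (y \<bullet> b - x \<bullet> b) = 1" unfolding diff_conv_add_uminus ex_add ex_neg by (simp add: ex_cis complex_norm_square[symmetric])
    then obtain k where "y \<bullet> b - x \<bullet> b = of_int k" by (auto simp: ex_eq_1 elim: Ints_cases)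
    thus ?thesis by (intro exI[of _ k]) simp
  qed
  then obtain n where n: "\<And>b. b \<in> Basis \<Longrightarrow> y \<bullet> b = x \<bullet> b + of_int (n b)" by metis
  have "y = x + (\<Sum>b\<in>Basis. of_int (n b) *\<^sub>R b)"
    by (rule euclidean_eqI) (simp add: n inner_add_left)
  thus ?thesis by blast
qed

text \<open>A periodic function descends to a function on the compact image of \<open>torus\<close>,
  where it is approximated by polynomials.\<close>

theorem trig_dense:
  fixes F :: "'a::euclidean_space \<Rightarrow> complex^'m"
  assumes F: "continuous_on UNIV F" and per: "\<And>b x. b \<in> Basis \<Longrightarrow> F (x + b) = F x" and \<delta>: "0 < \<delta>"
  shows "\<exists>f. vtrig f \<and> (\<forall>x. norm (F x - f x) < \<delta>)"
proof -
  define C where "C = cbox (0::'a) One"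
  define S where "S = torus ` C"
  have cS: "compact S" unfolding S_def C_def by (intro compact_continuous_image torus_continuous compact_cbox)
  define G where "G y = F (inv_into C torus y)" for y
  have Feq: "F x = F y" if xy: "torus x = torus y" for x y
  proof -
    obtain n where n: "y = x + (\<Sum>b\<in>Basis. of_int (n b) *\<^sub>R b)" using torus_eq_imp[OF xy] by blast
    show ?thesis unfolding n by (rule periodic_lattice[OF per order_refl, symmetric])
  qed
  have Gt: "G (torus x) = F x" if "x \<in> C" for x
    unfolding G_def by (rule Feq) (use f_inv_into_f[of "torus x" torus C] that in auto)
  have "continuous_on S G"
    unfolding continuous_on_closed_vimage[OF compact_imp_closed[OF cS]]
  proof (intro allI impI)
    fix T :: "(complex^'m) set" assume "closed T"
    \<comment> \<open>Continuity on the image: preimages of closed sets are images of compact sets,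
      since the cube is compact.\<close>
    have GT: "G -` T \<inter> S = torus ` (C \<inter> F -` T)" using Gt by (auto simp: S_def)
    have "closed (F -` T)" by (rule closed_vimage[OF \<open>closed T\<close> F])
    hence "compact (C \<inter> F -` T)" unfolding C_def by (intro compact_Int_closed compact_cbox)
    from compact_imp_closed[OF compact_continuous_image[OF torus_continuous this]]
    show "closed (G -` T \<inter> S)" unfolding GT .
  qed
  from Stone_Weierstrass_polynomial_function[OF cS this \<delta>]
  obtain g where g1: "polynomial_function g" and g2: "\<forall>y\<in>S. norm (G y - g y) < \<delta>" by (elim exE conjE)
  have rp: "real_polynomial_function (\<lambda>y. g y \<bullet> i)" for i
    using g1[unfolded polynomial_function_def, rule_format, OF bounded_linear_inner_left[of i]] by (simp add: o_def)
  have "vtrig (\<lambda>x. \<Sum>i\<in>Basis. of_real (g (torus x) \<bullet> i) *s i)"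
    by (intro vtrig_sum ctrig_smult ctrig_poly rp)
  moreover have "(\<Sum>i\<in>Basis. of_real (g (torus x) \<bullet> i) *s i) = g (torus x)" for x
    by (simp add: scaleR_eq_smult[symmetric] euclidean_representation)
  ultimately have vt: "vtrig (\<lambda>x. g (torus x))" by simp
  have "norm (F x - g (torus x)) < \<delta>" for x
  proof -
    \<comment> \<open>The integral shift that brings \<open>x\<close> into the unit cube.\<close>
    define n where "n b = - \<lfloor>x \<bullet> b\<rfloor>" for b
    define y where "y = x + (\<Sum>b\<in>Basis. of_int (n b) *\<^sub>R b)"
    have yb: "y \<bullet> b = x \<bullet> b - of_int \<lfloor>x \<bullet> b\<rfloor>" if "b \<in> Basis" for b
      unfolding y_def inner_add_left inner_sum_left_Basis[OF that] by (simp add: n_def)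
    have yC: "y \<in> C" unfolding C_def mem_box
    proof
      fix b :: 'a assume b: "b \<in> Basis"
      have "0 \<le> x \<bullet> b - of_int \<lfloor>x \<bullet> b\<rfloor>" "x \<bullet> b - of_int \<lfloor>x \<bullet> b\<rfloor> \<le> 1" by linarith+
      thus "0 \<bullet> b \<le> y \<bullet> b \<and> y \<bullet> b \<le> One \<bullet> b" using yb[OF b] b by simp
    qed
    have F1: "F y = F x" unfolding y_def by (rule periodic_lattice[OF per order_refl])
    have "torus (x + b) = torus x" if b: "b \<in> Basis" for x b :: 'a
    proof -
      have "cos (2 * pi * ((x + b) \<bullet> c)) = cos (2 * pi * (x \<bullet> c)) \<and> sin (2 * pi * ((x + b) \<bullet> c)) = sin (2 * pi * (x \<bullet> c))"
        if c: "c \<in> Basis" for c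
        using b c sin_cos_eq_iff[of "2 * pi * (x \<bullet> c) + 2 * pi" "2 * pi * (x \<bullet> c)"]
        by (auto simp: inner_add_left inner_Basis distrib_left)
      thus ?thesis by (simp add: torus_def)
    qed
    hence "torus y = torus x" unfolding y_def by (rule periodic_lattice[OF _ order_refl])
    moreover have "norm (G (torus y) - g (torus y)) < \<delta>" using yC by (intro bspec[OF g2]) (simp add: S_def)
    ultimately show ?thesis using Gt[OF yC] F1 by simp
  qed
  with vt show ?thesis by blast
qed

section \<open>Averages of characters over the integer translations\<close>

context dirac_setting
begin

lemma phase_mult: assumes "x \<in> \<Gamma>" "y \<in> \<Gamma>" shows "phase (x \<odot> y) = phase x * phase y"
proof -
  have "\<epsilon> (x \<odot> y) = (\<epsilon> x + \<epsilon> y) mod 2"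
    using hom assms by (simp add: lattice_hom_def hom_def mult_integer_mod_group integer_mod_group_def)
  hence "\<epsilon> x + \<epsilon> y = \<epsilon> (x \<odot> y) + 2 * ((\<epsilon> x + \<epsilon> y) div 2)" by simp
  then obtain k where k: "\<epsilon> x + \<epsilon> y = \<epsilon> (x \<odot> y) + 2 * k" by blast
  have "phase x * phase y = exp (\<i> * of_real pi * of_int (\<epsilon> x + \<epsilon> y))"
    by (simp add: phase_def exp_add[symmetric] algebra_simps)
  also have "... = phase (x \<odot> y) * exp (\<i> * of_real pi * of_int (2 * k))"
    unfolding k of_int_add distrib_left exp_add phase_def ..
  also have "exp (\<i> * of_real pi * of_int (2 * k)) = 1" by (simp add: exp_eq_1)
  finally show ?thesis by simp
qed

lemma phase_sq: "phase x * phase x = 1"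
proof -
  have "phase x * phase x = exp (\<i> * of_real pi * of_int (2 * \<epsilon> x))" by (simp add: phase_def exp_add[symmetric] algebra_simps)
  also have "... = 1" by (simp add: exp_eq_1)
  finally show ?thesis .
qed

lemma phase_cnj [simp]: "cnj (phase x) = phase x"
proof -
  have "phase x * cnj (phase x) = phase x * phase x" by (simp add: complex_norm_square[symmetric] phase_sq)
  thus ?thesis by simp
qed

abbreviation tr :: "int \<Rightarrow> 'n pt" where "tr k \<equiv> (0, of_int k)"
abbreviation ho :: "real^'n \<Rightarrow> 'n pt" where "ho m \<equiv> (m, 0)"

lemma tr_lat: "tr k \<in> \<Gamma>" by (simp add: lat_iff intvec_def)
lemma ho_lat: "intvec m \<Longrightarrow> ho m \<in> \<Gamma>" by (simp add: lat_iff)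

definition sg :: "int \<Rightarrow> complex" where "sg k = phase (tr k)"

lemma tr_add: "tr j \<odot> tr k = tr (j + k)" by (simp add: sdp_simps)

lemma sg_add: "sg (j + k) = sg j * sg k"
  unfolding sg_def tr_add[symmetric] by (rule phase_mult[OF tr_lat tr_lat])

lemma sg_sq: "sg k * sg k = 1" by (simp add: sg_def phase_sq)
lemma sg_norm [simp]: "cmod (sg k) = 1" by (simp add: sg_def)
lemma sg_cnj [simp]: "cnj (sg k) = sg k" by (simp add: sg_def)
lemma sg_nz [simp]: "sg k \<noteq> 0" by (simp add: sg_def)
lemma sg_0 [simp]: "sg 0 = 1" using sg_add[of 0 0] by simp

lemma tr_ho: "tr k \<odot> ho m = ho (flow B (of_int k) *v m) \<odot> tr k" by (simp add: sdp_simps)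

text \<open>Conjugation by \<open>tr k\<close> maps \<open>ho m\<close> to
  \<open>ho (flow B (of_int k) *v m)\<close>, and the multiplicative function \<open>phase\<close>
  has commuting values. So the condition on a character is preserved by the integral flow.\<close>

lemma phase_conj: assumes "intvec m" shows "phase (ho (flow B (of_int k) *v m)) = phase (ho m)"
proof -
  have "phase (tr k) * phase (ho m) = phase (ho (flow B (of_int k) *v m)) * phase (tr k)"
    using phase_mult[OF tr_lat ho_lat[OF assms]] phase_mult[OF ho_lat[OF intvec_flow[OF assms]] tr_lat] tr_ho[of k m] by metis
  thus ?thesis by simp
qed

lemma tr_mul: "tr k \<odot> p = (flow B (of_int k) *v fst p, of_int k + snd p)" by (simp add: sdp_simps)

text \<open>Summing over the non-zero terms only makes this a finite sum for functions that vanish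
  at large heights, with no bound on the height as a parameter.\<close>

definition per :: "('n pt \<Rightarrow> complex^'m) \<Rightarrow> 'n pt \<Rightarrow> complex^'m" where
  "per \<Phi> p = (\<Sum>k | \<Phi> (tr k \<odot> p) \<noteq> 0. sg k *s \<Phi> (tr k \<odot> p))"

definition vsupp :: "real \<Rightarrow> ('n pt \<Rightarrow> 'b::zero) \<Rightarrow> bool" where
  "vsupp R \<Phi> \<longleftrightarrow> (\<forall>p. R < \<bar>snd p\<bar> \<longrightarrow> \<Phi> p = 0)"

lemma supp_window:
  assumes "vsupp R \<Theta>" "R + \<bar>snd p\<bar> \<le> real n" shows "{k. \<Theta> (tr k \<odot> p) \<noteq> 0} \<subseteq> {- int n..int n}"
proof
  fix k assume "k \<in> {k. \<Theta> (tr k \<odot> p) \<noteq> 0}"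
  hence "\<not> R < \<bar>of_int k + snd p\<bar>" using assms(1) by (auto simp: vsupp_def tr_mul)
  hence "\<bar>of_int k\<bar> \<le> real n" using assms(2) by linarith
  thus "k \<in> {- int n..int n}" by (simp add: abs_le_iff)
qed

lemma per_window:
  assumes "vsupp R \<Phi>" "R + \<bar>snd p\<bar> \<le> real n"
  shows "per \<Phi> p = (\<Sum>k\<in>{- int n..int n}. sg k *s \<Phi> (tr k \<odot> p))"
  unfolding per_def
by (rule sum.mono_neutral_left) (use supp_window[OF assms] in auto)

lemma window_ex: "\<exists>n::nat. R + \<bar>snd p\<bar> \<le> real n" by (rule real_arch_simple)

lemma tr_shift:
  assumes "snd \<gamma> = of_int j"
  shows "tr k \<odot> (\<gamma> \<odot> p) = ho (flow B (of_int k) *v fst \<gamma>) \<odot> (tr (k + j) \<odot> p)"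
proof -
  have "tr k \<odot> (\<gamma> \<odot> p) = tr k \<odot> \<gamma> \<odot> p" by (rule Gr.m_assoc[symmetric]) auto
  also have "tr k \<odot> \<gamma> = ho (flow B (of_int k) *v fst \<gamma>) \<odot> tr (k + j)" using assms by (simp add: sdp_simps)
  also have "ho (flow B (of_int k) *v fst \<gamma>) \<odot> tr (k + j) \<odot> p = ho (flow B (of_int k) *v fst \<gamma>) \<odot> (tr (k + j) \<odot> p)" by (rule Gr.m_assoc) auto
  finally show ?thesis .
qed

text \<open>Write a lattice element as \<open>ho m\<close> times \<open>tr j\<close>. Moving
  \<open>ho m\<close> past \<open>tr k\<close> turns \<open>m\<close> by the flow, which
  \<open>phase_conj\<close> ignores, and \<open>tr j\<close> only shifts the summation index at the
  cost of a sign.\<close>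

lemma per_equi:
  assumes \<Phi>: "\<And>m p. intvec m \<Longrightarrow> \<Phi> (ho m \<odot> p) = phase (ho m) *s \<Phi> p" shows "equi (per \<Phi>)"
  unfolding equi_iff
proof (intro ballI allI)
  fix \<gamma> p assume g: "\<gamma> \<in> \<Gamma>"
  obtain j where j: "snd \<gamma> = of_int j" using g by (auto simp: lat_iff elim: Ints_cases)
  have m: "intvec (fst \<gamma>)" using g by (simp add: lat_iff)
  have \<gamma>: "\<gamma> = ho (fst \<gamma>) \<odot> tr j" using j by (simp add: sdp_simps prod_eq_iff)
  have sh: "\<Phi> (tr k \<odot> (\<gamma> \<odot> p)) = phase (ho (fst \<gamma>)) *s \<Phi> (tr (k + j) \<odot> p)" for k
    unfolding tr_shift[OF j] using \<Phi>[OF intvec_flow[OF m]] phase_conj[OF m] by simp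
  have nz: "\<Phi> (tr k \<odot> (\<gamma> \<odot> p)) \<noteq> 0 \<longleftrightarrow> \<Phi> (tr (k + j) \<odot> p) \<noteq> 0" for k
    unfolding sh by (simp add: vec_eq_iff)
  have "per \<Phi> (\<gamma> \<odot> p) = (\<Sum>k | \<Phi> (tr (k + j) \<odot> p) \<noteq> 0. sg k *s (phase (ho (fst \<gamma>)) *s \<Phi> (tr (k + j) \<odot> p)))"
    unfolding per_def nz by (simp only: sh)
  also have "... = (\<Sum>k | \<Phi> (tr (k + j) \<odot> p) \<noteq> 0. phase \<gamma> *s (sg (k + j) *s \<Phi> (tr (k + j) \<odot> p)))"
  proof (intro sum.cong refl)
    fix k
    have "phase \<gamma> = phase (ho (fst \<gamma>)) * sg j" using phase_mult[OF ho_lat[OF m] tr_lat[of j]] \<gamma> by (simp add: sg_def)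
    thus "sg k *s (phase (ho (fst \<gamma>)) *s \<Phi> (tr (k + j) \<odot> p)) = phase \<gamma> *s (sg (k + j) *s \<Phi> (tr (k + j) \<odot> p))"
      using sg_sq[of j] by (simp add: sg_add vector_smult_assoc)
  qed
  also have "... = (\<Sum>k | \<Phi> (tr k \<odot> p) \<noteq> 0. phase \<gamma> *s (sg k *s \<Phi> (tr k \<odot> p)))"
    by (rule sum.reindex_bij_witness[of _ "\<lambda>k. k - j" "\<lambda>k. k + j"]) auto
  also have "... = phase \<gamma> *s per \<Phi> p"
    unfolding per_def by (simp only: vec.scale_sum_right)
  finally show "per \<Phi> (\<gamma> \<odot> p) = phase \<gamma> *s per \<Phi> p" .
qed

lemma left_affine: "\<exists>L a. bounded_linear L \<and> (\<forall>p. q \<odot> p = L p + a)"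
proof (intro exI conjI allI)
  show "bounded_linear (\<lambda>v. (flow B (snd q) *v fst v, snd v))"
    by (intro bounded_linear_Pair bounded_linear_compose[OF matrix_vector_mul_bounded_linear] bounded_linear_fst bounded_linear_snd)
  show "q \<odot> p = (flow B (snd q) *v fst p, snd p) + q" for p by (simp add: sdp_simps prod_eq_iff)
qed

lemma smooth_left: "smooth \<Phi> \<Longrightarrow> smooth (\<lambda>p. \<Phi> (q \<odot> p))"
  using left_affine[of q] smooth_compose_affine by (metis (no_types, lifting) ext)

lemma smooth_smult: "smooth f \<Longrightarrow> smooth (\<lambda>p. a *s (f p :: complex^'m))"
  by (rule smooth_bilinear[OF smult_bounded_bilinear smooth_const])

lemma open_strip: "open {p::'n pt. \<bar>snd p\<bar> < S}"
  by (intro open_Collect_less continuous_intros)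

lemma per_smooth: assumes "smooth \<Phi>" "vsupp R \<Phi>" shows "smooth (per \<Phi>)"
proof (rule smooth_local)
  fix p :: "'n pt"
  obtain n :: nat where n: "R + (\<bar>snd p\<bar> + 1) \<le> real n" using real_arch_simple by blast
  have "smooth (\<lambda>q. \<Sum>k\<in>{- int n..int n}. sg k *s \<Phi> (tr k \<odot> q))"
    by (intro smooth_sum smooth_smult smooth_left assms)
  moreover have "\<forall>q\<in>{q. \<bar>snd q\<bar> < \<bar>snd p\<bar> + 1}. per \<Phi> q = (\<Sum>k\<in>{- int n..int n}. sg k *s \<Phi> (tr k \<odot> q))"
    using n by (intro ballI per_window[OF assms(2)]) auto
  ultimately show "\<exists>U g. open U \<and> p \<in> U \<and> (\<forall>y\<in>U. per \<Phi> y = g y) \<and> smooth g"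
    using open_strip[of "\<bar>snd p\<bar> + 1"] by (intro exI[of _ "{q. \<bar>snd q\<bar> < \<bar>snd p\<bar> + 1}"] exI) auto
qed

text \<open>Stated for a family of linear maps so that all first order terms and the zero order term
  of the operator are treated at once.\<close>

lemma per_linear:
  assumes R: "vsupp R \<Phi>" "\<And>i. i \<in> I \<Longrightarrow> vsupp R (\<Phi>i i)" and f: "\<And>i. i \<in> I \<Longrightarrow> bounded_linear (f i)"
    and fs: "\<And>i a x. i \<in> I \<Longrightarrow> f i (a *s x) = a *s f i x"
    and eq: "\<And>p. \<Phi> p = (\<Sum>i\<in>I. f i (\<Phi>i i p))"
  shows "per \<Phi> p = (\<Sum>i\<in>I. f i (per (\<Phi>i i) p))"
proof -
  obtain n :: nat where n: "R + \<bar>snd p\<bar> \<le> real n" using window_ex by blast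
  have "f i (per (\<Phi>i i) p) = (\<Sum>k\<in>{- int n..int n}. sg k *s f i (\<Phi>i i (tr k \<odot> p)))" if "i \<in> I" for i
    by (simp only: per_window[OF R(2)[OF that] n] linear_sum[OF bounded_linear.linear[OF f[OF that]]] fs[OF that])
  hence "(\<Sum>i\<in>I. f i (per (\<Phi>i i) p)) = (\<Sum>i\<in>I. \<Sum>k\<in>{- int n..int n}. sg k *s f i (\<Phi>i i (tr k \<odot> p)))" by simp
  also have "... = (\<Sum>k\<in>{- int n..int n}. sg k *s \<Phi> (tr k \<odot> p))"
    by (subst sum.swap) (simp only: eq vec.scale_sum_right)
  finally show ?thesis by (simp only: per_window[OF R(1) n])
qed

text \<open>The fields are left-invariant and the average runs over left translations; along a short
  path the same finite range of \<open>k\<close> serves for all points.\<close>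

lemma per_dir_deriv:
  assumes v: "fst v = 0 \<or> snd v = 0" and \<Phi>: "smooth \<Phi>" "vsupp R \<Phi>" and X\<Phi>: "vsupp R (Xd v \<Phi>)"
  shows "Xd v (per \<Phi>) p = per (Xd v \<Phi>) p"
proof -
  obtain n :: nat where n: "R + (\<bar>snd p\<bar> + 1) \<le> real n" using real_arch_simple by blast
  have d1: "((\<lambda>t. per \<Phi> (p \<odot> opath v t)) has_vector_derivative Xd v (per \<Phi>) p) (at 0)"
    using deriv_along_path[OF v smooth_differentiable[OF per_smooth[OF \<Phi>]], of p 0] by simp
  have bl: "bounded_linear (\<lambda>x::complex^'m. a *s x)" for a by (rule bounded_bilinear.bounded_linear_right[OF smult_bounded_bilinear])
  have dk: "((\<lambda>t. \<Phi> (tr k \<odot> (p \<odot> opath v t))) has_vector_derivative Xd v \<Phi> (tr k \<odot> p)) (at 0)" for k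
  proof -
    have "tr k \<odot> (p \<odot> x) = tr k \<odot> p \<odot> x" for x by (rule Gr.m_assoc[symmetric]) auto
    thus ?thesis using deriv_along_path[OF v smooth_differentiable[OF \<Phi>(1)], of "tr k \<odot> p" 0] by simp
  qed
  have d2: "((\<lambda>t. \<Sum>k\<in>{- int n..int n}. sg k *s \<Phi> (tr k \<odot> (p \<odot> opath v t))) has_vector_derivative
      (\<Sum>k\<in>{- int n..int n}. sg k *s Xd v \<Phi> (tr k \<odot> p))) (at 0)"
    by (intro has_vector_derivative_sum bounded_linear.has_vector_derivative[OF bl] dk)
  define U where "U = {t. \<bar>t * snd v\<bar> < 1}"
  have U: "open U" "0 \<in> U" unfolding U_def by (auto intro!: open_Collect_less continuous_intros)
  have "((\<lambda>t. per \<Phi> (p \<odot> opath v t)) has_vector_derivative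
      (\<Sum>k\<in>{- int n..int n}. sg k *s Xd v \<Phi> (tr k \<odot> p))) (at 0)"
  proof (rule has_vector_derivative_transform_within_open[OF d2 U])
    fix t assume "t \<in> U"
    hence "\<bar>snd (p \<odot> opath v t)\<bar> \<le> \<bar>snd p\<bar> + 1" by (simp add: sdp_simps opath_def U_def)
    thus "(\<Sum>k\<in>{- int n..int n}. sg k *s \<Phi> (tr k \<odot> (p \<odot> opath v t))) = per \<Phi> (p \<odot> opath v t)"
      using n by (intro per_window[OF \<Phi>(2), symmetric]) linarith
  qed
  from vector_derivative_unique_at[OF d1 this] show ?thesis
    using n by (simp only: per_window[OF X\<Phi>, of p n])
qed

text \<open>The characters of \<open>\<real>^n\<close> that restrict to the sign of
  \<open>\<epsilon>\<close> on integral vectors.\<close>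

definition \<Lambda> :: "(real^'n) set" where "\<Lambda> = {l. \<forall>m. intvec m \<longrightarrow> ex (l \<bullet> m) = phase (ho m)}"

definition mode :: "real^'n \<Rightarrow> (real \<Rightarrow> complex^'m) \<Rightarrow> 'n pt \<Rightarrow> complex^'m" where
  "mode l f p = ex (l \<bullet> fst p) *s f (snd p)"

lemma mode_ho: assumes "l \<in> \<Lambda>" "intvec m" shows "mode l f (ho m \<odot> p) = phase (ho m) *s mode l f p"
  using assms by (simp add: mode_def sdp_simps \<Lambda>_def inner_add_right ex_add vector_smult_assoc)

lemma mode_smooth: assumes "smooth f" shows "smooth (mode l f)"
  unfolding mode_def[abs_def]
  by (intro smooth_bilinear[OF smult_bounded_bilinear] ex_smooth smooth_compose_linear[OF bounded_linear_snd] assms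
      bounded_linear_compose[OF bounded_linear_inner_right] bounded_linear_fst)

lemma mode_vsupp: "(\<And>t. R < \<bar>t\<bar> \<Longrightarrow> f t = 0) \<Longrightarrow> vsupp R (mode l f)"
  by (simp add: vsupp_def mode_def)

lemma mode_dir_deriv:
  assumes f: "smooth f"
  shows "Xd v (mode l f) = mode l (\<lambda>t. snd v *\<^sub>R vector_derivative f (at t) + (2 * of_real pi * \<i> * of_real (freq l (fst v) t)) *s f t)"
proof
  fix p :: "'n pt"
  have 1: "((\<lambda>p. ex (l \<bullet> fst p)) has_derivative (\<lambda>v. (l \<bullet> fst v) *\<^sub>R (2 * of_real pi * \<i> * ex (l \<bullet> fst p)))) (at p)"
  proof -
    have bl: "bounded_linear (\<lambda>p::'n pt. l \<bullet> fst p)" by (intro bounded_linear_compose[OF bounded_linear_inner_right] bounded_linear_fst)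
    from diff_chain_at[OF bounded_linear_imp_has_derivative[OF bl, of "at p"] ex_deriv[unfolded has_vector_derivative_def, of "l \<bullet> fst p"]]
    show ?thesis by (simp add: o_def)
  qed
  have 2: "((\<lambda>p::'n pt. f (snd p)) has_derivative (\<lambda>v. snd v *\<^sub>R vector_derivative f (at (snd p)))) (at p)"
    using diff_chain_at[OF bounded_linear_imp_has_derivative[OF bounded_linear_snd, of "at p"]
        vector_derivative_smooth(1)[OF f, unfolded has_vector_derivative_def, of "snd p"]]
    by (simp add: o_def)
  have "(mode l f has_derivative (\<lambda>v. ex (l \<bullet> fst p) *s (snd v *\<^sub>R vector_derivative f (at (snd p)))
      + ((l \<bullet> fst v) *\<^sub>R (2 * of_real pi * \<i> * ex (l \<bullet> fst p))) *s f (snd p))) (at p)"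
    unfolding mode_def[abs_def] by (rule bounded_bilinear.FDERIV[OF smult_bounded_bilinear 1 2])
  from frechet_derivative_at[OF this]
  have "frechet_derivative (mode l f) (at p) w = ex (l \<bullet> fst p) *s (snd w *\<^sub>R vector_derivative f (at (snd p)))
      + ((l \<bullet> fst w) *\<^sub>R (2 * of_real pi * \<i> * ex (l \<bullet> fst p))) *s f (snd p)" for w by (rule fun_cong[OF sym])
  thus "Xd v (mode l f) p = mode l (\<lambda>t. snd v *\<^sub>R vector_derivative f (at t) + (2 * of_real pi * \<i> * of_real (freq l (fst v) t)) *s f t) p"
    by (simp add: dir_deriv_def left_field_formula mode_def freq_def vector_add_ldistrib vector_smult_assoc scaleR_conv_of_real mult_ac)
qed

definition \<Psi> :: "real^'n \<Rightarrow> (real \<Rightarrow> complex^'m) \<Rightarrow> 'n pt \<Rightarrow> complex^'m" where "\<Psi> l f = per (mode l f)"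

lemma \<Psi>_SS: assumes "l \<in> \<Lambda>" "f \<in> Cc" shows "\<Psi> l f \<in> SS"
proof -
  obtain R where "\<And>t. R < \<bar>t\<bar> \<Longrightarrow> f t = 0" using Cc_bound[OF assms(2)] by blast
  hence "smooth (\<Psi> l f)" unfolding \<Psi>_def
    by (intro per_smooth[of _ R] mode_smooth mode_vsupp Cc_smooth assms)
  moreover have "equi (\<Psi> l f)" unfolding \<Psi>_def by (intro per_equi mode_ho assms)
  ultimately show ?thesis by (simp add: smooth_spinors_def)
qed

text \<open>The fields \<open>s i\<close> with \<open>i < d\<close> lie in the ideal, so on
  \<open>mode l f\<close> they differentiate only the character; the factor is
  \<open>2 * pi * \<i>\<close> times the frequency.\<close>

definition Pl :: "real^'n \<Rightarrow> real \<Rightarrow> complex^'m \<Rightarrow> complex^'m" where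
  "Pl l t x = (\<Sum>i\<in>{1..<d}. (2 * of_real pi * \<i> * of_real (freq l (fst (s i)) t)) *s c i x)"

definition Ql :: "real^'n \<Rightarrow> real \<Rightarrow> complex^'m \<Rightarrow> complex^'m" where "Ql l t x = Pl l t x + W x"

lemma c_in: "i \<in> {1..<d} \<Longrightarrow> i \<in> {1..d}" by simp

lemma sum_smult: "a *s (\<Sum>i\<in>I. f i) = (\<Sum>i\<in>I. a *s (f i :: complex^'m))"
  by (rule vec.scale_sum_right)

lemma Pl_lin: "Pl l t (a *s x + y) = a *s Pl l t x + Pl l t y"
proof -
  have "b *s c i (a *s x + y) = a *s (b *s c i x) + b *s c i y" if "i \<in> {1..<d}" for b i
    using cl_lin[OF s_H[OF c_in[OF that]]] by (simp add: vector_add_ldistrib vector_smult_assoc mult.commute)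
  thus ?thesis unfolding Pl_def sum_smult by (simp add: sum.distrib[symmetric])
qed

lemma Pl_herm: "h (Pl l t x) y = h x (Pl l t y)"
  unfolding Pl_def h_sum h_sum_right
  by (intro sum.cong refl) (simp add: h_scale h_scale_right cl_anti[OF s_H[OF c_in]])

lemma smooth_freq: "smooth (freq l w)"
proof -
  have bl: "bounded_linear (\<lambda>M::real^'n^'n. l \<bullet> (M *v w))"
    by (simp add: linear_conv_bounded_linear[symmetric] linear_iff matrix_vector_mult_add_rdistrib inner_add_right scaleR_matrix_vector_assoc[symmetric])
  show ?thesis unfolding freq_def[abs_def] by (rule smooth_linear_comp[OF bl smooth_flow])
qed

lemma Pl_smooth: "smooth (\<lambda>t. Pl l t x)"
  unfolding Pl_def
  by (intro smooth_sum smooth_bilinear[OF smult_bounded_bilinear] smooth_const smooth_mult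
     smooth_linear_comp[OF bounded_linear_of_real] smooth_freq)

sublocale ode: dirac_ode h "c d" cc "Ql l" for l
proof
  show "0 < cc" by (rule s_d)
  show "c d (a *s x + y) = a *s c d x + c d y" for a x y by (rule cl_lin[OF s_H[OF d_in]])
  show "c d (c d x) = - x" for x using cl_sq[OF s_H[OF d_in]] s_orth[OF d_in d_in] by simp
  show "h (c d x) y = - h x (c d y)" for x y by (rule cl_anti[OF s_H[OF d_in]])
  show "Ql l t (a *s x + y) = a *s Ql l t x + Ql l t y" for t a x y
    by (simp add: Ql_def Pl_lin W_lin vector_add_ldistrib)
  show "h (Ql l t x) y = h x (Ql l t y)" for t x y by (simp add: Ql_def h_add h_add_right Pl_herm W_herm)
  show "smooth (\<lambda>t. Ql l t x)" for x unfolding Ql_def by (intro smooth_add Pl_smooth smooth_const)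
qed

lemma D_mode: assumes f: "smooth f" shows "(\<Sum>i=1..d. c i (dir_deriv (X i) (mode l f) p)) + W (mode l f p) = mode l (ode.Dop l f) p"
proof -
  let ?e = "ex (l \<bullet> fst p)" and ?t = "snd p"
  let ?f' = "vector_derivative f (at ?t)"
  have S: "{1..d} = insert d {1..<d}" using d_pos by auto
  have "c i (dir_deriv (X i) (mode l f) p) = ?e *s ((2 * of_real pi * \<i> * of_real (freq l (fst (s i)) ?t)) *s c i (f ?t))" if "i \<in> {1..<d}" for i
    using s_ideal[OF that] s_H[OF c_in[OF that]] by (simp add: mode_dir_deriv[OF f] mode_def cl_smult)
  hence 1: "(\<Sum>i\<in>{1..<d}. c i (dir_deriv (X i) (mode l f) p)) = ?e *s Pl l ?t (f ?t)"
    unfolding Pl_def sum_smult by (intro sum.cong refl)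
  have 2: "c d (dir_deriv (X d) (mode l f) p) = ?e *s (cc *\<^sub>R c d ?f')"
    using s_d s_H[OF d_in] by (simp add: mode_dir_deriv[OF f] mode_def cl_smult cl_scaleR freq_def)
  have w: "W (a *s x) = a *s W x" for a x
    using W_lin[of a x 0] linear_0[OF bounded_linear.linear[OF clinear_bounded[OF W_lin]]] by simp
  show ?thesis unfolding S by (simp add: 1 2) (simp add: mode_def w ode.Dop_def Ql_def vector_add_ldistrib algebra_simps)
qed

text \<open>Averaging commutes with the derivatives and with the Clifford maps, so the formula of
  \<open>D_mode\<close> on the covering space passes to the average.\<close>

lemma D_\<Psi>: assumes l: "l \<in> \<Lambda>" and f: "f \<in> Cc" shows "Dsub (\<Psi> l f) = \<Psi> l (ode.Dop l f)"
proof
  fix p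
  obtain R where R: "\<And>t. R < \<bar>t\<bar> \<Longrightarrow> f t = 0" using Cc_bound[OF f] by blast
  have sf: "smooth f" using f by (rule Cc_smooth)
  have vs: "vsupp R (mode l f)" using R by (rule mode_vsupp)
  have vX: "vsupp R (dir_deriv (X i) (mode l f))" for i
    unfolding mode_dir_deriv[OF sf] by (rule mode_vsupp) (simp add: R vector_derivative_zero[of R f])
  have vD: "vsupp R (mode l (ode.Dop l f))"
    by (rule mode_vsupp) (simp add: ode.Dop_def R vector_derivative_zero[of R f] ode.Q_zero linear_0[OF bounded_linear.linear[OF cl_bl[OF s_H[OF d_in]]]])
  have W0: "bounded_linear W" by (rule clinear_bounded[OF W_lin])
  have w: "W (a *s x) = a *s W x" for a x using W_lin[of a x 0] linear_0[OF bounded_linear.linear[OF W0]] by simp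
  \<comment> \<open>Index 0, which no frame vector has, stands for the zero order term.\<close>
  define fi where "fi i = (if i = 0 then W else c i)" for i
  define \<Phi>i where "\<Phi>i i = (if i = 0 then mode l f else dir_deriv (X i) (mode l f))" for i
  have sp: "(\<Sum>i\<in>insert 0 {1..d}. F i) = F 0 + (\<Sum>i=1..d. F i)" for F :: "nat \<Rightarrow> complex^'m" by simp
  have "per (mode l (ode.Dop l f)) p = (\<Sum>i\<in>insert 0 {1..d}. fi i (per (\<Phi>i i) p))"
  proof (rule per_linear[OF vD])
    show "vsupp R (\<Phi>i i)" for i by (simp add: \<Phi>i_def vs vX)
    show "bounded_linear (fi i)" if "i \<in> insert 0 {1..d}" for i using that W0 cl_bl[OF s_H] by (auto simp: fi_def)
    show "fi i (a *s x) = a *s fi i x" if "i \<in> insert 0 {1..d}" for i a x using that w cl_smult[OF s_H] by (auto simp: fi_def)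
    show "mode l (ode.Dop l f) p = (\<Sum>i\<in>insert 0 {1..d}. fi i (\<Phi>i i p))" for p
    proof -
      have "(\<Sum>i=1..d. fi i (\<Phi>i i p)) = (\<Sum>i=1..d. c i (dir_deriv (X i) (mode l f) p))"
        by (intro sum.cong refl) (auto simp: fi_def \<Phi>i_def)
      thus ?thesis unfolding sp D_mode[OF sf, of l p, symmetric] by (simp add: fi_def \<Phi>i_def add.commute)
    qed
  qed
  also have "... = W (per (mode l f) p) + (\<Sum>i=1..d. c i (per (dir_deriv (X i) (mode l f)) p))"
  proof -
    have "(\<Sum>i=1..d. fi i (per (\<Phi>i i) p)) = (\<Sum>i=1..d. c i (per (dir_deriv (X i) (mode l f)) p))"
      by (intro sum.cong refl) (auto simp: fi_def \<Phi>i_def)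
    thus ?thesis unfolding sp by (simp add: fi_def \<Phi>i_def)
  qed
  also have "... = Dsub (per (mode l f)) p"
  proof -
    have "c i (per (dir_deriv (X i) (mode l f)) p) = c i (dir_deriv (X i) (per (mode l f)) p)" if "i \<in> {1..d}" for i
      by (simp only: per_dir_deriv[OF s_path[OF that] mode_smooth[OF sf] vs vX])
    hence "(\<Sum>i=1..d. c i (per (dir_deriv (X i) (mode l f)) p)) = (\<Sum>i=1..d. c i (dir_deriv (X i) (per (mode l f)) p))" by (intro sum.cong refl)
    thus ?thesis unfolding Dsub_eq by simp
  qed
  finally show "Dsub (\<Psi> l f) p = \<Psi> l (ode.Dop l f) p" by (simp only: \<Psi>_def)
qed

end

section \<open>The averaging map is isometric\<close>

definition Kc :: "(real \<Rightarrow> complex) set" where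
  "Kc = {\<phi>. continuous_on UNIV \<phi> \<and> (\<exists>R. \<forall>t. R < \<bar>t\<bar> \<longrightarrow> \<phi> t = 0)}"

lemma KcI: "continuous_on UNIV \<phi> \<Longrightarrow> (\<And>t. R < \<bar>t\<bar> \<Longrightarrow> \<phi> t = 0) \<Longrightarrow> \<phi> \<in> Kc" by (auto simp: Kc_def)
lemma Kc_cont: "\<phi> \<in> Kc \<Longrightarrow> continuous_on UNIV \<phi>" by (simp add: Kc_def)
lemma Kc_bound: assumes "\<phi> \<in> Kc" obtains R where "0 < R" "\<And>t. R < \<bar>t\<bar> \<Longrightarrow> \<phi> t = 0"
proof -
  obtain R where R: "\<forall>t. R < \<bar>t\<bar> \<longrightarrow> \<phi> t = 0" using assms by (auto simp: Kc_def)
  hence "\<And>t. max R 1 < \<bar>t\<bar> \<Longrightarrow> \<phi> t = 0" by simp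
  thus thesis by (intro that[of "max R 1"]) auto
qed
lemma Kc_mult: assumes "\<phi> \<in> Kc" "continuous_on UNIV \<psi>" shows "(\<lambda>t. \<phi> t * \<psi> t) \<in> Kc"
proof -
  obtain R where "\<And>t. R < \<bar>t\<bar> \<Longrightarrow> \<phi> t = 0" using Kc_bound[OF assms(1)] by blast
  thus ?thesis by (intro KcI[OF continuous_on_mult[OF Kc_cont[OF assms(1)] assms(2)], of R]) simp
qed
lemma Kc_zero: "(\<lambda>t. 0) \<in> Kc" by (rule KcI[of _ 0]) auto
lemma Kc_add: assumes "\<phi> \<in> Kc" "\<psi> \<in> Kc" shows "(\<lambda>t. \<phi> t + \<psi> t) \<in> Kc"
proof -
  obtain R where "\<And>t. R < \<bar>t\<bar> \<Longrightarrow> \<phi> t = 0" using Kc_bound[OF assms(1)] by blast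
  moreover obtain R' where "\<And>t. R' < \<bar>t\<bar> \<Longrightarrow> \<psi> t = 0" using Kc_bound[OF assms(2)] by blast
  ultimately show ?thesis by (intro KcI[OF continuous_on_add[OF Kc_cont[OF assms(1)] Kc_cont[OF assms(2)]], of "max R R'"]) simp
qed
lemma Kc_sum: "(\<And>i. i \<in> I \<Longrightarrow> \<phi> i \<in> Kc) \<Longrightarrow> (\<lambda>t. \<Sum>i\<in>I. \<phi> i t) \<in> Kc"
  by (induction I rule: infinite_finite_induct) (auto intro: Kc_zero Kc_add)

lemma integral_unit_pieces:
  fixes \<phi> :: "real \<Rightarrow> 'a::euclidean_space"
  assumes "continuous_on UNIV \<phi>"
  shows "(\<Sum>k\<in>{a..a + int j}. integral {0..1} (\<lambda>s. \<phi> (s + of_int k))) = integral {of_int a..of_int a + real j + 1} \<phi>"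
proof -
  have sh: "integral {0..1} (\<lambda>s. \<phi> (s + of_int k)) = integral {of_int k..of_int k + 1} \<phi>" for k
    using integral_shift[of 0 "of_int k" 1 \<phi>] continuous_on_subset[OF assms] by (simp add: o_def add.commute)
  show ?thesis
  proof (induction j)
    case (Suc j)
    have S: "{a..a + int (Suc j)} = insert (a + int j + 1) {a..a + int j}" by auto
    have "integral {of_int a..of_int a + real j + 1} \<phi> + integral {of_int a + real j + 1..of_int a + real j + 1 + 1} \<phi>
        = integral {of_int a..of_int a + real j + 1 + 1} \<phi>"
      by (rule Henstock_Kurzweil_Integration.integral_combine)
        (auto intro!: integrable_continuous_real continuous_on_subset[OF assms])
    thus ?case unfolding S using Suc sh[of "a + int j + 1"] by (simp add: algebra_simps)
  qed (simp add: sh)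
qed

context dirac_setting
begin

definition perS :: "('n pt \<Rightarrow> complex) \<Rightarrow> 'n pt \<Rightarrow> complex" where
  "perS \<Theta> p = (\<Sum>k | \<Theta> (tr k \<odot> p) \<noteq> 0. \<Theta> (tr k \<odot> p))"

lemma perS_window:
  assumes "vsupp R \<Theta>" "R + \<bar>snd p\<bar> \<le> real n"
  shows "perS \<Theta> p = (\<Sum>k\<in>{- int n..int n}. \<Theta> (tr k \<odot> p))"
  unfolding perS_def by (rule sum.mono_neutral_left) (use supp_window[OF assms] in auto)

lemma perS_invariant:
  assumes \<Theta>: "\<And>m p. intvec m \<Longrightarrow> \<Theta> (ho m \<odot> p) = \<Theta> p" shows "invariant (perS \<Theta>)"
  unfolding invariant_def
proof (intro ballI allI)
  fix \<gamma> p assume g: "\<gamma> \<in> \<Gamma>"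
  obtain j where j: "snd \<gamma> = of_int j" using g by (auto simp: lat_iff elim: Ints_cases)
  have m: "intvec (fst \<gamma>)" using g by (simp add: lat_iff)
  have sh: "\<Theta> (tr k \<odot> (\<gamma> \<odot> p)) = \<Theta> (tr (k + j) \<odot> p)" for k
    unfolding tr_shift[OF j] using \<Theta>[OF intvec_flow[OF m]] by simp
  show "perS \<Theta> (\<gamma> \<odot> p) = perS \<Theta> p" unfolding perS_def sh
    by (rule sum.reindex_bij_witness[of _ "\<lambda>k. k - j" "\<lambda>k. k + j"]) auto
qed

lemma perS_continuous: assumes "continuous_on UNIV \<Theta>" "vsupp R \<Theta>" shows "continuous_on UNIV (perS \<Theta>)"
proof -
  have "isCont (perS \<Theta>) p" for p
  proof -
    obtain n :: nat where n: "R + (\<bar>snd p\<bar> + 1) \<le> real n" using real_arch_simple by blast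
    have "continuous_on {q. \<bar>snd q\<bar> < \<bar>snd p\<bar> + 1} (\<lambda>q. \<Sum>k\<in>{- int n..int n}. \<Theta> (tr k \<odot> q))"
      by (intro continuous_on_sum continuous_on_compose2[OF assms(1)] continuous_on_subset[OF continuous_left]) auto
    hence "continuous_on {q. \<bar>snd q\<bar> < \<bar>snd p\<bar> + 1} (perS \<Theta>)"
      by (rule continuous_on_eq) (use n in \<open>auto intro!: perS_window[OF assms(2), symmetric]\<close>)
    thus ?thesis by (intro bspec[OF iffD1[OF continuous_on_eq_continuous_at[OF open_strip]]]) auto
  qed
  thus ?thesis by (simp add: continuous_at_imp_continuous_on)
qed

definition mS :: "real^'n \<Rightarrow> (real \<Rightarrow> complex) \<Rightarrow> 'n pt \<Rightarrow> complex" where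
  "mS \<nu> \<phi> p = ex (\<nu> \<bullet> fst p) * \<phi> (snd p)"

definition \<Lambda>0 :: "(real^'n) set" where "\<Lambda>0 = {\<nu>. \<forall>m. intvec m \<longrightarrow> ex (\<nu> \<bullet> m) = 1}"

text \<open>The quotient integral of \<open>n2 (\<Psi> l f)\<close> decomposes into such
  functionals. They are evaluated from invariance and total mass of \<open>\<mu>\<close> alone,
  without a formula for \<open>\<mu>\<close> in coordinates.\<close>

definition Tm :: "real^'n \<Rightarrow> (real \<Rightarrow> complex) \<Rightarrow> complex" where "Tm \<nu> \<phi> = integ (perS (mS \<nu> \<phi>))"

lemma mS_vsupp: "(\<And>t. R < \<bar>t\<bar> \<Longrightarrow> \<phi> t = 0) \<Longrightarrow> vsupp R (mS \<nu> \<phi>)" by (simp add: vsupp_def mS_def)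

lemma mS_invariant: "\<nu> \<in> \<Lambda>0 \<Longrightarrow> invariant (perS (mS \<nu> \<phi>))"
  by (rule perS_invariant) (simp add: mS_def sdp_simps \<Lambda>0_def inner_add_right ex_add)

lemma mS_continuous: assumes "\<phi> \<in> Kc" shows "continuous_on UNIV (perS (mS \<nu> \<phi>))"
proof -
  obtain R where "\<And>t. R < \<bar>t\<bar> \<Longrightarrow> \<phi> t = 0" using Kc_bound[OF assms] by blast
  moreover have "continuous_on UNIV (mS \<nu> \<phi>)" unfolding mS_def[abs_def]
    by (intro continuous_intros ex_continuous continuous_on_compose2[OF Kc_cont[OF assms]]) auto
  ultimately show ?thesis by (intro perS_continuous[of _ R] mS_vsupp)
qed

lemma perS_add: assumes "\<phi> \<in> Kc" "\<psi> \<in> Kc"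
  shows "perS (mS \<nu> (\<lambda>t. \<phi> t + \<psi> t)) p = perS (mS \<nu> \<phi>) p + perS (mS \<nu> \<psi>) p"
proof -
  obtain R where R: "\<And>t. R < \<bar>t\<bar> \<Longrightarrow> \<phi> t = 0" using Kc_bound[OF assms(1)] by blast
  obtain R' where R': "\<And>t. R' < \<bar>t\<bar> \<Longrightarrow> \<psi> t = 0" using Kc_bound[OF assms(2)] by blast
  obtain n :: nat where n: "max R R' + \<bar>snd p\<bar> \<le> real n" using real_arch_simple by blast
  have "vsupp (max R R') (mS \<nu> \<phi>)" "vsupp (max R R') (mS \<nu> \<psi>)" "vsupp (max R R') (mS \<nu> (\<lambda>t. \<phi> t + \<psi> t))"
    using R R' by (auto intro!: mS_vsupp)
  from this[THEN perS_window, OF n] show ?thesis by (simp add: mS_def distrib_left sum.distrib)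
qed

lemma Tm_add: assumes "\<nu> \<in> \<Lambda>0" "\<phi> \<in> Kc" "\<psi> \<in> Kc"
  shows "Tm \<nu> (\<lambda>t. \<phi> t + \<psi> t) = Tm \<nu> \<phi> + Tm \<nu> \<psi>"
  unfolding Tm_def integ_def perS_add[OF assms(2,3)]
  by (intro Bochner_Integration.integral_add integrable_invariant mS_invariant mS_continuous assms)

lemma Tm_zero: "Tm \<nu> (\<lambda>t. 0) = 0" by (simp add: Tm_def integ_def perS_def mS_def)

lemma Tm_sum: assumes "\<nu> \<in> \<Lambda>0" "\<And>i. i \<in> I \<Longrightarrow> \<phi> i \<in> Kc"
  shows "Tm \<nu> (\<lambda>t. \<Sum>i\<in>I. \<phi> i t) = (\<Sum>i\<in>I. Tm \<nu> (\<phi> i))"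
  using assms(2)
proof (induction I rule: infinite_finite_induct)
  case (insert i I)
  thus ?case using Tm_add[OF assms(1) _ Kc_sum[of I \<phi>], of "\<phi> i"] by simp
qed (simp_all add: Tm_zero)

text \<open>Right translation by \<open>(y, 0)\<close> leaves the integral unchanged and multiplies
  the integrand at height \<open>t\<close> by \<open>ex (freq \<nu> y t)\<close>.\<close>

lemma Tm_shift: assumes "\<nu> \<in> \<Lambda>0" "\<phi> \<in> Kc" shows "Tm \<nu> (\<lambda>t. \<phi> t * ex (freq \<nu> y t)) = Tm \<nu> \<phi>"
proof -
  have "perS (mS \<nu> \<phi>) (p \<odot> (y, 0)) = perS (mS \<nu> (\<lambda>t. \<phi> t * ex (freq \<nu> y t))) p" for p
  proof -
    have "mS \<nu> \<phi> (tr k \<odot> (p \<odot> (y, 0))) = mS \<nu> (\<lambda>t. \<phi> t * ex (freq \<nu> y t)) (tr k \<odot> p)" for k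
    proof -
      have "tr k \<odot> (p \<odot> (y, 0)) = tr k \<odot> p \<odot> (y, 0)" by (rule Gr.m_assoc[symmetric]) auto
      also have "mS \<nu> \<phi> (q \<odot> (y, 0)) = mS \<nu> (\<lambda>t. \<phi> t * ex (freq \<nu> y t)) q" for q
        by (simp add: mS_def sdp_simps inner_add_right ex_add freq_def)
      finally show ?thesis .
    qed
    thus ?thesis unfolding perS_def by simp
  qed
  thus ?thesis unfolding Tm_def
    using integ_right[OF mS_invariant[OF assms(1)] borel_measurable_continuous_onI[OF mS_continuous[OF assms(2)]], where q = "(y, 0)"]
    by simp
qed

lemma smooth_continuous': "continuous_on UNIV (freq l w)" by (rule smooth_continuous[OF smooth_freq])

text \<open>By \<open>Tm_shift\<close> the functional kills everything of the form
  \<open>\<phi> (1 - E i)\<close>. For \<open>\<nu> \<noteq> 0\<close> the factors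
  \<open>1 - E i\<close> have no common zero on the support of \<open>\<phi>\<close>, so
  \<open>\<phi>\<close> is a combination of such functions, with coefficients built from the
  conjugates.\<close>

lemma Tm_vanish: assumes \<nu>: "\<nu> \<in> \<Lambda>0" "\<nu> \<noteq> 0" and \<phi>: "\<phi> \<in> Kc" shows "Tm \<nu> \<phi> = 0"
proof -
  obtain R where R: "0 < R" "\<And>t. R < \<bar>t\<bar> \<Longrightarrow> \<phi> t = 0" using Kc_bound[OF \<phi>] by blast
  define b where "b = (\<Sum>i\<in>UNIV. Sup ((\<lambda>t. \<bar>freq \<nu> (axis i 1) t\<bar>) ` {-R..R}))"
  have bd: "bdd_above ((\<lambda>t. \<bar>freq \<nu> (axis i 1) t\<bar>) ` {-R..R})" for i
    by (intro bounded_imp_bdd_above compact_imp_bounded compact_continuous_image continuous_intros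
       continuous_on_subset[OF smooth_continuous']) auto
  have le: "\<bar>freq \<nu> (axis i 1) t\<bar> \<le> b" if "t \<in> {-R..R}" for i t
  proof -
    have u: "\<bar>freq \<nu> (axis i 1) t\<bar> \<le> Sup ((\<lambda>t. \<bar>freq \<nu> (axis i 1) t\<bar>) ` {-R..R})" for i
      by (rule cSUP_upper[OF that bd])
    show ?thesis unfolding b_def
      by (rule order_trans[OF u[of i] member_le_sum[of i UNIV "\<lambda>i. Sup ((\<lambda>t. \<bar>freq \<nu> (axis i 1) t\<bar>) ` {-R..R})"]]) (use order_trans[OF abs_ge_zero u] in auto)
  qed
  \<comment> \<open>Scaling by \<open>a\<close> makes the frequencies smaller than 1 in modulus on
    the support, so \<open>E i t = 1\<close> only where the frequency is 0.\<close>
  define a where "a = 1 / (b + 1)"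
  have b0: "0 \<le> b" using le[of 0] R order_trans[OF abs_ge_zero] by auto
  define E where "E i t = ex (freq \<nu> (a *\<^sub>R axis i 1) t)" for i t
  \<comment> \<open>The last summand keeps \<open>S\<close> positive where \<open>\<phi>\<close>
    vanishes anyway and is 0 on the interval that supports \<open>\<phi>\<close>; thus
    \<open>S\<close> can be a continuous denominator on the whole line.\<close>
  define S where "S t = (\<Sum>i\<in>UNIV. (cmod (1 - E i t))\<^sup>2) + max 0 (\<bar>t\<bar> - R)" for t
  have Ec: "continuous_on UNIV (E i)" for i unfolding E_def[abs_def] by (intro ex_continuous smooth_continuous')
  have Sc: "continuous_on UNIV S" unfolding S_def[abs_def] by (intro continuous_intros Ec)
  have sm: "freq \<nu> (a *\<^sub>R w) t = a * freq \<nu> w t" for w t by (simp add: freq_def matrix_vector_mult_scaleR)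
  have Sp: "0 < S t" for t
  proof (cases "R < \<bar>t\<bar>")
    case True thus ?thesis unfolding S_def by (intro add_nonneg_pos sum_nonneg) auto
  next
    case False
    obtain w where w: "freq \<nu> w t \<noteq> 0"
    proof (rule ccontr)
      assume n: "\<not> thesis"
      have "freq \<nu> (flow B (- t) *v \<nu>) t = 0" using n that by blast
      thus False using \<nu>(2) by (simp add: freq_def matrix_vector_mul_assoc flow_neg)
    qed
    have "\<exists>i. freq \<nu> (axis i 1) t \<noteq> 0"
    proof (rule ccontr)
      assume "\<not> ?thesis"
      moreover have "w = (\<Sum>i\<in>UNIV. w $ i *\<^sub>R axis i 1)" by (simp only: scalar_mult_eq_scaleR[symmetric] basis_expansion)
      hence "freq \<nu> w t = freq \<nu> (\<Sum>i\<in>UNIV. w $ i *\<^sub>R axis i 1) t" by simp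
      hence "freq \<nu> w t = (\<Sum>i\<in>UNIV. w $ i * freq \<nu> (axis i 1) t)"
        by (simp add: freq_def linear_sum[OF matrix_vector_mul_linear] inner_sum_right matrix_vector_mult_scaleR)
      ultimately show False using w by simp
    qed
    then obtain i where i: "freq \<nu> (axis i 1) t \<noteq> 0" by blast
    have "t \<in> {-R..R}" using False by (auto simp: abs_le_iff not_less)
    from le[OF this, of i] have "\<bar>a * freq \<nu> (axis i 1) t\<bar> < 1"
      using b0 by (simp add: a_def abs_mult)
    moreover have "a * freq \<nu> (axis i 1) t \<noteq> 0" using i b0 by (simp add: a_def)
    ultimately have "a * freq \<nu> (axis i 1) t \<notin> \<int>" using Ints_nonzero_abs_ge1 by fastforce
    hence "E i t \<noteq> 1" by (simp add: E_def ex_eq_1 sm)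
    hence "0 < (cmod (1 - E i t))\<^sup>2" by simp
    also have "... \<le> (\<Sum>i\<in>UNIV. (cmod (1 - E i t))\<^sup>2)" by (rule member_le_sum) auto
    finally show ?thesis by (simp add: S_def)
  qed
  define \<phi>i where "\<phi>i i t = \<phi> t * (cnj (1 - E i t) / of_real (S t))" for i t
  have \<phi>iK: "\<phi>i i \<in> Kc" for i unfolding \<phi>i_def[abs_def]
    by (intro Kc_mult \<phi> continuous_intros Ec Sc) (use Sp in \<open>simp add: less_imp_neq[symmetric]\<close>)
  have d: "Tm \<nu> (\<lambda>t. \<phi>i i t * (1 - E i t)) = 0" for i
  proof -
    have e: "\<phi>i i t * (1 - E i t) + \<phi>i i t * ex (freq \<nu> (a *\<^sub>R axis i 1) t) = \<phi>i i t" for t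
      by (simp add: E_def algebra_simps)
    have k1: "(\<lambda>t. \<phi>i i t * (1 - E i t)) \<in> Kc" by (intro Kc_mult \<phi>iK continuous_intros Ec)
    have k2: "(\<lambda>t. \<phi>i i t * ex (freq \<nu> (a *\<^sub>R axis i 1) t)) \<in> Kc" by (intro Kc_mult \<phi>iK ex_continuous smooth_continuous')
    show ?thesis using Tm_add[OF \<nu>(1) k1 k2] unfolding e Tm_shift[OF \<nu>(1) \<phi>iK] by simp
  qed
  have "(\<Sum>i\<in>UNIV. \<phi>i i t * (1 - E i t)) = \<phi> t" for t
  proof (cases "R < \<bar>t\<bar>")
    case True thus ?thesis by (simp add: \<phi>i_def R)
  next
    case False
    hence "S t = (\<Sum>i\<in>UNIV. (cmod (1 - E i t))\<^sup>2)" by (simp add: S_def)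
    hence S: "of_real (S t) = (\<Sum>i\<in>UNIV. cnj (1 - E i t) * (1 - E i t))"
      by (simp only: of_real_sum complex_norm_square mult.commute)
    have "(\<Sum>i\<in>UNIV. \<phi>i i t * (1 - E i t)) = (\<Sum>i\<in>UNIV. (\<phi> t / of_real (S t)) * (cnj (1 - E i t) * (1 - E i t)))"
      by (simp only: \<phi>i_def times_divide_eq_left times_divide_eq_right mult.assoc)
    also have "... = \<phi> t / of_real (S t) * of_real (S t)" unfolding S by (rule sum_distrib_left[symmetric])
    also have "... = \<phi> t" using Sp[of t] by simp
    finally show ?thesis .
  qed
  hence "Tm \<nu> \<phi> = Tm \<nu> (\<lambda>t. \<Sum>i\<in>UNIV. \<phi>i i t * (1 - E i t))" by simp
  also have "... = (\<Sum>i\<in>UNIV. Tm \<nu> (\<lambda>t. \<phi>i i t * (1 - E i t)))"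
    by (rule Tm_sum[OF \<nu>(1)]) (intro Kc_mult \<phi>iK continuous_intros Ec)
  finally show ?thesis by (simp add: d)
qed

lemma zero_\<Lambda>0: "0 \<in> \<Lambda>0" by (simp add: \<Lambda>0_def)

text \<open>For the trivial character the average depends on the height only and has period 1. After
  subtraction of its mean it has a periodic antiderivative, so it is a derivative along
  \<open>bvec\<close> and integrates to 0; the mean over a period unfolds to the integral over the
  line.\<close>

lemma Tm_diag: assumes \<phi>: "\<phi> \<in> Kc" shows "Tm 0 \<phi> = integral UNIV \<phi>"
proof -
  obtain R where R: "0 < R" "\<And>t. R < \<bar>t\<bar> \<Longrightarrow> \<phi> t = 0" using Kc_bound[OF \<phi>] by blast
  define u where "u t = perS (mS 0 \<phi>) (0, t)" for t
  have vs: "vsupp R (mS 0 \<phi>)" by (rule mS_vsupp[OF R(2)])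
  have uw: "u t = (\<Sum>k\<in>{- int n..int n}. \<phi> (t + of_int k))" if "R + \<bar>t\<bar> \<le> real n" for t n
    using that unfolding u_def by (subst perS_window[OF vs]) (auto simp: mS_def tr_mul add.commute)
  have pu: "perS (mS 0 \<phi>) p = u (snd p)" for p by (simp add: u_def perS_def mS_def tr_mul)
  have uc: "continuous_on UNIV u" unfolding u_def
    by (intro continuous_on_compose2[OF mS_continuous[OF \<phi>]] continuous_intros) auto
  have inv: "invariant (\<lambda>p. u (snd p))" using mS_invariant[OF zero_\<Lambda>0, of \<phi>] pu by (simp add: invariant_def)
  have u1: "u (t + of_int j) = u t" for t j
    using inv tr_lat[of j] unfolding invariant_def by (auto simp: tr_mul add.commute dest!: bspec spec[of _ t])
  define c0 where "c0 = integral {0..1} u"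
  have gc: "continuous_on UNIV (\<lambda>t. u t - c0)" by (intro continuous_intros uc)
  \<comment> \<open>Periodic because the integrand has mean 0 over a period; hence it defines a
    lattice-invariant function of the height.\<close>
  define Gf where "Gf = antid 0 (\<lambda>t. u t - c0)"
  have Gd: "(Gf has_vector_derivative (u t - c0)) (at t)" for t unfolding Gf_def by (rule antid_deriv[OF gc])
  have G1: "Gf (t + 1) = Gf t" for t
  proof -
    have "((\<lambda>t. Gf (t + 1) - Gf t) has_vector_derivative 0) (at t)" for t
    proof -
      have "((\<lambda>t. t + 1) has_vector_derivative 1) (at t)" by (auto intro!: derivative_eq_intros simp: has_vector_derivative_def)
      from vector_diff_chain_at[OF this Gd] have "((\<lambda>t. Gf (t + 1)) has_vector_derivative (u t - c0)) (at t)"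
        using u1[of t 1] by (simp add: o_def)
      from has_vector_derivative_diff[OF this Gd] show ?thesis by simp
    qed
    hence z: "Gf (t + 1) - Gf t = Gf (0 + 1) - Gf 0"
      by (intro has_derivative_zero_unique[of UNIV "\<lambda>t. Gf (t + 1) - Gf t"]) (auto simp: has_vector_derivative_def)
    have "Gf 1 = integral {0..1} (\<lambda>t. u t - c0)" by (simp add: Gf_def antid_def)
    also have "... = c0 - integral {0..1} (\<lambda>t::real. c0)" unfolding c0_def
      by (intro Henstock_Kurzweil_Integration.integral_diff integrable_continuous_real continuous_on_subset[OF uc] continuous_intros) auto
    finally have "Gf 1 = 0" by simp
    with z show ?thesis by (simp add: Gf_def)
  qed
  have Gj: "Gf (t + of_int j) = Gf t" for t j
  proof (induction j rule: int_induct[of _ 0])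
    case (step1 i) thus ?case using G1[of "t + of_int i"] by (simp add: add.assoc)
  next
    case (step2 i) thus ?case using G1[of "t + of_int (i - 1)"] by (simp add: algebra_simps)
  qed simp
  define F where "F p = Gf (snd p)" for p :: "'n pt"
  have Fd: "(F has_derivative (\<lambda>v. snd v *\<^sub>R (u (snd p) - c0))) (at p)" for p
    using diff_chain_at[OF bounded_linear_imp_has_derivative[OF bounded_linear_snd, of "at p"] Gd[unfolded has_vector_derivative_def, of "snd p"]]
    by (simp add: o_def F_def[abs_def])
  have XF: "Xd bvec F p = u (snd p) - c0" for p
    using fun_cong[OF frechet_derivative_at[OF Fd[of p]], of "left_field B bvec p"]
    by (simp add: dir_deriv_def left_field_formula bvec_def)
  have XFe: "Xd bvec F = (\<lambda>p. u (snd p) - c0)" by (rule ext) (rule XF)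
  have Fi: "invariant F" unfolding invariant_def F_def
    using Gj by (auto simp: lat_iff sdp_simps add.commute elim!: Ints_cases)
  have cus: "continuous_on UNIV (\<lambda>p::'n pt. u (snd p))"
    by (intro continuous_on_compose2[OF uc] continuous_intros) auto
  have "integ (\<lambda>p. u (snd p) - c0) = 0" unfolding XFe[symmetric]
  proof (rule integ_dir_deriv)
    show "fst (bvec::'n pt) = 0 \<or> snd (bvec::'n pt) = 0" by (simp add: bvec_def)
    show "F differentiable at p" for p unfolding differentiable_def by (rule exI) (rule Fd)
    show "invariant F" by (rule Fi)
    show "continuous_on UNIV (Xd bvec F)" unfolding XFe by (intro continuous_intros cus)
  qed
  moreover have "integ (\<lambda>p. u (snd p) - c0) = integ (\<lambda>p. u (snd p)) - c0"
    unfolding integ_def using integrable_invariant[OF inv cus] emeasure_one by (simp add: measure_def)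
  ultimately have 1: "Tm 0 \<phi> = c0" by (simp add: Tm_def ext[of "perS (mS 0 \<phi>)", OF pu])
  obtain n :: nat where n: "R + 1 \<le> real n" using real_arch_simple by blast
  have "c0 = integral {0..1} (\<lambda>t. \<Sum>k\<in>{- int n..int n}. \<phi> (t + of_int k))"
    unfolding c0_def using n by (intro Henstock_Kurzweil_Integration.integral_cong uw) auto
  also have "... = (\<Sum>k\<in>{- int n..- int n + int (2 * n)}. integral {0..1} (\<lambda>t. \<phi> (t + of_int k)))"
    by (subst Henstock_Kurzweil_Integration.integral_sum)
      (auto intro!: integrable_continuous_real continuous_intros continuous_on_compose2[OF Kc_cont[OF \<phi>]])
  also have "... = integral {- real n..real n + 1} \<phi>"
    unfolding integral_unit_pieces[OF Kc_cont[OF \<phi>]] by (simp add: add.commute)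
  also have "... = integral {- real n..real n} \<phi> + integral {real n..real n + 1} \<phi>"
    by (rule Henstock_Kurzweil_Integration.integral_combine[symmetric])
      (auto intro!: integrable_continuous_real continuous_on_subset[OF Kc_cont[OF \<phi>]])
  also have "integral {real n..real n + 1} \<phi> = integral {real n..real n + 1} (\<lambda>t. 0)"
    using n R by (intro Henstock_Kurzweil_Integration.integral_cong R(2)) auto
  also have "integral {- real n..real n} \<phi> = integral UNIV \<phi>"
    by (rule integral_UNIV_restrict(1)[OF Kc_cont[OF \<phi>], symmetric]) (use n in \<open>auto intro: R(2)\<close>)
  finally show ?thesis using 1 by simp
qed

text \<open>The character that appears in the product of a mode with the conjugate of its translate
  by \<open>tr j\<close>.\<close>

definition shl :: "real^'n \<Rightarrow> int \<Rightarrow> real^'n" where "shl l j = l - l v* flow B (of_int j)"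

lemma shl_inner: "shl l j \<bullet> w = l \<bullet> w - l \<bullet> (flow B (of_int j) *v w)"
  by (simp add: shl_def inner_diff_left dot_lmul_matrix)

lemma shl_0: "shl l 0 = 0" by (simp add: shl_def)

lemma shl_\<Lambda>0: assumes "l \<in> \<Lambda>" shows "shl l j \<in> \<Lambda>0"
  unfolding \<Lambda>0_def
proof safe
  fix m :: "real^'n" assume m: "intvec m"
  have "ex (shl l j \<bullet> m) = ex (l \<bullet> m) * cnj (ex (l \<bullet> (flow B (of_int j) *v m)))"
    unfolding shl_inner diff_conv_add_uminus ex_add ex_neg ..
  also have "... = phase (ho m) * cnj (phase (ho m))"
    using assms m intvec_flow[OF m, of j] phase_conj[OF m, of j] by (simp add: \<Lambda>_def)
  finally show "ex (shl l j \<bullet> m) = 1" by (simp add: phase_sq)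
qed

lemma shl_nz: assumes "\<not> fixed l" "j \<noteq> 0" shows "shl l j \<noteq> 0"
proof
  assume z: "shl l j = 0"
  have "freq l w (of_int j) = l \<bullet> w" for w using shl_inner[of l j w] z by (simp add: freq_def)
  thus False using fixed_of_period[of "of_int j" l] assms by simp
qed

text \<open>Expanding the square pairs the translates with each other. Pairs at distance
  \<open>j\<close> contribute the functional of the character \<open>shl l j\<close>, which is
  nonzero for \<open>j \<noteq> 0\<close>, so only the diagonal terms survive.\<close>

lemma norm_\<Psi>:
  assumes l: "l \<in> \<Lambda>" "\<not> fixed l" and f: "f \<in> Cc"
  shows "(L.N (\<Psi> l f))\<^sup>2 = integral UNIV (\<lambda>t. n2 (f t))"
proof -
  obtain R where R: "0 < R" "\<And>t. R < \<bar>t\<bar> \<Longrightarrow> f t = 0" using Cc_bound[OF f] by blast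
  \<comment> \<open>Translates of \<open>f\<close> by more than \<open>2 * R\<close> have disjoint
    supports, so only \<open>|j| \<le> J\<close> matters, uniformly in the point.\<close>
  obtain J :: nat where J: "2 * R \<le> real J" using real_arch_simple by blast
  have vs: "vsupp R (mode l f)" by (rule mode_vsupp[OF R(2)])
  define \<phi> where "\<phi> j t = h (f t) (f (t + of_int j))" for j t
  have fc: "continuous_on UNIV f" by (rule Cc_continuous[OF f])
  have \<phi>K: "\<phi> j \<in> Kc" for j
    unfolding \<phi>_def[abs_def]
    by (rule KcI[of _ R]) (auto simp: R(2) intro!: h_continuous fc continuous_on_compose2[OF fc] continuous_intros)
  have \<phi>v: "vsupp R (mS \<nu> (\<phi> j))" for \<nu> j by (rule mS_vsupp) (simp add: \<phi>_def R(2))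
  have \<Psi>k: "h (sg k *s mode l f (tr k \<odot> p)) (\<Psi> l f p) = (\<Sum>j\<in>{- int J..int J}. sg j * mS (shl l j) (\<phi> j) (tr k \<odot> p))" for k p
  proof (cases "R < \<bar>of_int k + snd p\<bar>")
    case True
    hence "mode l f (tr k \<odot> p) = 0" "mS (shl l j) (\<phi> j) (tr k \<odot> p) = 0" for j
      using vs \<phi>v[of "shl l j" j] by (auto simp: vsupp_def tr_mul)
    thus ?thesis by simp
  next
    case False
    have "\<Psi> l f p = (\<Sum>i\<in>{k - int J..k + int J}. sg i *s mode l f (tr i \<odot> p))"
      unfolding \<Psi>_def per_def
    proof (rule sum.mono_neutral_left)
      show "{i. mode l f (tr i \<odot> p) \<noteq> 0} \<subseteq> {k - int J..k + int J}"
      proof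
        fix i assume "i \<in> {i. mode l f (tr i \<odot> p) \<noteq> 0}"
        hence "\<not> R < \<bar>of_int i + snd p\<bar>" using vs by (auto simp: vsupp_def tr_mul)
        hence "\<bar>of_int i - of_int k\<bar> \<le> real J" using False J by linarith
        thus "i \<in> {k - int J..k + int J}" by (auto simp: abs_le_iff)
      qed
    qed auto
    also have "... = (\<Sum>j\<in>{- int J..int J}. sg (k + j) *s mode l f (tr (k + j) \<odot> p))"
      by (rule sum.reindex_bij_witness[of _ "\<lambda>j. k + j" "\<lambda>i. i - k"]) auto
    finally have P: "\<Psi> l f p = (\<Sum>j\<in>{- int J..int J}. sg (k + j) *s mode l f (tr (k + j) \<odot> p))" .
    have "h (sg k *s mode l f (tr k \<odot> p)) (sg (k + j) *s mode l f (tr (k + j) \<odot> p)) = sg j * mS (shl l j) (\<phi> j) (tr k \<odot> p)" for j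
    proof -
      let ?x = "flow B (of_int k) *v fst p"
      have fl: "flow B (of_int (k + j)) *v fst p = flow B (of_int j) *v ?x"
        using flow_add[of "of_int j" "of_int k"] by (simp add: matrix_vector_mul_assoc add.commute)
      have e: "ex (shl l j \<bullet> ?x) = ex (l \<bullet> ?x) * cnj (ex (l \<bullet> (flow B (of_int j) *v ?x)))"
        unfolding shl_inner diff_conv_add_uminus ex_add ex_neg ..
      have s: "sg k * sg (k + j) = sg j" unfolding sg_add mult.assoc[symmetric] sg_sq by simp
      have "h (sg k *s mode l f (tr k \<odot> p)) (sg (k + j) *s mode l f (tr (k + j) \<odot> p))
         = (sg k * sg (k + j)) * (ex (l \<bullet> ?x) * cnj (ex (l \<bullet> (flow B (of_int j) *v ?x))) * h (f (of_int k + snd p)) (f (of_int (k + j) + snd p)))"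
        unfolding mode_def tr_mul fst_conv snd_conv fl h_scale h_scale_right sg_cnj complex_cnj_mult by (simp only: mult_ac)
      also have "... = sg j * mS (shl l j) (\<phi> j) (tr k \<odot> p)"
        unfolding s e[symmetric] by (simp add: mS_def tr_mul \<phi>_def add_ac)
      finally show ?thesis .
    qed
    thus ?thesis unfolding P h_sum_right by (intro sum.cong refl)
  qed
  have pt: "of_real (n2 (\<Psi> l f p)) = (\<Sum>j\<in>{- int J..int J}. sg j * perS (mS (shl l j) (\<phi> j)) p)" for p
  proof -
    obtain n :: nat where n: "R + \<bar>snd p\<bar> \<le> real n" using real_arch_simple by blast
    have "of_real (n2 (\<Psi> l f p)) = h (\<Psi> l f p) (\<Psi> l f p)" by (rule h_self[symmetric])
    also have "... = h (\<Sum>k\<in>{- int n..int n}. sg k *s mode l f (tr k \<odot> p)) (\<Psi> l f p)"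
      using per_window[OF vs n] by (simp only: \<Psi>_def)
    also have "... = (\<Sum>k\<in>{- int n..int n}. \<Sum>j\<in>{- int J..int J}. sg j * mS (shl l j) (\<phi> j) (tr k \<odot> p))"
      unfolding h_sum \<Psi>k ..
    also have "... = (\<Sum>j\<in>{- int J..int J}. sg j * perS (mS (shl l j) (\<phi> j)) p)"
      unfolding perS_window[OF \<phi>v n] sum_distrib_left by (rule sum.swap)
    finally show ?thesis .
  qed
  have SSf: "\<Psi> l f \<in> SS" by (rule \<Psi>_SS[OF l(1) f])
  hence M2f: "\<Psi> l f \<in> M2" using SS_Ceq Ceq_M2 by blast
  have "of_real ((L.N (\<Psi> l f))\<^sup>2) = (LINT C|\<mu>. complex_of_real (n2 (\<Psi> l f (rep C))))"
    unfolding N_sq_integral[OF M2f] by (rule integral_complex_of_real[symmetric])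
  also have "... = (\<Sum>j\<in>{- int J..int J}. LINT C|\<mu>. sg j * perS (mS (shl l j) (\<phi> j)) (rep C))"
    unfolding pt
    by (intro Bochner_Integration.integral_sum integrable_mult_right integrable_invariant mS_invariant mS_continuous shl_\<Lambda>0 l \<phi>K)
  also have "... = (\<Sum>j\<in>{- int J..int J}. sg j * Tm (shl l j) (\<phi> j))" by (simp add: Tm_def integ_def)
  also have "... = (\<Sum>j\<in>{- int J..int J}. if j = 0 then Tm 0 (\<phi> 0) else 0)"
    by (intro sum.cong refl) (auto simp: Tm_vanish[OF shl_\<Lambda>0[OF l(1)] shl_nz[OF l(2)] \<phi>K] shl_0)
  also have "... = integral UNIV (\<phi> 0)" by (simp add: Tm_diag[OF \<phi>K])
  also have "... = integral UNIV (\<lambda>t. complex_of_real (n2 (f t)))" by (simp add: \<phi>_def[abs_def] h_self)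
  also have "... = of_real (integral UNIV (\<lambda>t. n2 (f t)))"
    using integral_linear[OF integral_UNIV_restrict(2)[OF n2_continuous[OF fc], of R] bounded_linear_of_real] R(2)
    by (simp add: o_def n2_def)
  finally show ?thesis by (simp only: of_real_eq_iff)
qed

end

text \<open>The derivative has smaller degree, so it is dominated by the polynomial outside a
  compact interval and bounded inside. This is the source of \<open>P'_bound\<close>.\<close>

lemma is_poly_deriv_bound:
  assumes f: "is_poly f" "\<And>t. (f has_real_derivative f' t) (at t)"
  shows "\<exists>C\<ge>0. \<forall>t. (f' t)\<^sup>2 \<le> (f t)\<^sup>2 + C"
proof -
  obtain p where p: "\<And>t. f t = poly p t" using f(1) by (auto simp: is_poly_def)
  have f': "f' t = poly (pderiv p) t" for t
    using DERIV_unique[OF f(2)[of t]] poly_DERIV[of p t] p by (metis DERIV_cong_ev[OF refl always_eventually refl])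
  show ?thesis
  proof (cases "degree p = 0")
    case True
    hence "pderiv p = 0" by (simp add: pderiv_eq_0_iff)
    thus ?thesis by (intro exI[of _ 0]) (simp add: f')
  next
    case False
    have "((\<lambda>x. poly (pderiv p) x / poly p x) \<longlongrightarrow> 0) at_infinity"
      by (rule poly_divide_tendsto_0_at_infinity) (use False in \<open>simp add: degree_pderiv\<close>)
    from tendstoD[OF this, of 1] have 1: "\<forall>\<^sub>F x in at_infinity. \<bar>poly (pderiv p) x / poly p x\<bar> < 1" by simp
    have "filterlim (poly p) at_infinity at_infinity" by (rule filterlim_poly_at_infinity) (use False in simp)
    hence "\<forall>\<^sub>F x in at_infinity. 1 \<le> norm (poly p x)" unfolding filterlim_at_infinity[OF order_refl] by simp
    with 1 have "\<forall>\<^sub>F x in at_infinity. \<bar>poly (pderiv p) x\<bar> \<le> \<bar>poly p x\<bar>"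
      by eventually_elim (auto simp: abs_divide divide_less_eq split: if_splits)
    then obtain b where b: "\<And>x. b \<le> \<bar>x\<bar> \<Longrightarrow> \<bar>poly (pderiv p) x\<bar> \<le> \<bar>poly p x\<bar>"
      unfolding eventually_at_infinity by auto
    have "compact ((\<lambda>x. poly (pderiv p) x) ` {-b..b})" by (intro compact_continuous_image continuous_intros) auto
    then obtain M where M: "\<And>x. x \<in> {-b..b} \<Longrightarrow> \<bar>poly (pderiv p) x\<bar> \<le> M"
      using compact_imp_bounded bounded_iff by (metis (no_types, lifting) imageI real_norm_def)
    have "(f' t)\<^sup>2 \<le> (f t)\<^sup>2 + M\<^sup>2" for t
    proof (cases "b \<le> \<bar>t\<bar>")
      case True
      hence "(f' t)\<^sup>2 \<le> (f t)\<^sup>2" unfolding f' p using b[OF True] by (simp add: abs_le_square_iff)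
      thus ?thesis using zero_le_power2[of M] by linarith
    next
      case False
      hence "t \<in> {-b..b}" by auto
      from M[OF this] have "\<bar>f' t\<bar> \<le> \<bar>M\<bar>" unfolding f' by linarith
      hence "(f' t)\<^sup>2 \<le> M\<^sup>2" by (simp add: abs_le_square_iff)
      thus ?thesis using zero_le_power2[of "f t"] by linarith
    qed
    thus ?thesis by (intro exI[of _ "M\<^sup>2"]) auto
  qed
qed

lemma is_poly_lim:
  assumes f: "is_poly f" and n: "f a \<noteq> f b"
  shows "\<exists>T. \<forall>t. T \<le> \<bar>t\<bar> \<longrightarrow> M \<le> (f t)\<^sup>2"
proof -
  obtain p where p: "\<And>t. f t = poly p t" using f by (auto simp: is_poly_def)
  have d: "degree p \<noteq> 0"
  proof
    assume "degree p = 0"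
    then obtain c where "p = [:c:]" by (rule degree_eq_zeroE)
    thus False using n by (simp add: p)
  qed
  have "filterlim (poly p) at_infinity at_infinity" by (rule filterlim_poly_at_infinity) (use d in simp)
  hence "\<forall>\<^sub>F x in at_infinity. \<bar>M\<bar> + 1 \<le> norm (poly p x)" unfolding filterlim_at_infinity[OF order_refl] by simp
  then obtain T where T: "\<And>x. T \<le> \<bar>x\<bar> \<Longrightarrow> \<bar>M\<bar> + 1 \<le> \<bar>poly p x\<bar>" unfolding eventually_at_infinity by auto
  have "M \<le> (f t)\<^sup>2" if "T \<le> \<bar>t\<bar>" for t
  proof -
    have "(\<bar>M\<bar> + 1)\<^sup>2 \<le> \<bar>poly p t\<bar>\<^sup>2" by (rule power_mono[OF T[OF that]]) simp
    moreover have "(\<bar>M\<bar> + 1)\<^sup>2 = M\<^sup>2 + 2 * \<bar>M\<bar> + 1" by (simp add: power2_sum)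
    hence "M \<le> (\<bar>M\<bar> + 1)\<^sup>2" using zero_le_power2[of M] abs_ge_self[of M] by linarith
    ultimately show ?thesis by (simp add: p)
  qed
  thus ?thesis by blast
qed

section \<open>Growth of the potential and the pieces of non-fixed characters\<close>

context dirac_setting
begin

definition Vc :: "(nat \<Rightarrow> real) \<Rightarrow> complex^'m \<Rightarrow> complex^'m" where
  "Vc a x = (\<Sum>i\<in>{1..<d}. a i *\<^sub>R c i x)"

lemma Vc_anti: "h (Vc a x) y = - h x (Vc a y)"
  unfolding Vc_def h_sum h_sum_right sum_negf[symmetric]
  by (intro sum.cong refl) (simp add: h_scaleR h_scaleR_right cl_anti[OF s_H[OF c_in]])

lemma c_bl: "i \<in> {1..d} \<Longrightarrow> bounded_linear (c i)" by (rule cl_bl[OF s_H])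

text \<open>Symmetrising the double sum leaves only the anticommutators, of which those with
  different indices vanish.\<close>

lemma Vc_sq: "Vc a (Vc a x) = - ((\<Sum>i\<in>{1..<d}. (a i)\<^sup>2) *\<^sub>R x)"
proof -
  let ?I = "{1..<d}"
  have e: "Vc a (Vc a x) = (\<Sum>i\<in>?I. \<Sum>j\<in>?I. (a i * a j) *\<^sub>R c i (c j x))"
    unfolding Vc_def
  proof (intro sum.cong refl)
    fix i assume i: "i \<in> ?I"
    note l = bounded_linear.linear[OF c_bl[OF c_in[OF i]]]
    show "a i *\<^sub>R c i (\<Sum>j\<in>?I. a j *\<^sub>R c j x) = (\<Sum>j\<in>?I. (a i * a j) *\<^sub>R c i (c j x))"
      unfolding linear_sum[OF l] linear_scale[OF l] scaleR_sum_right by simp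
  qed
  have "Vc a (Vc a x) + Vc a (Vc a x) = (\<Sum>i\<in>?I. \<Sum>j\<in>?I. (a i * a j) *\<^sub>R c i (c j x)) + (\<Sum>i\<in>?I. \<Sum>j\<in>?I. (a i * a j) *\<^sub>R c j (c i x))"
    unfolding e by (rule arg_cong2[of _ _ _ _ "(+)", OF refl]) (subst sum.swap, simp only: mult.commute)
  also have "... = (\<Sum>i\<in>?I. \<Sum>j\<in>?I. (a i * a j) *\<^sub>R (c i (c j x) + c j (c i x)))"
    by (simp only: sum.distrib[symmetric] scaleR_add_right)
  also have "... = (\<Sum>i\<in>?I. \<Sum>j\<in>?I. if j = i then - ((2 * (a i)\<^sup>2) *\<^sub>R x) else 0)"
  proof (intro sum.cong refl)
    fix i j assume ij: "i \<in> ?I" "j \<in> ?I"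
    show "(a i * a j) *\<^sub>R (c i (c j x) + c j (c i x)) = (if j = i then - ((2 * (a i)\<^sup>2) *\<^sub>R x) else 0)"
      using c_anticomm[OF c_in[OF ij(1)] c_in[OF ij(2)], of x] by (auto simp: power2_eq_square)
  qed
  also have "... = - ((2 * (\<Sum>i\<in>?I. (a i)\<^sup>2)) *\<^sub>R x)"
    by (simp add: sum_negf scaleR_left.sum[symmetric] sum_distrib_left)
  finally have "2 *\<^sub>R Vc a (Vc a x) = 2 *\<^sub>R (- ((\<Sum>i\<in>?I. (a i)\<^sup>2) *\<^sub>R x))"
    by (simp add: scaleR_2)
  thus ?thesis by (simp only: scaleR_cancel_left) simp
qed

lemma Vc_n2: "n2 (Vc a x) = (\<Sum>i\<in>{1..<d}. (a i)\<^sup>2) * n2 x"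
  by (simp add: n2_def Vc_anti Vc_sq h_minus_right h_scaleR_right)

lemma sum_smult_Vc: "(\<Sum>i\<in>{1..<d}. (z * of_real (a i)) *s c i x) = z *s Vc a x"
  unfolding Vc_def sum_smult by (intro sum.cong refl) (simp add: scaleR_eq_smult vector_smult_assoc)

lemma Pl_Vc: "Pl l t x = (2 * of_real pi * \<i>) *s Vc (\<lambda>i. freq l (fst (s i)) t) x"
  unfolding Pl_def by (rule sum_smult_Vc)

definition Pl' :: "real^'n \<Rightarrow> real \<Rightarrow> complex^'m \<Rightarrow> complex^'m" where
  "Pl' l t x = (2 * of_real pi * \<i>) *s Vc (\<lambda>i. freq l (B *v fst (s i)) t) x"

definition ql :: "real^'n \<Rightarrow> real \<Rightarrow> real" where
  "ql l t = 4 * pi\<^sup>2 * (\<Sum>i\<in>{1..<d}. (freq l (fst (s i)) t)\<^sup>2)"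

lemma n2_2pi: "n2 ((2 * of_real pi * \<i>) *s x) = 4 * pi\<^sup>2 * n2 x"
  by (simp add: n2_scale norm_mult power_mult_distrib)

text \<open>The one condition that uses more than Clifford relations is growth at infinity: it comes
  from bracket generation, and the bound on the derivative from the frequencies being
  polynomials.\<close>

lemma potential:
  assumes "\<not> fixed l"
  shows "\<exists>C0. dirac_ode_potential h (c d) cc (Ql l) (Pl l) (Pl' l) W (ql l) C0"
proof -
  let ?f = "\<lambda>i. freq l (fst (s i))" and ?f' = "\<lambda>i. freq l (B *v fst (s i))"
  have "\<forall>i. \<exists>C\<ge>0. \<forall>t. (?f' i t)\<^sup>2 \<le> (?f i t)\<^sup>2 + C" by (intro allI is_poly_deriv_bound is_poly_freq freq_deriv)
  then obtain C where C: "\<And>i. 0 \<le> C i" "\<And>i t. (?f' i t)\<^sup>2 \<le> (?f i t)\<^sup>2 + C i" by metis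
  \<comment> \<open>Half of what remains, besides \<open>ql\<close>, when the mixed term is
    estimated by \<open>n2 (cc *\<^sub>R c d x) + n2 (Pl' l t x)\<close> and squared derivatives by
    squared frequencies plus \<open>C i\<close>.\<close>
  define C0 where "C0 = cc\<^sup>2 / 2 + 2 * pi\<^sup>2 * (\<Sum>i\<in>{1..<d}. C i)"
  have dd: "n2 (c d x) = n2 x" for x by (rule ode.e_n2)
  have Plin: "Pl l t (a *s x + y) = a *s Pl l t x + Pl l t y" for t a x y by (rule Pl_lin)
  have "dirac_ode_potential_axioms h (c d) cc (Ql l) (Pl l) (Pl' l) W (ql l) C0"
  proof
    show "Ql l t x = Pl l t x + W x" for t x by (simp add: Ql_def)
    show "((\<lambda>t. Pl l t x) has_vector_derivative Pl' l t x) (at t)" for t x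
      unfolding Pl_Vc Pl'_def Vc_def
      by (intro bounded_linear.has_vector_derivative[OF bounded_bilinear.bounded_linear_right[OF smult_bounded_bilinear]]
          has_vector_derivative_sum bounded_linear.has_vector_derivative[OF bounded_linear_scaleR_left])
        (rule freq_deriv[unfolded has_real_derivative_iff_has_vector_derivative])
    show "c d (Pl l t x) = - Pl l t (c d x)" for t x
    proof -
      note l = bounded_linear.linear[OF c_bl[OF d_in]]
      have "c d (a *s c i x) = - (a *s c i (c d x))" if "i \<in> {1..<d}" for i a
        using c_anticomm[OF d_in c_in[OF that], of x] that cl_smult[OF s_H[OF d_in]] by (simp add: vector_smult_rneg)
      thus ?thesis unfolding Pl_def linear_sum[OF l] sum_negf[symmetric] by (intro sum.cong refl)
    qed
    show "n2 (Pl l t x) = ql l t * n2 x" for t x by (simp add: Pl_Vc n2_2pi Vc_n2 ql_def)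
    show "cc * \<bar>Re (h (c d x) (Pl' l t x))\<bar> \<le> (ql l t / 2 + C0) * n2 x" for t x
    proof -
      have "2 * (cc * \<bar>Re (h (c d x) (Pl' l t x))\<bar>) = 2 * \<bar>Re (h (cc *\<^sub>R c d x) (Pl' l t x))\<bar>"
        using s_d(2) by (simp add: h_scaleR abs_mult)
      also have "... \<le> 2 * cmod (h (cc *\<^sub>R c d x) (Pl' l t x))" using abs_Re_le_cmod by simp
      also have "... \<le> n2 (cc *\<^sub>R c d x) + n2 (Pl' l t x)" by (rule h_amgm)
      also have "... = (cc\<^sup>2 + 4 * pi\<^sup>2 * (\<Sum>i\<in>{1..<d}. (?f' i t)\<^sup>2)) * n2 x"
        unfolding n2_scaleR dd Pl'_def n2_2pi Vc_n2 by (simp only: distrib_right mult.assoc)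
      also have "... \<le> (cc\<^sup>2 + 4 * pi\<^sup>2 * (\<Sum>i\<in>{1..<d}. (?f i t)\<^sup>2 + C i)) * n2 x"
        by (intro mult_right_mono add_left_mono mult_left_mono sum_mono C) auto
      also have "... = 2 * ((ql l t / 2 + C0) * n2 x)" by (simp add: ql_def C0_def sum.distrib algebra_simps)
      finally show ?thesis by simp
    qed
    show "0 \<le> C0" unfolding C0_def by (intro add_nonneg_nonneg mult_nonneg_nonneg sum_nonneg C) auto
    show "continuous_on UNIV (ql l)" unfolding ql_def[abs_def] by (intro continuous_intros smooth_continuous')
    show "0 \<le> ql l t" for t unfolding ql_def by (intro mult_nonneg_nonneg sum_nonneg) auto
    show "\<exists>T. \<forall>t. T \<le> \<bar>t\<bar> \<longrightarrow> M \<le> ql l t" for M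
    proof -
      have "\<exists>i\<in>{1..<d}. \<exists>t. ?f i t \<noteq> ?f i 0"
      proof (rule ccontr)
        assume n: "\<not> ?thesis"
        \<comment> \<open>If all frequencies along the frame were constant, this subspace would
          contain \<open>H (0, 0)\<close>, and bracket generation would make \<open>l\<close>
          fixed.\<close>
        define Z where "Z = {v::'n pt. \<forall>t. freq l (fst v) t = l \<bullet> fst v}"
        have "subspace Z"
          by (auto simp: Z_def subspace_def freq_def matrix_vector_right_distrib inner_add_right matrix_vector_mult_scaleR)
        moreover have "s i \<in> Z" if i: "i \<in> {1..d}" for i
        proof (cases "i = d")
          case True thus ?thesis using s_d(1) by (simp add: Z_def freq_def)
        next
          case False
          hence "i \<in> {1..<d}" using i by simp
          hence "?f i t = ?f i 0" for t using n by blast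
          thus ?thesis by (simp add: Z_def)
        qed
        ultimately have "span (s ` {1..d}) \<subseteq> Z" by (intro span_minimal) auto
        hence "\<And>v t. v \<in> H (0, 0) \<Longrightarrow> snd v = 0 \<Longrightarrow> freq l (fst v) t = l \<bullet> fst v"
          unfolding s_span by (auto simp: Z_def)
        hence "fixed l" by (rule fixed_of_bracket_generating[OF bg bH H_sub])
        with assms show False by contradiction
      qed
      then obtain i t0 where i: "i \<in> {1..<d}" "?f i t0 \<noteq> ?f i 0" by blast
      obtain T where T: "\<And>t. T \<le> \<bar>t\<bar> \<Longrightarrow> M / (4 * pi\<^sup>2) \<le> (?f i t)\<^sup>2" using is_poly_lim[OF is_poly_freq i(2)] by blast
      have "M \<le> ql l t" if "T \<le> \<bar>t\<bar>" for t
      proof -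
        have "M / (4 * pi\<^sup>2) \<le> (?f i t)\<^sup>2" by (rule T[OF that])
        also have "... \<le> (\<Sum>i\<in>{1..<d}. (?f i t)\<^sup>2)" using i(1) by (intro member_le_sum) auto
        finally show ?thesis by (simp add: ql_def field_simps)
      qed
      thus ?thesis by blast
    qed
  qed (use W_lin Plin Pl_herm in auto)
  thus ?thesis using dirac_ode_potential.intro[OF ode.dirac_ode_axioms] by blast
qed

lemma sym_op_subspace:
  assumes "VS.subspace V" "V \<subseteq> SS" shows "sym_op sc ip L2 V Dsub"
proof -
  have "sym_op_axioms sc ip L2 V Dsub"
  proof
    show "VS.subspace V" by (rule assms)
    show "V \<subseteq> L2" using assms(2) SS_L2 by (rule order_trans)
    show "Dsub u \<in> L2" if "u \<in> V" for u by (rule S.D_L[OF subsetD[OF assms(2) that]])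
    show "Dsub (u + w) = Dsub u + Dsub w" if "u \<in> V" "w \<in> V" for u w
      by (rule S.D_add[OF subsetD[OF assms(2) that(1)] subsetD[OF assms(2) that(2)]])
    show "Dsub (sc a u) = sc a (Dsub u)" if "u \<in> V" for a u by (rule S.D_scale[OF subsetD[OF assms(2) that]])
    show "ip (Dsub u) w = ip u (Dsub w)" if "u \<in> V" "w \<in> V" for u w
      by (rule S.D_sym[OF subsetD[OF assms(2) that(1)] subsetD[OF assms(2) that(2)]])
  qed
  thus ?thesis by (intro sym_op.intro) (rule L.semi_hilbert_axioms)
qed

lemma Cc_zero: "(\<lambda>t. 0 :: complex^'m) \<in> Cc" by (rule CcI[of _ 0]) (auto intro: smooth_const)

lemma Cc_add: "f \<in> Cc \<Longrightarrow> f2 \<in> Cc \<Longrightarrow> (\<lambda>t. f t + f2 t :: complex^'m) \<in> Cc"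
proof -
  assume f: "f \<in> Cc" and f2: "f2 \<in> Cc"
  have "(\<lambda>t. 0 - f2 t) \<in> Cc" by (rule Cc_diff[OF Cc_zero f2])
  from Cc_diff[OF f this] show ?thesis by simp
qed

lemma Cc_smult: assumes "f \<in> Cc" shows "(\<lambda>t. a *s f t :: complex^'m) \<in> Cc"
proof -
  obtain R where "\<And>t. R < \<bar>t\<bar> \<Longrightarrow> f t = 0" using Cc_bound[OF assms] by blast
  thus ?thesis by (intro CcI[OF smooth_smult[OF Cc_smooth[OF assms]], of R]) simp
qed

lemma \<Psi>_combine: assumes "f \<in> Cc" "f2 \<in> Cc" shows "\<Psi> l (\<lambda>t. a *s f t + f2 t) p = a *s \<Psi> l f p + \<Psi> l f2 p"
proof -
  obtain R where R: "\<And>t. R < \<bar>t\<bar> \<Longrightarrow> f t = 0" using Cc_bound[OF assms(1)] by blast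
  obtain R' where R': "\<And>t. R' < \<bar>t\<bar> \<Longrightarrow> f2 t = 0" using Cc_bound[OF assms(2)] by blast
  obtain n :: nat where n: "max R R' + \<bar>snd p\<bar> \<le> real n" using real_arch_simple by blast
  have v: "vsupp (max R R') (mode l f)" "vsupp (max R R') (mode l f2)" "vsupp (max R R') (mode l (\<lambda>t. a *s f t + f2 t))"
    using R R' by (auto intro!: mode_vsupp)
  show ?thesis unfolding \<Psi>_def v[THEN per_window, OF n] sum_smult sum.distrib[symmetric]
    by (intro sum.cong refl) (simp add: mode_def vector_add_ldistrib vector_smult_assoc mult_ac)
qed

lemma \<Psi>_sub: "VS.subspace (\<Psi> l ` Cc)"
proof (rule VS.subspaceI)
  have "\<Psi> l (\<lambda>t. 0) = 0" by (simp add: \<Psi>_def per_def mode_def fun_eq_iff)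
  with Cc_zero show "0 \<in> \<Psi> l ` Cc" by (metis imageI)
next
  fix x y assume "x \<in> \<Psi> l ` Cc" "y \<in> \<Psi> l ` Cc"
  then obtain f f2 where fg: "f \<in> Cc" "f2 \<in> Cc" "x = \<Psi> l f" "y = \<Psi> l f2" by blast
  have "x + y = \<Psi> l (\<lambda>t. f t + f2 t)" using \<Psi>_combine[OF fg(1,2), of l 1] by (simp add: fun_eq_iff fg)
  thus "x + y \<in> \<Psi> l ` Cc" using Cc_add[OF fg(1,2)] by blast
next
  fix x a assume "x \<in> \<Psi> l ` Cc"
  then obtain f where f: "f \<in> Cc" "x = \<Psi> l f" by blast
  have "\<Psi> l (\<lambda>t. 0) p = 0" for p by (simp add: \<Psi>_def per_def mode_def)
  hence "sc a x = \<Psi> l (\<lambda>t. a *s f t)" using \<Psi>_combine[OF f(1) Cc_zero, of l a] by (simp add: fun_eq_iff f)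
  thus "sc a x \<in> \<Psi> l ` Cc" using Cc_smult[OF f(1)] by blast
qed

lemma \<Psi>_diff: assumes "f \<in> Cc" "f2 \<in> Cc" shows "\<Psi> l f - \<Psi> l f2 = \<Psi> l (\<lambda>t. f t - f2 t)"
proof -
  have "\<Psi> l (\<lambda>t. (-1) *s f2 t + f t) p = (-1) *s \<Psi> l f2 p + \<Psi> l f p" for p by (rule \<Psi>_combine[OF assms(2,1)])
  thus ?thesis by (simp add: fun_eq_iff)
qed

text \<open>\<open>norm_\<Psi>\<close> and \<open>D_\<Psi>\<close> carry the results on the line
  over to the quotient; the square in \<open>norm_\<Psi>\<close> is why the tolerances below are
  squared.\<close>

lemma \<Psi>_piece: assumes l: "l \<in> \<Lambda>" "\<not> fixed l" shows "compact_sym_op sc ip L2 (\<Psi> l ` Cc) Dsub"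
proof -
  obtain C0 where "dirac_ode_potential h (c d) cc (Ql l) (Pl l) (Pl' l) W (ql l) C0" using potential[OF l(2)] by blast
  then interpret pot: dirac_ode_potential h "c d" cc "Ql l" "Pl l" "Pl' l" W "ql l" C0 .
  have sub: "\<Psi> l ` Cc \<subseteq> SS" using \<Psi>_SS[OF l(1)] by blast
  have D: "Dsub (\<Psi> l f) = \<Psi> l (ode.Dop l f)" if "f \<in> Cc" for f by (rule D_\<Psi>[OF l(1) that])
  have nl: "L.N (\<Psi> l f) < e" if "f \<in> Cc" "integral UNIV (\<lambda>t. n2 (f t)) < e\<^sup>2" "0 < e" for f e
    using norm_\<Psi>[OF l that(1)] that by (intro power_less_imp_less_base[of _ 2 e]) auto
  have n1: "integral UNIV (\<lambda>t. n2 (f t)) \<le> 1" if "f \<in> Cc" "L.N (\<Psi> l f) \<le> 1" for f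
  proof -
    have "\<Psi> l f \<in> L2" using sub SS_L2 that(1) by blast
    hence "(L.N (\<Psi> l f))\<^sup>2 \<le> 1\<^sup>2" by (intro power_mono that(2) L.N_nonneg)
    thus ?thesis using norm_\<Psi>[OF l that(1)] by simp
  qed
  have "compact_sym_op_axioms sc ip (\<Psi> l ` Cc) Dsub"
  proof
    show "Dsub u \<in> \<Psi> l ` Cc" if "u \<in> \<Psi> l ` Cc" for u
    proof -
      obtain f where f: "f \<in> Cc" "u = \<Psi> l f" using \<open>u \<in> \<Psi> l ` Cc\<close> by blast
      show ?thesis unfolding f(2) D[OF f(1)] by (intro imageI ode.Cc_Dop f(1))
    qed
  next
    fix U :: "nat \<Rightarrow> 'n pt \<Rightarrow> complex^'m"
    assume U: "\<And>n. U n \<in> \<Psi> l ` Cc" "\<And>n. L.N (U n) \<le> 1" "\<And>n. L.N (Dsub (U n)) \<le> 1"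
    have "\<forall>n. \<exists>f. f \<in> Cc \<and> U n = \<Psi> l f" using U(1) by blast
    then obtain f where f: "\<And>n. f n \<in> Cc" "\<And>n. U n = \<Psi> l (f n)" by metis
    have b1: "integral UNIV (\<lambda>t. n2 (f n t)) \<le> 1" for n using n1[OF f(1)] U(2)[of n] by (simp add: f(2))
    have b2: "integral UNIV (\<lambda>t. n2 (ode.Dop l (f n) t)) \<le> 1" for n
      using n1[OF ode.Cc_Dop[OF f(1)]] U(3)[of n] by (simp add: f(2) D[OF f(1)])
    from pot.compact_sequence[of f, OF f(1) b1 b2] obtain r :: "nat \<Rightarrow> nat" where r: "strict_mono r"
      "\<forall>\<epsilon>>0. \<exists>M. \<forall>m\<ge>M. \<forall>n\<ge>M. integral UNIV (\<lambda>t. n2 (f (r m) t - f (r n) t)) < \<epsilon>" by (elim exE conjE)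
    have "\<exists>M. \<forall>m\<ge>M. \<forall>n\<ge>M. L.N (U (r m) - U (r n)) < e" if e: "0 < e" for e
    proof -
      have "0 < e\<^sup>2" using e by simp
      then obtain M where M: "\<forall>m\<ge>M. \<forall>n\<ge>M. integral UNIV (\<lambda>t. n2 (f (r m) t - f (r n) t)) < e\<^sup>2" using r(2) by blast
      have "L.N (U (r m) - U (r n)) < e" if "M \<le> m" "M \<le> n" for m n
        unfolding f(2) \<Psi>_diff[OF f(1) f(1)] using M that by (intro nl Cc_diff f(1) e) blast
      thus ?thesis by blast
    qed
    with r(1) show "\<exists>r::nat \<Rightarrow> nat. strict_mono r \<and> (\<forall>e>0. \<exists>M. \<forall>m\<ge>M. \<forall>n\<ge>M. L.N (U (r m) - U (r n)) < e)" by blast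
  next
    fix \<eta> v and \<delta> :: real assume \<eta>: "\<eta> = \<i> \<or> \<eta> = - \<i>" and v: "v \<in> \<Psi> l ` Cc" and \<delta>: "0 < \<delta>"
    obtain f where f: "f \<in> Cc" "v = \<Psi> l f" using v by blast
    have "0 < \<delta>\<^sup>2" using \<delta> by simp
    from ode.dense_range[OF \<eta> f(1) this] obtain u where u: "u \<in> Cc"
      "integral UNIV (\<lambda>t. n2 (ode.Dop l u t - \<eta> *s u t - f t)) < \<delta>\<^sup>2" by blast
    have k: "(\<lambda>t. ode.Dop l u t - \<eta> *s u t) \<in> Cc" by (intro Cc_diff ode.Cc_Dop u Cc_smult)
    have "sc \<eta> (\<Psi> l u) = \<Psi> l (\<lambda>t. \<eta> *s u t)"
    proof -
      have "\<Psi> l (\<lambda>t. 0) p = 0" for p by (simp add: \<Psi>_def per_def mode_def)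
      thus ?thesis using \<Psi>_combine[OF u(1) Cc_zero, of l \<eta>] by (simp add: fun_eq_iff)
    qed
    hence "Dsub (\<Psi> l u) - sc \<eta> (\<Psi> l u) - v = \<Psi> l (\<lambda>t. ode.Dop l u t - \<eta> *s u t - f t)"
      unfolding f(2) D[OF u(1)] by (simp only: \<Psi>_diff ode.Cc_Dop u(1) Cc_smult f(1) k)
    hence "L.N (Dsub (\<Psi> l u) - sc \<eta> (\<Psi> l u) - v) < \<delta>" using nl[OF Cc_diff[OF k f(1)] u(2) \<delta>] by simp
    with u(1) show "\<exists>u\<in>\<Psi> l ` Cc. L.N (Dsub u - sc \<eta> u - v) < \<delta>" by blast
  qed
  thus ?thesis by (intro compact_sym_op.intro sym_op_subspace \<Psi>_sub sub)
qed

section \<open>The finite-dimensional pieces of fixed characters\<close>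

definition om :: "real^'n \<Rightarrow> real \<Rightarrow> complex^'m \<Rightarrow> 'n pt \<Rightarrow> complex^'m" where
  "om l \<kappa> w p = ex (l \<bullet> fst p + \<kappa> * snd p) *s w"

lemma om_mode: "om l \<kappa> w = mode l (\<lambda>t. ex (\<kappa> * t) *s w)"
  by (simp add: fun_eq_iff om_def mode_def ex_add vector_smult_assoc)

lemma smooth_ex_w: "smooth (\<lambda>t. ex (\<kappa> * t) *s (w :: complex^'m))"
  by (intro smooth_bilinear[OF smult_bounded_bilinear] ex_smooth bounded_linear_mult_right smooth_const)

lemma ex_sg: assumes "ex \<kappa> = sg 1" shows "ex (\<kappa> * of_int j) = sg j"
proof (induction j rule: int_induct[of _ 0])
  case (step1 i) thus ?case using assms by (simp add: distrib_left ex_add sg_add)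
next
  case (step2 i)
  have "ex (\<kappa> * of_int (i - 1)) * ex \<kappa> = ex (\<kappa> * of_int i)" by (simp add: ex_add[symmetric] algebra_simps)
  moreover have "sg (i - 1) * sg 1 = sg i" by (simp add: sg_add[symmetric])
  ultimately show ?case using step2 assms by (metis mult_right_cancel sg_nz)
qed simp

lemma om_SS: assumes l: "l \<in> \<Lambda>" "fixed l" and \<kappa>: "ex \<kappa> = sg 1" shows "om l \<kappa> w \<in> SS"
proof -
  have "equi (om l \<kappa> w)" unfolding equi_iff
  proof (intro ballI allI)
    fix \<gamma> p assume g: "\<gamma> \<in> \<Gamma>"
    obtain j where j: "snd \<gamma> = of_int j" using g by (auto simp: lat_iff elim: Ints_cases)
    have m: "intvec (fst \<gamma>)" using g by (simp add: lat_iff)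
    have \<gamma>: "\<gamma> = ho (fst \<gamma>) \<odot> tr j" using j by (simp add: sdp_simps prod_eq_iff)
    have ph: "phase \<gamma> = phase (ho (fst \<gamma>)) * sg j" using phase_mult[OF ho_lat[OF m] tr_lat[of j]] \<gamma> by (simp add: sg_def)
    have "l \<bullet> fst (\<gamma> \<odot> p) = l \<bullet> fst \<gamma> + l \<bullet> fst p"
      using l(2) by (simp add: sdp_simps inner_add_right fixed_def freq_def)
    hence "l \<bullet> fst (\<gamma> \<odot> p) + \<kappa> * snd (\<gamma> \<odot> p) = l \<bullet> fst \<gamma> + \<kappa> * of_int j + (l \<bullet> fst p + \<kappa> * snd p)"
      using j by (simp add: sdp_simps distrib_left)
    hence "ex (l \<bullet> fst (\<gamma> \<odot> p) + \<kappa> * snd (\<gamma> \<odot> p)) = phase \<gamma> * ex (l \<bullet> fst p + \<kappa> * snd p)"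
      using l(1) m ex_sg[OF \<kappa>, of j] by (simp add: ex_add ph \<Lambda>_def)
    thus "om l \<kappa> w (\<gamma> \<odot> p) = phase \<gamma> *s om l \<kappa> w p" by (simp add: om_def vector_smult_assoc)
  qed
  moreover have "smooth (om l \<kappa> w)" unfolding om_mode by (intro mode_smooth smooth_ex_w)
  ultimately show ?thesis by (simp add: smooth_spinors_def)
qed

definition Aom :: "real^'n \<Rightarrow> real \<Rightarrow> complex^'m \<Rightarrow> complex^'m" where
  "Aom l \<kappa> w = (2 * of_real pi * \<i> * of_real (cc * \<kappa>)) *s c d w + Ql l 0 w"

text \<open>The frequencies of a fixed character are constant, so the operator acts on the
  coefficient \<open>w\<close> by a constant matrix.\<close>

lemma D_om: assumes "fixed l" shows "Dsub (om l \<kappa> w) = om l \<kappa> (Aom l \<kappa> w)"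
proof
  fix p
  let ?f = "\<lambda>t. ex (\<kappa> * t) *s w"
  have "((\<lambda>t. ex (\<kappa> * t)) has_vector_derivative \<kappa> *\<^sub>R (2 * of_real pi * \<i> * ex (\<kappa> * t))) (at t)" for t
  proof -
    have "((\<lambda>t. \<kappa> * t) has_vector_derivative \<kappa>) (at t)" by (auto intro!: derivative_eq_intros simp: has_vector_derivative_def)
    from vector_diff_chain_at[OF this ex_deriv] show ?thesis by (simp add: o_def)
  qed
  hence "(?f has_vector_derivative (\<kappa> *\<^sub>R (2 * of_real pi * \<i> * ex (\<kappa> * t))) *s w) (at t)" for t
    by (rule bounded_linear.has_vector_derivative[OF bounded_bilinear.bounded_linear_left[OF smult_bounded_bilinear]])
  hence f': "vector_derivative ?f (at t) = (\<kappa> *\<^sub>R (2 * of_real pi * \<i> * ex (\<kappa> * t))) *s w" for t by (rule vector_derivative_at)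
  have "Ql l t x = Ql l 0 x" for t x using assms by (simp add: Ql_def Pl_def fixed_def)
  hence Q: "Ql l t (?f t) = ex (\<kappa> * t) *s Ql l 0 w" for t using ode.Q_scale by metis
  have Dp: "ode.Dop l ?f t = ex (\<kappa> * t) *s Aom l \<kappa> w" for t
    unfolding ode.Dop_def f' Q Aom_def vector_add_ldistrib cl_smult[OF s_H[OF d_in]]
    by (simp add: scaleR_eq_smult vector_smult_assoc scaleR_conv_of_real mult_ac)
  have "Dsub (om l \<kappa> w) p = mode l (ode.Dop l ?f) p"
    unfolding Dsub_eq om_mode by (rule D_mode[OF smooth_ex_w])
  also have "... = om l \<kappa> (Aom l \<kappa> w) p" by (simp add: mode_def Dp om_mode)
  finally show "Dsub (om l \<kappa> w) p = om l \<kappa> (Aom l \<kappa> w) p" .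
qed

lemma Aom_lin: "Aom l \<kappa> (a *s x + y) = a *s Aom l \<kappa> x + Aom l \<kappa> y"
  unfolding Aom_def ode.Q_lin cl_lin[OF s_H[OF d_in]] by (simp add: vector_add_ldistrib vector_smult_assoc mult_ac)

lemma Aom_herm: "h (Aom l \<kappa> x) y = h x (Aom l \<kappa> y)"
  unfolding Aom_def h_add h_add_right ode.Q_herm h_scale h_scale_right cl_anti[OF s_H[OF d_in]] by simp

lemma om_combine: "om l \<kappa> (a *s x + y) = (\<lambda>p. a *s om l \<kappa> x p + om l \<kappa> y p)"
  by (simp add: om_def fun_eq_iff vector_add_ldistrib vector_smult_assoc mult_ac)

text \<open>Up to \<open>n2\<close> the piece is the spinor module itself. Bounded sequences have
  convergent subsequences, and a hermitian matrix minus \<open>\<i>\<close> or plus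
  \<open>\<i>\<close> is invertible, so the range condition holds exactly.\<close>

lemma om_piece: assumes l: "l \<in> \<Lambda>" "fixed l" and \<kappa>: "ex \<kappa> = sg 1"
  shows "compact_sym_op sc ip L2 (range (om l \<kappa>)) Dsub"
proof -
  have sub: "range (om l \<kappa>) \<subseteq> SS" using om_SS[OF assms] by blast
  have ss: "VS.subspace (range (om l \<kappa>))"
  proof (rule VS.subspaceI)
    have "om l \<kappa> 0 = 0" by (simp add: om_def fun_eq_iff)
    thus "0 \<in> range (om l \<kappa>)" by (metis rangeI)
  next
    fix x y assume "x \<in> range (om l \<kappa>)" "y \<in> range (om l \<kappa>)"
    then obtain v w where "x = om l \<kappa> v" "y = om l \<kappa> w" by blast
    hence "x + y = om l \<kappa> (v + w)" using om_combine[of l \<kappa> 1 v w] by (simp add: fun_eq_iff)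
    thus "x + y \<in> range (om l \<kappa>)" by simp
  next
    fix x a assume "x \<in> range (om l \<kappa>)"
    then obtain v where "x = om l \<kappa> v" by blast
    hence "sc a x = om l \<kappa> (a *s v)" using om_combine[of l \<kappa> a v 0] by (simp add: fun_eq_iff om_def)
    thus "sc a x \<in> range (om l \<kappa>)" by simp
  qed
  have df: "om l \<kappa> x - om l \<kappa> y = om l \<kappa> (x - y)" for x y
    using om_combine[of l \<kappa> "-1" y x] by (simp add: fun_eq_iff)
  have N2: "(L.N (om l \<kappa> w))\<^sup>2 = n2 w" for w
  proof -
    have "om l \<kappa> w \<in> M2" using om_SS[OF assms] SS_Ceq Ceq_M2 by blast
    from N_sq_integral[OF this] show ?thesis using emeasure_one by (simp add: om_def n2_scale measure_def)
  qed
  have "compact_sym_op_axioms sc ip (range (om l \<kappa>)) Dsub"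
  proof
    show "Dsub u \<in> range (om l \<kappa>)" if "u \<in> range (om l \<kappa>)" for u
      using that by (auto simp: D_om[OF l(2)])
  next
    fix U :: "nat \<Rightarrow> 'n pt \<Rightarrow> complex^'m"
    assume U: "\<And>n. U n \<in> range (om l \<kappa>)" "\<And>n. L.N (U n) \<le> 1"
    have "\<forall>n. \<exists>w. U n = om l \<kappa> w" using U(1) by blast
    then obtain w where w: "\<And>n. U n = om l \<kappa> (w n)" by metis
    obtain c1 where c1: "0 < c1" "\<And>x. c1 * (norm x)\<^sup>2 \<le> n2 x" using n2_lower by blast
    obtain C where C: "0 < C" "\<And>x. n2 x \<le> C * (norm x)\<^sup>2" using n2_upper by blast
    have "norm (w n) \<le> sqrt (1 / c1)" for n
    proof (rule real_le_rsqrt)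
      have "U n \<in> L2" using U(1) sub SS_L2 by blast
      hence "(L.N (U n))\<^sup>2 \<le> 1\<^sup>2" by (intro power_mono U(2) L.N_nonneg)
      hence "c1 * (norm (w n))\<^sup>2 \<le> 1" using c1(2)[of "w n"] N2[of "w n"] by (simp add: w)
      thus "(norm (w n))\<^sup>2 \<le> 1 / c1" using c1(1) by (simp add: field_simps)
    qed
    hence "\<forall>n. w n \<in> cball 0 (sqrt (1 / c1))" by simp
    then obtain x and r :: "nat \<Rightarrow> nat" where r: "strict_mono r" "(w \<circ> r) \<longlonglongrightarrow> x"
      using compact_cball[of "0 :: complex^'m" "sqrt (1 / c1)"] unfolding compact_def by blast
    have ca: "Cauchy (w \<circ> r)" using r(2) LIMSEQ_imp_Cauchy by blast
    have "\<exists>M. \<forall>m\<ge>M. \<forall>n\<ge>M. L.N (U (r m) - U (r n)) < e" if e: "0 < e" for e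
    proof -
      have "0 < e / sqrt C" using e C(1) by simp
      from CauchyD[OF ca this] obtain M where M: "\<forall>m\<ge>M. \<forall>n\<ge>M. norm ((w \<circ> r) m - (w \<circ> r) n) < e / sqrt C" by blast
      have "L.N (U (r m) - U (r n)) < e" if "M \<le> m" "M \<le> n" for m n
      proof -
        have lt: "norm (w (r m) - w (r n)) < e / sqrt C" using M that by simp
        have "(L.N (U (r m) - U (r n)))\<^sup>2 \<le> C * (norm (w (r m) - w (r n)))\<^sup>2"
          unfolding w df N2 by (rule C(2))
        also have "... < C * (e / sqrt C)\<^sup>2" by (intro mult_strict_left_mono power_strict_mono lt C(1)) auto
        also have "... = e\<^sup>2" using C(1) by (simp add: power_divide)
        finally show ?thesis using e by (intro power_less_imp_less_base[of _ 2 e]) auto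
      qed
      thus ?thesis by blast
    qed
    with r(1) show "\<exists>r::nat \<Rightarrow> nat. strict_mono r \<and> (\<forall>e>0. \<exists>M. \<forall>m\<ge>M. \<forall>n\<ge>M. L.N (U (r m) - U (r n)) < e)" by blast
  next
    fix \<eta> v and \<delta> :: real assume \<eta>: "\<eta> = \<i> \<or> \<eta> = - \<i>" and v: "v \<in> range (om l \<kappa>)" and \<delta>: "0 < \<delta>"
    obtain w where w: "v = om l \<kappa> w" using v by blast
    define T where "T x = Aom l \<kappa> x - \<eta> *s x" for x
    have Tl: "linear T"
      by (rule bounded_linear.linear, rule clinear_bounded)
        (simp add: T_def Aom_lin vector_add_ldistrib vector_ssub_ldistrib vector_smult_assoc mult_ac)
    have "inj T" unfolding linear_injective_0[OF Tl]
    proof (intro allI impI)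
      fix x assume "T x = 0"
      hence Ax: "Aom l \<kappa> x = \<eta> *s x" by (simp add: T_def)
      have "\<eta> * h x x = cnj \<eta> * h x x" using Aom_herm[of l \<kappa> x x] unfolding Ax h_scale h_scale_right .
      hence "h x x = 0" using \<eta> by (auto simp: complex_eq_iff)
      hence "n2 x = 0" by (simp add: n2_def)
      thus "x = 0" by simp
    qed
    then obtain u where u: "T u = w" using linear_injective_imp_surjective[OF Tl] by (metis surjD)
    have "Dsub (om l \<kappa> u) - sc \<eta> (om l \<kappa> u) - v = 0"
      unfolding D_om[OF l(2)] w u[symmetric] T_def
      by (simp add: fun_eq_iff om_def vector_ssub_ldistrib vector_smult_assoc mult_ac)
    hence "L.N (Dsub (om l \<kappa> u) - sc \<eta> (om l \<kappa> u) - v) < \<delta>" using \<delta> by simp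
    thus "\<exists>u\<in>range (om l \<kappa>). L.N (Dsub u - sc \<eta> u - v) < \<delta>" by blast
  qed
  thus ?thesis by (intro compact_sym_op.intro sym_op_subspace ss sub)
qed

end

section \<open>Density of the pieces\<close>

context dirac_setting
begin

definition \<W> :: "('n pt \<Rightarrow> complex^'m) set set" where
  "\<W> = {\<Psi> l ` Cc | l. l \<in> \<Lambda> \<and> \<not> fixed l} \<union> {range (om l \<kappa>) | l \<kappa>. l \<in> \<Lambda> \<and> fixed l \<and> ex \<kappa> = sg 1}"

lemma \<W>_piece: assumes "V \<in> \<W>" shows "V \<subseteq> SS \<and> compact_sym_op sc ip L2 V Dsub"
proof -
  from assms consider (A) l where "V = \<Psi> l ` Cc" "l \<in> \<Lambda>" "\<not> fixed l"
    | (B) l \<kappa> where "V = range (om l \<kappa>)" "l \<in> \<Lambda>" "fixed l" "ex \<kappa> = sg 1"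
    unfolding \<W>_def by blast
  thus ?thesis
  proof cases
    case A thus ?thesis using \<Psi>_SS \<Psi>_piece by blast
  next
    case B thus ?thesis using om_SS om_piece by blast
  qed
qed

definition Sp :: "('n pt \<Rightarrow> complex^'m) set" where "Sp = L.clo (VS.span (\<Union>\<W>))"

lemma span_\<W>_SS: "VS.span (\<Union>\<W>) \<subseteq> SS" using \<W>_piece by (intro VS.span_minimal SS_sub) blast

lemma span_\<W>_L2: "VS.span (\<Union>\<W>) \<subseteq> L2" using span_\<W>_SS SS_L2 by blast

lemma Sp_sub: "VS.subspace Sp" unfolding Sp_def by (rule L.clo_subspace[OF VS.subspace_span span_\<W>_L2])

lemma Sp_span: "VS.span (\<Union>\<W>) \<subseteq> Sp" unfolding Sp_def by (rule L.clo_superset[OF span_\<W>_L2])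

text \<open>Uniform approximation is enough because the quotient has total mass 1; the constant
  \<open>K\<close> absorbs the loss in averaging.\<close>

lemma Sp_approx:
  fixes K :: real
  assumes u: "u \<in> Ceq" and K: "0 < K"
    and y: "\<And>\<delta>. 0 < \<delta> \<Longrightarrow> \<exists>y. y \<in> Sp \<and> y \<in> Ceq \<and> (\<forall>p. norm (u p - y p) \<le> K * \<delta>)"
  shows "u \<in> Sp"
proof -
  obtain C where C: "0 < C" "\<And>x. n2 x \<le> C * (norm x)\<^sup>2" using n2_upper by blast
  have "u \<in> L.clo Sp" unfolding L.clo_def
  proof (intro CollectI conjI allI impI)
    show "u \<in> L2" using u Ceq_L2 by blast
    fix \<delta> :: real assume \<delta>: "0 < \<delta>"
    define \<delta>' where "\<delta>' = \<delta> / (2 * K * sqrt C)"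
    have "0 < \<delta>'" using \<delta> K C by (simp add: \<delta>'_def)
    from y[OF this] obtain y where y: "y \<in> Sp" "y \<in> Ceq" "\<And>p. norm (u p - y p) \<le> K * \<delta>'" by blast
    have "L.N (u - y) \<le> sqrt C * (K * \<delta>')"
    proof (rule LN_sup[OF _ _ C(2)])
      show "u - y \<in> Ceq" by (rule VS.subspace_diff[OF Ceq_sub u y(2)])
      show "norm ((u - y) p) \<le> K * \<delta>'" for p using y(3)[of p] by simp
    qed (use C in simp)
    also have "... < \<delta>" using \<delta> K C by (simp add: \<delta>'_def field_simps)
    finally show "\<exists>y\<in>Sp. L.N (u - y) < \<delta>" using y(1) by blast
  qed
  thus ?thesis unfolding Sp_def using L.clo_clo[OF span_\<W>_L2] by blast
qed

lemma phase_ex: "phase x = ex (of_int (\<epsilon> x) / 2)"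
  by (simp add: phase_def ex_def algebra_simps)

lemma ho_add: "ho m \<odot> ho m' = ho (m + m')" by (simp add: sdp_simps)

lemma phase_ho_add: "intvec m \<Longrightarrow> intvec m' \<Longrightarrow> phase (ho (m + m')) = phase (ho m) * phase (ho m')"
  unfolding ho_add[symmetric] by (rule phase_mult[OF ho_lat ho_lat])

text \<open>A base point of \<open>\<Lambda>\<close>: its entries are halves of the values of
  \<open>\<epsilon>\<close> on the unit vectors, and adding integral vectors gives further
  characters.\<close>

definition l0 :: "real^'n" where "l0 = (\<chi> i. of_int (\<epsilon> (ho (axis i 1))) / 2)"

lemma intvec_axis: "intvec (of_int k *\<^sub>R axis i 1)" by (simp add: intvec_def axis_def)

lemma phase_ho_axis: "phase (ho (of_int k *\<^sub>R axis i 1)) = ex (of_int k * l0 $ i)"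
proof (induction k rule: int_induct[of _ 0])
  case base
  have "phase (ho 0) * phase (ho 0) = phase (ho 0)" using phase_ho_add[of 0 0] by (simp add: intvec_def)
  thus ?case by simp
next
  case (step1 k)
  have "phase (ho (of_int k *\<^sub>R axis i 1 + of_int 1 *\<^sub>R axis i 1)) = phase (ho (of_int k *\<^sub>R axis i 1)) * phase (ho (of_int 1 *\<^sub>R axis i 1))"
    by (rule phase_ho_add[OF intvec_axis intvec_axis])
  moreover have "of_int k *\<^sub>R axis i 1 + of_int 1 *\<^sub>R axis i (1::real) = of_int (k + 1) *\<^sub>R axis i 1" by (simp add: scaleR_add_left)
  moreover have "phase (ho (of_int 1 *\<^sub>R axis i 1)) = ex (l0 $ i)" by (simp add: phase_ex l0_def)
  ultimately show ?case using step1 by (simp only: ex_add[symmetric]) (simp add: distrib_right)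
next
  case (step2 k)
  have "phase (ho (of_int (k - 1) *\<^sub>R axis i 1 + of_int 1 *\<^sub>R axis i 1)) = phase (ho (of_int (k - 1) *\<^sub>R axis i 1)) * phase (ho (of_int 1 *\<^sub>R axis i 1))"
    by (rule phase_ho_add[OF intvec_axis intvec_axis])
  moreover have "of_int (k - 1) *\<^sub>R axis i 1 + of_int 1 *\<^sub>R axis i (1::real) = of_int k *\<^sub>R axis i 1" by (simp add: algebra_simps)
  moreover have "phase (ho (of_int 1 *\<^sub>R axis i 1)) = ex (l0 $ i)" by (simp add: phase_ex l0_def)
  ultimately have "phase (ho (of_int (k - 1) *\<^sub>R axis i 1)) * ex (l0 $ i) = ex (of_int k * l0 $ i)" using step2 by simp
  also have "... = ex (of_int (k - 1) * l0 $ i) * ex (l0 $ i)" by (simp add: ex_add[symmetric] algebra_simps)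
  finally show ?case by simp
qed

lemma l0_\<Lambda>: "l0 \<in> \<Lambda>" unfolding \<Lambda>_def
proof safe
  fix m :: "real^'n" assume m: "intvec m"
  hence "\<forall>i. \<exists>k::int. m $ i = of_int k" by (auto simp: intvec_def elim: Ints_cases)
  then obtain k where k: "\<And>i. m $ i = of_int (k i)" by metis
  have "phase (ho (\<Sum>i\<in>I. of_int (k i) *\<^sub>R axis i 1)) = ex (\<Sum>i\<in>I. of_int (k i) * l0 $ i)
      \<and> intvec (\<Sum>i\<in>I. of_int (k i) *\<^sub>R axis i 1)" if "finite I" for I
    using that
  proof (induction I)
    case empty
    show ?case using phase_ho_axis[of 0] by (simp add: intvec_def)
  next
    case (insert i I)
    thus ?case using phase_ho_add[OF intvec_axis, of "\<Sum>i\<in>I. of_int (k i) *\<^sub>R axis i 1" "k i" i] intvec_add[OF intvec_axis]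
      by (simp add: phase_ho_axis ex_add)
  qed
  from conjunct1[OF this[OF finite_class.finite_UNIV]] have "phase (ho (\<Sum>i\<in>UNIV. of_int (k i) *\<^sub>R axis i 1)) = ex (\<Sum>i\<in>UNIV. of_int (k i) * l0 $ i)" .
  moreover have "(\<Sum>i\<in>UNIV. of_int (k i) *\<^sub>R axis i 1) = m"
    unfolding k[symmetric] by (simp only: scalar_mult_eq_scaleR[symmetric] basis_expansion)
  moreover have "(\<Sum>i\<in>UNIV. of_int (k i) * l0 $ i) = l0 \<bullet> m" by (simp add: inner_vec_def k mult.commute)
  ultimately show "ex (l0 \<bullet> m) = phase (ho m)" by simp
qed

lemma Lat_intvec: assumes "\<kappa> \<in> Lat" "intvec m" shows "ex (\<kappa> \<bullet> m) = 1"
proof -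
  have "\<kappa> $ i \<in> \<int>" for i
  proof -
    have "axis i 1 \<in> (Basis :: (real^'n) set)" by (auto simp: Basis_vec_def)
    hence "\<kappa> \<bullet> axis i 1 \<in> \<int>" using assms(1) by (simp add: Lat_def)
    thus ?thesis by (simp add: inner_axis)
  qed
  hence "\<kappa> \<bullet> m \<in> \<int>" using assms(2) by (auto simp: inner_vec_def intvec_def intro!: Ints_sum Ints_mult)
  thus ?thesis by (simp add: ex_eq_1)
qed

lemma \<Lambda>_Lat: "l \<in> \<Lambda> \<Longrightarrow> \<kappa> \<in> Lat \<Longrightarrow> l + \<kappa> \<in> \<Lambda>"
  by (simp add: \<Lambda>_def inner_add_left ex_add Lat_intvec)

lemma om_span:
  assumes l: "l \<in> \<Lambda>" "fixed l" and \<kappa>: "ex \<kappa> = sg 1" and f: "vtrig f"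
  shows "(\<lambda>p. ex (l \<bullet> fst p + \<kappa> * snd p) *s f (snd p)) \<in> VS.span (\<Union>\<W>)"
  using f
proof (induction f rule: vtrig.induct)
  case (base \<kappa>' w)
  have "ex \<kappa>' = 1" using base by (simp add: Lat_def ex_eq_1)
  hence "ex (\<kappa> + \<kappa>') = sg 1" by (simp add: ex_add \<kappa>)
  hence "om l (\<kappa> + \<kappa>') w \<in> \<Union>\<W>" using l unfolding \<W>_def by blast
  from VS.span_base[OF this] show ?case
    by (simp add: om_def[abs_def] vector_smult_assoc ex_add distrib_right mult.assoc)
next
  case (add f f')
  have "(\<lambda>p. ex (l \<bullet> fst p + \<kappa> * snd p) *s (f (snd p) + f' (snd p)))
     = (\<lambda>p. ex (l \<bullet> fst p + \<kappa> * snd p) *s f (snd p)) + (\<lambda>p. ex (l \<bullet> fst p + \<kappa> * snd p) *s f' (snd p))"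
    by (simp add: fun_eq_iff vector_add_ldistrib)
  thus ?case using VS.span_add[OF add.IH] by simp
qed

text \<open>If \<open>l\<close> is fixed, the average is not itself in a piece. It is the character
  of \<open>l\<close> times a function of the height which has period 1 up to the sign
  \<open>sg 1\<close>; this function is approximated by trigonometric polynomials.\<close>

lemma \<Psi>_Sp: assumes l: "l \<in> \<Lambda>" and f: "f \<in> Cc" shows "\<Psi> l f \<in> Sp"
proof (cases "fixed l")
  case False
  hence "\<Psi> l f \<in> \<Union>\<W>" using l f unfolding \<W>_def by blast
  thus ?thesis using Sp_span VS.span_base by blast
next
  case True
  \<comment> \<open>A half-integral frequency that reproduces the sign of the translation by
    1.\<close>
  define \<kappa> where "\<kappa> = real_of_int (\<epsilon> (tr 1)) / 2"
  have \<kappa>: "ex \<kappa> = sg 1" by (simp only: \<kappa>_def sg_def phase_ex)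
  have SSf: "\<Psi> l f \<in> SS" by (rule \<Psi>_SS[OF l f])
  have fl: "mode l f (tr k \<odot> p) = ex (l \<bullet> fst p) *s mode l f (tr k \<odot> (0, snd p))" for k p
    using True by (simp add: mode_def tr_mul fixed_def freq_def)
  have fx: "\<Psi> l f p = ex (l \<bullet> fst p) *s \<Psi> l f (0, snd p)" for p
  proof -
    have "mode l f (tr k \<odot> p) \<noteq> 0 \<longleftrightarrow> mode l f (tr k \<odot> (0, snd p)) \<noteq> 0" for k
      unfolding fl[of k p] by simp
    thus ?thesis unfolding \<Psi>_def per_def sum_smult
      by (intro sum.cong) (simp_all add: fl[of _ p] vector_smult_assoc mult.commute)
  qed
  \<comment> \<open>Dividing by the exponential of frequency \<open>\<kappa>\<close> removes the
    sign and leaves a function of period 1.\<close>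
  define F where "F t = ex (- (\<kappa> * t)) *s \<Psi> l f (0, t)" for t
  have "continuous_on UNIV F" unfolding F_def
    by (intro bounded_bilinear.continuous_on[OF smult_bounded_bilinear] ex_continuous continuous_intros
        continuous_on_compose2[OF smooth_continuous[OF SS_D(1)[OF SSf]]]) auto
  moreover have "F (x + b) = F x" if "b \<in> Basis" for x b :: real
  proof -
    have b: "b = 1" using that by simp
    have "\<Psi> l f (tr 1 \<odot> (0, x)) = phase (tr 1) *s \<Psi> l f (0, x)" using SS_D(2)[OF SSf] tr_lat[of 1] unfolding equi_iff by blast
    moreover have "tr 1 \<odot> (0, x) = (0, x + 1)" by (simp add: sdp_simps add.commute)
    ultimately have "\<Psi> l f (0, x + 1) = sg 1 *s \<Psi> l f (0, x)" by (simp only: sg_def)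
    moreover have "ex (- (\<kappa> * (x + 1))) = ex (- (\<kappa> * x)) * cnj (sg 1)"
      by (simp only: distrib_left mult_1_right minus_add_distrib ex_add ex_neg \<kappa>)
    ultimately show ?thesis unfolding F_def b by (simp add: vector_smult_assoc mult.assoc sg_sq)
  qed
  ultimately have td: "\<exists>f1. vtrig f1 \<and> (\<forall>t. norm (F t - f1 t) < \<delta>)" if "0 < \<delta>" for \<delta> using that by (rule trig_dense)
  show ?thesis
  proof (rule Sp_approx[where K = 1])
    show "\<Psi> l f \<in> Ceq" using SSf SS_Ceq by blast
    fix \<delta> :: real assume "0 < \<delta>"
    from td[OF this] obtain f1 where f1: "vtrig f1" "\<And>t. norm (F t - f1 t) < \<delta>" by blast
    define y where "y = (\<lambda>p. ex (l \<bullet> fst p + \<kappa> * snd p) *s f1 (snd p))"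
    have y: "y \<in> VS.span (\<Union>\<W>)" unfolding y_def by (rule om_span[OF l True \<kappa> f1(1)])
    have "norm (\<Psi> l f p - y p) \<le> 1 * \<delta>" for p
    proof -
      have "\<Psi> l f p - y p = ex (l \<bullet> fst p + \<kappa> * snd p) *s (F (snd p) - f1 (snd p))"
        unfolding F_def y_def fx[of p]
        by (simp add: vector_ssub_ldistrib vector_smult_assoc ex_add ex_neg mult.assoc)
      thus ?thesis using f1(2)[of "snd p"] by (simp only: smult_norm ex_norm mult_1 less_imp_le)
    qed
    thus "\<exists>y. y \<in> Sp \<and> y \<in> Ceq \<and> (\<forall>p. norm (\<Psi> l f p - y p) \<le> 1 * \<delta>)"
      using y Sp_span span_\<W>_SS SS_Ceq by blast
  qed simp
qed

text \<open>The sum of all integer translates of \<open>bump\<close>, used as the denominator of a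
  partition of unity in the height.\<close>

definition BB :: "real \<Rightarrow> real" where "BB t = Re (perS (\<lambda>p. of_real (bump (snd p))) (0, t))"

lemma bump_vsupp: "vsupp 1 (\<lambda>p. of_real (bump (snd p)) :: complex)" by (simp add: vsupp_def bump_zero)

lemma bump_continuous: "continuous_on S bump" using smooth_continuous[OF smooth_bump] continuous_on_subset by blast

lemma BB_window: "1 + \<bar>t\<bar> \<le> real n \<Longrightarrow> BB t = (\<Sum>k\<in>{- int n..int n}. bump (of_int k + t))"
  unfolding BB_def by (subst perS_window[OF bump_vsupp]) (auto simp: tr_mul)

lemma BB_continuous: "continuous_on UNIV BB"
  unfolding BB_def[abs_def]
  by (intro continuous_intros continuous_on_compose2[OF perS_continuous[OF _ bump_vsupp]]
     continuous_on_compose2[OF bump_continuous[of UNIV]]) auto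

lemma BB_periodic: "BB (of_int j + t) = BB t"
proof -
  have "invariant (perS (\<lambda>p. of_real (bump (snd p))))" by (rule perS_invariant) (simp add: sdp_simps)
  hence "perS (\<lambda>p. of_real (bump (snd p))) (tr j \<odot> (0, t)) = perS (\<lambda>p. of_real (bump (snd p))) (0, t)"
    using tr_lat[of j] unfolding invariant_def by blast
  thus ?thesis by (simp add: BB_def tr_mul)
qed

lemma BB_pos: "0 < BB t"
proof -
  obtain n :: nat where n: "1 + \<bar>t\<bar> \<le> real n" using real_arch_simple by blast
  \<comment> \<open>This translate of \<open>t\<close> lies in the half-open unit interval from 0,
    where \<open>bump\<close> is positive.\<close>
  define k where "k = - \<lfloor>t\<rfloor>"
  have k1: "\<bar>of_int k + t\<bar> < 1" unfolding k_def by (simp add: abs_less_iff) linarith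
  have "\<bar>real_of_int k\<bar> \<le> real n" using k1 n by linarith
  hence kn: "k \<in> {- int n..int n}" by (simp add: abs_le_iff)
  have "0 < bump (of_int k + t)" by (rule bump_pos[OF k1])
  also have "... \<le> (\<Sum>k\<in>{- int n..int n}. bump (of_int k + t))" by (rule member_le_sum[OF kn]) (auto intro: bump_nonneg)
  finally show ?thesis using BB_window[OF n] by simp
qed

lemma BB_bounded: obtains K where "0 < K" "\<And>t. BB t \<le> K"
proof -
  have "invariant (\<lambda>p::'n pt. BB (snd p))"
    unfolding invariant_def using BB_periodic by (auto simp: lat_iff sdp_simps elim!: Ints_cases)
  moreover have "continuous_on UNIV (\<lambda>p::'n pt. BB (snd p))"
    by (intro continuous_on_compose2[OF BB_continuous] continuous_intros) auto
  ultimately obtain b where b: "\<And>p::'n pt. norm (BB (snd p)) \<le> b" using invariant_bounded by blast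
  have "BB t \<le> max b 1" for t using b[of "(0, t)"] by simp
  thus thesis by (intro that[of "max b 1"]) auto
qed

text \<open>Localises a periodic function by \<open>bump\<close>, twists it by the base character
  and averages. The height is divided by 4 so that the support of \<open>bump\<close> becomes the
  interval from -1/4 to 1/4, on which the function \<open>\<tau>\<close> used in
  \<open>Ceq_Sp\<close> is linear.\<close>

definition Tf :: "('n pt \<Rightarrow> complex^'m) \<Rightarrow> 'n pt \<Rightarrow> complex^'m" where
  "Tf f = per (\<lambda>p. bump (snd p) *\<^sub>R (ex (l0 \<bullet> fst p) *s f (fst p, snd p / 4)))"

lemma Tf_window: "1 + \<bar>snd p\<bar> \<le> real n \<Longrightarrow> Tf f p = (\<Sum>k\<in>{- int n..int n}. sg k *s
    (bump (of_int k + snd p) *\<^sub>R (ex (l0 \<bullet> (flow B (of_int k) *v fst p)) *s f (flow B (of_int k) *v fst p, (of_int k + snd p) / 4))))"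
  unfolding Tf_def by (subst per_window[of 1]) (auto simp: vsupp_def bump_zero tr_mul)

text \<open>A trigonometric monomial contributes an integral vector to the character and an
  exponential to the function of the height, so its image is a single \<open>\<Psi>\<close>.\<close>

lemma Tf_Sp: "vtrig f \<Longrightarrow> Tf f \<in> Sp \<and> Tf f \<in> SS"
proof (induction f rule: vtrig.induct)
  case (base \<kappa> w)
  have "fst \<kappa> \<in> Lat" using base unfolding Lat_def by (auto simp: Basis_prod_def inner_prod_def)
  hence l: "l0 + fst \<kappa> \<in> \<Lambda>" by (rule \<Lambda>_Lat[OF l0_\<Lambda>])
  define f1 where "f1 = (\<lambda>t. bump t *\<^sub>R (ex (snd \<kappa> / 4 * t) *s w))"
  have f1: "f1 \<in> Cc" unfolding f1_def
  proof (rule CcI[of _ 1])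
    show "smooth (\<lambda>t. bump t *\<^sub>R (ex (snd \<kappa> / 4 * t) *s w))" by (intro smooth_scaleR smooth_bump smooth_ex_w)
  qed (simp add: bump_zero)
  have "Tf (\<lambda>x. ex (\<kappa> \<bullet> x) *s w) = \<Psi> (l0 + fst \<kappa>) f1"
    unfolding Tf_def \<Psi>_def
    by (rule arg_cong[of _ _ per]) (simp add: fun_eq_iff mode_def f1_def inner_prod_def inner_add_left ex_add scaleR_eq_smult vector_smult_assoc mult_ac)
  thus ?case using \<Psi>_Sp[OF l f1] \<Psi>_SS[OF l f1] by simp
next
  case (add f f')
  have eq: "Tf (\<lambda>x. f x + f' x) = Tf f + Tf f'"
  proof
    fix p :: "'n pt"
    obtain n :: nat where n: "1 + \<bar>snd p\<bar> \<le> real n" using real_arch_simple by blast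
    show "Tf (\<lambda>x. f x + f' x) p = (Tf f + Tf f') p"
      unfolding plus_fun_def Tf_window[OF n] sum.distrib[symmetric]
      by (intro sum.cong refl) (simp only: vector_add_ldistrib scaleR_add_right)
  qed
  show ?case unfolding eq using add.IH by (intro conjI VS.subspace_add[OF Sp_sub] VS.subspace_add[OF SS_sub]) blast+
qed

text \<open>By the partition of unity, \<open>u\<close> is the average of \<open>bump\<close> times
  \<open>v\<close>. Only heights of modulus at most 1 enter, and there \<open>v\<close>, freed from
  the base character, agrees with a function periodic in all variables. Its trigonometric
  approximation is localised and averaged by \<open>Tf\<close>, and the pointwise errors add up to
  at most \<open>BB\<close> times \<open>\<delta>\<close>.\<close>

lemma Ceq_Sp: "Ceq \<subseteq> Sp"
proof
  fix u assume u: "u \<in> Ceq"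
  hence uc: "continuous_on UNIV u" and ue: "equi u" by (auto simp: Ceq_def)
  obtain K where K: "0 < K" "\<And>t. BB t \<le> K" using BB_bounded by blast
  define v where "v p = (1 / BB (snd p)) *\<^sub>R u p" for p
  have vc: "continuous_on UNIV v" unfolding v_def
    by (intro continuous_intros uc continuous_on_compose2[OF BB_continuous]) (use BB_pos in \<open>auto simp: less_imp_neq[symmetric]\<close>)
  have ve: "v (\<gamma> \<odot> p) = phase \<gamma> *s v p" if \<gamma>: "\<gamma> \<in> \<Gamma>" for \<gamma> p
  proof -
    obtain j where j: "snd \<gamma> = of_int j" using \<gamma> by (auto simp: lat_iff elim: Ints_cases)
    have "BB (snd (\<gamma> \<odot> p)) = BB (snd p)" using BB_periodic[of j "snd p"] by (simp add: sdp_simps j)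
    moreover have "u (\<gamma> \<odot> p) = phase \<gamma> *s u p" using ue \<gamma> unfolding equi_iff by blast
    ultimately show ?thesis by (simp add: v_def scaleR_eq_smult vector_smult_assoc mult.commute)
  qed
  \<comment> \<open>A continuous triangle wave of period 1 that equals \<open>4 t\<close> for
    \<open>|t| \<le> 1/4\<close>; it extends the values of \<open>v\<close> near height 0
    periodically without a jump.\<close>
  define \<tau> where "\<tau> t = (2 / pi) * arcsin (sin (2 * pi * t))" for t :: real
  have \<tau>4: "\<tau> (t / 4) = t" if "\<bar>t\<bar> \<le> 1" for t
  proof -
    have "arcsin (sin (2 * pi * (t / 4))) = 2 * pi * (t / 4)"
    proof (rule arcsin_sin)
      have "pi * (- 1) \<le> pi * t" "pi * t \<le> pi * 1" using that by (intro mult_left_mono, auto)+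
      thus "- (pi / 2) \<le> 2 * pi * (t / 4)" "2 * pi * (t / 4) \<le> pi / 2" by auto
    qed
    thus ?thesis by (simp add: \<tau>_def field_simps)
  qed
  have \<tau>1: "\<tau> (t + 1) = \<tau> t" for t by (simp add: \<tau>_def distrib_left)
  have \<tau>c: "continuous_on UNIV \<tau>" unfolding \<tau>_def by (intro continuous_intros) auto
  \<comment> \<open>Removing the base character turns equivariance under integral vectors into
    periodicity in \<open>x\<close>; periodicity in the last variable is built into
    \<open>\<tau>\<close>.\<close>
  define F where "F x = ex (- (l0 \<bullet> fst x)) *s v (fst x, \<tau> (snd x))" for x
  have "continuous_on UNIV F" unfolding F_def
    by (intro bounded_bilinear.continuous_on[OF smult_bounded_bilinear] ex_continuous continuous_intros
        continuous_on_compose2[OF vc] continuous_on_compose2[OF \<tau>c]) auto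
  moreover have "F (x + b) = F x" if bB: "b \<in> Basis" for x b
  proof -
    consider (a) e where "e \<in> Basis" "b = (e, 0)" | (b) "b = (0, 1)" using bB by (auto simp: Basis_prod_def)
    thus ?thesis
    proof cases
      case a
      then obtain i where e: "e = axis i 1" by (auto simp: Basis_vec_def)
      have iv: "intvec e" using intvec_axis[of 1 i] by (simp add: e)
      have "v (ho e \<odot> (fst x, \<tau> (snd x))) = phase (ho e) *s v (fst x, \<tau> (snd x))" by (rule ve[OF ho_lat[OF iv]])
      moreover have "ho e \<odot> (fst x, \<tau> (snd x)) = (fst (x + b), \<tau> (snd (x + b)))" by (simp add: sdp_simps a(2) add.commute)
      moreover have ph: "ex (l0 \<bullet> e) = phase (ho e)" using l0_\<Lambda> iv by (simp add: \<Lambda>_def)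
      have "ex (- (l0 \<bullet> fst (x + b))) = ex (- (l0 \<bullet> fst x)) * cnj (phase (ho e))"
        by (simp only: a(2) fst_add fst_conv inner_add_right minus_add_distrib ex_add ex_neg ph)
      ultimately show ?thesis
        by (simp only: F_def vector_smult_assoc mult.assoc phase_cnj phase_sq mult_1_right)
    next
      case b
      show ?thesis by (simp add: F_def b \<tau>1)
    qed
  qed
  ultimately have td: "\<exists>f. vtrig f \<and> (\<forall>x. norm (F x - f x) < \<delta>)" if "0 < \<delta>" for \<delta> using that by (rule trig_dense)
  show "u \<in> Sp"
  proof (rule Sp_approx[OF u K(1)])
    fix \<delta> :: real assume \<delta>: "0 < \<delta>"
    from td[OF this] obtain f where f: "vtrig f" "\<And>x. norm (F x - f x) < \<delta>" by blast
    have "norm (u p - Tf f p) \<le> K * \<delta>" for p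
    proof -
      obtain n :: nat where n: "1 + \<bar>snd p\<bar> \<le> real n" using real_arch_simple by blast
      let ?b = "\<lambda>k. bump (of_int k + snd p)" and ?x = "\<lambda>k. flow B (of_int k) *v fst p"
      have "u p = BB (snd p) *\<^sub>R v p" using BB_pos[of "snd p"] by (simp add: v_def)
      also have "... = (\<Sum>k\<in>{- int n..int n}. sg k *s (?b k *\<^sub>R v (tr k \<odot> p)))"
        unfolding BB_window[OF n] scaleR_left.sum
      proof (intro sum.cong refl)
        fix k
        have "sg k *s (?b k *\<^sub>R v (tr k \<odot> p)) = (sg k * sg k) *s (?b k *\<^sub>R v p)"
          unfolding ve[OF tr_lat] sg_def[symmetric] by (simp add: scaleR_eq_smult vector_smult_assoc mult_ac)
        thus "?b k *\<^sub>R v p = sg k *s (?b k *\<^sub>R v (tr k \<odot> p))" by (simp add: sg_sq)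
      qed
      finally have "u p - Tf f p = (\<Sum>k\<in>{- int n..int n}. sg k *s (?b k *\<^sub>R (v (?x k, of_int k + snd p)
          - ex (l0 \<bullet> ?x k) *s f (?x k, (of_int k + snd p) / 4))))"
        unfolding Tf_window[OF n] tr_mul by (simp only: sum_subtractf[symmetric] vector_ssub_ldistrib scaleR_diff_right)
      also have "norm ... \<le> (\<Sum>k\<in>{- int n..int n}. ?b k * \<delta>)"
      proof (rule sum_norm_le)
        fix k
        let ?t = "of_int k + snd p"
        let ?z = "v (?x k, ?t) - ex (l0 \<bullet> ?x k) *s f (?x k, ?t / 4)"
        have "norm (sg k *s (?b k *\<^sub>R ?z)) = ?b k * norm ?z" using bump_nonneg[of ?t] by (simp add: smult_norm)
        also have "... \<le> ?b k * \<delta>"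
        proof (cases "\<bar>?t\<bar> \<le> 1")
          case True
          have "?z = ex (l0 \<bullet> ?x k) *s (F (?x k, ?t / 4) - f (?x k, ?t / 4))"
            unfolding F_def fst_conv snd_conv \<tau>4[OF True]
            by (simp add: vector_ssub_ldistrib vector_smult_assoc ex_neg)
          hence "norm ?z \<le> \<delta>" using f(2)[of "(?x k, ?t / 4)"] by (simp only: smult_norm ex_norm mult_1 less_imp_le)
          thus ?thesis by (intro mult_left_mono bump_nonneg)
        next
          case False
          thus ?thesis by (simp add: bump_zero)
        qed
        finally show "norm (sg k *s (?b k *\<^sub>R ?z)) \<le> ?b k * \<delta>" .
      qed
      also have "... = BB (snd p) * \<delta>" unfolding BB_window[OF n] by (rule sum_distrib_right[symmetric])
      also have "... \<le> K * \<delta>" using K(2) \<delta> by (intro mult_right_mono) auto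
      finally show ?thesis .
    qed
    thus "\<exists>y. y \<in> Sp \<and> y \<in> Ceq \<and> (\<forall>p. norm (u p - y p) \<le> K * \<delta>)"
      using Tf_Sp[OF f(1)] SS_Ceq by blast
  qed
qed

lemma L2_Sp: "L2 \<subseteq> L.clo (VS.span (\<Union>\<W>))"
  by (rule L2_dense[OF Ceq_Sp[unfolded Sp_def] span_\<W>_L2])

lemma graph_eq: "closure_graph (L2_norm \<mu> h) L2 SS Dsub = S.G"
  unfolding closure_graph_def S.G_def L.tends_def LN_eq fun_diff_def ..

theorem pure_point: "pure_point_closure ip (L2_norm \<mu> h) L2 SS Dsub"
proof -
  have "\<exists>E. E \<subseteq> S.Eig \<and> (\<forall>e\<in>E. \<forall>f\<in>E. ip e f = (if e = f then 1 else 0)) \<and> L2 \<subseteq> L.clo (VS.span E)"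
    by (rule S.pure_point_of_pieces[OF \<W>_piece L2_Sp]) (assumption, blast)
  then obtain E where E: "E \<subseteq> S.Eig" "\<And>e f. e \<in> E \<Longrightarrow> f \<in> E \<Longrightarrow> ip e f = (if e = f then 1 else 0)" "L2 \<subseteq> L.clo (VS.span E)"
    by blast
  have EL: "E \<subseteq> L2" using E(1) by (auto simp: S.Eig_def)
  have "closable (L2_norm \<mu> h) L2 SS Dsub"
    unfolding closable_def graph_eq unfolding LN_eq[symmetric]
  proof (intro allI impI)
    fix x y assume a: "(x, y) \<in> S.G \<and> L.N x = 0"
    show "L.N y = 0"
      \<comment> \<open>The span of the pieces lies in the domain, so the domain is dense and
        symmetry gives closability.\<close>
      by (rule S.closable_dense[OF order_trans[OF L2_Sp L.clo_mono[OF span_\<W>_SS]] conjunct1[OF a] conjunct2[OF a]])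
  qed
  moreover have "orthonormal_basis ip (L2_norm \<mu> h) L2 E"
    unfolding orthonormal_basis_def
  proof (intro conjI ballI allI impI)
    show "E \<subseteq> L2" by (rule EL)
    show "ip e f = (if e = f then 1 else 0)" if "e \<in> E" "f \<in> E" for e f by (rule E(2)[OF that])
    fix \<psi> and \<delta> :: real assume "\<psi> \<in> L2" "0 < \<delta>"
    then obtain x where x: "x \<in> VS.span E" "L.N (\<psi> - x) < \<delta>" using E(3) unfolding L.clo_def by blast
    from x(1) obtain t r where t: "finite t" "t \<subseteq> E" "x = (\<Sum>a\<in>t. sc (r a) a)" unfolding VS.span_explicit by blast
    have eq: "\<psi> - x = (\<lambda>p. \<psi> p - (\<Sum>e\<in>t. r e *s e p))" by (simp add: fun_eq_iff t(3) sum_fun_apply)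
    show "\<exists>F a. finite F \<and> F \<subseteq> E \<and> L2_norm \<mu> h (\<lambda>p. \<psi> p - (\<Sum>e\<in>F. a e *s e p)) < \<delta>"
      by (rule exI[of _ t], rule exI[of _ r]) (intro conjI t(1,2) x(2)[unfolded eq LN_eq])
  qed
  moreover have "closure_eigenvector (L2_norm \<mu> h) L2 SS Dsub e" if e: "e \<in> E" for e
  proof -
    have "L.N e \<noteq> 0" using E(2)[OF e e] by (simp add: L.N_def)
    moreover obtain l :: real where "(e, sc (of_real l) e) \<in> S.G" using E(1) e unfolding S.Eig_def by blast
    ultimately show ?thesis unfolding closure_eigenvector_def graph_eq unfolding LN_eq[symmetric]
      by (intro conjI exI)
  qed
  ultimately show ?thesis unfolding pure_point_closure_def by blast
qed

end

theorem theorem3p14: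
  fixes B :: "real^'n^'n"
    and d :: nat
    and H :: "(real^'n) \<times> real \<Rightarrow> ((real^'n) \<times> real) set"
    and Or :: "(real^'n) \<times> real \<Rightarrow> (nat \<Rightarrow> (real^'n) \<times> real) set"
    and g :: "(real^'n) \<times> real \<Rightarrow> (real^'n) \<times> real \<Rightarrow> (real^'n) \<times> real \<Rightarrow> real"
    and nabla :: "((real^'n) \<times> real \<Rightarrow> (real^'n) \<times> real) \<Rightarrow> ((real^'n) \<times> real \<Rightarrow> (real^'n) \<times> real)
                    \<Rightarrow> ((real^'n) \<times> real \<Rightarrow> (real^'n) \<times> real)"
    and \<epsilon> :: "(real^'n) \<times> real \<Rightarrow> int"
    and \<mu> :: "((real^'n) \<times> real) set measure"
    and cl :: "(real^'n) \<times> real \<Rightarrow> complex^'m \<Rightarrow> complex^'m"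
    and h :: "complex^'m \<Rightarrow> complex^'m \<Rightarrow> complex"
    and s :: "nat \<Rightarrow> (real^'n) \<times> real"
  assumes "flow B 1 \<in> SL_int"
    and "nilpotent_group (sdp B)"
    and "left_invariant_distribution B d H"
    and "left_invariant_orientation B d H Or"
    and "bracket_generating B (H \<one>\<^bsub>sdp B\<^esub>)"
    and "bvec \<in> H \<one>\<^bsub>sdp B\<^esub>"
    and "left_invariant_metric B H g"
    and "\<forall>v \<in> H \<one>\<^bsub>sdp B\<^esub> \<inter> ideal_n. g \<one>\<^bsub>sdp B\<^esub> bvec v = 0"
    and "metric_connection H g nabla"
    and "left_invariant_connection B H nabla"
    and "divergence_condition B d H g nabla"
    and "lattice_hom B \<epsilon>"
    and "normalised_invariant_measure B \<mu>"
    and "spinor_representation (H \<one>\<^bsub>sdp B\<^esub>) (g \<one>\<^bsub>sdp B\<^esub>) cl h"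
    and "adapted_basis d (H \<one>\<^bsub>sdp B\<^esub>) (g \<one>\<^bsub>sdp B\<^esub>) (Or \<one>\<^bsub>sdp B\<^esub>) s"
  shows "pure_point_closure (L2_inner \<mu> h) (L2_norm \<mu> h) (L2_space B \<epsilon> \<mu> h)
           (smooth_spinors B \<epsilon>) (sub_dirac B d g nabla cl s)"
proof -
  interpret nil_flow B by (rule nil_flow.intro) (rule assms)+
  have one: "\<one>\<^bsub>sdp B\<^esub> = (0, 0)" by (rule sdp_simps(2))
  have hh: "hermitian_inner_product h" using assms(14) unfolding spinor_representation_def by blast
  interpret dirac_setting B \<mu> h \<epsilon> d H g nabla cl s "Or (0, 0)"
    by unfold_locales (use assms hh in \<open>simp_all only: one\<close>)
  show ?thesis by (rule pure_point)
qed

end
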